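(* Let $V_1$ and $V_2$ be open connected bounded subsets of $\mathbb{R}^n$ with $0\in\partial V_1\cap\partial V_2$. Set $V=V_1\cup V_2$. If $F_1\in\mathcal{O}^{b}_{\mathcal{D}'_{E'_\ast}}(T^{V_1})$ and $F_2\in\mathcal{O}^{b}_{\mathcal{D}'_{E'_\ast}}(T^{V_2})$ have distributional boundary values on $\mathbb{R}^n$ (i.e. the limits below exist) and $$\lim_{y\to0,\ y\in V_1}F_1(\,\cdot\,+iy)=\lim_{y\to0,\ y\in V_2}F_2(\,\cdot\,+iy)\qquad\text{weakly in }\mathcal{D}'_{E'_\ast},$$ then there is $F\in\mathcal{O}^{b}_{\mathcal{D}'_{E'_\ast}}(T^{\operatorname{ch}(V)})$ such that $F(z)=F_j(z)$ for $z\in T^{V_j}$, $j=1,2$.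
   Context: Throughout, $E$ is a translation-invariant Banach space of tempered distributions on $\mathbb{R}^n$, i.e. a Banach space such that: (a) $\mathcal{S}(\mathbb{R}^n)\hookrightarrow E\hookrightarrow\mathcal{S}'(\mathbb{R}^n)$ with continuous dense inclusions; (b) $T_h(E)=E$ for all $h\in\mathbb{R}^n$, where $(T_hg)(x)=g(x+h)$; (c) there are $M'>0$, $\tau\ge0$ with $\omega(h):=\|T_{-h}\|_{L(E)}\le M'(1+|h|)^{\tau}$ for all $h\in\mathbb{R}^n$. $E'$ is the dual Banach space, regarded as a subspace of $\mathcal{S}'(\mathbb{R}^n)$ (by restricting functionals to the dense subspace $\mathcal{S}(\mathbb{R}^n)$); a function belongs to $E'$ if the distribution it defines does. $\mathcal{D}_E$ is the Fréchet space of all $\varphi\in E$ with $\varphi^{(\alpha)}\in E$ for all $\alpha\in\mathbb{N}^n$, topologized by the norms $\max_{|\alpha|\le N}\|\varphi^{(\alpha)}\|_E$, $N\in\mathbb{N}$. $\mathcal{D}'_{E'_\ast}$ denotes the strong dual of $\mathcal{D}_E$; since $\mathcal{S}(\mathbb{R}^n)$ is dense in $\mathcal{D}_E$, it is continuously included in $\mathcal{S}'(\mathbb{R}^n)$. For open $V\subseteq\mathbb{R}^n$, $T^V=\mathbb{R}^n+iV\subseteq\mathbb{C}^n$; $\operatorname{ch}(V)$ is the convex hull of $V$. $\mathcal{O}_{E'}(T^V)$ is the space of all holomorphic functions $F$ on $T^V$ such that $F(\,\cdot\,+iy)\in E'$ for all $y\in V$ and $\sup_{y\in K}\|F(\,\cdot\,+iy)\|_{E'}<\infty$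 for every compact $K\subset V$. $\mathcal{O}^{b}_{\mathcal{D}'_{E'_\ast}}(T^V)$ is the set of $F\in\mathcal{O}_{E'}(T^V)$ such that $\{F(\,\cdot\,+iy):y\in V\}$ is bounded in $\mathcal{D}'_{E'_\ast}$. *)

theory Defs
  imports "HOL-Analysis.Analysis"
begin

section \<open>Complex function spaces given by an increasing sequence of seminorms\<close>

text \<open>Test functions are complex-valued functions on \<open>\<real>\<^sup>n\<close>, distributions are complex-valued
  functions of test functions, so one notion of linear form serves for both. A linear form on a
  space \<open>X\<close> is normalised to vanish outside \<open>X\<close>, so that equality of forms is equality on \<open>X\<close>.\<close>

definition complex_subspace :: "('x \<Rightarrow> complex) set \<Rightarrow> bool" where
  "complex_subspace X \<longleftrightarrow> (\<lambda>_. 0) \<in> X \<and>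
     (\<forall>u\<in>X. \<forall>v\<in>X. (\<lambda>x. u x + v x) \<in> X) \<and> (\<forall>c. \<forall>u\<in>X. (\<lambda>x. c * u x) \<in> X)"

definition linear_forms :: "('x \<Rightarrow> complex) set \<Rightarrow> (('x \<Rightarrow> complex) \<Rightarrow> complex) set" where
  "linear_forms X = {L. (\<forall>u. u \<notin> X \<longrightarrow> L u = 0) \<and>
     (\<forall>u\<in>X. \<forall>v\<in>X. L (\<lambda>x. u x + v x) = L u + L v) \<and>
     (\<forall>c. \<forall>u\<in>X. L (\<lambda>x. c * u x) = c * L u)}"

text \<open>In the next three definitions the topology of \<open>X\<close> is the one of the seminorms
  \<open>p 0 \<le> p 1 \<le> \<dots>\<close>; a single norm is treated as a constant sequence.\<close>

definition continuous_forms ::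
    "('x \<Rightarrow> complex) set \<Rightarrow> (nat \<Rightarrow> ('x \<Rightarrow> complex) \<Rightarrow> real) \<Rightarrow> (('x \<Rightarrow> complex) \<Rightarrow> complex) set" where
  "continuous_forms X p = {L \<in> linear_forms X. \<exists>N C. \<forall>u\<in>X. cmod (L u) \<le> C * p N u}"

definition bounded_subset ::
    "('x \<Rightarrow> complex) set \<Rightarrow> (nat \<Rightarrow> ('x \<Rightarrow> complex) \<Rightarrow> real) \<Rightarrow> ('x \<Rightarrow> complex) set \<Rightarrow> bool" where
  "bounded_subset X p B \<longleftrightarrow> B \<subseteq> X \<and> (\<forall>N. \<exists>C. \<forall>u\<in>B. p N u \<le> C)"

definition strongly_bounded ::
    "('x \<Rightarrow> complex) set \<Rightarrow> (nat \<Rightarrow> ('x \<Rightarrow> complex) \<Rightarrow> real) \<Rightarrow> (('x \<Rightarrow> complex) \<Rightarrow> complex) set \<Rightarrow> bool"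
  where
  "strongly_bounded X p H \<longleftrightarrow> H \<subseteq> continuous_forms X p \<and>
     (\<forall>B. bounded_subset X p B \<longrightarrow> (\<exists>C. \<forall>L\<in>H. \<forall>u\<in>B. cmod (L u) \<le> C))"

definition banach_norm_on :: "('x \<Rightarrow> complex) set \<Rightarrow> (('x \<Rightarrow> complex) \<Rightarrow> real) \<Rightarrow> bool" where
  "banach_norm_on X nrm \<longleftrightarrow> complex_subspace X \<and>
     (\<forall>u\<in>X. 0 \<le> nrm u \<and> (nrm u = 0 \<longleftrightarrow> u = (\<lambda>_. 0))) \<and>
     (\<forall>u\<in>X. \<forall>v\<in>X. nrm (\<lambda>x. u x + v x) \<le> nrm u + nrm v) \<and>
     (\<forall>c. \<forall>u\<in>X. nrm (\<lambda>x. c * u x) = cmod c * nrm u) \<and>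
     (\<forall>s. (\<forall>k. s k \<in> X) \<and>
          (\<forall>e>0. \<exists>M. \<forall>j\<ge>M. \<forall>k\<ge>M. nrm (\<lambda>x. s j x - s k x) < e) \<longrightarrow>
        (\<exists>u\<in>X. (\<lambda>k. nrm (\<lambda>x. s k x - u x)) \<longlonglongrightarrow> 0))"

definition dual_norm :: "('x \<Rightarrow> complex) set \<Rightarrow> (('x \<Rightarrow> complex) \<Rightarrow> real) \<Rightarrow> (('x \<Rightarrow> complex) \<Rightarrow> complex) \<Rightarrow> real" where
  "dual_norm X nrm L = (SUP u\<in>{u \<in> X. nrm u \<le> 1}. cmod (L u))"


section \<open>Schwartz functions and tempered distributions\<close>

text \<open>Multi-indices are represented by lists of coordinate directions: \<open>[i, j, k]\<close> stands for
  \<open>\<partial>\<^sub>i \<partial>\<^sub>j \<partial>\<^sub>k\<close>, and the length of the list is the order. The order of the entries is irrelevant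
  for smooth functions and for distributions, and every multi-index arises in this way.\<close>

definition partial :: "'n::finite \<Rightarrow> (real^'n \<Rightarrow> complex) \<Rightarrow> real^'n \<Rightarrow> complex" where
  "partial i f x = frechet_derivative f (at x) (axis i 1)"

definition partials :: "'n::finite list \<Rightarrow> (real^'n \<Rightarrow> complex) \<Rightarrow> real^'n \<Rightarrow> complex" where
  "partials is f = foldr partial is f"

definition smooth :: "(real^'n::finite \<Rightarrow> complex) \<Rightarrow> bool" where
  "smooth f \<longleftrightarrow> (\<forall>is. partials is f differentiable_on UNIV)"

definition test_functions :: "(real^'n::finite \<Rightarrow> complex) set" where
  "test_functions = {f. smooth f \<and> compact (closure {x. f x \<noteq> 0})}"

definition schwartz :: "(real^'n::finite \<Rightarrow> complex) set" where
  "schwartz = {f. smooth f \<and>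
     (\<forall>N is. bdd_above (range (\<lambda>x. (1 + norm x) ^ N * cmod (partials is f x))))}"

definition schwartz_seminorm :: "nat \<Rightarrow> (real^'n::finite \<Rightarrow> complex) \<Rightarrow> real" where
  "schwartz_seminorm N f =
     (SUP (is, x)\<in>{is. length is \<le> N} \<times> UNIV. (1 + norm x) ^ N * cmod (partials is f x))"

definition tempered :: "((real^'n::finite \<Rightarrow> complex) \<Rightarrow> complex) set" where
  "tempered = continuous_forms schwartz schwartz_seminorm"

definition dist_partial ::
    "'n::finite \<Rightarrow> ((real^'n \<Rightarrow> complex) \<Rightarrow> complex) \<Rightarrow> (real^'n \<Rightarrow> complex) \<Rightarrow> complex" where
  "dist_partial i u \<phi> = (if \<phi> \<in> schwartz then - u (partial i \<phi>) else 0)"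

definition dist_partials ::
    "'n::finite list \<Rightarrow> ((real^'n \<Rightarrow> complex) \<Rightarrow> complex) \<Rightarrow> (real^'n \<Rightarrow> complex) \<Rightarrow> complex" where
  "dist_partials is u = foldr dist_partial is u"

text \<open>\<open>(T\<^sub>h g)(x) = g(x + h)\<close> for functions, hence \<open>\<langle>T\<^sub>h u, \<phi>\<rangle> = \<langle>u, \<phi>(\<cdot> - h)\<rangle>\<close> for distributions.\<close>

definition translate ::
    "real^'n::finite \<Rightarrow> ((real^'n \<Rightarrow> complex) \<Rightarrow> complex) \<Rightarrow> (real^'n \<Rightarrow> complex) \<Rightarrow> complex" where
  "translate h u \<phi> = u (\<lambda>x. \<phi> (x - h))"

text \<open>The inclusion of the Schwartz space into the tempered distributions.\<close>

definition schwartz_dist :: "(real^'n::finite \<Rightarrow> complex) \<Rightarrow> (real^'n \<Rightarrow> complex) \<Rightarrow> complex" where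
  "schwartz_dist \<psi> \<phi> = (if \<phi> \<in> schwartz then LINT x|lborel. \<psi> x * \<phi> x else 0)"

text \<open>A general function need not be integrable against all Schwartz functions, even if the
  distribution it defines is tempered; so the distribution is tested on compactly supported
  functions, which determine a tempered distribution.\<close>

definition defines_dist ::
    "(real^'n::finite \<Rightarrow> complex) \<Rightarrow> ((real^'n \<Rightarrow> complex) \<Rightarrow> complex) \<Rightarrow> bool" where
  "defines_dist f u \<longleftrightarrow> u \<in> tempered \<and>
     (\<forall>K. compact K \<longrightarrow> set_integrable lborel K f) \<and>
     (\<forall>\<phi>\<in>test_functions. u \<phi> = (LINT x|lborel. f x * \<phi> x))"

text \<open>For a space \<open>X\<close> of distributions in which the Schwartz space is dense, restriction to the
  Schwartz space identifies continuous linear forms on \<open>X\<close> with tempered distributions.\<close>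

definition restrict_form ::
    "(((real^'n::finite \<Rightarrow> complex) \<Rightarrow> complex) \<Rightarrow> complex) \<Rightarrow> (real^'n \<Rightarrow> complex) \<Rightarrow> complex" where
  "restrict_form L \<phi> = (if \<phi> \<in> schwartz then L (schwartz_dist \<phi>) else 0)"

definition in_dual ::
    "((real^'n::finite \<Rightarrow> complex) \<Rightarrow> complex) set \<Rightarrow> (nat \<Rightarrow> ((real^'n \<Rightarrow> complex) \<Rightarrow> complex) \<Rightarrow> real) \<Rightarrow>
     (real^'n \<Rightarrow> complex) \<Rightarrow> bool" where
  "in_dual X p f \<longleftrightarrow> (\<exists>L\<in>continuous_forms X p. defines_dist f (restrict_form L))"

definition form_of ::
    "((real^'n::finite \<Rightarrow> complex) \<Rightarrow> complex) set \<Rightarrow> (nat \<Rightarrow> ((real^'n \<Rightarrow> complex) \<Rightarrow> complex) \<Rightarrow> real) \<Rightarrow>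
     (real^'n \<Rightarrow> complex) \<Rightarrow> ((real^'n \<Rightarrow> complex) \<Rightarrow> complex) \<Rightarrow> complex" where
  "form_of X p f = (THE L. L \<in> continuous_forms X p \<and> defines_dist f (restrict_form L))"


section \<open>Translation-invariant Banach spaces of tempered distributions\<close>

text \<open>The tempered distributions carry the strong topology, given by the seminorms
  \<open>u \<mapsto> sup {\<bar>u \<phi>\<bar> | \<phi> \<in> B}\<close> for bounded sets \<open>B\<close> of Schwartz functions.\<close>

definition translation_invariant_banach ::
    "((real^'n::finite \<Rightarrow> complex) \<Rightarrow> complex) set \<Rightarrow> (((real^'n \<Rightarrow> complex) \<Rightarrow> complex) \<Rightarrow> real) \<Rightarrow> bool" where
  "translation_invariant_banach E nrm \<longleftrightarrow>
     banach_norm_on E nrm \<and>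
     \<comment> \<open>continuous dense inclusion of the Schwartz space into \<open>E\<close>\<close>
     schwartz_dist ` schwartz \<subseteq> E \<and>
     (\<exists>N C. \<forall>\<phi>\<in>schwartz. nrm (schwartz_dist \<phi>) \<le> C * schwartz_seminorm N \<phi>) \<and>
     (\<forall>u\<in>E. \<forall>e>0. \<exists>\<phi>\<in>schwartz. nrm (\<lambda>\<psi>. u \<psi> - schwartz_dist \<phi> \<psi>) < e) \<and>
     \<comment> \<open>continuous dense inclusion of \<open>E\<close> into the tempered distributions\<close>
     E \<subseteq> tempered \<and>
     (\<forall>B. bounded_subset schwartz schwartz_seminorm B \<longrightarrow>
        (\<exists>C. \<forall>u\<in>E. \<forall>\<phi>\<in>B. cmod (u \<phi>) \<le> C * nrm u)) \<and>
     (\<forall>v\<in>tempered. \<forall>B. bounded_subset schwartz schwartz_seminorm B \<longrightarrow>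
        (\<forall>e>0. \<exists>u\<in>E. \<forall>\<phi>\<in>B. cmod (v \<phi> - u \<phi>) < e)) \<and>
     \<comment> \<open>translation invariance, with polynomially bounded operator norms of \<open>T\<^sub>-\<^sub>h\<close> on \<open>E\<close>\<close>
     (\<forall>h. translate h ` E = E) \<and>
     (\<exists>M>0. \<exists>\<tau>\<ge>0. \<forall>h. \<forall>u\<in>E. nrm (translate (- h) u) \<le> M * (1 + norm h) powr \<tau> * nrm u)"

definition DE ::
    "((real^'n::finite \<Rightarrow> complex) \<Rightarrow> complex) set \<Rightarrow> ((real^'n \<Rightarrow> complex) \<Rightarrow> complex) set" where
  "DE E = {u \<in> E. \<forall>is. dist_partials is u \<in> E}"

definition DE_norm ::
    "(((real^'n::finite \<Rightarrow> complex) \<Rightarrow> complex) \<Rightarrow> real) \<Rightarrow> nat \<Rightarrow> ((real^'n \<Rightarrow> complex) \<Rightarrow> complex) \<Rightarrow> real" where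
  "DE_norm nrm N u = Max ((\<lambda>is. nrm (dist_partials is u)) ` {is. length is \<le> N})"


section \<open>Holomorphic functions on tubes and their boundary values\<close>

definition tube :: "(real^'n::finite) set \<Rightarrow> (complex^'n) set" where
  "tube V = {z. (\<chi> i. Im (z $ i)) \<in> V}"

definition slice :: "(complex^'n::finite \<Rightarrow> complex) \<Rightarrow> real^'n \<Rightarrow> real^'n \<Rightarrow> complex" where
  "slice F y x = F (\<chi> i. Complex (x $ i) (y $ i))"

definition holomorphic_on_Cn :: "(complex^'n::finite \<Rightarrow> complex) \<Rightarrow> (complex^'n) set \<Rightarrow> bool" where
  "holomorphic_on_Cn F U \<longleftrightarrow>
     (\<forall>z\<in>U. \<exists>D. (F has_derivative D) (at z) \<and> (\<forall>c v. D (c *s v) = c * D v))"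

definition O_dual ::
    "((real^'n::finite \<Rightarrow> complex) \<Rightarrow> complex) set \<Rightarrow> (((real^'n \<Rightarrow> complex) \<Rightarrow> complex) \<Rightarrow> real) \<Rightarrow>
     (real^'n) set \<Rightarrow> (complex^'n \<Rightarrow> complex) set" where
  "O_dual E nrm V = {F. holomorphic_on_Cn F (tube V) \<and>
     (\<forall>y\<in>V. in_dual E (\<lambda>_. nrm) (slice F y)) \<and>
     (\<forall>K. compact K \<and> K \<subseteq> V \<longrightarrow>
        bdd_above ((\<lambda>y. dual_norm E nrm (form_of E (\<lambda>_. nrm) (slice F y))) ` K))}"

definition Ob_DE_dual ::
    "((real^'n::finite \<Rightarrow> complex) \<Rightarrow> complex) set \<Rightarrow> (((real^'n \<Rightarrow> complex) \<Rightarrow> complex) \<Rightarrow> real) \<Rightarrow>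
     (real^'n) set \<Rightarrow> (complex^'n \<Rightarrow> complex) set" where
  "Ob_DE_dual E nrm V = {F \<in> O_dual E nrm V.
     strongly_bounded (DE E) (DE_norm nrm) ((\<lambda>y. form_of (DE E) (DE_norm nrm) (slice F y)) ` V)}"

text \<open>Weak convergence in the dual of \<open>DE E\<close> is pointwise convergence on \<open>DE E\<close>.\<close>

definition has_weak_boundary_value ::
    "((real^'n::finite \<Rightarrow> complex) \<Rightarrow> complex) set \<Rightarrow> (((real^'n \<Rightarrow> complex) \<Rightarrow> complex) \<Rightarrow> real) \<Rightarrow>
     (real^'n) set \<Rightarrow> (complex^'n \<Rightarrow> complex) \<Rightarrow>
     (((real^'n \<Rightarrow> complex) \<Rightarrow> complex) \<Rightarrow> complex) \<Rightarrow> bool" where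
  "has_weak_boundary_value E nrm V F L \<longleftrightarrow> L \<in> continuous_forms (DE E) (DE_norm nrm) \<and>
     (\<forall>u\<in>DE E. ((\<lambda>y. form_of (DE E) (DE_norm nrm) (slice F y) u) \<longlongrightarrow> L u) (at 0 within V))"

end

theory Submission
  imports Defs "HOL-Complex_Analysis.Conformal_Mappings"
begin

text \<open>The convolutions of the slices of \<open>F\<^sub>j\<close> with a Gaussian of width \<open>e\<close> extend to an entire function
  \<open>U\<^sub>e\<close>. Shifting the contour to \<open>y \<rightarrow> 0\<close> expresses \<open>U\<^sub>e\<close> through the boundary value alone, so \<open>F\<^sub>1\<close> and \<open>F\<^sub>2\<close>
  yield the same \<open>U\<^sub>e\<close>. These Gaussian convolutions converge to \<open>F\<^sub>j\<close> as \<open>e \<rightarrow> 0\<close>: a mean value formula shows that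
  \<open>F\<^sub>j\<close> grows polynomially along the slices, so the convergence is uniform on compact sets of slices with the weight
  \<open>exp (- \<bar>x\<bar>\<^sup>2)\<close>. By the three lines theorem a weighted bound on two slices holds on all slices between them; hence
  \<open>U\<^sub>e\<close> is Cauchy on the tube over the convex hull, and its limit is \<open>F\<close>.

  For a test function \<open>g\<close> the three lines theorem for \<open>z \<mapsto> \<integral> F(t + z) g(t) dt\<close> carries the bounds by the norms of
  \<open>g\<close> in \<open>E\<close> and in \<open>D\<^sub>E\<close> over to the convex hull. Test functions are dense in both spaces, so these are bounds of
  the functionals.\<close>

section \<open>Calculus of iterated partial derivatives\<close>

text \<open>Compactly supported mollifiers would not do: convolutions of slices with Gaussians
  extend to all complex arguments. The price is that polynomial growth must be tracked throughout;
  its degree on slices is an exponent that bounds the translations of \<open>E\<close>. Functions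
  obtained as integrals or limits are holomorphic along complex lines by one-variable theorems, so
  the proof works with that notion and returns to several variables only at the end, by Osgood's
  lemma. A slice is tied to a functional only by its integrals against compactly supported
  functions, so all estimates pass through density of these functions. For \<open>E\<close> this
  follows from the hypotheses by a cutoff. For \<open>DE E\<close> it must be proved: an element is
  averaged over short coordinate segments so often that the norm of \<open>E\<close> controls its
  derivatives, is then approximated in \<open>E\<close>, and the averages are removed again. At the
  boundary the Gaussian test function moves with the slice; equicontinuity of the bounded family of
  slices allows replacing it by a fixed one.\<close>

lemma partial_eqI: "(f has_derivative D) (at x) \<Longrightarrow> partial i f x = D (axis i 1)"
  unfolding partial_def using frechet_derivative_at by metis

lemma partials_Nil [simp]: "partials [] f = f"
  by (simp add: partials_def)

lemma partials_Cons [simp]: "partials (i # is) f = partial i (partials is f)"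
  by (simp add: partials_def)

lemma partials_append: "partials (is @ js) f = partials is (partials js f)"
  by (simp add: partials_def)

lemma smooth_differentiable: "smooth f \<Longrightarrow> partials is f differentiable (at x)"
  by (auto simp: smooth_def differentiable_on_def)

lemma smooth_differentiable0: "smooth f \<Longrightarrow> f differentiable (at x)"
  using smooth_differentiable[of f "[]"] by simp

lemma smooth_partials: "smooth f \<Longrightarrow> smooth (partials is f)"
  unfolding smooth_def by (metis partials_append)

lemma smooth_continuous: "smooth f \<Longrightarrow> continuous_on S (partials is f)"
  by (meson smooth_def differentiable_imp_continuous_on continuous_on_subset subset_UNIV)

lemma smooth_continuous0: "smooth f \<Longrightarrow> continuous_on S f"
  using smooth_continuous[of f S "[]"] by simp

text \<open>Derivatives of all orders are to be bounded uniformly in a parameter \<open>c\<close>.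
  It suffices to exhibit a set of parametrised functions that is closed under every
  \<open>partial i\<close>; the bump functions and the Gaussians below form such sets.\<close>

lemma partials_family_closed:
  assumes "g \<in> A" and "\<And>g i. g \<in> A \<Longrightarrow> (\<lambda>c. partial i (g c)) \<in> A"
  shows "(\<lambda>c. partials is (g c)) \<in> A"
  using assms by (induction "is") auto

lemma smooth_familyI:
  assumes "g \<in> A" and "\<And>g i. g \<in> A \<Longrightarrow> (\<lambda>c. partial i (g c)) \<in> A"
    and "\<And>g c x. g \<in> A \<Longrightarrow> g c differentiable (at x)"
  shows "smooth (g c)"
  using partials_family_closed[OF assms(1,2)] assms(3)
  unfolding smooth_def differentiable_on_def by fastforce

lemma has_derivative_partial:
  fixes f :: "real^'n::finite \<Rightarrow> complex"
  assumes "f differentiable (at x)"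
  shows "(f has_derivative (\<lambda>h. \<Sum>i\<in>UNIV. of_real (h $ i) * partial i f x)) (at x)"
proof -
  let ?D = "frechet_derivative f (at x)"
  have D: "(f has_derivative ?D) (at x)"
    using assms by (simp add: frechet_derivative_works)
  then interpret bounded_linear ?D by (rule has_derivative_bounded_linear)
  have "?D h = (\<Sum>i\<in>UNIV. of_real (h $ i) * partial i f x)" for h
  proof -
    have "?D h = ?D (\<Sum>i\<in>UNIV. (h $ i) *\<^sub>R axis i 1)"
      by (simp add: basis_expansion scalar_mult_eq_scaleR[symmetric])
    also have "\<dots> = (\<Sum>i\<in>UNIV. (h $ i) *\<^sub>R ?D (axis i 1))"
      by (simp add: sum scaleR)
    finally show ?thesis by (simp add: partial_def scaleR_conv_of_real)
  qed
  then have "?D = (\<lambda>h. \<Sum>i\<in>UNIV. of_real (h $ i) * partial i f x)" by blast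
  with D show ?thesis by simp
qed

lemma sum_axis: "(\<Sum>j\<in>UNIV. of_real (axis i 1 $ j) * g j) = (g (i::'n::finite) :: complex)"
  by (simp add: axis_def if_distrib if_distribR sum.delta' cong: if_cong)

lemma partial_add:
  assumes "f differentiable (at x)" "g differentiable (at x)"
  shows "partial i (\<lambda>x. f x + g x) x = partial i f x + partial i g x"
  by (rule trans[OF partial_eqI[OF has_derivative_add[OF assms[THEN has_derivative_partial]]]])
    (simp add: sum_axis)

lemma partial_cmult:
  assumes "f differentiable (at x)"
  shows "partial i (\<lambda>x. c * f x) x = c * partial i f x"
  by (rule trans[OF partial_eqI[OF has_derivative_mult_right[OF has_derivative_partial[OF assms]]]])
    (simp add: sum_axis)

lemma partial_mult:
  assumes "f differentiable (at x)" "g differentiable (at x)"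
  shows "partial i (\<lambda>x. f x * g x) x = partial i f x * g x + f x * partial i g x"
  by (rule trans[OF partial_eqI[OF has_derivative_mult[OF assms[THEN has_derivative_partial]]]])
    (simp add: sum_axis)

lemma partials_add:
  assumes "smooth f" "smooth g"
  shows "partials is (\<lambda>x. f x + g x) = (\<lambda>x. partials is f x + partials is g x)"
  by (induction "is") (auto intro!: ext simp: partial_add smooth_differentiable assms)

lemma partials_cmult:
  assumes "smooth f"
  shows "partials is (\<lambda>x. c * f x) = (\<lambda>x. c * partials is f x)"
  by (induction "is") (auto intro!: ext simp: partial_cmult smooth_differentiable assms)

lemma partials_const_0: "partials is (\<lambda>x. 0) = (\<lambda>x. 0)"
  by (induction "is") (auto intro!: ext simp: partial_def)

lemma smooth_add: "smooth f \<Longrightarrow> smooth g \<Longrightarrow> smooth (\<lambda>x. f x + g x)"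
  by (subst smooth_def) (auto simp: partials_add differentiable_on_def intro!: differentiable_add smooth_differentiable)

lemma smooth_cmult: "smooth f \<Longrightarrow> smooth (\<lambda>x. c * f x)"
  by (subst smooth_def) (auto simp: partials_cmult differentiable_on_def intro!: differentiable_mult smooth_differentiable)

lemma has_derivative_shift:
  fixes f :: "real^'n::finite \<Rightarrow> complex"
  assumes "(f has_derivative D) (at (x + h))"
  shows "((\<lambda>x. f (x + h)) has_derivative D) (at x)"
  by (rule has_derivative_compose[where f = "\<lambda>y. y + h" and f' = "\<lambda>y. y", simplified])
    (auto intro!: derivative_eq_intros assms)

lemma has_derivative_shift_iff:
  fixes f :: "real^'n::finite \<Rightarrow> complex"
  shows "((\<lambda>x. f (x + h)) has_derivative D) (at x) \<longleftrightarrow> (f has_derivative D) (at (x + h))"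
  using has_derivative_shift[of f D x h] has_derivative_shift[of "\<lambda>x. f (x + h)" D "x + h" "-h"]
  by auto

lemma partials_shift: "partials is (\<lambda>x. f (x + h)) = (\<lambda>x. partials is f (x + h))"
  by (induction "is") (auto intro!: ext simp: partial_def frechet_derivative_def has_derivative_shift_iff)

lemma smooth_shift: 
  assumes "smooth f" shows "smooth (\<lambda>x. f (x + h))"
  using smooth_differentiable[OF assms]
  by (subst smooth_def) (simp add: partials_shift differentiable_on_def differentiable_def has_derivative_shift_iff)

lemma partials_dilate:
  fixes f :: "real^'n::finite \<Rightarrow> complex"
  assumes "smooth f"
  shows "partials is (\<lambda>x. f (d *\<^sub>R x)) = (\<lambda>x. of_real d ^ length is * partials is f (d *\<^sub>R x))"
proof (induction "is")
  case (Cons i "is")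
  have "((\<lambda>x. of_real d ^ length is * partials is f (d *\<^sub>R x)) has_derivative
      (\<lambda>h. of_real d ^ length is * (\<Sum>j\<in>UNIV. of_real ((d *\<^sub>R h) $ j) * partial j (partials is f) (d *\<^sub>R x)))) (at x)" for x
    by (rule has_derivative_mult_right, rule has_derivative_compose[where f = "\<lambda>x. d *\<^sub>R x"])
      (auto intro!: derivative_eq_intros has_derivative_partial smooth_differentiable assms)
  from partial_eqI[OF this, of i] show ?case
    by (auto intro!: ext simp: Cons sum_axis sum_distrib_left mult.assoc simp flip: sum_distrib_left)
qed auto

lemma smooth_dilate:
  fixes f :: "real^'n::finite \<Rightarrow> complex"
  assumes "smooth f"
  shows "smooth (\<lambda>x. f (d *\<^sub>R x))"
proof -
  have "(\<lambda>x. partials is f (d *\<^sub>R x)) differentiable at x" for "is" x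
    using differentiable_chain_at[of "\<lambda>x. d *\<^sub>R x" x "partials is f"] smooth_differentiable[OF assms]
    by (auto simp: o_def)
  then show ?thesis
    unfolding smooth_def partials_dilate[OF assms] by (auto simp: differentiable_on_def)
qed

text \<open>The Leibniz rule without binomial coefficients: each entry of the list goes to one of
  the two factors, and a pair of multi-indices is listed as often as its coefficient
  demands.\<close>

fun splits :: "'a list \<Rightarrow> ('a list \<times> 'a list) list" where
  "splits [] = [([], [])]"
| "splits (i # is) = map (\<lambda>(a, b). (i # a, b)) (splits is) @ map (\<lambda>(a, b). (a, i # b)) (splits is)"

lemma differentiable_sum_list:
  assumes "\<And>p. p \<in> set ps \<Longrightarrow> h p differentiable (at x)"
  shows "(\<lambda>x. \<Sum>p\<leftarrow>ps. h p x) differentiable (at x)"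
  using assms by (induction ps) (auto intro!: differentiable_add)

lemma partial_sum_list:
  assumes "\<And>p. p \<in> set ps \<Longrightarrow> h p differentiable (at x)"
  shows "partial i (\<lambda>x. \<Sum>p\<leftarrow>ps. h p x) x = (\<Sum>p\<leftarrow>ps. partial i (h p) x)"
  using assms
proof (induction ps)
  case Nil then show ?case by (simp add: partial_def)
next
  case (Cons p ps)
  then show ?case by (simp add: partial_add differentiable_sum_list)
qed

lemma partials_mult:
  assumes "smooth f" "smooth g"
  shows "partials is (\<lambda>x. f x * g x) = (\<lambda>x. \<Sum>(a, b)\<leftarrow>splits is. partials a f x * partials b g x)"
proof (induction "is")
  case (Cons i "is")
  have "partial i (\<lambda>x. \<Sum>p\<leftarrow>splits is. partials (fst p) f x * partials (snd p) g x) x =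
     (\<Sum>p\<leftarrow>splits is. partial i (\<lambda>x. partials (fst p) f x * partials (snd p) g x) x)" for x
    by (rule partial_sum_list) (auto intro!: differentiable_mult smooth_differentiable assms)
  then show ?case
    by (auto intro!: ext simp: Cons partial_mult smooth_differentiable assms case_prod_unfold sum_list_addf o_def)
qed auto

lemma smooth_mult:
  assumes "smooth f" "smooth g"
  shows "smooth (\<lambda>x. f x * g x)"
  unfolding smooth_def partials_mult[OF assms]
  by (auto simp: differentiable_on_def case_prod_unfold
      intro!: differentiable_sum_list differentiable_mult smooth_differentiable assms)

section \<open>Schwartz functions\<close>

lemma finite_lists_le: "finite {is::'n::finite list. length is \<le> N}"
  using finite_lists_length_le[of "UNIV::'n set" N] by simp

lemma schwartz_smooth: "f \<in> schwartz \<Longrightarrow> smooth f"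
  by (simp add: schwartz_def)

lemma schwartzI:
  assumes "smooth f" "\<And>N is. \<exists>C. \<forall>x. (1 + norm x) ^ N * cmod (partials is f x) \<le> C"
  shows "f \<in> schwartz"
  using assms by (auto simp: schwartz_def bdd_above_def)

lemma schwartzE:
  assumes "f \<in> schwartz"
  obtains C where "C \<ge> 0" "\<And>x. (1 + norm x) ^ N * cmod (partials is f x) \<le> C"
proof -
  from assms obtain C where C: "\<And>x. (1 + norm x) ^ N * cmod (partials is f x) \<le> C"
    unfolding schwartz_def bdd_above_def by blast
  have "0 \<le> (1 + norm (0::real^'a)) ^ N * cmod (partials is f 0)" by simp
  also have "\<dots> \<le> C" by (rule C)
  finally show ?thesis using C that by blast
qed

lemma schwartz_seminorm_ge:
  fixes f :: "real^'n::finite \<Rightarrow> complex"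
  assumes "f \<in> schwartz" "length is \<le> N"
  shows "(1 + norm x) ^ N * cmod (partials is f x) \<le> schwartz_seminorm N f"
proof -
  let ?h = "\<lambda>(is, x). (1 + norm x) ^ N * cmod (partials is f x)"
  have eq: "?h ` ({is. length is \<le> N} \<times> UNIV) =
      (\<Union>is\<in>{is. length is \<le> N}. range (\<lambda>x. (1 + norm x) ^ N * cmod (partials is f x)))" by auto
  have "bdd_above (?h ` ({is. length is \<le> N} \<times> UNIV))"
    unfolding eq using assms(1) by (subst bdd_above_UN[OF finite_lists_le]) (auto simp: schwartz_def)
  from cSUP_upper[OF _ this, of "(is, x)"] show ?thesis
    using assms(2) by (simp add: schwartz_seminorm_def)
qed

lemma schwartz_seminorm_nonneg: "f \<in> schwartz \<Longrightarrow> 0 \<le> schwartz_seminorm N f"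
  by (rule order_trans[OF _ schwartz_seminorm_ge[of f "[]" N 0]]) auto

lemma schwartz_seminorm_le:
  fixes f :: "real^'n::finite \<Rightarrow> complex"
  assumes "\<And>is x. length is \<le> N \<Longrightarrow> (1 + norm x) ^ N * cmod (partials is f x) \<le> C"
  shows "schwartz_seminorm N f \<le> C"
  unfolding schwartz_seminorm_def
  by (rule cSUP_least) (auto intro!: assms exI[of _ "[]"])

lemma schwartz_zero: "(\<lambda>x. 0) \<in> schwartz"
  by (rule schwartzI) (auto simp: smooth_def partials_const_0)

lemma schwartz_add:
  assumes "f \<in> schwartz" "g \<in> schwartz" shows "(\<lambda>x. f x + g x) \<in> schwartz"
proof (rule schwartzI)
  show "smooth (\<lambda>x. f x + g x)" using assms by (intro smooth_add schwartz_smooth)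
  fix N "is"
  obtain C where C: "\<And>x. (1 + norm x) ^ N * cmod (partials is f x) \<le> C" using schwartzE[OF assms(1)] by metis
  obtain D where D: "\<And>x. (1 + norm x) ^ N * cmod (partials is g x) \<le> D" using schwartzE[OF assms(2)] by metis
  have "(1 + norm x) ^ N * cmod (partials is f x + partials is g x) \<le> C + D" for x
  proof -
    have "(1 + norm x) ^ N * cmod (partials is f x + partials is g x) \<le>
      (1 + norm x) ^ N * (cmod (partials is f x) + cmod (partials is g x))"
      by (intro mult_left_mono norm_triangle_ineq) auto
    then show ?thesis using C[of x] D[of x] by (simp add: distrib_left)
  qed
  then show "\<exists>C. \<forall>x. (1 + norm x) ^ N * cmod (partials is (\<lambda>x. f x + g x) x) \<le> C"
    using assms by (auto simp: partials_add schwartz_smooth)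
qed

lemma schwartz_cmult:
  assumes "f \<in> schwartz" shows "(\<lambda>x. c * f x) \<in> schwartz"
proof (rule schwartzI)
  show "smooth (\<lambda>x. c * f x)" using assms by (intro smooth_cmult schwartz_smooth)
  fix N "is"
  obtain C where C: "\<And>x. (1 + norm x) ^ N * cmod (partials is f x) \<le> C" using schwartzE[OF assms(1)] by metis
  have "(1 + norm x) ^ N * cmod (c * partials is f x) \<le> cmod c * C" for x
    using mult_left_mono[OF C[of x], of "cmod c"] by (simp add: norm_mult mult_ac)
  then show "\<exists>C. \<forall>x. (1 + norm x) ^ N * cmod (partials is (\<lambda>x. c * f x) x) \<le> C"
    using assms by (auto simp: partials_cmult schwartz_smooth)
qed

lemma schwartz_diff:
  assumes "f \<in> schwartz" "g \<in> schwartz" shows "(\<lambda>x. f x - g x) \<in> schwartz"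
  using schwartz_add[OF assms(1) schwartz_cmult[OF assms(2), of "-1"]] by simp

lemma partials_diff:
  assumes "smooth f" "smooth g"
  shows "partials is (\<lambda>x. f x - g x) = (\<lambda>x. partials is f x - partials is g x)"
  using partials_add[OF assms(1) smooth_cmult[OF assms(2), of "-1"], of "is"] partials_cmult[OF assms(2), of "is" "-1"]
  by simp

lemma schwartz_partials: 
  assumes "f \<in> schwartz" shows "partials js f \<in> schwartz"
  using assms by (auto simp: schwartz_def smooth_partials simp flip: partials_append)

lemma schwartz_partial: "f \<in> schwartz \<Longrightarrow> partial i f \<in> schwartz"
  using schwartz_partials[of f "[i]"] by simp

text \<open>Peetre's inequality. It moves polynomial weights through translations, here and for the
  Gaussians below.\<close>

lemma weight_shift: "1 + norm (x::'a::real_normed_vector) \<le> (1 + norm (x + h)) * (1 + norm h)"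
proof -
  have "norm x \<le> norm (x + h) + norm h" by (metis add_diff_cancel_right' norm_triangle_ineq4)
  moreover have "0 \<le> norm (x + h) * norm h" by simp
  ultimately show ?thesis unfolding distrib_left distrib_right by linarith
qed

lemma weight_shift_power:
  "(1 + norm (x::'a::real_normed_vector)) ^ N \<le> (1 + norm (x + h)) ^ N * (1 + norm h) ^ N"
  unfolding power_mult_distrib[symmetric] by (intro power_mono weight_shift) auto

lemma schwartz_shift:
  assumes "f \<in> schwartz" shows "(\<lambda>x. f (x + h)) \<in> schwartz"
proof (rule schwartzI)
  show "smooth (\<lambda>x. f (x + h))" using assms by (intro smooth_shift schwartz_smooth)
  fix N "is"
  obtain C where C: "\<And>x. (1 + norm x) ^ N * cmod (partials is f x) \<le> C" using schwartzE[OF assms(1)] by metis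
  have "(1 + norm x) ^ N * cmod (partials is f (x + h)) \<le> (1 + norm h) ^ N * C" for x
  proof -
    have "(1 + norm x) ^ N * cmod (partials is f (x + h)) \<le>
       (1 + norm (x + h)) ^ N * (1 + norm h) ^ N * cmod (partials is f (x + h))"
      by (intro mult_right_mono weight_shift_power) auto
    then show ?thesis using mult_left_mono[OF C[of "x + h"], of "(1 + norm h) ^ N"] by (simp add: mult_ac)
  qed
  then show "\<exists>C. \<forall>x. (1 + norm x) ^ N * cmod (partials is (\<lambda>x. f (x + h)) x) \<le> C"
    by (auto simp: partials_shift)
qed

lemma schwartz_shift_minus: "f \<in> schwartz \<Longrightarrow> (\<lambda>x. f (x - h)) \<in> schwartz"
  using schwartz_shift[of f "-h"] by simp

lemma schwartz_subspace: "complex_subspace schwartz"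
  by (auto simp: complex_subspace_def schwartz_zero schwartz_add schwartz_cmult)

lemma schwartz_shift_iff: "(\<lambda>x. f (x - h)) \<in> schwartz \<longleftrightarrow> f \<in> schwartz"
  using schwartz_shift_minus[of f h] schwartz_shift[of "\<lambda>x. f (x - h)" h] by auto

text \<open>Mean value inequality on the unit ball around \<open>x\<close>. Inside that ball the
  weight changes by a factor of at most \<open>2 ^ N\<close>; \<open>CARD('n)\<close> counts the
  partial derivatives.\<close>

lemma shift_estimate:
  fixes f :: "real^'n::finite \<Rightarrow> complex"
  assumes d: "\<And>x. f differentiable (at x)" and B: "\<And>i x. (1 + norm x) ^ N * cmod (partial i f x) \<le> B"
    and h: "norm h \<le> 1"
  shows "(1 + norm x) ^ N * cmod (f (x + h) - f x) \<le> 2 ^ N * real CARD('n) * B * norm h"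
proof -
  have B0: "0 \<le> B" by (rule order_trans[OF _ B[of 0 undefined]]) auto
  define K where "K = real CARD('n) * (B * 2 ^ N / (1 + norm x) ^ N)"
  have px: "0 < (1 + norm x) ^ N" by (simp add: add_pos_nonneg)
  have pxn: "1 + norm x \<noteq> 0" using norm_ge_zero[of x] by linarith
  have "norm (f (x + h) - f x) \<le> K * norm ((x + h) - x)"
  proof (rule differentiable_bound)
    show "convex (cball x 1)" by simp
    show "x + h \<in> cball x 1" "x \<in> cball x 1" using h by (auto simp: dist_norm)
    fix y assume y: "y \<in> cball x 1"
    show "(f has_derivative (\<lambda>h. \<Sum>i\<in>UNIV. of_real (h $ i) * partial i f y)) (at y within cball x 1)"
      using has_derivative_partial[OF d] has_derivative_at_withinI by blast
    have pb: "cmod (partial i f y) \<le> B * 2 ^ N / (1 + norm x) ^ N" for i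
    proof -
      have "(1 + norm x) ^ N * cmod (partial i f y) \<le> ((1 + norm y) ^ N * 2 ^ N) * cmod (partial i f y)"
      proof (rule mult_right_mono)
        have "(1 + norm x) ^ N \<le> (1 + norm (x + (y - x))) ^ N * (1 + norm (y - x)) ^ N" by (rule weight_shift_power)
        also have "\<dots> \<le> (1 + norm y) ^ N * 2 ^ N"
          using y by (intro mult_mono power_mono) (auto simp: dist_norm norm_minus_commute)
        finally show "(1 + norm x) ^ N \<le> (1 + norm y) ^ N * 2 ^ N" .
      qed auto
      also have "\<dots> \<le> B * 2 ^ N" using mult_right_mono[OF B[of y i], of "2 ^ N"] by (simp add: mult_ac)
      finally show ?thesis using px by (simp add: field_simps)
    qed
    show "onorm (\<lambda>h. \<Sum>i\<in>UNIV. of_real (h $ i) * partial i f y) \<le> K"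
    proof (rule onorm_le)
      fix k :: "real^'n"
      have "norm (\<Sum>i\<in>UNIV. of_real (k $ i) * partial i f y) \<le> (\<Sum>i\<in>(UNIV::'n set). norm k * (B * 2 ^ N / (1 + norm x) ^ N))"
        by (intro sum_norm_le) (simp only: norm_mult norm_of_real, intro mult_mono pb component_le_norm_cart, auto)
      also have "\<dots> = K * norm k" by (simp add: K_def)
      finally show "norm (\<Sum>i\<in>UNIV. of_real (k $ i) * partial i f y) \<le> K * norm k" .
    qed
  qed
  then have "(1 + norm x) ^ N * cmod (f (x + h) - f x) \<le> (1 + norm x) ^ N * (K * norm h)"
    using px by (intro mult_left_mono) auto
  also have "\<dots> = 2 ^ N * real CARD('n) * B * norm h" by (simp add: K_def pxn)
  finally show ?thesis .
qed

text \<open>The derivative of the remainder in \<open>s\<close> is a difference of values of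
  \<open>partial i f\<close>, which \<open>shift_estimate\<close> bounds linearly in
  \<open>s\<close>. The shift has a negative sign because \<open>translate h\<close> acts on test
  functions by \<open>x - h\<close>.\<close>

lemma shift_estimate2:
  fixes f :: "real^'n::finite \<Rightarrow> complex"
  assumes d: "\<And>x. f differentiable (at x)" and d1: "\<And>x. partial i f differentiable (at x)"
    and B: "\<And>j x. (1 + norm x) ^ N * cmod (partial j (partial i f) x) \<le> B"
    and s: "0 \<le> s" "s \<le> 1"
  shows "(1 + norm x) ^ N * cmod (f (x - s *\<^sub>R axis i 1) - f x + of_real s * partial i f x) \<le> 2 ^ N * real CARD('n) * B * s^2"
proof -
  have px: "0 < (1 + norm x) ^ N" by (simp add: add_pos_nonneg)
  have pxn: "1 + norm x \<noteq> 0" using norm_ge_zero[of x] by linarith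
  define K where "K = 2 ^ N * real CARD('n) * B * s / (1 + norm x) ^ N"
  define r where "r = (\<lambda>s. f (x - s *\<^sub>R axis i 1) - f x + of_real s * partial i f x)"
  have rd: "(r has_vector_derivative (partial i f x - partial i f (x - t *\<^sub>R axis i 1))) (at t within {0..s})" for t
  proof -
    have "((\<lambda>t. f (x - t *\<^sub>R axis i 1)) has_derivative
       (\<lambda>h. \<Sum>j\<in>UNIV. of_real ((- (h *\<^sub>R axis i 1)) $ j) * partial j f (x - t *\<^sub>R axis i 1))) (at t within {0..s})"
      by (rule has_derivative_compose[where f = "\<lambda>t. x - t *\<^sub>R axis i 1"])
        (auto intro!: derivative_eq_intros has_derivative_partial d)
    moreover have "(\<lambda>h. \<Sum>j\<in>UNIV. of_real ((- (h *\<^sub>R axis i 1)) $ j) * partial j f (x - t *\<^sub>R axis i 1)) =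
        (\<lambda>h. h *\<^sub>R (- partial i f (x - t *\<^sub>R axis i 1)))"
      by (simp add: sum_negf mult.assoc sum_axis scaleR_conv_of_real[where 'a = complex] flip: sum_distrib_left)
    ultimately have "((\<lambda>t. f (x - t *\<^sub>R axis i 1)) has_vector_derivative (- partial i f (x - t *\<^sub>R axis i 1))) (at t within {0..s})"
      by (simp add: has_vector_derivative_def)
    moreover have "((\<lambda>t. of_real t * partial i f x) has_vector_derivative partial i f x) (at t within {0..s})"
      by (auto intro!: derivative_eq_intros simp: has_vector_derivative_def scaleR_conv_of_real)
    ultimately show ?thesis unfolding r_def
      by (auto intro!: derivative_eq_intros)
  qed
  have ax: "norm (axis i 1 :: real^'n) = 1" by simp
  have "norm (r s - r 0) \<le> K * norm (s - 0)"
  proof (rule differentiable_bound)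
    show "(r has_derivative (\<lambda>h. h *\<^sub>R (partial i f x - partial i f (x - t *\<^sub>R axis i 1)))) (at t within {0..s})" for t
      using rd by (simp add: has_vector_derivative_def)
    fix t assume t: "t \<in> {0..s}"
    have "(1 + norm x) ^ N * cmod (partial i f (x + - (t *\<^sub>R axis i 1)) - partial i f x) \<le>
      2 ^ N * real CARD('n) * B * norm (- (t *\<^sub>R axis i 1 :: real^'n))"
      using t s by (intro shift_estimate d1 B) (auto simp: ax)
    also have "\<dots> \<le> 2 ^ N * real CARD('n) * B * s"
      using t order_trans[OF _ B[of 0 undefined]] by (intro mult_left_mono) (auto simp: ax)
    finally have "norm (partial i f x - partial i f (x - t *\<^sub>R axis i 1)) \<le> K"
      using px by (simp add: K_def field_simps norm_minus_commute)
    then show "onorm (\<lambda>h. h *\<^sub>R (partial i f x - partial i f (x - t *\<^sub>R axis i 1))) \<le> K"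
      by (intro onorm_le) (simp add: mult.commute[of K] mult_left_mono)
  qed (use s in auto)
  then have "(1 + norm x) ^ N * cmod (r s) \<le> (1 + norm x) ^ N * (K * s)"
    using px s by (intro mult_left_mono) (auto simp: r_def)
  also have "\<dots> = 2 ^ N * real CARD('n) * B * s^2" by (simp add: K_def power2_eq_square pxn)
  finally show ?thesis by (simp add: r_def)
qed

section \<open>Integrals of rapidly decreasing functions\<close>

text \<open>The function is majorised by indicators of the balls of radius \<open>k + 1\<close> with
  coefficients \<open>1 / (1 + k) ^ (CARD('n) + 2)\<close>. The exponent is chosen so that the
  volume of the ball leaves the summable \<open>1 / (k + 1) ^ 2\<close>.\<close>

lemma integrable_weight: "integrable lborel (\<lambda>x::real^'n::finite. 1 / (1 + norm x) ^ (CARD('n) + 2))"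
proof (rule integrableI_bounded)
  let ?n = "CARD('n)" and ?N = "CARD('n) + 2"
  define c where "c = (\<lambda>k::nat. 1 / (1 + real k) ^ ?N)"
  have c0: "c k \<ge> 0" for k by (simp add: c_def)
  define u where "u = unit_ball_vol (real CARD('n))"
  have u0: "u \<ge> 0" by (simp add: u_def)
  define T where "T = (\<lambda>(k::nat) (x::real^'n). ennreal (c k) * indicator (cball 0 (real k + 1)) x)"
  have le: "ennreal (norm (1 / (1 + norm x) ^ ?N)) \<le> (\<Sum>k. T k x)" for x :: "real^'n"
  proof -
    let ?k = "nat \<lfloor>norm x\<rfloor>"
    have k: "real ?k \<le> norm x" "norm x \<le> real ?k + 1" using norm_ge_zero[of x] by linarith+
    have "1 / (1 + norm x) ^ ?N \<le> c ?k"
      unfolding c_def using k by (intro divide_left_mono power_mono mult_pos_pos zero_less_power) (auto simp: add_pos_nonneg)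
    then have "ennreal (norm (1 / (1 + norm x) ^ ?N)) \<le> T ?k x"
      using k by (simp add: T_def ennreal_leI indicator_def)
    also have "\<dots> \<le> (\<Sum>k. T k x)"
      using sum_le_suminf[OF summableI, of "{?k}" "\<lambda>k. T k x"] by simp
    finally show ?thesis .
  qed
  have "(\<integral>\<^sup>+x. ennreal (norm (1 / (1 + norm (x::real^'n)) ^ ?N)) \<partial>lborel) \<le> (\<integral>\<^sup>+x. (\<Sum>k. T k x) \<partial>lborel)"
    by (intro nn_integral_mono le)
  also have "\<dots> = (\<Sum>k. \<integral>\<^sup>+x. T k x \<partial>lborel)"
    unfolding T_def by (intro nn_integral_suminf borel_measurable_times_ennreal borel_measurable_indicator) auto
  also have "\<dots> = (\<Sum>k. ennreal (u * inverse ((real (Suc k))^2)))"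
  proof (rule suminf_cong)
    fix k
    have "(\<integral>\<^sup>+x. T k x \<partial>lborel) = ennreal (c k) * emeasure lborel (cball (0::real^'n) (real k + 1))"
      unfolding T_def by (rule nn_integral_cmult_indicator) auto
    also have "\<dots> = ennreal (c k) * ennreal (u * (real k + 1) ^ ?n)"
      by (subst emeasure_cball) (simp_all add: u_def)
    also have "\<dots> = ennreal (c k * (u * (real k + 1) ^ ?n))"
      using u0 c0 by (intro ennreal_mult[symmetric]) auto
    also have "c k * (u * (real k + 1) ^ ?n) = u * inverse ((real (Suc k))^2)"
    proof -
      have "(1 + real k) ^ ?n > 0" by simp
      then show ?thesis unfolding c_def power_add by (simp add: field_simps del: power_Suc)
    qed
    finally show "(\<integral>\<^sup>+x. T k x \<partial>lborel) = ennreal (u * inverse ((real (Suc k))^2))" .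
  qed
  also have "\<dots> < \<infinity>"
  proof -
    have "summable (\<lambda>k. u * inverse ((real (Suc k))^2))"
      using inverse_power_summable[of 2, where 'a = real] by (intro summable_mult) (subst summable_Suc_iff[of "\<lambda>k. inverse (real k ^ 2)"], simp)
    then have "(\<Sum>k. ennreal (u * inverse ((real (Suc k))^2))) \<noteq> top"
      using u0 by (intro ennreal_suminf_neq_top) auto
    then show ?thesis by (simp add: less_top)
  qed
  finally show "(\<integral>\<^sup>+x. ennreal (norm (1 / (1 + norm (x::real^'n)) ^ ?N)) \<partial>lborel) < \<infinity>" .
qed simp

lemma weight_pos: "0 < (1 + norm (x::'a::real_normed_vector)) ^ N"
  by (simp add: add_pos_nonneg)

lemma integrable_decay:
  fixes f :: "real^'n::finite \<Rightarrow> complex"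
  assumes m: "f \<in> borel_measurable borel" and C: "\<And>x. (1 + norm x) ^ (CARD('n) + 2) * cmod (f x) \<le> C"
  shows "integrable lborel f"
proof (rule Bochner_Integration.integrable_bound)
  show "integrable lborel (\<lambda>x::real^'n. C * (1 / (1 + norm x) ^ (CARD('n) + 2)))"
    by (intro integrable_mult_right integrable_weight)
  have "norm (f x) \<le> norm (C * (1 / (1 + norm x) ^ (CARD('n) + 2)))" for x
    using C[of x] weight_pos[of x "CARD('n) + 2"]
    by (auto simp: field_simps simp del: power_Suc intro!: order_trans[OF _ abs_ge_self])
  then show "AE x in lborel. norm (f x) \<le> norm (C * (1 / (1 + norm x) ^ (CARD('n) + 2)))" by simp
qed (use m in simp)

lemma integral_shift:
  fixes f :: "'a::euclidean_space \<Rightarrow> complex"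
  assumes [measurable]: "f \<in> borel_measurable borel"
  shows "(LINT x|lborel. f (x + h)) = (LINT x|lborel. f x)"
proof -
  have "(LINT x|lborel. f x) = (LINT x|distr lborel borel ((+) h). f x)" by (simp add: lborel_distr_plus)
  also have "\<dots> = (LINT x|lborel. f (h + x))" by (rule integral_distr) auto
  finally show ?thesis by (simp add: add.commute)
qed

lemma integrable_shift:
  fixes f :: "'a::euclidean_space \<Rightarrow> complex"
  assumes "integrable lborel f"
  shows "integrable lborel (\<lambda>x. f (x + h))"
proof -
  have [measurable]: "f \<in> borel_measurable borel" using assms by (auto dest: borel_measurable_integrable)
  have "integrable (distr lborel borel ((+) h)) f" using assms by (simp add: lborel_distr_plus)
  then show ?thesis by (subst (asm) integrable_distr_eq) (auto simp: add.commute)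
qed

lemma integral_dilate:
  fixes f :: "real^'n::finite \<Rightarrow> complex"
  assumes [measurable]: "f \<in> borel_measurable borel" and e: "e > 0"
  shows "(LINT x|lborel. f x) = e ^ CARD('n) *\<^sub>R (LINT t|lborel. f (x + e *\<^sub>R t))"
proof -
  have "(LINT x|lborel. f x) = (LINT y|density (distr lborel borel (\<lambda>t. x + e *\<^sub>R t)) (\<lambda>_. ennreal \<bar>e\<bar> ^ DIM(real^'n)). f y)"
    by (subst lborel_affine[of e x]) (use e in \<open>simp_all add: ennreal_power\<close>)
  also have "\<dots> = (LINT y|density (distr lborel borel (\<lambda>t. x + e *\<^sub>R t)) (\<lambda>_. ennreal (e ^ CARD('n))). f y)"
    using e by (simp add: ennreal_power)
  also have "\<dots> = (LINT y|distr lborel borel (\<lambda>t. x + e *\<^sub>R t). e ^ CARD('n) *\<^sub>R f y)"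
    using e by (intro integral_density) auto
  also have "\<dots> = (LINT t|lborel. e ^ CARD('n) *\<^sub>R f (x + e *\<^sub>R t))"
    by (intro integral_distr) auto
  finally show ?thesis by simp
qed

lemma schwartz_measurable: "f \<in> schwartz \<Longrightarrow> f \<in> borel_measurable borel"
  by (intro borel_measurable_continuous_onI smooth_continuous0 schwartz_smooth)

lemma schwartz_growth_integrable:
  fixes f :: "real^'n::finite \<Rightarrow> complex"
  assumes f: "f \<in> borel_measurable borel" "\<And>x. cmod (f x) \<le> C * (1 + norm x) ^ m" and g: "g \<in> schwartz"
  shows "integrable lborel (\<lambda>x. f x * g x)"
proof -
  obtain D where D: "\<And>x. (1 + norm x) ^ (m + (CARD('n) + 2)) * cmod (partials [] g x) \<le> D" "D \<ge> 0"
    using schwartzE[OF g] by metis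
  have C0: "C \<ge> 0" using order_trans[OF norm_ge_zero f(2)[of 0]] by simp
  show ?thesis
  proof (rule integrable_decay)
    show "(\<lambda>x. f x * g x) \<in> borel_measurable borel"
      using f schwartz_measurable[OF g] by auto
    fix x :: "real^'n"
    have "(1 + norm x) ^ (CARD('n) + 2) * cmod (f x * g x) \<le> (1 + norm x) ^ (CARD('n) + 2) * ((C * (1 + norm x) ^ m) * cmod (g x))"
      unfolding norm_mult by (intro mult_left_mono mult_right_mono f(2)) auto
    also have "\<dots> \<le> C * D"
      using mult_left_mono[OF D(1)[of x] C0] by (simp add: power_add mult_ac)
    finally show "(1 + norm x) ^ (CARD('n) + 2) * cmod (f x * g x) \<le> C * D" .
  qed
qed

lemma schwartz_integrable:
  assumes "f \<in> schwartz" shows "integrable lborel f"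
  using schwartz_growth_integrable[of "\<lambda>x. 1" 1 0 f] assms by simp

lemma sum_list_weighted_bound:
  fixes h :: "'p \<Rightarrow> 'z \<Rightarrow> complex"
  assumes "\<And>p. p \<in> set ps \<Longrightarrow> \<exists>C. \<forall>z\<in>Z. w z * cmod (h p z) \<le> C" and w: "\<And>z. z \<in> Z \<Longrightarrow> 0 \<le> w z"
  shows "\<exists>C. \<forall>z\<in>Z. w z * cmod (\<Sum>p\<leftarrow>ps. h p z) \<le> C"
  using assms(1)
proof (induction ps)
  case (Cons p ps)
  then obtain C where C: "\<forall>z\<in>Z. w z * cmod (\<Sum>p\<leftarrow>ps. h p z) \<le> C" by auto
  from Cons.prems obtain D where D: "\<forall>z\<in>Z. w z * cmod (h p z) \<le> D" by auto
  have "w z * cmod (\<Sum>p\<leftarrow>p # ps. h p z) \<le> D + C" if "z \<in> Z" for z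
  proof -
    have "w z * cmod (\<Sum>p\<leftarrow>p # ps. h p z) \<le> w z * (cmod (h p z) + cmod (\<Sum>p\<leftarrow>ps. h p z))"
      using w[OF that] by (intro mult_left_mono) (auto intro: norm_triangle_ineq)
    then show ?thesis using C D that by (fastforce simp: distrib_left)
  qed
  then show ?case by blast
qed auto

lemma schwartz_mult:
  assumes f: "f \<in> schwartz" and g: "g \<in> schwartz" shows "(\<lambda>x. f x * g x) \<in> schwartz"
proof (rule schwartzI)
  show "smooth (\<lambda>x. f x * g x)" using assms by (intro smooth_mult schwartz_smooth)
  fix N "is"
  have "\<exists>C. \<forall>x\<in>UNIV. (1 + norm x) ^ N * cmod (\<Sum>p\<leftarrow>splits is. partials (fst p) f x * partials (snd p) g x) \<le> C"
  proof (rule sum_list_weighted_bound)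
    fix p assume "p \<in> set (splits is)"
    obtain C where C: "\<And>x. (1 + norm x) ^ N * cmod (partials (fst p) f x) \<le> C" "C \<ge> 0" using schwartzE[OF f] by metis
    obtain D where D: "\<And>x. (1 + norm x) ^ 0 * cmod (partials (snd p) g x) \<le> D" "D \<ge> 0" using schwartzE[OF g] by metis
    have "(1 + norm x) ^ N * cmod (partials (fst p) f x * partials (snd p) g x) \<le> C * D" for x
      using mult_mono[OF C(1)[of x] D(1)[of x]] C D by (simp add: norm_mult mult_ac)
    then show "\<exists>C. \<forall>x\<in>UNIV. (1 + norm x) ^ N * cmod (partials (fst p) f x * partials (snd p) g x) \<le> C" by blast
  qed auto
  then show "\<exists>C. \<forall>x. (1 + norm x) ^ N * cmod (partials is (\<lambda>x. f x * g x) x) \<le> C"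
    using assms by (simp add: partials_mult schwartz_smooth case_prod_unfold)
qed

lemma schwartz_partial_sup:
  fixes f :: "real^'n::finite \<Rightarrow> complex"
  assumes "f \<in> schwartz"
  obtains B where "B \<ge> 0" "\<And>i x. (1 + norm x) ^ N * cmod (partial i (partials is f) x) \<le> B"
proof
  let ?B = "schwartz_seminorm (N + Suc (length is)) f"
  show "0 \<le> ?B" by (rule schwartz_seminorm_nonneg[OF assms])
  fix i x
  have "(1 + norm x) ^ N * cmod (partials (i # is) f x) \<le> (1 + norm x) ^ (N + Suc (length is)) * cmod (partials (i # is) f x)"
    by (intro mult_right_mono power_increasing) auto
  also have "\<dots> \<le> ?B" by (rule schwartz_seminorm_ge) (use assms in auto)
  finally show "(1 + norm x) ^ N * cmod (partial i (partials is f) x) \<le> ?B" by simp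
qed

text \<open>Difference quotients have integral 0 by translation invariance, and
  \<open>shift_estimate\<close> dominates them by the integrable weight. This is the whole content
  of integration by parts for Schwartz functions.\<close>

lemma integral_partial_zero:
  fixes f :: "real^'n::finite \<Rightarrow> complex"
  assumes f: "f \<in> schwartz"
  shows "(LINT x|lborel. partial i f x) = 0"
proof -
  let ?N = "CARD('n) + 2"
  obtain B where B: "B \<ge> 0" "\<And>i x. (1 + norm x) ^ ?N * cmod (partial i f x) \<le> B"
    using schwartz_partial_sup[OF f, of ?N "[]"] by auto
  define K where "K = 2 ^ ?N * real CARD('n) * B"
  define q where "q = (\<lambda>(k::nat) x. (f (x + (1 / real (Suc k)) *\<^sub>R axis i 1) - f x) * of_nat (Suc k))"
  have fm[measurable]: "f \<in> borel_measurable borel" by (rule schwartz_measurable[OF f])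
  have pm[measurable]: "partial i f \<in> borel_measurable borel" by (rule schwartz_measurable[OF schwartz_partial[OF f]])
  have fd: "f differentiable (at x)" for x by (rule smooth_differentiable0[OF schwartz_smooth[OF f]])
  have "(\<lambda>k. LINT x|lborel. q k x) \<longlonglongrightarrow> (LINT x|lborel. partial i f x)"
  proof (rule integral_dominated_convergence)
    show "integrable lborel (\<lambda>x::real^'n. K * (1 / (1 + norm x) ^ ?N))"
      by (intro integrable_mult_right integrable_weight)
    show "AE x in lborel. (\<lambda>k. q k x) \<longlonglongrightarrow> partial i f x"
    proof (rule AE_I2)
      fix x
      have "((\<lambda>t. f (x + t *\<^sub>R axis i 1)) has_derivative (\<lambda>h. \<Sum>j\<in>UNIV. of_real ((h *\<^sub>R axis i 1) $ j) * partial j f (x + 0 *\<^sub>R axis i 1))) (at 0)"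
        by (rule has_derivative_compose[where f = "\<lambda>t. x + t *\<^sub>R axis i 1"])
          (auto intro!: derivative_eq_intros has_derivative_partial fd)
      then have "((\<lambda>t. f (x + t *\<^sub>R axis i 1)) has_vector_derivative partial i f x) (at 0)"
        by (simp add: has_vector_derivative_def mult.assoc sum_axis scaleR_conv_of_real[where 'a = complex] flip: sum_distrib_left)
      then have "((\<lambda>t. norm (f (x + (0 + t) *\<^sub>R axis i 1) - f (x + 0 *\<^sub>R axis i 1) - t *\<^sub>R partial i f x) / norm t) \<longlongrightarrow> 0) (at 0)"
        unfolding has_vector_derivative_def has_derivative_at by blast
      from filterlim_compose[OF this, of "\<lambda>k. 1 / real (Suc k)" sequentially]
      have "(\<lambda>k. norm (f (x + (1 / real (Suc k)) *\<^sub>R axis i 1) - f x - (1 / real (Suc k)) *\<^sub>R partial i f x) / norm (1 / real (Suc k))) \<longlonglongrightarrow> 0"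
        using LIMSEQ_inverse_real_of_nat by (simp add: filterlim_at inverse_eq_divide del: of_nat_Suc)
      moreover have "norm (f (x + (1 / real (Suc k)) *\<^sub>R axis i 1) - f x - (1 / real (Suc k)) *\<^sub>R partial i f x) / norm (1 / real (Suc k))
          = norm (q k x - partial i f x)" for k
      proof -
        define D where "D = f (x + (1 / real (Suc k)) *\<^sub>R axis i 1) - f x"
        have "q k x - partial i f x = of_nat (Suc k) * (D - (1 / real (Suc k)) *\<^sub>R partial i f x)"
          unfolding q_def D_def[symmetric] by (simp add: right_diff_distrib scaleR_conv_of_real mult.commute del: of_nat_Suc)
        then show ?thesis unfolding D_def[symmetric] by (simp add: norm_mult mult.commute del: of_nat_Suc)
      qed
      ultimately show "(\<lambda>k. q k x) \<longlonglongrightarrow> partial i f x"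
        by (simp only: tendsto_norm_zero_iff LIM_zero_iff)
    qed
    fix k
    show "AE x in lborel. norm (q k x) \<le> K * (1 / (1 + norm x) ^ ?N)"
    proof (rule AE_I2)
      fix x
      have "(1 + norm x) ^ ?N * cmod (f (x + (1 / real (Suc k)) *\<^sub>R axis i 1) - f x) \<le> K * norm ((1 / real (Suc k)) *\<^sub>R axis i 1 :: real^'n)"
        unfolding K_def by (intro shift_estimate fd B) auto
      also have "\<dots> = K / real (Suc k)" by simp
      finally have "(1 + norm x) ^ ?N * cmod (f (x + (1 / real (Suc k)) *\<^sub>R axis i 1) - f x) * real (Suc k) \<le> K"
        by (simp add: field_simps)
      then have "(1 + norm x) ^ ?N * norm (q k x) \<le> K"
        unfolding q_def norm_mult norm_of_nat by (simp only: mult.assoc)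
      then show "norm (q k x) \<le> K * (1 / (1 + norm x) ^ ?N)"
        using weight_pos[of x ?N] by (simp only: mult_1_right times_divide_eq_right pos_le_divide_eq mult.commute)
    qed
  qed (auto simp: q_def)
  moreover have "(LINT x|lborel. q k x) = 0" for k
  proof -
    have "(LINT x|lborel. f (x + (1 / real (Suc k)) *\<^sub>R axis i 1) - f x) = 0"
      using integrable_shift[OF schwartz_integrable[OF f]] schwartz_integrable[OF f]
      by (subst Bochner_Integration.integral_diff) (auto simp: integral_shift)
    then show ?thesis by (simp only: q_def integral_mult_left_zero mult_zero_left)
  qed
  ultimately show ?thesis by (simp add: LIMSEQ_const_iff)
qed

lemma schwartz_dist_partial:
  fixes f :: "real^'n::finite \<Rightarrow> complex"
  assumes f: "f \<in> schwartz"
  shows "dist_partial i (schwartz_dist f) = schwartz_dist (partial i f)"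
proof (rule ext)
  fix g :: "real^'n \<Rightarrow> complex"
  show "dist_partial i (schwartz_dist f) g = schwartz_dist (partial i f) g"
  proof (cases "g \<in> schwartz")
    case True
    have "(LINT x|lborel. partial i (\<lambda>x. f x * g x) x) = 0"
      by (intro integral_partial_zero schwartz_mult f True)
    moreover have "partial i (\<lambda>x. f x * g x) = (\<lambda>x. partial i f x * g x + f x * partial i g x)"
      by (intro ext partial_mult smooth_differentiable0 schwartz_smooth f True)
    ultimately have "(LINT x|lborel. partial i f x * g x + f x * partial i g x) = 0" by simp
    then have "(LINT x|lborel. partial i f x * g x) + (LINT x|lborel. f x * partial i g x) = 0"
      by (subst (asm) Bochner_Integration.integral_add) (auto intro!: schwartz_integrable schwartz_mult schwartz_partial f True)
    then show ?thesis using True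
      by (simp add: dist_partial_def schwartz_dist_def schwartz_partial) (metis add.commute add_eq_0_iff)
  qed (simp_all add: dist_partial_def schwartz_dist_def)
qed

lemma dist_partials_Nil [simp]: "dist_partials [] u = u"
  by (simp add: dist_partials_def)

lemma dist_partials_Cons [simp]: "dist_partials (i # is) u = dist_partial i (dist_partials is u)"
  by (simp add: dist_partials_def)

lemma dist_partials_append: "dist_partials (is @ js) u = dist_partials is (dist_partials js u)"
  by (simp add: dist_partials_def)

lemma schwartz_dist_partials:
  assumes "f \<in> schwartz"
  shows "dist_partials is (schwartz_dist f) = schwartz_dist (partials is f)"
  using assms by (induction "is") (auto simp: schwartz_dist_partial schwartz_partials)

lemma schwartz_dist_translate:
  assumes f: "f \<in> schwartz"
  shows "translate h (schwartz_dist f) = schwartz_dist (\<lambda>x. f (x + h))"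
proof (rule ext)
  fix g
  show "translate h (schwartz_dist f) g = schwartz_dist (\<lambda>x. f (x + h)) g"
  proof (cases "g \<in> schwartz")
    case True
    note [measurable] = schwartz_measurable[OF f] schwartz_measurable[OF True]
    have "(LINT x|lborel. f x * g (x - h)) = (LINT x|lborel. f (x + h) * g ((x + h) - h))"
      by (rule integral_shift[symmetric]) measurable
    then show ?thesis using True schwartz_shift_minus[OF True] by (simp add: translate_def schwartz_dist_def)
  qed (simp add: translate_def schwartz_dist_def schwartz_shift_iff)
qed

lemma schwartz_dist_add:
  assumes "f \<in> schwartz" "g \<in> schwartz"
  shows "schwartz_dist (\<lambda>x. f x + g x) = (\<lambda>p. schwartz_dist f p + schwartz_dist g p)"
  using assms by (auto simp: schwartz_dist_def fun_eq_iff distrib_right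
      intro!: Bochner_Integration.integral_add schwartz_integrable schwartz_mult)

lemma schwartz_dist_cmult: "schwartz_dist (\<lambda>x. c * f x) = (\<lambda>p. c * schwartz_dist f p)"
  by (auto simp: schwartz_dist_def fun_eq_iff mult.assoc)

lemma schwartz_dist_diff:
  assumes "f \<in> schwartz" "g \<in> schwartz"
  shows "schwartz_dist (\<lambda>x. f x - g x) = (\<lambda>p. schwartz_dist f p - schwartz_dist g p)"
  using assms by (auto simp: schwartz_dist_def fun_eq_iff left_diff_distrib
      intro!: Bochner_Integration.integral_diff schwartz_integrable schwartz_mult)

section \<open>Density of the test functions\<close>

lemma test_function_smooth: "f \<in> test_functions \<Longrightarrow> smooth f"
  by (simp add: test_functions_def)

lemma partials_support:
  fixes f :: "real^'n::finite \<Rightarrow> complex"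
  assumes "x \<notin> closure {x. f x \<noteq> 0}"
  shows "partials is f x = 0"
proof -
  let ?S = "closure {x. f x \<noteq> 0}"
  have "\<forall>x. x \<notin> ?S \<longrightarrow> partials is f x = 0"
  proof (induction "is")
    case Nil
    then show ?case using closure_subset[of "{x. f x \<noteq> 0}"] by auto
  next
    case (Cons i "is")
    show ?case
    proof (intro allI impI)
      fix x assume x: "x \<notin> ?S"
      have "(partials is f has_derivative (\<lambda>h. 0)) (at x)"
        by (rule has_derivative_transform_within_open[of "\<lambda>x. 0" _ _ _ "- ?S"]) (use x Cons in auto)
      then show "partials (i # is) f x = 0" using partial_eqI by fastforce
    qed
  qed
  then show ?thesis using assms by blast
qed

lemma test_function_bounded:
  assumes "f \<in> test_functions"
  obtains C where "\<And>x. (1 + norm x) ^ N * cmod (partials is f x) \<le> C"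
proof -
  let ?S = "closure {x. f x \<noteq> 0}"
  have "compact ((\<lambda>x. (1 + norm x) ^ N * cmod (partials is f x)) ` ?S)"
    using assms by (intro compact_continuous_image continuous_intros smooth_continuous) (auto simp: test_functions_def)
  then have "bounded ((\<lambda>x. (1 + norm x) ^ N * cmod (partials is f x)) ` ?S)" by (rule compact_imp_bounded)
  then obtain C where "\<forall>y\<in>(\<lambda>x. (1 + norm x) ^ N * cmod (partials is f x)) ` ?S. norm y \<le> C" by (auto simp only: bounded_iff)
  then have C: "\<bar>(1 + norm x) ^ N * cmod (partials is f x)\<bar> \<le> C" if "x \<in> ?S" for x
    using that unfolding real_norm_def by blast
  have "(1 + norm x) ^ N * cmod (partials is f x) \<le> max C 0" for x
    using C[of x] partials_support[of x f "is"] by (cases "x \<in> ?S") auto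
  then show ?thesis using that by blast
qed

lemma test_schwartz:
  assumes "f \<in> test_functions" shows "f \<in> schwartz"
proof (rule schwartzI)
  show "smooth f" by (rule test_function_smooth[OF assms])
  fix N "is"
  obtain C where "\<And>x. (1 + norm x) ^ N * cmod (partials is f x) \<le> C"
    using test_function_bounded[OF assms, of N "is"] by blast
  then show "\<exists>C. \<forall>x. (1 + norm x) ^ N * cmod (partials is f x) \<le> C" by blast
qed

lemma test_functions_support:
  assumes "smooth f" "\<And>x. norm x > r \<Longrightarrow> f x = 0"
  shows "f \<in> test_functions"
proof -
  have "{x. f x \<noteq> 0} \<subseteq> cball 0 r" using assms(2) by (force simp: not_less[symmetric])
  then show ?thesis using assms(1) compact_closure bounded_subset[OF bounded_cball]
    unfolding test_functions_def by (auto simp: compact_closure)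
qed

lemma test_function_support:
  assumes "f \<in> test_functions"
  obtains r where "r > 0" "\<And>x. norm x > r \<Longrightarrow> f x = 0"
proof -
  have "bounded {x. f x \<noteq> 0}" using assms by (auto simp: test_functions_def compact_closure)
  then obtain r where "r > 0" "\<And>x. f x \<noteq> 0 \<Longrightarrow> norm x \<le> r" by (auto simp: bounded_pos)
  then show ?thesis using that by (metis not_less)
qed

lemma partials_const: "partials is (\<lambda>x. c) = (\<lambda>x. if is = [] then c else 0)"
proof (induction "is")
  case (Cons i "is")
  then show ?case by (auto intro!: ext simp: partial_def simp flip: if_distrib)
qed auto

lemma smooth_const: "smooth (\<lambda>x. c)"
  by (simp add: smooth_def partials_const)

text \<open>Cutoff by \<open>chi (d x)\<close> with \<open>d\<close> tending to 0. The error factor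
  \<open>eta d\<close> and all its derivatives are of size \<open>d * (1 + norm x)\<close>; the
  additional power of \<open>1 + norm x\<close> is paid for by the decay of
  \<open>f\<close>.\<close>

lemma test_functions_dense_aux:
  fixes chi f :: "real^'n::finite \<Rightarrow> complex"
  assumes chi: "chi \<in> test_functions" "chi 0 = 1" and f: "f \<in> schwartz" and e: "e > 0"
  shows "\<exists>g\<in>test_functions. schwartz_seminorm N (\<lambda>x. f x - g x) < e"
proof -
  define eta where "eta = (\<lambda>d x. chi (d *\<^sub>R x) + (-1))"
  have sm: "smooth chi" by (rule test_function_smooth[OF chi(1)])
  have se: "smooth (eta d)" for d unfolding eta_def by (rule smooth_add[OF smooth_dilate[OF sm] smooth_const])
  let ?Z = "{0<..1::real} \<times> (UNIV::(real^'n) set)"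
  have eb: "\<exists>C. \<forall>(d,x)\<in>?Z. cmod (partials a (eta d) x) \<le> C * d * (1 + norm x)" for a
  proof -
    obtain B where B: "\<And>x. (1 + norm x) ^ 0 * cmod (partials a chi x) \<le> B" using test_function_bounded[OF chi(1)] by metis
    have B0: "B \<ge> 0" using order_trans[OF _ B[of 0]] by simp
    show ?thesis
    proof (cases "a = []")
      case False
      have "cmod (partials a (eta d) x) \<le> B * d * (1 + norm x)" if "d \<in> {0<..1}" for d x
      proof -
        have "partials a (eta d) x = of_real d ^ length a * partials a chi (d *\<^sub>R x)"
          using False unfolding eta_def by (subst partials_add[OF smooth_dilate[OF sm] smooth_const]) (simp add: partials_const partials_dilate[OF sm])
        then have "cmod (partials a (eta d) x) = d ^ length a * cmod (partials a chi (d *\<^sub>R x))"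
          using that by (simp add: norm_mult norm_power)
        also have "\<dots> \<le> d ^ 1 * B"
          using False that B[of "d *\<^sub>R x"] by (intro mult_mono power_decreasing) (auto simp: Suc_le_eq)
        also have "\<dots> \<le> B * d * (1 + norm x)"
          using B0 that by (simp add: mult_ac mult_le_cancel_left1) (simp add: distrib_left mult_ac)
        finally show ?thesis .
      qed
      then show ?thesis by blast
    next
      case True
      obtain D where D: "D \<ge> 0" "\<And>i x. (1 + norm x) ^ 0 * cmod (partial i (partials [] chi) x) \<le> D"
        using schwartz_partial_sup[OF test_schwartz[OF chi(1)]] by metis
      define C where "C = 2 ^ 0 * real CARD('n) * D + B + 1"
      have "cmod (partials a (eta d) x) \<le> C * d * (1 + norm x)" if d: "d \<in> {0<..1}" for d x
      proof -
        \<comment> \<open>Two regimes: where \<open>d x\<close> lies in the unit ball,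
          \<open>chi 0 = 1\<close> and the mean value inequality apply; elsewhere \<open>eta\<close>
          is merely bounded, and \<open>d * norm x\<close> exceeds 1.\<close>
        have "cmod (eta d x) \<le> C * (d * norm x)"
        proof (cases "norm (d *\<^sub>R x) \<le> 1")
          case True
          have "(1 + norm (0::real^'n)) ^ 0 * cmod (chi (0 + d *\<^sub>R x) - chi 0) \<le> 2 ^ 0 * real CARD('n) * D * norm (d *\<^sub>R x)"
            using D True by (intro shift_estimate smooth_differentiable0 sm) auto
          also have "\<dots> \<le> C * norm (d *\<^sub>R x)" using B0 by (intro mult_right_mono) (auto simp: C_def)
          finally show ?thesis using d by (simp add: eta_def chi)
        next
          case False
          have "cmod (eta d x) \<le> B + 1"
            using B[of "d *\<^sub>R x"] \<open>a = []\<close> norm_triangle_ineq[of "chi (d *\<^sub>R x)" "-1"] by (simp add: eta_def)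
          also have "\<dots> \<le> C" using D by (simp add: C_def)
          also have "\<dots> \<le> C * (d * norm x)" using False d D B0 mult_left_mono[of 1 "d * norm x" C] by (simp add: C_def)
          finally show ?thesis .
        qed
        also have "\<dots> \<le> C * (d * (1 + norm x))"
          using d D B0 by (intro mult_left_mono) (auto simp: C_def)
        finally show ?thesis using True by (simp add: mult_ac)
      qed
      then show ?thesis by blast
    qed
  qed
  have tb: "\<exists>C. \<forall>z\<in>?Z. ((1 + norm (snd z)) ^ N / fst z) * cmod (\<Sum>p\<leftarrow>splits is. partials (fst p) (eta (fst z)) (snd z) * partials (snd p) f (snd z)) \<le> C" for "is"
  proof (rule sum_list_weighted_bound)
    fix p assume "p \<in> set (splits is)"
    obtain C where C: "\<forall>(d,x)\<in>?Z. cmod (partials (fst p) (eta d) x) \<le> C * d * (1 + norm x)" using eb by blast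
    obtain D where D: "\<And>x. (1 + norm x) ^ Suc N * cmod (partials (snd p) f x) \<le> D" "D \<ge> 0" using schwartzE[OF f] by metis
    have "cmod (partials (fst p) (eta 1) 0) \<le> C * 1 * (1 + norm (0::real^'n))"
      using C[rule_format, of "(1, 0)"] by simp
    from order_trans[OF norm_ge_zero this] have C0: "C \<ge> 0" by simp
    have bd: "((1 + norm x) ^ N / d) * cmod (partials (fst p) (eta d) x * partials (snd p) f x) \<le> C * D" if "d \<in> {0<..1}" for d x
    proof -
      have "((1 + norm x) ^ N / d) * cmod (partials (fst p) (eta d) x * partials (snd p) f x) \<le>
         ((1 + norm x) ^ N / d) * ((C * d * (1 + norm x)) * cmod (partials (snd p) f x))"
        unfolding norm_mult using C that by (intro mult_left_mono mult_right_mono) auto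
      also have "\<dots> = C * ((1 + norm x) ^ Suc N * cmod (partials (snd p) f x))" using that by (simp add: field_simps)
      also have "\<dots> \<le> C * D" by (intro mult_left_mono D C0)
      finally show ?thesis .
    qed
    show "\<exists>C. \<forall>z\<in>?Z. ((1 + norm (snd z)) ^ N / fst z) * cmod (partials (fst p) (eta (fst z)) (snd z) * partials (snd p) f (snd z)) \<le> C"
    proof (intro exI ballI)
      fix z assume "z \<in> ?Z"
      then show "((1 + norm (snd z)) ^ N / fst z) * cmod (partials (fst p) (eta (fst z)) (snd z) * partials (snd p) f (snd z)) \<le> C * D"
        by (intro bd) (simp add: mem_Times_iff)
    qed
  next
    fix z assume "z \<in> ?Z"
    then show "0 \<le> (1 + norm (snd z)) ^ N / fst z" by (simp add: mem_Times_iff)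
  qed
  have "\<exists>C. \<forall>is. \<forall>z\<in>?Z. length is \<le> N \<longrightarrow> ((1 + norm (snd z)) ^ N / fst z) * cmod (partials is (\<lambda>x. eta (fst z) x * f x) (snd z)) \<le> C"
  proof -
    have "\<forall>is. \<exists>C. \<forall>z\<in>?Z. ((1 + norm (snd z)) ^ N / fst z) * cmod (partials is (\<lambda>x. eta (fst z) x * f x) (snd z)) \<le> C"
      using tb by (simp add: partials_mult se schwartz_smooth[OF f] case_prod_unfold)
    then obtain C where C: "\<And>is z. z \<in> ?Z \<Longrightarrow> ((1 + norm (snd z)) ^ N / fst z) * cmod (partials is (\<lambda>x. eta (fst z) x * f x) (snd z)) \<le> C is"
      by metis
    have "C is \<le> Max (C ` {is. length is \<le> N})" if "length is \<le> N" for "is"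
      using that finite_lists_le by (intro Max_ge) auto
    then show ?thesis using C by (meson order_trans)
  qed
  then obtain C where C0: "\<forall>is. \<forall>z\<in>?Z. length is \<le> N \<longrightarrow> ((1 + norm (snd z)) ^ N / fst z) * cmod (partials is (\<lambda>x. eta (fst z) x * f x) (snd z)) \<le> C"
    by blast
  have C: "(1 + norm x) ^ N / d * cmod (partials is (\<lambda>x. eta d x * f x) x) \<le> C" if "length is \<le> N" "d \<in> {0<..1}" for "is" d x
    using C0[rule_format, of "(d, x)" "is"] that by simp
  define d where "d = min 1 (e / (2 * (\<bar>C\<bar> + 1)))"
  have d: "d \<in> {0<..1}" using e by (auto simp: d_def)
  define g where "g = (\<lambda>x. chi (d *\<^sub>R x) * f x)"
  have fg: "(\<lambda>x. f x - g x) = (\<lambda>x. (-1) * (eta d x * f x))"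
    by (auto simp: g_def eta_def fun_eq_iff algebra_simps)
  have "schwartz_seminorm N (\<lambda>x. f x - g x) \<le> \<bar>C\<bar> * d"
  proof (rule schwartz_seminorm_le)
    fix "is" :: "'n list" and x :: "real^'n" assume l: "length is \<le> N"
    have "(1 + norm x) ^ N * cmod (partials is (\<lambda>x. f x - g x) x) = (1 + norm x) ^ N * cmod (partials is (\<lambda>x. eta d x * f x) x)"
      unfolding fg by (subst partials_cmult) (auto intro: smooth_mult[OF se schwartz_smooth[OF f]] simp: norm_mult)
    also have "\<dots> \<le> C * d" using C[OF l d, of x] d by (simp add: field_simps)
    also have "\<dots> \<le> \<bar>C\<bar> * d" using d by (intro mult_right_mono) auto
    finally show "(1 + norm x) ^ N * cmod (partials is (\<lambda>x. f x - g x) x) \<le> \<bar>C\<bar> * d" .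
  qed
  also have "\<bar>C\<bar> * d < e"
  proof -
    define k where "k = 2 * (\<bar>C\<bar> + 1)"
    have k: "\<bar>C\<bar> < k" "0 < k" by (auto simp: k_def)
    have "\<bar>C\<bar> * d \<le> \<bar>C\<bar> * (e / k)"
      unfolding d_def k_def[symmetric] by (intro mult_left_mono min.cobounded2 abs_ge_zero)
    also have "\<dots> = (\<bar>C\<bar> / k) * e" by simp
    also have "\<dots> < 1 * e" using k by (intro mult_strict_right_mono e) simp
    finally show ?thesis by simp
  qed
  finally have "schwartz_seminorm N (\<lambda>x. f x - g x) < e" .
  moreover have "g \<in> test_functions"
  proof -
    obtain r where r: "r > 0" "\<And>x. norm x > r \<Longrightarrow> chi x = 0" using test_function_support[OF chi(1)] by blast
    show ?thesis
    proof (rule test_functions_support)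
      show "smooth g" unfolding g_def by (rule smooth_mult[OF smooth_dilate[OF sm] schwartz_smooth[OF f]])
      show "g x = 0" if "norm x > r / d" for x
        using r(2)[of "d *\<^sub>R x"] that d by (simp add: g_def field_simps)
    qed
  qed
  ultimately show ?thesis by blast
qed

section \<open>A smooth compactly supported function\<close>

text \<open>The flat function \<open>exp (- 1 / s)\<close> with a polynomial in \<open>1 / s\<close>
  as a factor, so that the set of these functions is closed under differentiation.\<close>

definition flat_exp :: "real poly \<Rightarrow> real \<Rightarrow> real" where
  "flat_exp p s = (if s > 0 then poly p (1 / s) * exp (- (1 / s)) else 0)"

lemma tendsto_poly_div_exp: "((\<lambda>u. poly q u / exp u) \<longlongrightarrow> (0::real)) at_top"
proof -
  have "((\<lambda>u. \<Sum>i\<le>degree q. coeff q i * (u ^ i / exp u)) \<longlongrightarrow> (\<Sum>i\<le>degree q. coeff q i * 0)) at_top"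
    by (intro tendsto_intros tendsto_power_div_exp_0)
  then show ?thesis by (simp add: poly_altdef sum_divide_distrib)
qed

text \<open>With \<open>u = 1 / s\<close> the derivative of \<open>p(u) exp (- u)\<close> is
  \<open>u^2 (p - p')(u) exp (- u)\<close>; the polynomial \<open>[:0, 0, 1:]\<close> is
  \<open>u^2\<close>.\<close>

lemma flat_exp_deriv:
  "(flat_exp p has_real_derivative flat_exp ([:0, 0, 1:] * (p - pderiv p)) s) (at s)"
proof -
  consider "s > 0" | "s < 0" | "s = 0" by linarith
  then show ?thesis
  proof cases
    case 1
    have "((\<lambda>s. poly p (1 / s) * exp (- (1 / s))) has_real_derivative
        (poly (pderiv p) (1 / s) * (- (1 / s^2)) * exp (- (1 / s)) + poly p (1 / s) * (exp (- (1 / s)) * (1 / s^2)))) (at s)"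
      using 1 by (auto intro!: derivative_eq_intros DERIV_chain2[OF poly_DERIV] simp: power2_eq_square)
    moreover have "poly (pderiv p) (1 / s) * (- (1 / s^2)) * exp (- (1 / s)) + poly p (1 / s) * (exp (- (1 / s)) * (1 / s^2)) =
        flat_exp ([:0, 0, 1:] * (p - pderiv p)) s"
      using 1 by (simp add: flat_exp_def field_simps power2_eq_square)
    ultimately have "((\<lambda>s. poly p (1 / s) * exp (- (1 / s))) has_real_derivative flat_exp ([:0, 0, 1:] * (p - pderiv p)) s) (at s)"
      by simp
    then show ?thesis
      by (rule has_field_derivative_transform_within[where d = s]) (use 1 in \<open>auto simp: flat_exp_def dist_real_def\<close>)
  next
    case 2
    have "((\<lambda>s. 0) has_real_derivative 0) (at s)" by simp
    then have "(flat_exp p has_real_derivative 0) (at s)"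
      by (rule has_field_derivative_transform_within[where d = "-s"]) (use 2 in \<open>auto simp: flat_exp_def dist_real_def\<close>)
    then show ?thesis using 2 by (simp add: flat_exp_def)
  next
    case 3
    have "((\<lambda>h. flat_exp p h / h) \<longlongrightarrow> 0) (at_right 0)"
    proof -
      \<comment> \<open>The quotient by \<open>h\<close> contributes one more factor
        \<open>u = 1 / h\<close>, which is the shift of coefficients in
        \<open>pCons 0 p\<close>.\<close>
      have "((\<lambda>u. poly (pCons 0 p) u / exp u) \<longlongrightarrow> 0) at_top" by (rule tendsto_poly_div_exp)
      then have "((\<lambda>u. flat_exp p (inverse u) / inverse u) \<longlongrightarrow> 0) at_top"
        by (rule Lim_transform_eventually)
          (auto intro!: eventually_mono[OF eventually_gt_at_top[of 0]] simp: flat_exp_def exp_minus field_simps)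
      then show ?thesis by (simp add: filterlim_at_right_to_top)
    qed
    moreover have "((\<lambda>h. flat_exp p h / h) \<longlongrightarrow> 0) (at_left 0)"
      by (rule tendsto_eventually) (auto simp: flat_exp_def eventually_at_filter)
    ultimately have "((\<lambda>h. flat_exp p h / h) \<longlongrightarrow> 0) (at 0)" by (simp add: filterlim_split_at)
    then show ?thesis using 3 by (simp add: DERIV_def flat_exp_def)
  qed
qed

lemma flat_exp_continuous: "continuous_on S (flat_exp p)"
  using flat_exp_deriv DERIV_isCont continuous_at_imp_continuous_on by blast

lemma flat_exp_bounded:
  obtains B where "\<And>s. s \<le> R \<Longrightarrow> \<bar>flat_exp p s\<bar> \<le> B"
proof -
  have "compact (flat_exp p ` {0..R})" by (intro compact_continuous_image flat_exp_continuous) simp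
  then have "bounded (flat_exp p ` {0..R})" by (rule compact_imp_bounded)
  then obtain B where B: "\<forall>y\<in>flat_exp p ` {0..R}. norm y \<le> B" by (auto simp only: bounded_iff)
  have "\<bar>flat_exp p s\<bar> \<le> max B 0" if "s \<le> R" for s
  proof (cases "s > 0")
    case True
    then have "flat_exp p s \<in> flat_exp p ` {0..R}" using that by auto
    then have "norm (flat_exp p s) \<le> B" using B by blast
    then show ?thesis by simp
  qed (simp add: flat_exp_def)
  then show ?thesis using that by blast
qed

text \<open>The parameter \<open>c\<close> will be \<open>s \<bullet> s\<close>: with
  \<open>R = r\<^sup>2\<close> the member of the base case with \<open>p = 1\<close> is the
  horizontal section, at height \<open>s\<close>, of a radial bump function on pairs of real
  vectors. The further rules close the set under partial derivatives.\<close>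

inductive_set bump_family :: "real \<Rightarrow> (real \<Rightarrow> real^'n::finite \<Rightarrow> complex) set" for R where
  base: "(\<lambda>c t. of_real (flat_exp p (R - t \<bullet> t - c))) \<in> bump_family R"
| coord: "g \<in> bump_family R \<Longrightarrow> (\<lambda>c t. of_real (t $ i) * g c t) \<in> bump_family R"
| cmult: "g \<in> bump_family R \<Longrightarrow> (\<lambda>c t. k * g c t) \<in> bump_family R"
| add: "g \<in> bump_family R \<Longrightarrow> h \<in> bump_family R \<Longrightarrow> (\<lambda>c t. g c t + h c t) \<in> bump_family R"

lemma flat_exp_has_derivative:
  fixes t :: "real^'n::finite"
  shows "((\<lambda>t. complex_of_real (flat_exp p (R - t \<bullet> t - c))) has_derivative
    (\<lambda>h. of_real (flat_exp ([:0, 0, 1:] * (p - pderiv p)) (R - t \<bullet> t - c) * (- (2 * (t \<bullet> h)))))) (at t)"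
proof -
  let ?q = "flat_exp ([:0, 0, 1:] * (p - pderiv p)) (R - t \<bullet> t - c)"
  have 1: "((\<lambda>t. R - t \<bullet> t - c) has_derivative (\<lambda>h. - (2 * (t \<bullet> h)))) (at t)"
    by (auto intro!: derivative_eq_intros simp: inner_commute)
  have "(flat_exp p has_derivative (*) ?q) (at (R - t \<bullet> t - c))"
    using flat_exp_deriv by (simp add: has_field_derivative_def)
  from has_derivative_of_real[OF has_derivative_compose[OF 1 this]] show ?thesis by simp
qed

lemma coord_has_derivative:
  "((\<lambda>t::real^'n::finite. complex_of_real (t $ i)) has_derivative (\<lambda>h. of_real (h $ i))) (at t)"
  by (intro has_derivative_of_real bounded_linear_imp_has_derivative bounded_linear_vec_nth)

lemma bump_family_partial:
  fixes g :: "real \<Rightarrow> real^'n::finite \<Rightarrow> complex"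
  assumes "g \<in> bump_family R"
  shows "(\<forall>c t. g c differentiable (at t)) \<and> (\<lambda>c. partial j (g c)) \<in> bump_family R"
  using assms
proof induction
  case (base p)
  let ?q = "[:0, 0, 1:] * (p - pderiv p)"
  have eq: "partial j (\<lambda>t. of_real (flat_exp p (R - t \<bullet> t - c))) t = of_real (t $ j) * ((-2) * of_real (flat_exp ?q (R - t \<bullet> t - c)))" for c and t :: "real^'n"
    by (rule trans[OF partial_eqI[OF flat_exp_has_derivative]]) (simp add: inner_axis)
  have eq: "(\<lambda>c. partial j (\<lambda>t. of_real (flat_exp p (R - t \<bullet> t - c)))) = (\<lambda>c t. of_real (t $ j) * ((-2) * of_real (flat_exp ?q (R - t \<bullet> t - c))))"
    by (intro ext eq)
  have "(\<lambda>c t. of_real (t $ j) * ((-2) * of_real (flat_exp ?q (R - t \<bullet> t - c)))) \<in> bump_family R"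
    by (intro bump_family.intros)
  then show ?case unfolding eq using flat_exp_has_derivative unfolding differentiable_def by blast
next
  case (coord g i)
  have d: "(\<lambda>t. of_real (t $ i) :: complex) differentiable (at t)" for t :: "real^'n"
    using coord_has_derivative by (auto simp: differentiable_def)
  have eq: "partial j (\<lambda>t. of_real (t $ i) * g c t) t = of_real (if i = j then 1 else 0) * g c t + of_real (t $ i) * partial j (g c) t" for c t
    using coord partial_eqI[OF coord_has_derivative, of j i t] by (subst partial_mult[OF d]) (auto simp: axis_def)
  have eq: "(\<lambda>c. partial j (\<lambda>t. of_real (t $ i) * g c t)) = (\<lambda>c t. of_real (if i = j then 1 else 0) * g c t + of_real (t $ i) * partial j (g c) t)"
    by (intro ext eq)
  show ?case unfolding eq
    using coord d by (auto intro!: bump_family.intros differentiable_mult)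
next
  case (cmult g k)
  have eq: "(\<lambda>c. partial j (\<lambda>t. k * g c t)) = (\<lambda>c t. k * partial j (g c) t)"
    using cmult by (intro ext partial_cmult) auto
  show ?case unfolding eq using cmult by (auto intro!: bump_family.intros differentiable_mult)
next
  case (add g h)
  have eq: "(\<lambda>c. partial j (\<lambda>t. g c t + h c t)) = (\<lambda>c t. partial j (g c) t + partial j (h c) t)"
    using add by (intro ext partial_add) auto
  show ?case unfolding eq using add by (auto intro!: bump_family.intros differentiable_add)
qed

lemma bump_family_bound:
  fixes g :: "real \<Rightarrow> real^'n::finite \<Rightarrow> complex"
  assumes "g \<in> bump_family R" and R: "R > 0"
  shows "(\<exists>B\<ge>0. \<forall>c\<ge>0. \<forall>t. cmod (g c t) \<le> B) \<and> (\<forall>c\<ge>0. \<forall>t. norm t > 1 + R \<longrightarrow> g c t = 0)"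
  using assms(1)
proof induction
  case (base p)
  obtain B where B: "\<And>s. s \<le> R \<Longrightarrow> \<bar>flat_exp p s\<bar> \<le> B" using flat_exp_bounded by blast
  have "B \<ge> 0" using B[of R] by linarith
  \<comment> \<open>The radius \<open>1 + R\<close> is crude but avoids a square root: its square is
    at least \<open>R\<close>, so the argument is not positive.\<close>
  moreover have "flat_exp p (R - t \<bullet> t - c) = 0" if "norm t > 1 + R" "c \<ge> 0" for t :: "real^'n" and c
  proof -
    have "(1 + R) * (1 + R) \<le> t \<bullet> t" using that R unfolding dot_square_norm power2_eq_square
      by (intro mult_mono) auto
    moreover have "R \<le> (1 + R) * (1 + R)" using R by (simp add: distrib_left distrib_right)
    ultimately show ?thesis using that by (simp add: flat_exp_def)
  qed
  moreover have "R - t \<bullet> t - c \<le> R" if "c \<ge> 0" for t :: "real^'n" and c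
    using inner_ge_zero[of t] that by linarith
  ultimately show ?case using B by (auto intro!: exI[of _ B])
next
  case (coord g i)
  then obtain B where B: "B \<ge> 0" "\<And>c t. c \<ge> 0 \<Longrightarrow> cmod (g c t) \<le> B" and 0: "\<And>c t. c \<ge> 0 \<Longrightarrow> norm t > 1 + R \<Longrightarrow> g c t = 0" by blast
  have "cmod (of_real (t $ i) * g c t) \<le> (1 + R) * B" if "c \<ge> 0" for c t
  proof (cases "norm t > 1 + R")
    case False
    then have "\<bar>t $ i\<bar> \<le> 1 + R" using component_le_norm_cart[of t i] by linarith
    then show ?thesis using B that by (simp add: norm_mult mult_mono)
  qed (use 0 that B R in auto)
  then show ?case using 0 B R by (auto intro!: exI[of _ "(1 + R) * B"])
next
  case (cmult g k)
  then obtain B where "B \<ge> 0" "\<And>c t. c \<ge> 0 \<Longrightarrow> cmod (g c t) \<le> B" by blast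
  then show ?case using cmult by (auto intro!: exI[of _ "cmod k * B"] simp: norm_mult mult_left_mono)
next
  case (add g h)
  from add(3) obtain B where B: "B \<ge> 0" "\<forall>c\<ge>0. \<forall>t. cmod (g c t) \<le> B" by blast
  from add(4) obtain C where C: "C \<ge> 0" "\<forall>c\<ge>0. \<forall>t. cmod (h c t) \<le> C" by blast
  have "\<forall>c\<ge>0. \<forall>t. cmod (g c t + h c t) \<le> B + C"
    using B(2) C(2) by (auto intro!: norm_triangle_le add_mono)
  moreover have "\<forall>c\<ge>0. \<forall>t. norm t > 1 + R \<longrightarrow> g c t + h c t = 0" using add(3,4) by simp
  moreover have "0 \<le> B + C" using B C by simp
  ultimately show ?case by blast
qed

lemma bump_family_test:
  assumes "g \<in> bump_family R" "R > 0" "c \<ge> 0"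
  shows "g c \<in> test_functions"
proof (rule test_functions_support)
  show "smooth (g c)" by (rule smooth_familyI[OF assms(1)]) (use bump_family_partial in blast)+
  show "g c t = 0" if "norm t > 1 + R" for t using bump_family_bound[OF assms(1,2)] assms that by blast
qed

text \<open>All members with \<open>c \<ge> 0\<close> live on one ball and are bounded there, and so
  are their derivatives, which stay in the family. The uniformity in \<open>c\<close> makes the
  sections of the mean value weight a bounded set of test functions.\<close>

lemma bump_family_seminorm:
  fixes g :: "real \<Rightarrow> real^'n::finite \<Rightarrow> complex"
  assumes g: "g \<in> bump_family R" and R: "R > 0"
  shows "\<exists>C. \<forall>c\<ge>0. schwartz_seminorm N (g c) \<le> C"
proof -
  have "\<exists>B\<ge>0. \<forall>c\<ge>0. \<forall>t. (1 + norm t) ^ N * cmod (partials is (g c) t) \<le> B" for "is"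
  proof -
    have h: "(\<lambda>c. partials is (g c)) \<in> bump_family R"
      by (rule partials_family_closed[OF g]) (use bump_family_partial in blast)
    then obtain B where B: "B \<ge> 0" "\<And>c t. c \<ge> 0 \<Longrightarrow> cmod (partials is (g c) t) \<le> B"
      and 0: "\<And>c t. c \<ge> 0 \<Longrightarrow> norm t > 1 + R \<Longrightarrow> partials is (g c) t = 0"
      using bump_family_bound[OF h R] by blast
    have "(1 + norm t) ^ N * cmod (partials is (g c) t) \<le> (2 + R) ^ N * B" if "c \<ge> 0" for c t
    proof (cases "norm t > 1 + R")
      case False
      then have "1 + norm t \<le> 2 + R" by simp
      then show ?thesis using B(2)[OF that, of t] R by (intro mult_mono power_mono) auto
    next
      case True
      then show ?thesis using 0[OF that True] B(1) R by simp
    qed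
    moreover have "(2 + R) ^ N * B \<ge> 0" using B(1) R by simp
    ultimately show ?thesis by blast
  qed
  then obtain B where B: "\<And>is c t. c \<ge> 0 \<Longrightarrow> (1 + norm t) ^ N * cmod (partials is (g c) t) \<le> B is" by metis
  have "schwartz_seminorm N (g c) \<le> Max (B ` {is. length is \<le> N})" if "c \<ge> 0" for c
  proof (rule schwartz_seminorm_le)
    fix "is" :: "'n list" and x :: "real^'n" assume "length is \<le> N"
    then have "B is \<le> Max (B ` {is. length is \<le> N})" using finite_lists_le by (intro Max_ge) auto
    then show "(1 + norm x) ^ N * cmod (partials is (g c) x) \<le> Max (B ` {is. length is \<le> N})"
      using B[OF that, of x "is"] by linarith
  qed
  then show ?thesis by blast
qed

theorem test_functions_dense:
  fixes f :: "real^'n::finite \<Rightarrow> complex"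
  assumes f: "f \<in> schwartz" and e: "e > 0"
  shows "\<exists>g\<in>test_functions. schwartz_seminorm N (\<lambda>x. f x - g x) < e"
proof -
  \<comment> \<open>The factor \<open>exp 1\<close> normalises the bump at the origin, where
    \<open>flat_exp 1 1 = exp (-1)\<close>.\<close>
  define chi where "chi = (\<lambda>(c::real) (t::real^'n). complex_of_real (exp 1) * of_real (flat_exp 1 (1 - t \<bullet> t - c)))"
  have "chi \<in> bump_family 1" unfolding chi_def by (intro bump_family.intros)
  then have "chi 0 \<in> test_functions" by (rule bump_family_test) auto
  moreover have "chi 0 0 = 1"
    by (simp add: chi_def flat_exp_def exp_minus)
  ultimately show ?thesis using test_functions_dense_aux[OF _ _ f e] by metis
qed

section \<open>Complex vectors\<close>

definition cv :: "real^'n::finite \<Rightarrow> real^'n \<Rightarrow> complex^'n" where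
  "cv x y = (\<chi> i. Complex (x $ i) (y $ i))"

definition im_vec :: "complex^'n::finite \<Rightarrow> real^'n" where
  "im_vec z = (\<chi> i. Im (z $ i))"

definition re_vec :: "complex^'n::finite \<Rightarrow> real^'n" where
  "re_vec z = (\<chi> i. Re (z $ i))"

lemma slice_cv: "slice F y x = F (cv x y)"
  by (simp add: slice_def cv_def)

lemma tube_iff: "z \<in> tube V \<longleftrightarrow> im_vec z \<in> V"
  by (simp add: tube_def im_vec_def)

lemma imv_cv [simp]: "im_vec (cv x y) = y" and rev_cv [simp]: "re_vec (cv x y) = x"
  by (simp_all add: im_vec_def re_vec_def cv_def vec_eq_iff)

lemma cv_rev_imv [simp]: "cv (re_vec z) (im_vec z) = z"
  by (simp add: im_vec_def re_vec_def cv_def vec_eq_iff)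

lemma cv_add: "cv x y + cv x' y' = cv (x + x') (y + y')"
  by (simp add: cv_def vec_eq_iff complex_eq_iff)

lemma cv_diff: "cv x y - cv x' y' = cv (x - x') (y - y')"
  by (simp add: cv_def vec_eq_iff complex_eq_iff)

lemma cv_smult_real: "Complex a b *s cv v 0 = cv (a *\<^sub>R v) (b *\<^sub>R v)"
  by (simp add: cv_def vec_eq_iff complex_eq_iff)

lemma norm_vec_power2: "norm x ^ 2 = (\<Sum>i\<in>UNIV. norm ((x::'a::real_normed_vector^'n::finite) $ i) ^ 2)"
  by (simp add: norm_vec_def L2_set_def sum_nonneg)

lemma norm_cv_power2: "norm (cv x y) ^ 2 = norm x ^ 2 + norm y ^ 2"
  unfolding norm_vec_power2 by (simp add: cv_def cmod_power2 sum.distrib)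

lemma norm_cv_0 [simp]: "norm (cv x 0) = norm x" "norm (cv 0 x) = norm x"
  using norm_cv_power2[of x 0] norm_cv_power2[of 0 x] by simp_all

lemma norm_cv_le: "norm (cv x y) \<le> norm x + norm y"
  using norm_triangle_ineq[of "cv x 0" "cv 0 y"] by (simp add: cv_add)

lemma norm_smult: "norm (c *s (v::complex^'n::finite)) = cmod c * norm v"
proof -
  have "(norm (c *s v)) ^ 2 = (cmod c * norm v) ^ 2"
    by (simp add: norm_vec_power2 power_mult_distrib norm_mult sum_distrib_left)
  then show ?thesis by (rule power2_eq_imp_eq) auto
qed

lemma continuous_cv [continuous_intros]:
  "continuous_on S f \<Longrightarrow> continuous_on S g \<Longrightarrow> continuous_on S (\<lambda>x. cv (f x) (g x))"
  unfolding cv_def Complex_eq by (intro continuous_intros)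

lemma continuous_imv [continuous_intros]: "continuous_on S f \<Longrightarrow> continuous_on S (\<lambda>x. im_vec (f x))"
  unfolding im_vec_def by (intro continuous_intros)

lemma continuous_rev [continuous_intros]: "continuous_on S f \<Longrightarrow> continuous_on S (\<lambda>x. re_vec (f x))"
  unfolding re_vec_def by (intro continuous_intros)

lemma continuous_smult [continuous_intros]:
  fixes f :: "'a::topological_space \<Rightarrow> complex" and g :: "'a \<Rightarrow> complex^'n::finite"
  shows "continuous_on S f \<Longrightarrow> continuous_on S g \<Longrightarrow> continuous_on S (\<lambda>x. f x *s g x)"
  unfolding vector_scalar_mult_def by (intro continuous_intros)

lemma open_tube:
  fixes V :: "(real^'n::finite) set"
  assumes "open V"
  shows "open (tube V)"
proof -
  note assms
  moreover have "tube V = im_vec -` V" by (auto simp: tube_iff)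
  moreover have "continuous_on UNIV (im_vec :: complex^'n \<Rightarrow> _)" using continuous_imv[OF continuous_on_id] by simp
  ultimately show ?thesis by (simp only: open_vimage)
qed

section \<open>Gaussians\<close>

text \<open>The exponent contains the complex squares of the coordinates and not the squared
  modulus, so the function is entire. It decays in real directions and grows in imaginary ones. Its
  mass is divided out later, in \<open>tube_extension\<close>.\<close>

definition gauss :: "real \<Rightarrow> complex^'n::finite \<Rightarrow> complex" where
  "gauss e w = exp (- (\<Sum>i\<in>UNIV. (w $ i) ^ 2) / of_real (e ^ 2))"

text \<open>Polynomials times the Gaussian, generated so that complex partial derivatives stay in
  the set. Decay of all derivatives then follows by one induction.\<close>

inductive_set gauss_family :: "real \<Rightarrow> (complex^'n::finite \<Rightarrow> complex) set" for e where
  base: "gauss e \<in> gauss_family e"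
| coord: "q \<in> gauss_family e \<Longrightarrow> (\<lambda>w. (w $ i) * q w) \<in> gauss_family e"
| cmult: "q \<in> gauss_family e \<Longrightarrow> (\<lambda>w. k * q w) \<in> gauss_family e"
| add: "q \<in> gauss_family e \<Longrightarrow> r \<in> gauss_family e \<Longrightarrow> (\<lambda>w. q w + r w) \<in> gauss_family e"

lemma cmod_gauss: "cmod (gauss e (cv x y)) = exp ((norm y ^ 2 - norm x ^ 2) / e ^ 2)"
proof -
  have "Re (\<Sum>i\<in>UNIV. (cv x y $ i) ^ 2) = norm x ^ 2 - norm y ^ 2"
    unfolding norm_vec_power2 by (simp add: cv_def sum_subtractf power2_eq_square)
  then show ?thesis
    unfolding gauss_def norm_exp_eq_Re Re_divide_of_real by simp
qed

lemma vec_nth_has_derivative: "((\<lambda>w. w $ i) has_derivative (\<lambda>h. h $ i)) (at (w::complex^'n::finite))"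
  by (intro bounded_linear_imp_has_derivative bounded_linear_vec_nth)

lemma gauss_family_derivative:
  fixes q :: "complex^'n::finite \<Rightarrow> complex"
  assumes "q \<in> gauss_family e"
  shows "\<exists>d. (\<forall>i. d i \<in> gauss_family e) \<and> (\<forall>w. (q has_derivative (\<lambda>h. \<Sum>i\<in>UNIV. h $ i * d i w)) (at w))"
  using assms
proof induction
  case base
  define d where "d = (\<lambda>i w. (- 2 / of_real (e ^ 2)) * (w $ i * gauss e (w::complex^'n)))"
  have "(gauss e has_derivative (\<lambda>h. \<Sum>i\<in>UNIV. h $ i * d i w)) (at w)" for w :: "complex^'n"
  proof -
    define k where "k = - 1 / complex_of_real (e ^ 2)"
    have g: "gauss e = (\<lambda>w::complex^'n. exp (k * (\<Sum>i\<in>UNIV. (w $ i) ^ 2)))" by (simp add: gauss_def[abs_def] k_def)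
    have 1: "((\<lambda>w. k * (\<Sum>i\<in>UNIV. (w $ i) ^ 2)) has_derivative
       (\<lambda>h. k * (\<Sum>i\<in>UNIV. of_nat 2 * (h $ i) * (w $ i) ^ (2 - 1)))) (at w)"
      by (intro has_derivative_mult_right has_derivative_sum has_derivative_power vec_nth_has_derivative)
    have "((\<lambda>w. exp (k * (\<Sum>i\<in>UNIV. (w $ i) ^ 2))) has_derivative
       (\<lambda>h. exp (k * (\<Sum>i\<in>UNIV. (w $ i) ^ 2)) * (k * (\<Sum>i\<in>UNIV. of_nat 2 * (h $ i) * (w $ i) ^ (2 - 1))))) (at w)"
      by (rule has_derivative_compose[OF 1]) (use DERIV_exp in \<open>simp add: has_field_derivative_def\<close>)
    moreover have "(\<lambda>h. exp (k * (\<Sum>i\<in>UNIV. (w $ i) ^ 2)) * (k * (\<Sum>i\<in>UNIV. of_nat 2 * (h $ i) * (w $ i) ^ (2 - 1)))) =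
        (\<lambda>h. \<Sum>i\<in>UNIV. h $ i * d i w)"
      by (simp add: d_def g sum_distrib_left k_def mult_ac fun_eq_iff)
    ultimately show ?thesis using g by simp
  qed
  moreover have "d i \<in> gauss_family e" for i unfolding d_def by (intro gauss_family.intros)
  ultimately show ?case by blast
next
  case (coord q i)
  then obtain d where d: "\<And>i. d i \<in> gauss_family e" "\<And>w. (q has_derivative (\<lambda>h. \<Sum>i\<in>UNIV. h $ i * d i w)) (at w)" by blast
  define d' where "d' = (\<lambda>j w. (if j = i then 1 else 0) * q w + (w $ i) * d j w)"
  have "((\<lambda>w. w $ i * q w) has_derivative (\<lambda>h. \<Sum>j\<in>UNIV. h $ j * d' j w)) (at w)" for w
  proof -
    have "(\<lambda>h. w $ i * (\<Sum>j\<in>UNIV. h $ j * d j w) + h $ i * q w) = (\<lambda>h. \<Sum>j\<in>UNIV. h $ j * d' j w)"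
    proof
      fix h :: "complex^'n"
      have "(\<Sum>j\<in>UNIV. h $ j * ((if j = i then 1 else 0) * q w)) = (\<Sum>j\<in>UNIV. if j = i then h $ i * q w else 0)"
        by (rule sum.cong) auto
      then show "w $ i * (\<Sum>j\<in>UNIV. h $ j * d j w) + h $ i * q w = (\<Sum>j\<in>UNIV. h $ j * d' j w)"
        by (simp add: d'_def distrib_left sum.distrib sum_distrib_left mult_ac)
    qed
    then show ?thesis using has_derivative_mult[OF vec_nth_has_derivative[where i = i and w = w] d(2)[of w]] by simp
  qed
  moreover have "d' j \<in> gauss_family e" for j unfolding d'_def by (intro gauss_family.intros d coord)
  ultimately show ?case by blast
next
  case (cmult q k)
  then obtain d where d: "\<And>i. d i \<in> gauss_family e" "\<And>w. (q has_derivative (\<lambda>h. \<Sum>i\<in>UNIV. h $ i * d i w)) (at w)" by blast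
  have "((\<lambda>w. k * q w) has_derivative (\<lambda>h. \<Sum>j\<in>UNIV. h $ j * (k * d j w))) (at w)" for w
    using has_derivative_mult_right[OF d(2), of k] by (simp add: sum_distrib_left mult_ac)
  then show ?case by (intro exI[of _ "\<lambda>j w. k * d j w"] conjI allI gauss_family.cmult d)
next
  case (add q r)
  then obtain d d' where d: "\<And>i. d i \<in> gauss_family e" "\<And>w. (q has_derivative (\<lambda>h. \<Sum>i\<in>UNIV. h $ i * d i w)) (at w)"
    "\<And>i. d' i \<in> gauss_family e" "\<And>w. (r has_derivative (\<lambda>h. \<Sum>i\<in>UNIV. h $ i * d' i w)) (at w)" by blast
  have "((\<lambda>w. q w + r w) has_derivative (\<lambda>h. \<Sum>j\<in>UNIV. h $ j * (d j w + d' j w))) (at w)" for w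
    using has_derivative_add[OF d(2,4)] by (simp add: sum.distrib distrib_left)
  then show ?case by (intro exI[of _ "\<lambda>j w. d j w + d' j w"] conjI allI gauss_family.add d)
qed

text \<open>The power is bounded by \<open>N! exp (1 + r)\<close> from the exponential series, and
  \<open>r \<le> r^2 / e^2 + e^2 / 4\<close> because \<open>(r / e - e / 2)^2\<close> is
  nonnegative.\<close>

lemma gaussian_weight_bounded:
  fixes r e :: real
  assumes "r \<ge> 0" "e > 0"
  shows "(1 + r) ^ N * exp (- (r ^ 2) / e ^ 2) \<le> fact N * exp (1 + e ^ 2 / 4)"
proof -
  have "(1 + r) ^ N / fact N \<le> exp (1 + r)"
  proof -
    have "(\<Sum>k\<in>{N}. (1 + r) ^ k /\<^sub>R fact k) \<le> (\<Sum>k. (1 + r) ^ k /\<^sub>R fact k)"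
      using assms by (intro sum_le_suminf summable_exp_generic) auto
    then show ?thesis by (simp add: exp_def divide_inverse mult.commute)
  qed
  then have "(1 + r) ^ N \<le> fact N * exp (1 + r)" by (simp add: field_simps)
  then have "(1 + r) ^ N * exp (- (r ^ 2) / e ^ 2) \<le> fact N * exp (1 + r) * exp (- (r ^ 2) / e ^ 2)"
    by (intro mult_right_mono) auto
  also have "\<dots> = fact N * exp (1 + r - r ^ 2 / e ^ 2)" by (simp add: exp_diff exp_minus divide_inverse)
  also have "\<dots> \<le> fact N * exp (1 + e ^ 2 / 4)"
  proof -
    have "0 \<le> (r / e - e / 2) ^ 2" by simp
    then have "r \<le> r ^ 2 / e ^ 2 + e ^ 2 / 4" using assms by (simp add: power2_diff power_divide)
    then show ?thesis by simp
  qed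
  finally show ?thesis .
qed

text \<open>On a strip of bounded imaginary part the real part of the exponent is at most
  \<open>(- (norm w)^2 + 2 M^2) / e^2\<close>. The quantifier over \<open>N\<close> is part of the
  induction, since a coordinate factor costs one power of the weight.\<close>

lemma gauss_family_decay:
  fixes q :: "complex^'n::finite \<Rightarrow> complex"
  assumes "q \<in> gauss_family e" and e: "e > 0"
  shows "\<forall>N. \<exists>C\<ge>0. \<forall>w. norm (im_vec w) \<le> M \<longrightarrow> (1 + norm w) ^ N * cmod (q w) \<le> C"
  using assms(1)
proof induction
  case base
  show ?case
  proof
    fix N
    have "(1 + norm w) ^ N * cmod (gauss e w) \<le> fact N * exp (1 + e ^ 2 / 4) * exp (2 * M ^ 2 / e ^ 2)" if "norm (im_vec w) \<le> M" for w :: "complex^'n"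
    proof -
      have n: "norm w ^ 2 = norm (re_vec w) ^ 2 + norm (im_vec w) ^ 2" using norm_cv_power2[of "re_vec w" "im_vec w"] by simp
      have "cmod (gauss e w) = exp ((norm (im_vec w) ^ 2 - norm (re_vec w) ^ 2) / e ^ 2)" using cmod_gauss[of e "re_vec w" "im_vec w"] by simp
      also have "\<dots> \<le> exp (- (norm w ^ 2) / e ^ 2 + 2 * M ^ 2 / e ^ 2)"
      proof -
        have "norm (im_vec w) ^ 2 \<le> M ^ 2" using that by (intro power_mono) auto
        then have "norm (im_vec w) ^ 2 - norm (re_vec w) ^ 2 \<le> - (norm w ^ 2) + 2 * M ^ 2" using n by linarith
        then have "(norm (im_vec w) ^ 2 - norm (re_vec w) ^ 2) / e ^ 2 \<le> (- (norm w ^ 2) + 2 * M ^ 2) / e ^ 2"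
          by (intro divide_right_mono) simp_all
        then show ?thesis by (simp only: exp_le_cancel_iff add_divide_distrib)
      qed
      finally have "(1 + norm w) ^ N * cmod (gauss e w) \<le> (1 + norm w) ^ N * (exp (- (norm w ^ 2) / e ^ 2) * exp (2 * M ^ 2 / e ^ 2))"
        unfolding exp_add[symmetric] by (intro mult_left_mono) simp_all
      also have "\<dots> \<le> fact N * exp (1 + e ^ 2 / 4) * exp (2 * M ^ 2 / e ^ 2)"
        unfolding mult.assoc[symmetric] by (intro mult_right_mono gaussian_weight_bounded e) auto
      finally show ?thesis .
    qed
    then show "\<exists>C\<ge>0. \<forall>w::complex^'n. norm (im_vec w) \<le> M \<longrightarrow> (1 + norm w) ^ N * cmod (gauss e w) \<le> C"
      by (intro exI[of _ "fact N * exp (1 + e ^ 2 / 4) * exp (2 * M ^ 2 / e ^ 2)"]) auto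
  qed
next
  case (coord q i)
  show ?case
  proof
    fix N
    obtain C where C: "C \<ge> 0" "\<And>w. norm (im_vec w) \<le> M \<Longrightarrow> (1 + norm w) ^ Suc N * cmod (q w) \<le> C" using coord by meson
    have "(1 + norm w) ^ N * cmod (w $ i * q w) \<le> (1 + norm w) ^ Suc N * cmod (q w)" for w
    proof -
      have "cmod (w $ i) \<le> 1 + norm w" using Finite_Cartesian_Product.norm_nth_le[where x = w and i = i] by linarith
      then have "(1 + norm w) ^ N * (cmod (w $ i) * cmod (q w)) \<le> (1 + norm w) ^ N * ((1 + norm w) * cmod (q w))"
        by (intro mult_left_mono mult_right_mono) auto
      then show ?thesis by (simp add: norm_mult mult_ac)
    qed
    then show "\<exists>C\<ge>0. \<forall>w. norm (im_vec w) \<le> M \<longrightarrow> (1 + norm w) ^ N * cmod (w $ i * q w) \<le> C"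
      using C by (meson order_trans)
  qed
next
  case (cmult q k)
  show ?case
  proof
    fix N
    obtain C where C: "C \<ge> 0" "\<And>w. norm (im_vec w) \<le> M \<Longrightarrow> (1 + norm w) ^ N * cmod (q w) \<le> C" using cmult by meson
    have "(1 + norm w) ^ N * cmod (k * q w) \<le> cmod k * C" if "norm (im_vec w) \<le> M" for w
      using mult_left_mono[OF C(2)[OF that], of "cmod k"] by (simp add: norm_mult mult_ac)
    then show "\<exists>C\<ge>0. \<forall>w. norm (im_vec w) \<le> M \<longrightarrow> (1 + norm w) ^ N * cmod (k * q w) \<le> C"
      using C by (intro exI[of _ "cmod k * C"]) auto
  qed
next
  case (add q r)
  show ?case
  proof
    fix N
    obtain C where C: "C \<ge> 0" "\<And>w. norm (im_vec w) \<le> M \<Longrightarrow> (1 + norm w) ^ N * cmod (q w) \<le> C" using add by meson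
    obtain D where D: "D \<ge> 0" "\<And>w. norm (im_vec w) \<le> M \<Longrightarrow> (1 + norm w) ^ N * cmod (r w) \<le> D" using add by meson
    have "(1 + norm w) ^ N * cmod (q w + r w) \<le> C + D" if "norm (im_vec w) \<le> M" for w
    proof -
      have "(1 + norm w) ^ N * cmod (q w + r w) \<le> (1 + norm w) ^ N * (cmod (q w) + cmod (r w))"
        by (intro mult_left_mono norm_triangle_ineq) auto
      then show ?thesis using C(2)[OF that] D(2)[OF that] by (simp add: distrib_left)
    qed
    then show "\<exists>C\<ge>0. \<forall>w. norm (im_vec w) \<le> M \<longrightarrow> (1 + norm w) ^ N * cmod (q w + r w) \<le> C"
      using C D by (intro exI[of _ "C + D"]) auto
  qed
qed

text \<open>A real derivative in \<open>t\<close> of a function of \<open>z - t\<close> is the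
  negative of a complex partial derivative. Hence the same member \<open>r\<close> serves all
  \<open>z\<close>.\<close>

lemma gauss_family_partial:
  fixes q :: "complex^'n::finite \<Rightarrow> complex"
  assumes "q \<in> gauss_family e"
  shows "(\<forall>z t. (\<lambda>t. q (z - cv t 0)) differentiable (at t)) \<and>
    (\<exists>r\<in>gauss_family e. (\<lambda>z. partial j (\<lambda>t. q (z - cv t 0))) = (\<lambda>z t. r (z - cv t 0)))"
proof -
  obtain d where d: "\<And>i. d i \<in> gauss_family e" "\<And>w. (q has_derivative (\<lambda>h. \<Sum>i\<in>UNIV. h $ i * d i w)) (at w)"
    using gauss_family_derivative[OF assms] by blast
  have lin: "bounded_linear (\<lambda>t::real^'n. cv t 0)"
    by (rule bounded_linear_intro[where K = 1])
      (simp add: cv_def vec_eq_iff complex_eq_iff, simp add: cv_def vec_eq_iff complex_eq_iff, simp)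
  have D: "((\<lambda>t. q (z - cv t 0)) has_derivative (\<lambda>h. \<Sum>i\<in>UNIV. (0 - cv h 0) $ i * d i (z - cv t 0))) (at t)" for z t
    by (rule has_derivative_compose[OF _ d(2)])
      (intro has_derivative_diff has_derivative_const bounded_linear_imp_has_derivative lin)
  have "partial j (\<lambda>t. q (z - cv t 0)) t = (-1) * d j (z - cv t 0)" for z t
    by (rule trans[OF partial_eqI[OF D]])
      (simp add: cv_def axis_def sum_negf if_distrib if_distribR Complex_eq sum.delta' cong: if_cong)
  then have "(\<lambda>z. partial j (\<lambda>t. q (z - cv t 0))) = (\<lambda>z t. (\<lambda>w. (-1) * d j w) (z - cv t 0))" by (intro ext) simp
  moreover have "(\<lambda>w. (-1) * d j w) \<in> gauss_family e" by (intro gauss_family.intros d)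
  moreover have "(\<lambda>t. q (z - cv t 0)) differentiable (at t)" for z t
    by (rule differentiableI[OF D])
  ultimately show ?thesis by (intro conjI allI bexI[where x = "\<lambda>w. (-1) * d j w"])
qed

lemma gauss_family_partials:
  fixes q :: "complex^'n::finite \<Rightarrow> complex"
  assumes q: "q \<in> gauss_family e"
  shows "smooth (\<lambda>t. q (z - cv t 0))"
    and "\<exists>r\<in>gauss_family e. \<forall>z. partials is (\<lambda>t. q (z - cv t 0)) = (\<lambda>t. r (z - cv t 0))"
proof -
  define A where "A = (\<lambda>r. (\<lambda>z t. r (z - cv t 0))) ` (gauss_family e :: (complex^'n \<Rightarrow> complex) set)"
  have qA: "(\<lambda>z t. q (z - cv t 0)) \<in> A" using q by (auto simp: A_def)
  have cl: "(\<lambda>c. partial i (g c)) \<in> A" if gA: "g \<in> A" for g i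
  proof -
    obtain r where "r \<in> gauss_family e" "g = (\<lambda>z t. r (z - cv t 0))" using gA by (auto simp: A_def)
    then show ?thesis using gauss_family_partial[of r e i] by (auto simp: A_def)
  qed
  have df: "g c differentiable (at x)" if gA: "g \<in> A" for g c x
  proof -
    obtain r where "r \<in> gauss_family e" "g = (\<lambda>z t. r (z - cv t 0))" using gA by (auto simp: A_def)
    then show ?thesis using gauss_family_partial[of r e undefined] by simp
  qed
  show "smooth (\<lambda>t. q (z - cv t 0))"
    using smooth_familyI[where g = "\<lambda>z t. q (z - cv t 0)" and A = A and c = z] qA cl df by blast
  have "(\<lambda>c. partials is (\<lambda>t. q (c - cv t 0))) \<in> A" by (rule partials_family_closed[OF qA cl])
  then show "\<exists>r\<in>gauss_family e. \<forall>z. partials is (\<lambda>t. q (z - cv t 0)) = (\<lambda>t. r (z - cv t 0))"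
    by (auto simp: A_def fun_eq_iff)
qed

lemma gauss_schwartz:
  fixes z :: "complex^'n::finite"
  assumes e: "e > 0"
  shows "(\<lambda>t. gauss e (z - cv t 0)) \<in> schwartz"
proof (rule schwartzI)
  show "smooth (\<lambda>t. gauss e (z - cv t 0))" by (rule gauss_family_partials) (rule gauss_family.base)
  fix N and "is" :: "'n list"
  obtain r where r: "r \<in> gauss_family e" "\<forall>z. partials is (\<lambda>t. gauss e (z - cv t 0)) = (\<lambda>t. r (z - cv t 0))"
    using gauss_family_partials(2)[OF gauss_family.base] by blast
  obtain C where C: "\<And>w. norm (im_vec w) \<le> norm (im_vec z) \<Longrightarrow> (1 + norm w) ^ N * cmod (r w) \<le> C"
    using gauss_family_decay[OF r(1) e] by meson
  have "(1 + norm t) ^ N * cmod (r (z - cv t 0)) \<le> (1 + norm z) ^ N * C" for t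
  proof -
    have "(1 + norm (- cv t 0)) ^ N \<le> (1 + norm (- cv t 0 + z)) ^ N * (1 + norm z) ^ N"
      by (rule weight_shift_power)
    then have "(1 + norm t) ^ N * cmod (r (z - cv t 0)) \<le> ((1 + norm (z - cv t 0)) ^ N * (1 + norm z) ^ N) * cmod (r (z - cv t 0))"
      by (intro mult_right_mono) (auto simp: add.commute[of "- cv t 0"])
    also have "\<dots> = (1 + norm z) ^ N * ((1 + norm (z - cv t 0)) ^ N * cmod (r (z - cv t 0)))" by simp
    also have "\<dots> \<le> (1 + norm z) ^ N * C"
      by (intro mult_left_mono C) (auto simp: im_vec_def cv_def)
    finally show ?thesis .
  qed
  then show "\<exists>C. \<forall>x. (1 + norm x) ^ N * cmod (partials is (\<lambda>t. gauss e (z - cv t 0)) x) \<le> C"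
    using r(2) by auto
qed

lemma imv_add: "im_vec (a + b) = im_vec a + im_vec b" and imv_diff: "im_vec (a - b) = im_vec a - im_vec b"
  and imv_scaleR: "im_vec (k *\<^sub>R a) = k *\<^sub>R im_vec a"
  by (simp_all add: im_vec_def vec_eq_iff)

text \<open>Mean value inequality along the segment from \<open>z - t\<close> to
  \<open>z - t - i y\<close>. For \<open>norm y \<le> 1\<close> the segment stays in a strip of
  bounded imaginary part, where the derivatives decay, and \<open>weight_shift_power\<close> passes
  from the weight at \<open>w\<close> to the one at \<open>t\<close>.\<close>

lemma gauss_family_shift:
  fixes q :: "complex^'n::finite \<Rightarrow> complex"
  assumes q: "q \<in> gauss_family e" and e: "e > 0"
  shows "\<exists>C. \<forall>y. norm y \<le> 1 \<longrightarrow> (\<forall>t. (1 + norm t) ^ N * cmod (q (z - cv 0 y - cv t 0) - q (z - cv t 0)) \<le> C * norm y)"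
proof -
  obtain d where d: "\<And>i. d i \<in> gauss_family e" "\<And>w. (q has_derivative (\<lambda>h. \<Sum>i\<in>UNIV. h $ i * d i w)) (at w)"
    using gauss_family_derivative[OF q] by blast
  have "\<forall>i. \<exists>C\<ge>0. \<forall>w. norm (im_vec w) \<le> norm (im_vec z) + 1 \<longrightarrow> (1 + norm w) ^ N * cmod (d i w) \<le> C"
    using gauss_family_decay[OF d(1) e] by blast
  then obtain C where C: "\<And>i. C i \<ge> 0" "\<And>i w. norm (im_vec w) \<le> norm (im_vec z) + 1 \<Longrightarrow> (1 + norm w) ^ N * cmod (d i w) \<le> C i"
    by metis
  have "(1 + norm t) ^ N * cmod (q (z - cv 0 y - cv t 0) - q (z - cv t 0)) \<le> ((1 + (norm z + 1)) ^ N * (\<Sum>i\<in>UNIV. C i)) * norm y"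
    if y: "norm y \<le> 1" for y t
  proof -
    define K where "K = (1 + (norm z + 1)) ^ N * (\<Sum>i\<in>UNIV. C i) / (1 + norm t) ^ N"
    let ?S = "closed_segment (z - cv t 0) (z - cv 0 y - cv t 0)"
    have "norm (q (z - cv 0 y - cv t 0) - q (z - cv t 0)) \<le> K * norm ((z - cv 0 y - cv t 0) - (z - cv t 0))"
    proof (rule differentiable_bound)
      show "convex ?S" by simp
      show "z - cv 0 y - cv t 0 \<in> ?S" "z - cv t 0 \<in> ?S" by auto
      fix w assume "w \<in> ?S"
      then obtain u where u: "0 \<le> u" "u \<le> 1" "w = (1 - u) *\<^sub>R (z - cv t 0) + u *\<^sub>R (z - cv 0 y - cv t 0)"
        by (auto simp: closed_segment_def)
      have w: "w = z - u *\<^sub>R cv 0 y - cv t 0" unfolding u(3) by (simp add: algebra_simps)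
      show "(q has_derivative (\<lambda>h. \<Sum>i\<in>UNIV. h $ i * d i w)) (at w within ?S)" using d(2) has_derivative_at_withinI by blast
      have uy: "norm (u *\<^sub>R cv 0 y) \<le> 1" using u y by (simp add: mult_le_one)
      have im: "norm (im_vec w) \<le> norm (im_vec z) + 1"
      proof -
        have "im_vec w = im_vec z - u *\<^sub>R y" unfolding w by (simp add: imv_diff imv_scaleR)
        then have "norm (im_vec w) \<le> norm (im_vec z) + norm (u *\<^sub>R y)" by (metis norm_triangle_ineq4)
        then show ?thesis using uy by simp
      qed
      have wt: "(1 + norm t) ^ N \<le> (1 + norm w) ^ N * (1 + (norm z + 1)) ^ N"
      proof -
        have "(1 + norm (- cv t 0)) ^ N \<le> (1 + norm (- cv t 0 + (z - u *\<^sub>R cv 0 y))) ^ N * (1 + norm (z - u *\<^sub>R cv 0 y)) ^ N"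
          by (rule weight_shift_power)
        also have "\<dots> \<le> (1 + norm w) ^ N * (1 + (norm z + 1)) ^ N"
          using uy norm_triangle_ineq4[of z "u *\<^sub>R cv 0 y"]
          by (intro mult_mono power_mono) (auto simp: w algebra_simps)
        finally show ?thesis by simp
      qed
      have db: "cmod (d i w) \<le> (1 + (norm z + 1)) ^ N * C i / (1 + norm t) ^ N" for i
      proof -
        have "(1 + norm t) ^ N * cmod (d i w) \<le> ((1 + norm w) ^ N * (1 + (norm z + 1)) ^ N) * cmod (d i w)"
          by (intro mult_right_mono wt) auto
        also have "\<dots> = (1 + (norm z + 1)) ^ N * ((1 + norm w) ^ N * cmod (d i w))" by simp
        also have "\<dots> \<le> (1 + (norm z + 1)) ^ N * C i" by (intro mult_left_mono C im) auto
        finally show ?thesis using weight_pos[of t N] by (simp add: field_simps)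
      qed
      show "onorm (\<lambda>h. \<Sum>i\<in>UNIV. h $ i * d i w) \<le> K"
      proof (rule onorm_le)
        fix h :: "complex^'n"
        have "norm (\<Sum>i\<in>UNIV. h $ i * d i w) \<le> (\<Sum>i\<in>UNIV. norm h * ((1 + (norm z + 1)) ^ N * C i / (1 + norm t) ^ N))"
          by (intro sum_norm_le) (simp only: norm_mult, intro mult_mono db Finite_Cartesian_Product.norm_nth_le, auto)
        also have "\<dots> = (\<Sum>i\<in>UNIV. C i * (norm h * (1 + (norm z + 1)) ^ N / (1 + norm t) ^ N))"
          by (simp only: times_divide_eq_right times_divide_eq_left mult_ac)
        also have "\<dots> = K * norm h"
          unfolding K_def sum_distrib_right[symmetric]
          by (simp only: times_divide_eq_right times_divide_eq_left mult_ac)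
        finally show "norm (\<Sum>i\<in>UNIV. h $ i * d i w) \<le> K * norm h" .
      qed
    qed
    also have "norm ((z - cv 0 y - cv t 0) - (z - cv t 0)) = norm y" by simp
    finally have "(1 + norm t) ^ N * cmod (q (z - cv 0 y - cv t 0) - q (z - cv t 0)) \<le> (1 + norm t) ^ N * (K * norm y)"
      by (intro mult_left_mono) auto
    moreover have "(1 + norm t) ^ N * (K * norm y) = ((1 + (norm z + 1)) ^ N * (\<Sum>i\<in>UNIV. C i)) * norm y"
    proof -
      define T where "T = (1 + norm t) ^ N"
      have "T \<noteq> 0" using weight_pos[of t N] unfolding T_def by linarith
      then show ?thesis unfolding K_def T_def[symmetric] by simp
    qed
    ultimately show ?thesis by simp
  qed
  then show ?thesis by blast
qed

text \<open>Near the boundary the Gaussian test function depends on the height \<open>y\<close>; its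
  displacement is of order \<open>norm y\<close> in every Schwartz seminorm.\<close>

lemma gauss_shift_seminorm:
  fixes z :: "complex^'n::finite"
  assumes e: "e > 0"
  shows "\<exists>C. \<forall>y. norm y \<le> 1 \<longrightarrow> schwartz_seminorm N (\<lambda>t. gauss e (z - cv 0 y - cv t 0) - gauss e (z - cv t 0)) \<le> C * norm y"
proof -
  have "\<exists>C. \<forall>y. norm y \<le> 1 \<longrightarrow> (\<forall>t. (1 + norm t) ^ N *
      cmod (partials is (\<lambda>t. gauss e (z - cv 0 y - cv t 0) - gauss e (z - cv t 0)) t) \<le> C * norm y)" for "is"
  proof -
    obtain r where r: "r \<in> gauss_family e" "\<forall>z. partials is (\<lambda>t. gauss e (z - cv t 0)) = (\<lambda>t. r (z - cv t 0))"
      using gauss_family_partials(2)[OF gauss_family.base] by blast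
    have eq: "partials is (\<lambda>t. gauss e (z - cv 0 y - cv t 0) - gauss e (z - cv t 0)) =
        (\<lambda>t. r (z - cv 0 y - cv t 0) - r (z - cv t 0))" for y
      by (subst partials_diff[OF gauss_family_partials(1)[OF gauss_family.base] gauss_family_partials(1)[OF gauss_family.base]])
        (simp only: r(2))
    show ?thesis unfolding eq by (rule gauss_family_shift[OF r(1) e])
  qed
  then have "\<forall>is. \<exists>C. \<forall>y. norm y \<le> 1 \<longrightarrow> (\<forall>t. (1 + norm t) ^ N *
      cmod (partials is (\<lambda>t. gauss e (z - cv 0 y - cv t 0) - gauss e (z - cv t 0)) t) \<le> C * norm y)" by (rule allI)
  from choice[OF this] obtain C where C0: "\<forall>is. \<forall>y. norm y \<le> 1 \<longrightarrow> (\<forall>t. (1 + norm t) ^ N *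
      cmod (partials is (\<lambda>t. gauss e (z - cv 0 y - cv t 0) - gauss e (z - cv t 0)) t) \<le> C is * norm y)"
    by (elim exE) (rule that)
  note C = C0[rule_format]
  have "schwartz_seminorm N (\<lambda>t. gauss e (z - cv 0 y - cv t 0) - gauss e (z - cv t 0)) \<le> Max (C ` {is. length is \<le> N}) * norm y"
    if y: "norm y \<le> 1" for y
  proof (rule schwartz_seminorm_le)
    fix "is" :: "'n list" and x :: "real^'n" assume "length is \<le> N"
    then have "C is \<le> Max (C ` {is. length is \<le> N})" using finite_lists_le by (intro Max_ge) auto
    then have "C is * norm y \<le> Max (C ` {is. length is \<le> N}) * norm y" by (intro mult_right_mono) auto
    then show "(1 + norm x) ^ N * cmod (partials is (\<lambda>t. gauss e (z - cv 0 y - cv t 0) - gauss e (z - cv t 0)) x)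
        \<le> Max (C ` {is. length is \<le> N}) * norm y"
      using C[OF y, of x "is"] by linarith
  qed
  then show ?thesis by blast
qed

section \<open>Functions that are holomorphic on complex lines\<close>

text \<open>Cauchy's estimate on the disc of radius \<open>R / 4\<close> around a point of the unit
  disc. It lies in the large disc because \<open>1 + R / 4 < R\<close> for
  \<open>R \<ge> 2\<close>.\<close>

lemma higher_deriv_bound_le:
  assumes "g holomorphic_on ball 0 R" "R \<ge> 2" "\<And>z. z \<in> ball 0 R \<Longrightarrow> cmod (g z) \<le> B" "z \<in> cball 0 1" "n > 0"
  shows "cmod ((deriv ^^ n) g z) \<le> fact n * B / (R / 4) ^ n"
proof -
  have sub: "cball z (R / 4) \<subseteq> ball 0 R"
  proof
    fix w assume "w \<in> cball z (R / 4)"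
    then have "norm w \<le> norm z + R / 4" using norm_triangle_ineq2[of w z] by (simp add: dist_norm norm_minus_commute)
    then show "w \<in> ball 0 R" using assms by simp
  qed
  have R: "R / 4 > 0" using assms by simp
  define k where "k = fact n / (R / 4) ^ n"
  have k: "k \<ge> 0" using R by (simp add: k_def)
  \<comment> \<open>Cauchy's estimate is applied with values in an open disc, so the bound is first
    enlarged to \<open>B' > B\<close> and then let down to \<open>B\<close>.\<close>
  have le: "cmod ((deriv ^^ n) g z) \<le> k * B'" if "B' > B" for B'
  proof -
    have "cmod ((deriv ^^ n) g z) \<le> fact n * B' / (R / 4) ^ n"
    proof (rule Cauchy_higher_deriv_bound[where y = 0])
      show "g holomorphic_on ball z (R / 4)" using assms(1) sub ball_subset_cball by (meson holomorphic_on_subset order_trans)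
      show "continuous_on (cball z (R / 4)) g" using assms(1) sub holomorphic_on_imp_continuous_on continuous_on_subset by blast
      show "g w \<in> ball 0 B'" if "w \<in> ball z (R / 4)" for w
        using assms(3)[of w] that sub \<open>B' > B\<close> ball_subset_cball by (fastforce simp: subset_iff)
    qed (use R assms in auto)
    then show ?thesis by (simp add: k_def mult.commute)
  qed
  have "cmod ((deriv ^^ n) g z) \<le> k * B"
  proof (rule field_le_epsilon)
    fix e :: real assume e: "e > 0"
    have "cmod ((deriv ^^ n) g z) \<le> k * (B + e / (k + 1))" using e k by (intro le) simp
    also have "\<dots> \<le> k * B + e"
    proof -
      have "k * (e / (k + 1)) = e * (k / (k + 1))" by simp
      also have "\<dots> \<le> e * 1" using e k by (intro mult_left_mono) auto
      finally show ?thesis by (simp add: distrib_left)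
    qed
    finally show "cmod ((deriv ^^ n) g z) \<le> k * B + e" .
  qed
  then show ?thesis by (simp add: k_def)
qed

text \<open>Taylor's formula at 0 with Cauchy's estimates; \<open>32\<close> is \<open>2!\<close>
  times \<open>4^2\<close>. Rescaled to a segment of length \<open>norm h\<close>, with
  \<open>R\<close> proportional to \<open>1 / norm h\<close>, it gives increments of order
  \<open>norm h\<close> and first-order remainders of order \<open>(norm h)^2\<close>.\<close>

lemma bounded_holomorphic_increment:
  assumes g: "g holomorphic_on ball 0 R" and R: "R \<ge> 2" and B: "\<And>z. z \<in> ball 0 R \<Longrightarrow> cmod (g z) \<le> B"
  shows "cmod (g 1 - g 0) \<le> 4 * B / R"
    and "cmod (g 1 - g 0 - deriv g 0) \<le> 32 * B / R ^ 2"
proof -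
  have d: "((deriv ^^ i) g has_field_derivative (deriv ^^ Suc i) g z) (at z within cball 0 1)" if "z \<in> cball 0 1" for i z
  proof -
    have "(deriv ^^ i) g holomorphic_on ball 0 R" using g by (intro holomorphic_higher_deriv) auto
    moreover have "z \<in> ball 0 R" using that R by auto
    ultimately show ?thesis by (metis holomorphic_derivI open_ball funpow.simps(2) comp_apply has_field_derivative_at_within)
  qed
  have 1: "cmod ((deriv ^^ 1) g z) \<le> 4 * B / R" if "z \<in> cball 0 1" for z
    using higher_deriv_bound_le[OF g R B that, of 1] by (simp add: mult.commute)
  have 2: "cmod ((deriv ^^ 2) g z) \<le> 32 * B / R ^ 2" if "z \<in> cball 0 1" for z
    using higher_deriv_bound_le[OF g R B that, of 2] by (simp add: power_divide fact_numeral)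
  have "cmod ((deriv ^^ 0) g 1 - (\<Sum>i\<le>0. (deriv ^^ i) g 0 * (1 - 0) ^ i / fact i)) \<le> (4 * B / R) * cmod (1 - 0) ^ Suc 0 / fact 0"
    by (rule complex_Taylor[where S = "cball 0 1" and f = "\<lambda>i. (deriv ^^ i) g"]) (use d[where i = 0] 1 in auto)
  then show "cmod (g 1 - g 0) \<le> 4 * B / R" by simp
  have "cmod ((deriv ^^ 0) g 1 - (\<Sum>i\<le>1. (deriv ^^ i) g 0 * (1 - 0) ^ i / fact i)) \<le> (32 * B / R ^ 2) * cmod (1 - 0) ^ Suc 1 / fact 1"
    by (rule complex_Taylor[where S = "cball 0 1" and f = "\<lambda>i. (deriv ^^ i) g"]) (use d 2 in \<open>auto simp: numeral_2_eq_2\<close>)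
  then show "cmod (g 1 - g 0 - deriv g 0) \<le> 32 * B / R ^ 2" by (simp add: diff_diff_eq)
qed

text \<open>Separate holomorphy along all complex lines. Products, parameter integrals and locally
  uniform limits inherit it from the theorems in one variable; \<open>osgood\<close> converts it
  into differentiability.\<close>

definition lineholo :: "(complex^'n::finite \<Rightarrow> complex) \<Rightarrow> (complex^'n) set \<Rightarrow> bool" where
  "lineholo F U \<longleftrightarrow> (\<forall>z v. (\<lambda>\<zeta>. F (z + \<zeta> *s v)) holomorphic_on {\<zeta>. z + \<zeta> *s v \<in> U})"

lemma lineholo_subset: "lineholo F U \<Longrightarrow> W \<subseteq> U \<Longrightarrow> lineholo F W"
  unfolding lineholo_def by (blast intro: holomorphic_on_subset)

lemma lineholoD: "lineholo F U \<Longrightarrow> (\<And>\<zeta>. \<zeta> \<in> S \<Longrightarrow> z + \<zeta> *s v \<in> U) \<Longrightarrow> (\<lambda>\<zeta>. F (z + \<zeta> *s v)) holomorphic_on S"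
  unfolding lineholo_def by (rule holomorphic_on_subset) auto

lemma lineholo_mult: "lineholo F U \<Longrightarrow> lineholo G U \<Longrightarrow> lineholo (\<lambda>z. F z * G z) U"
  unfolding lineholo_def by (auto intro: holomorphic_on_mult)

lemma lineholo_diff: "lineholo F U \<Longrightarrow> lineholo G U \<Longrightarrow> lineholo (\<lambda>z. F z - G z) U"
  unfolding lineholo_def by (auto intro: holomorphic_on_diff)

lemma smult_has_derivative:
  "((\<lambda>\<zeta>. z + \<zeta> *s (v::complex^'n::finite)) has_derivative (\<lambda>h. h *s v)) (at \<zeta>)"
proof -
  have "bounded_linear (\<lambda>h. h *s v)"
    by (rule bounded_linear_intro[where K = "norm v"])
      (simp_all add: norm_smult vec_eq_iff distrib_right)
  from has_derivative_add[OF has_derivative_const[of z] bounded_linear_imp_has_derivative[OF this]]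
  show ?thesis by simp
qed

lemma lineholo_of_derivative:
  assumes "\<And>z. z \<in> U \<Longrightarrow> \<exists>D. (F has_derivative D) (at z) \<and> (\<forall>c v. D (c *s v) = c * D v)"
  shows "lineholo F U"
  unfolding lineholo_def
proof (intro allI)
  fix z v
  show "(\<lambda>\<zeta>. F (z + \<zeta> *s v)) holomorphic_on {\<zeta>. z + \<zeta> *s v \<in> U}"
  proof (rule holomorphic_onI)
    fix \<zeta> assume "\<zeta> \<in> {\<zeta>. z + \<zeta> *s v \<in> U}"
    then obtain D where D: "(F has_derivative D) (at (z + \<zeta> *s v))" "\<And>c v. D (c *s v) = c * D v" using assms by blast
    have "((\<lambda>\<zeta>. F (z + \<zeta> *s v)) has_derivative (\<lambda>h. D (h *s v))) (at \<zeta>)"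
      by (rule has_derivative_compose[OF smult_has_derivative D(1)])
    then have "((\<lambda>\<zeta>. F (z + \<zeta> *s v)) has_field_derivative D v) (at \<zeta>)"
      by (simp add: has_field_derivative_def D(2) mult.commute[of _ "D v"])
    then show "(\<lambda>\<zeta>. F (z + \<zeta> *s v)) field_differentiable (at \<zeta> within {\<zeta>. z + \<zeta> *s v \<in> U})"
      using field_differentiable_at_within field_differentiable_def by blast
  qed
qed

lemma holomorphic_on_Cn_lineholo: "holomorphic_on_Cn F U \<Longrightarrow> lineholo F U"
  by (rule lineholo_of_derivative) (auto simp: holomorphic_on_Cn_def)

lemma holomorphic_on_Cn_continuous: "holomorphic_on_Cn F U \<Longrightarrow> continuous_on U F"
  by (rule continuous_at_imp_continuous_on) (auto simp: holomorphic_on_Cn_def dest: has_derivative_continuous)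

lemma gauss_shift_lineholo:
  fixes a :: "complex^'n::finite"
  shows "lineholo (\<lambda>z. gauss e (z - a)) U"
proof (rule lineholo_of_derivative)
  fix z :: "complex^'n"
  obtain d where d: "\<And>w::complex^'n. (gauss e has_derivative (\<lambda>h. \<Sum>i\<in>UNIV. h $ i * d i w)) (at w)"
    using gauss_family_derivative[OF gauss_family.base] by blast
  have "((\<lambda>z. gauss e (z - a)) has_derivative (\<lambda>h. \<Sum>i\<in>UNIV. (h - 0) $ i * d i (z - a))) (at z)"
    by (rule has_derivative_compose[OF _ d]) (intro has_derivative_diff has_derivative_ident has_derivative_const)
  then show "\<exists>D. ((\<lambda>z. gauss e (z - a)) has_derivative D) (at z) \<and> (\<forall>c v. D (c *s v) = c * D v)"
    by (intro exI[of _ "\<lambda>h. \<Sum>i\<in>UNIV. (h - 0) $ i * d i (z - a)"]) (simp add: sum_distrib_left mult.assoc)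
qed

lemma gauss_continuous [continuous_intros]:
  "continuous_on S f \<Longrightarrow> continuous_on S (\<lambda>x. gauss e (f x))"
  unfolding gauss_def divide_inverse by (intro continuous_intros)

text \<open>Osgood's lemma. The second difference of \<open>F\<close> in the directions \<open>s v\<close> and \<open>s w\<close> is
  \<open>O(s\<^sup>2)\<close>, by applying the Cauchy estimates once in each direction; hence the directional
  derivative is additive.\<close>

lemma osgood:
  fixes F :: "complex^'n::finite \<Rightarrow> complex"
  assumes U: "open U" and cont: "continuous_on U F" and F: "lineholo F U"
  shows "holomorphic_on_Cn F U"
  unfolding holomorphic_on_Cn_def
proof
  fix z assume "z \<in> U"
  then obtain \<rho> where \<rho>: "\<rho> > 0" "cball z \<rho> \<subseteq> U" using U open_contains_cball by blast
  \<comment> \<open>The three layers leave room for a base point within \<open>r\<close> of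
    \<open>z\<close> and a further displacement, with all evaluations inside the ball of radius
    \<open>3 r\<close> where \<open>B\<close> bounds \<open>F\<close>.\<close>
  define r where "r = \<rho> / 3"
  have r: "r > 0" "cball z (3 * r) \<subseteq> U" using \<rho> by (auto simp: r_def)
  have "compact (F ` cball z (3 * r))" using r cont by (intro compact_continuous_image) (auto intro: continuous_on_subset)
  then obtain B0 where B0: "\<forall>w\<in>F ` cball z (3 * r). norm w \<le> B0" using compact_imp_bounded bounded_iff by metis
  define B where "B = max B0 1"
  have B: "cmod (F w) \<le> B" if "norm (w - z) \<le> 3 * r" for w
  proof -
    have "w \<in> cball z (3 * r)" using that by (simp add: dist_norm norm_minus_commute)
    then have "norm (F w) \<le> B0" using B0 by blast
    then show ?thesis by (simp add: B_def)
  qed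
  have Bpos: "B > 0" by (simp add: B_def)
  define D where "D = (\<lambda>a h. deriv (\<lambda>\<zeta>. F (a + \<zeta> *s h)) 0)"
  have ball: "norm ((a + \<zeta> *s h) - z) < 2 * r"
    if "norm (a - z) < r" "h \<noteq> 0" "\<zeta> \<in> ball 0 (r / norm h)" for a h \<zeta>
  proof -
    have "norm (\<zeta> *s h) < r" using that by (simp add: norm_smult field_simps)
    then show ?thesis using that norm_triangle_ineq[of "a - z" "\<zeta> *s h"] by (simp add: algebra_simps)
  qed
  have hol: "(\<lambda>\<zeta>. F (a + \<zeta> *s h)) holomorphic_on ball 0 (r / norm h)" if "norm (a - z) < r" "h \<noteq> 0" for a h
    by (rule lineholoD[OF F]) (use ball[OF that] r in \<open>force simp: dist_norm norm_minus_commute\<close>)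
  have T: "cmod (F (a + h) - F a) \<le> 4 * B * norm h / r \<and> cmod (F (a + h) - F a - D a h) \<le> 32 * B * norm h ^ 2 / r ^ 2"
    if a: "norm (a - z) < r" and h: "norm h \<le> r / 2" for a h
    proof (cases "h = 0")
      case False
      have R: "r / norm h \<ge> 2" using False h by (simp add: field_simps)
      have bd: "cmod (F (a + \<zeta> *s h)) \<le> B" if "\<zeta> \<in> ball 0 (r / norm h)" for \<zeta>
        using ball[OF a False that] r by (intro B) simp
      from bounded_holomorphic_increment[OF hol[OF a False] R bd] show ?thesis
        by (simp add: D_def power_divide)
    qed (simp add: D_def)
  note T1 = T[THEN conjunct1] and T2 = T[THEN conjunct2]
  have zz: "norm (z - z) < r" using r by simp
  have hom: "D z (c *s v) = c * D z v" for c v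
  proof (cases "c = 0 \<or> v = 0")
    case False
    have "((\<lambda>\<zeta>. F (z + \<zeta> *s v)) has_field_derivative D z v) (at (c * 0))"
      unfolding D_def mult_zero_right
      by (rule holomorphic_derivI[OF hol[OF zz]]) (use False r in auto)
    from DERIV_chain2[where f = "\<lambda>\<zeta>. F (z + \<zeta> *s v)" and g = "\<lambda>\<zeta>. c * \<zeta>" and x = 0 and s = UNIV and Db = c, OF this]
    have "((\<lambda>\<zeta>. F (z + (c * \<zeta>) *s v)) has_field_derivative D z v * c) (at 0)"
      by (auto intro!: derivative_eq_intros)
    then have "deriv (\<lambda>\<zeta>. F (z + (c * \<zeta>) *s v)) 0 = D z v * c" by (rule DERIV_imp_deriv)
    then show ?thesis unfolding D_def by (simp add: vector_smult_assoc mult.commute)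
  qed (auto simp: D_def)
  have add: "D z (v + w) = D z v + D z w" if v: "norm v \<le> 1" and w: "norm w \<le> 1" for v w
  proof -
    define \<Delta> where "\<Delta> = D z (v + w) - D z v - D z w"
    \<comment> \<open>The summands belong to the Taylor remainders in the directions
      \<open>v + w\<close> (of norm at most 2, hence the 4), \<open>v\<close> and \<open>w\<close>,
      and to the mixed second difference.\<close>
    define K where "K = 32 * B * 4 / r ^ 2 + 32 * B * 1 / r ^ 2 + 32 * B * 1 / r ^ 2 + 16 * B / r ^ 2"
    have bound: "cmod \<Delta> \<le> K * s" if s: "0 < s" "s \<le> r / 4" for s
    proof -
      let ?s = "complex_of_real s"
      have sv: "norm (?s *s v) \<le> s" and sw: "norm (?s *s w) \<le> s" using v w s by (simp_all add: norm_smult mult_left_le)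
      have svw: "norm (?s *s (v + w)) \<le> 2 * s"
        using norm_triangle_ineq[of "?s *s v" "?s *s w"] sv sw by (simp add: vector_add_ldistrib)
      have sq: "32 * B * norm (?s *s (v + w)) ^ 2 / r ^ 2 \<le> 32 * B * (2 * s) ^ 2 / r ^ 2"
        "32 * B * norm (?s *s v) ^ 2 / r ^ 2 \<le> 32 * B * s ^ 2 / r ^ 2"
        "32 * B * norm (?s *s w) ^ 2 / r ^ 2 \<le> 32 * B * s ^ 2 / r ^ 2"
        using Bpos sv sw svw by (intro divide_right_mono mult_left_mono power_mono; simp)+
      have e1: "cmod (F (z + ?s *s (v + w)) - F z - ?s * D z (v + w)) \<le> 32 * B * (2 * s) ^ 2 / r ^ 2"
        using order_trans[OF T2[OF zz, of "?s *s (v + w)"] sq(1)] svw s unfolding hom by linarith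
      have e2: "cmod (F (z + ?s *s v) - F z - ?s * D z v) \<le> 32 * B * s ^ 2 / r ^ 2"
        using order_trans[OF T2[OF zz, of "?s *s v"] sq(2)] sv s unfolding hom by linarith
      have e3: "cmod (F (z + ?s *s w) - F z - ?s * D z w) \<le> 32 * B * s ^ 2 / r ^ 2"
        using order_trans[OF T2[OF zz, of "?s *s w"] sq(3)] sw s unfolding hom by linarith
      have e4: "cmod ((F (z + ?s *s v + ?s *s w) - F (z + ?s *s v)) - (F (z + ?s *s w) - F z)) \<le> 16 * B * s ^ 2 / r ^ 2"
      proof -
        \<comment> \<open>The increment of \<open>F\<close> in direction \<open>s w\<close>, already
          of order \<open>s\<close>. As a function of \<open>\<zeta>\<close> it lives on a disc of
          radius \<open>r / s\<close>, so its own increment from 0 to 1 gains another factor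
          \<open>s / r\<close>.\<close>
        let ?p = "\<lambda>\<zeta>. F (z + ?s *s w + \<zeta> *s (?s *s v)) - F (z + \<zeta> *s (?s *s v))"
        have R: "r / s \<ge> 2" using s by (simp add: field_simps)
        have b: "norm ((z + \<zeta> *s (?s *s v)) - z) < r" if "\<zeta> \<in> ball 0 (r / s)" for \<zeta>
        proof -
          have "norm (\<zeta> *s (?s *s v)) \<le> cmod \<zeta> * s" unfolding norm_smult[of \<zeta>] by (intro mult_left_mono sv) simp
          also have "\<dots> < r" using that s by (simp add: field_simps)
          finally show ?thesis by simp
        qed
        have in1: "z + \<zeta> *s (?s *s v) \<in> U" if "\<zeta> \<in> ball 0 (r / s)" for \<zeta>
          using b[OF that] r by (force simp: dist_norm norm_minus_commute)
        have in2: "z + ?s *s w + \<zeta> *s (?s *s v) \<in> U" if "\<zeta> \<in> ball 0 (r / s)" for \<zeta>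
        proof -
          have "norm ((z + ?s *s w + \<zeta> *s (?s *s v)) - z) \<le> norm (?s *s w) + norm ((z + \<zeta> *s (?s *s v)) - z)"
            using norm_triangle_ineq[of "?s *s w" "(z + \<zeta> *s (?s *s v)) - z"] by (simp add: algebra_simps)
          also have "\<dots> \<le> 3 * r" using sw s b[OF that] by simp
          finally have "z + ?s *s w + \<zeta> *s (?s *s v) \<in> cball z (3 * r)"
            by (simp only: mem_cball dist_norm norm_minus_commute[of z])
          then show ?thesis using r by blast
        qed
        have hp: "?p holomorphic_on ball 0 (r / s)"
          by (intro holomorphic_on_diff lineholoD[OF F] in1 in2)
        have bp: "cmod (?p \<zeta>) \<le> 4 * B * s / r" if "\<zeta> \<in> ball 0 (r / s)" for \<zeta>
        proof -
          have "cmod (F ((z + \<zeta> *s (?s *s v)) + ?s *s w) - F (z + \<zeta> *s (?s *s v))) \<le> 4 * B * norm (?s *s w) / r"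
            using s sw r by (intro T1 b that) simp
          also have "\<dots> \<le> 4 * B * s / r" using Bpos r sw by (intro divide_right_mono mult_left_mono) auto
          finally show ?thesis by (simp add: add_ac)
        qed
        have "cmod (?p 1 - ?p 0) \<le> 4 * (4 * B * s / r) / (r / s)"
          by (rule bounded_holomorphic_increment(1)[OF hp R bp])
        then show ?thesis by (simp add: power2_eq_square add_ac algebra_simps)
      qed
      have "?s * \<Delta> = ((F (z + ?s *s v + ?s *s w) - F (z + ?s *s v)) - (F (z + ?s *s w) - F z))
         - (F (z + ?s *s (v + w)) - F z - ?s * D z (v + w)) + (F (z + ?s *s v) - F z - ?s * D z v) + (F (z + ?s *s w) - F z - ?s * D z w)"
        by (simp add: \<Delta>_def algebra_simps vector_add_ldistrib)
      also have "cmod \<dots> \<le> 16 * B * s ^ 2 / r ^ 2 + 32 * B * (2 * s) ^ 2 / r ^ 2 + 32 * B * s ^ 2 / r ^ 2 + 32 * B * s ^ 2 / r ^ 2"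
        by (intro norm_triangle_mono norm_triangle_le_diff add_mono e1 e2 e3 e4 order_refl order_trans[OF norm_triangle_ineq4])
      also have "\<dots> = s * (K * s)" by (simp add: K_def power2_eq_square algebra_simps add_divide_distrib)
      finally have "s * cmod \<Delta> \<le> s * (K * s)" using s by (simp add: norm_mult)
      then show ?thesis using s by simp
    qed
    have K: "K > 0" using Bpos r by (simp add: K_def add_pos_pos)
    have "cmod \<Delta> \<le> 0"
    proof (rule field_le_epsilon)
      fix e :: real assume e: "e > 0"
      have "cmod \<Delta> \<le> K * min (r / 4) (e / K)" using e r K by (intro bound) (simp_all only: min_less_iff_conj zero_less_divide_iff min.cobounded1, simp)
      also have "\<dots> \<le> K * (e / K)" using K by (intro mult_left_mono) auto
      finally show "cmod \<Delta> \<le> 0 + e" using K by simp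
    qed
    then show ?thesis by (simp add: \<Delta>_def algebra_simps)
  qed
  have Dadd: "D z (v + w) = D z v + D z w" for v w
  proof -
    define k where "k = complex_of_real (norm v + norm w + 1)"
    have k: "k \<noteq> 0" "norm ((1 / k) *s v) \<le> 1" "norm ((1 / k) *s w) \<le> 1"
    proof -
      have p: "norm v + norm w + 1 > 0" by (simp add: add_nonneg_pos)
      then have n: "cmod k = norm v + norm w + 1" unfolding k_def norm_of_real by simp
      show "k \<noteq> 0" using n p by auto
      show "norm ((1 / k) *s v) \<le> 1" "norm ((1 / k) *s w) \<le> 1"
        using p by (simp_all add: norm_smult norm_divide n)
    qed
    define v' w' where "v' = (1 / k) *s v" and "w' = (1 / k) *s w"
    have vw: "v = k *s v'" "w = k *s w'" using k(1) by (simp_all add: v'_def w'_def vector_smult_assoc)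
    have "D z (v + w) = D z (k *s (v' + w'))" by (simp add: vw vector_add_ldistrib)
    also have "\<dots> = k * (D z v' + D z w')" unfolding hom using k by (subst add) (auto simp: v'_def w'_def)
    also have "\<dots> = D z v + D z w" unfolding vw hom by (simp add: distrib_left)
    finally show ?thesis .
  qed
  have Dbound: "cmod (D z h) \<le> (20 * B / r) * norm h" for h
  proof (cases "h = 0")
    case False
    \<comment> \<open>Rescaling to \<open>h'\<close> of norm \<open>r / 2\<close>, the largest step
      that \<open>T\<close> admits: the two bounds there add up to \<open>2 B + 8 B\<close>, and
      scaling back gives \<open>20 B / r\<close>.\<close>
    define k where "k = complex_of_real (2 * norm h / r)"
    define h' where "h' = (1 / k) *s h"
    have ck: "cmod k = 2 * norm h / r" unfolding k_def norm_of_real using r by simp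
    have k: "k \<noteq> 0" using False r by (simp add: k_def)
    have h': "norm h' = r / 2" using False r by (simp add: h'_def norm_smult norm_divide ck)
    have "cmod (D z h') \<le> cmod (F (z + h') - F z) + cmod (F (z + h') - F z - D z h')"
      using norm_triangle_ineq4[of "F (z + h') - F z" "F (z + h') - F z - D z h'"] by simp
    also have "\<dots> \<le> 4 * B * norm h' / r + 32 * B * norm h' ^ 2 / r ^ 2"
      using h' by (intro add_mono T1 T2 zz) auto
    also have "\<dots> = 10 * B" using r by (simp add: h' power_divide)
    finally have "cmod k * cmod (D z h') \<le> cmod k * (10 * B)" by (intro mult_left_mono) auto
    moreover have "D z h = k * D z h'" using k by (simp add: h'_def vector_smult_assoc flip: hom)
    ultimately show ?thesis by (simp add: norm_mult ck mult.assoc mult.left_commute[of B] mult.commute[of B])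
  qed (simp add: D_def)
  have lin: "bounded_linear (D z)"
  proof (rule bounded_linear_intro[where K = "20 * B / r"])
    show "D z (k *\<^sub>R h) = k *\<^sub>R D z h" for k h
    proof -
      have "k *\<^sub>R h = complex_of_real k *s h" by (simp add: vec_eq_iff scaleR_conv_of_real[where 'a = complex])
      then show ?thesis by (simp add: hom scaleR_conv_of_real)
    qed
    show "cmod (D z h) \<le> norm h * (20 * B / r)" for h using Dbound[of h] by (simp add: mult.commute)
  qed (rule Dadd)
  have "(F has_derivative D z) (at z)"
    unfolding has_derivative_at
  proof (intro conjI lin)
    define K where "K = 32 * B / r ^ 2"
    have "\<forall>\<^sub>F h in at 0. norm (norm (F (z + h) - F z - D z h) / norm h) \<le> K * norm h"
    proof -
      have "\<forall>\<^sub>F h in at (0::complex^'n). norm h \<le> r / 2"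
        using r by (auto simp: eventually_at intro!: exI[of _ "r / 2"])
      then show ?thesis
      proof (rule eventually_mono)
        fix h :: "complex^'n" assume "norm h \<le> r / 2"
        from T2[OF zz this] have "norm (F (z + h) - F z - D z h) \<le> K * norm h * norm h" by (simp add: K_def power2_eq_square)
        then show "norm (norm (F (z + h) - F z - D z h) / norm h) \<le> K * norm h"
          by (cases "h = 0") (simp_all add: divide_le_eq)
      qed
    qed
    moreover have "((\<lambda>h::complex^'n. K * norm h) \<longlongrightarrow> 0) (at 0)"
      by (auto intro!: tendsto_eq_intros)
    ultimately show "((\<lambda>h. norm (F (z + h) - F z - D z h) / norm h) \<longlongrightarrow> 0) (at 0)"
      by (rule Lim_null_comparison)
  qed
  then show "\<exists>D. (F has_derivative D) (at z) \<and> (\<forall>c v. D (c *s v) = c * D v)" using hom by blast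
qed

section \<open>Holomorphic parameter integrals\<close>

text \<open>Cauchy's estimate bounds the difference quotients of \<open>g t\<close> by
  \<open>4 / \<rho>\<close> times the majorant of \<open>g t\<close> itself, so dominated
  convergence applies along every sequence tending to \<open>x\<close> without any majorant for the
  derivatives.\<close>

lemma holomorphic_integral:
  fixes g :: "'a::euclidean_space \<Rightarrow> complex \<Rightarrow> complex" and B :: "'a \<Rightarrow> real"
  assumes S: "open S" and hol: "\<And>t. g t holomorphic_on S"
    and meas: "\<And>\<zeta>. \<zeta> \<in> S \<Longrightarrow> (\<lambda>t. g t \<zeta>) \<in> borel_measurable borel"
    and B: "integrable lborel B" "\<And>t \<zeta>. \<zeta> \<in> S \<Longrightarrow> cmod (g t \<zeta>) \<le> B t"
  shows "(\<lambda>\<zeta>. LINT t|lborel. g t \<zeta>) holomorphic_on S"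
proof (rule holomorphic_onI)
  fix x assume x: "x \<in> S"
  obtain \<rho> where \<rho>: "\<rho> > 0" "ball x \<rho> \<subseteq> S" using S x open_contains_ball by blast
  define D where "D = (\<lambda>t. deriv (g t) x)"
  have int: "integrable lborel (\<lambda>t. g t \<zeta>)" if "\<zeta> \<in> S" for \<zeta>
    by (rule Bochner_Integration.integrable_bound[OF B(1)])
      (use meas[OF that] B(2)[OF that] in \<open>auto intro!: AE_I2 order_trans[OF _ abs_ge_self]\<close>)
  have "((\<lambda>y. ((LINT t|lborel. g t y) - (LINT t|lborel. g t x)) / (y - x)) \<longlongrightarrow> (LINT t|lborel. D t)) (at x)"
    unfolding tendsto_at_iff_sequentially
  proof (intro allI impI)
    fix X assume X: "\<forall>i. X i \<in> UNIV - {x}" "X \<longlonglongrightarrow> x"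
    have "\<forall>\<^sub>F i in sequentially. dist (X i) x < \<rho> / 2" using tendstoD[OF X(2), of "\<rho> / 2"] \<rho> by simp
    then obtain N where N: "\<And>i. i \<ge> N \<Longrightarrow> dist (X i) x < \<rho> / 2" by (auto simp: eventually_sequentially)
    define Y where "Y = (\<lambda>i. X (i + N))"
    have Y: "Y i \<noteq> x" "cmod (Y i - x) \<le> \<rho> / 2" "Y i \<in> S" for i
      using X(1) N[of "i + N"] \<rho> by (force simp: Y_def dist_norm norm_minus_commute)+
    have Yx: "Y \<longlonglongrightarrow> x" unfolding Y_def by (rule LIMSEQ_ignore_initial_segment[OF X(2)])
    have gd: "(g t has_field_derivative D t) (at x)" for t
      unfolding D_def by (rule holomorphic_derivI[OF hol S x])
    have lim: "(\<lambda>i. (g t (Y i) - g t x) / (Y i - x)) \<longlonglongrightarrow> D t" for t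
      using gd[of t] Y(1) Yx unfolding has_field_derivative_iff tendsto_at_iff_sequentially o_def by blast
    have "(\<lambda>i. LINT t|lborel. (g t (Y i) - g t x) / (Y i - x)) \<longlonglongrightarrow> (LINT t|lborel. D t)"
    proof (rule integral_dominated_convergence)
      show "integrable lborel (\<lambda>t. 4 / \<rho> * B t)" using B(1) by simp
      show "AE t in lborel. (\<lambda>i. (g t (Y i) - g t x) / (Y i - x)) \<longlonglongrightarrow> D t" using lim by simp
      show m: "(\<lambda>t. (g t (Y i) - g t x) / (Y i - x)) \<in> borel_measurable lborel" for i
        using meas[OF Y(3)[of i]] meas[OF x] by simp
      show "D \<in> borel_measurable lborel" by (rule borel_measurable_LIMSEQ_metric[OF m lim])
      fix i
      show "AE t in lborel. norm ((g t (Y i) - g t x) / (Y i - x)) \<le> 4 / \<rho> * B t"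
      proof (rule AE_I2)
        fix t
        let ?h = "Y i - x"
        have h: "cmod ?h > 0" using Y(1) by simp
        have inS: "x + \<zeta> * ?h \<in> S" if "\<zeta> \<in> ball 0 (\<rho> / cmod ?h)" for \<zeta>
        proof -
          have "cmod (\<zeta> * ?h) < \<rho>" unfolding norm_mult using that h by (simp add: pos_less_divide_eq)
          moreover have "dist x (x + u) = cmod u" for u by (simp add: dist_norm)
          ultimately have "x + \<zeta> * ?h \<in> ball x \<rho>" by (simp only: mem_ball)
          then show ?thesis using \<rho> by blast
        qed
        have hl: "(\<lambda>\<zeta>. g t (x + \<zeta> * ?h)) holomorphic_on ball 0 (\<rho> / cmod ?h)"
          by (rule holomorphic_on_compose_gen[OF _ hol, unfolded o_def]) (auto intro!: holomorphic_intros inS)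
        have R: "\<rho> / cmod ?h \<ge> 2" using Y(2)[of i] h by (simp add: field_simps)
        have "cmod (g t (x + 1 * ?h) - g t (x + 0 * ?h)) \<le> 4 * B t / (\<rho> / cmod ?h)"
          by (rule bounded_holomorphic_increment(1)[OF hl R]) (intro B(2) inS)
        then have "cmod (g t (Y i) - g t x) \<le> (4 / \<rho> * B t) * cmod ?h" by simp
        then show "norm ((g t (Y i) - g t x) / (Y i - x)) \<le> 4 / \<rho> * B t"
          using h by (simp add: norm_divide pos_divide_le_eq)
      qed
    qed
    moreover have eq: "(LINT t|lborel. (g t (Y i) - g t x) / (Y i - x)) = ((LINT t|lborel. g t (Y i)) - (LINT t|lborel. g t x)) / (Y i - x)" for i
      unfolding Bochner_Integration.integral_diff[OF int[OF Y(3)[of i]] int[OF x], symmetric] by simp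
    ultimately have "(\<lambda>i. ((\<lambda>y. ((LINT t|lborel. g t y) - (LINT t|lborel. g t x)) / (y - x)) \<circ> X) (i + N)) \<longlonglongrightarrow> (LINT t|lborel. D t)"
      unfolding eq by (simp only: Y_def o_def)
    then show "((\<lambda>y. ((LINT t|lborel. g t y) - (LINT t|lborel. g t x)) / (y - x)) \<circ> X) \<longlonglongrightarrow> (LINT t|lborel. D t)"
      by (rule LIMSEQ_offset)
  qed
  then show "(\<lambda>\<zeta>. LINT t|lborel. g t \<zeta>) field_differentiable (at x within S)"
    using field_differentiable_at_within field_differentiable_def has_field_derivative_iff by blast
qed

section \<open>The three lines theorem\<close>

text \<open>Phragmen-Lindeloef with the same bound on both lines: the factor
  \<open>exp (- d z^2)\<close> forces decay at both ends of the strip, the maximum principle is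
  applied on a long rectangle, and \<open>d\<close> tends to 0.\<close>

lemma three_lines_strip:
  assumes T: "open T" "{z. 0 \<le> Im z \<and> Im z \<le> 1} \<subseteq> T" and g: "g holomorphic_on T"
    and B: "\<And>z. 0 \<le> Im z \<Longrightarrow> Im z \<le> 1 \<Longrightarrow> cmod (g z) \<le> B"
    and C: "\<And>z. Im z = 0 \<or> Im z = 1 \<Longrightarrow> cmod (g z) \<le> C"
    and w: "Re w = 0" "0 \<le> Im w" "Im w \<le> 1"
  shows "cmod (g w) \<le> C"
proof -
  have C0: "C \<ge> 0" using order_trans[OF norm_ge_zero C[of 0]] by simp
  have B0: "B \<ge> 0" using order_trans[OF norm_ge_zero B[of 0]] by simp
  have key: "cmod (g w) \<le> (C + d) * exp d" if d: "d > 0" for d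
  proof -
    define f where "f = (\<lambda>z. g z * exp (- (of_real d * z\<^sup>2)))"
    have nf: "cmod (f z) = cmod (g z) * exp (d * ((Im z)\<^sup>2 - (Re z)\<^sup>2))" for z
    proof -
      have "Re (- (of_real d * z\<^sup>2)) = d * ((Im z)\<^sup>2 - (Re z)\<^sup>2)" by (simp add: power2_eq_square algebra_simps)
      then show ?thesis unfolding f_def norm_mult norm_exp_eq_Re by (simp only:)
    qed
    have hf: "f holomorphic_on T" unfolding f_def by (intro holomorphic_intros g)
    \<comment> \<open>Half the length of the rectangle: \<open>B \<le> d^2 A^2\<close> makes
      \<open>B / (1 + d A^2)\<close> at most \<open>d\<close>, which covers the vertical
      sides.\<close>
    define A where "A = sqrt (B / d / d) + 1"
    have A: "A > 0" "B \<le> d * d * A\<^sup>2"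
    proof -
      show "A > 0" by (simp add: A_def add_nonneg_pos B0 d less_imp_le)
      have "B / d / d \<le> A\<^sup>2" unfolding A_def using B0 d
        by (simp add: power2_sum)
      then show "B \<le> d * d * A\<^sup>2" using d by (simp add: field_simps)
    qed
    let ?S = "cbox (Complex (-A) 0) (Complex A 1)"
    have ST: "?S \<subseteq> T" using T(2) by (auto simp: in_cbox_complex_iff)
    have "cmod (f w) \<le> (C + d) * exp d"
    proof (rule maximum_modulus_frontier[where f = f and S = ?S and \<xi> = w])
      show "f holomorphic_on interior ?S" by (rule holomorphic_on_subset[OF hf]) (use ST interior_subset in blast)
      show "continuous_on (closure ?S) f"
        using ST by (simp add: continuous_on_subset[OF holomorphic_on_imp_continuous_on[OF hf]])
      show "bounded ?S" by simp
      show "w \<in> ?S" using w A by (simp add: in_cbox_complex_iff)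
      fix z assume "z \<in> frontier ?S"
      then have "z \<in> ?S" "z \<notin> box (Complex (-A) 0) (Complex A 1)" by (auto simp: frontier_cbox)
      then have z: "0 \<le> Im z" "Im z \<le> 1" and zc: "(Im z = 0 \<or> Im z = 1) \<or> \<bar>Re z\<bar> = A"
        by (auto simp: in_cbox_complex_iff in_box_complex_iff)
      have im: "(Im z)\<^sup>2 \<le> 1" using z by (simp add: power_le_one)
      from zc show "cmod (f z) \<le> (C + d) * exp d"
      proof
        assume i: "Im z = 0 \<or> Im z = 1"
        have "d * ((Im z)\<^sup>2 - (Re z)\<^sup>2) \<le> d * 1" using d im by (intro mult_left_mono) (auto intro: order_trans[of _ "(Im z)\<^sup>2"])
        then show ?thesis unfolding nf using C[OF i] C0 d by (intro mult_mono) auto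
      next
        assume "\<bar>Re z\<bar> = A"
        then have "(Re z)\<^sup>2 = A\<^sup>2" by (metis power2_abs)
        then have "exp (d * ((Im z)\<^sup>2 - (Re z)\<^sup>2)) \<le> exp d * exp (- (d * A\<^sup>2))"
          using d im by (simp add: right_diff_distrib mult_left_le flip: exp_add)
        also have "exp (- (d * A\<^sup>2)) \<le> 1 / (1 + d * A\<^sup>2)"
          using exp_ge_add_one_self[of "d * A\<^sup>2"] d by (simp add: exp_minus divide_inverse le_imp_inverse_le add_pos_nonneg)
        finally have "exp (d * ((Im z)\<^sup>2 - (Re z)\<^sup>2)) \<le> exp d * (1 / (1 + d * A\<^sup>2))" by simp
        then have "cmod (f z) \<le> B * (exp d * (1 / (1 + d * A\<^sup>2)))"
          unfolding nf using B[OF z] B0 by (intro mult_mono) auto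
        also have "\<dots> = (B / (1 + d * A\<^sup>2)) * exp d" by simp
        also have "\<dots> \<le> (C + d) * exp d"
        proof (rule mult_right_mono)
          have p: "0 < 1 + d * A\<^sup>2" using d by (simp add: add_pos_nonneg)
          have "B \<le> d * (1 + d * A\<^sup>2)" using A(2) d by (simp add: distrib_left)
          then have "B / (1 + d * A\<^sup>2) \<le> d" using p by (simp add: pos_divide_le_eq)
          then show "B / (1 + d * A\<^sup>2) \<le> C + d" using C0 by linarith
        qed simp
        finally show ?thesis .
      qed
    qed
    \<comment> \<open>On the imaginary axis the damping factor has modulus
      \<open>exp (d (Im w)^2)\<close>, which is at least 1.\<close>
    moreover have "cmod (g w) \<le> cmod (f w)"
      unfolding nf using w d by (simp add: mult_le_cancel_left1)
    ultimately show ?thesis by linarith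
  qed
  have "((\<lambda>d. (C + d) * exp d) \<longlongrightarrow> (C + 0) * exp 0) (at_right 0)" by (intro tendsto_intros)
  then show ?thesis
    by (intro tendsto_lowerbound[of "\<lambda>d. (C + d) * exp d" C "at_right 0"])
      (auto intro!: key eventually_at_right_less[THEN eventually_mono])
qed

text \<open>The complex line through \<open>cv x y1\<close> in the direction of the real vector
  \<open>y2 - y1\<close>: the imaginary part of the parameter moves the height along the segment,
  and its real part only shifts \<open>x\<close>. The edges of the unit strip lie over
  \<open>y1\<close> and \<open>y2\<close>.\<close>

lemma three_lines_tube:
  fixes H :: "complex^'n::finite \<Rightarrow> complex"
  assumes \<Omega>: "open \<Omega>" and H: "lineholo H (tube \<Omega>)" and seg: "closed_segment y1 y2 \<subseteq> \<Omega>"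
    and B: "\<And>x y. y \<in> closed_segment y1 y2 \<Longrightarrow> cmod (H (cv x y)) \<le> B"
    and C: "\<And>x. cmod (H (cv x y1)) \<le> C" "\<And>x. cmod (H (cv x y2)) \<le> C"
    and y: "y \<in> closed_segment y1 y2"
  shows "cmod (H (cv x y)) \<le> C"
proof -
  obtain b where b: "0 \<le> b" "b \<le> 1" "y = y1 + b *\<^sub>R (y2 - y1)"
    using y by (auto simp: closed_segment_def algebra_simps)
  let ?v = "y2 - y1"
  define g where "g = (\<lambda>\<zeta>. H (cv x y1 + \<zeta> *s cv ?v 0))"
  have pt: "cv x y1 + \<zeta> *s cv ?v 0 = cv (x + Re \<zeta> *\<^sub>R ?v) (y1 + Im \<zeta> *\<^sub>R ?v)" for \<zeta>
    using cv_smult_real[of "Re \<zeta>" "Im \<zeta>" ?v] by (simp add: cv_add)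
  have in_seg: "y1 + s *\<^sub>R ?v \<in> closed_segment y1 y2" if "0 \<le> s" "s \<le> 1" for s
    unfolding closed_segment_def using that by (auto intro!: exI[of _ s] simp: algebra_simps)
  define T where "T = {\<zeta>. cv x y1 + \<zeta> *s cv ?v 0 \<in> tube \<Omega>}"
  have "cmod (g (Complex 0 b)) \<le> C"
  proof (rule three_lines_strip[where g = g and w = "Complex 0 b" and T = T and B = B])
    show "open T"
    proof -
      have "continuous_on UNIV (\<lambda>\<zeta>::complex. cv x y1 + \<zeta> *s cv ?v 0)" by (intro continuous_intros)
      from open_vimage[OF open_tube[OF \<Omega>] this] show ?thesis by (simp add: T_def vimage_def)
    qed
    show "{z. 0 \<le> Im z \<and> Im z \<le> 1} \<subseteq> T" using in_seg seg by (auto simp: T_def pt tube_iff)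
    show "g holomorphic_on T" using H unfolding lineholo_def T_def g_def by blast
    show "cmod (g z) \<le> B" if "0 \<le> Im z" "Im z \<le> 1" for z
      unfolding g_def pt by (intro B in_seg that)
    show "cmod (g z) \<le> C" if "Im z = 0 \<or> Im z = 1" for z
      using that C by (auto simp: g_def pt)
  qed (use b in auto)
  then show ?thesis by (simp add: g_def pt b)
qed

lemma gauss_1_cmod: "cmod (gauss 1 (cv x y - cv x0 0)) = exp ((norm y)\<^sup>2 - (norm (x - x0))\<^sup>2)"
  by (simp add: cv_diff cmod_gauss)

text \<open>Centring the Gaussian at \<open>x0\<close> transfers the polynomial weight to
  \<open>x0\<close>. A weighted estimate can so be read off at its centre with the exponent
  \<open>m\<close> preserved.\<close>

lemma poly_gauss_bounded:
  "\<exists>A\<ge>0. \<forall>x x0::'a::real_normed_vector. (1 + norm x) ^ m * exp (- ((norm (x - x0))\<^sup>2)) \<le> A * (1 + norm x0) ^ m"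
proof -
  define A where "A = fact m * exp (1 + 1 ^ 2 / 4 :: real)"
  have "(1 + norm x) ^ m * exp (- ((norm (x - x0))\<^sup>2)) \<le> A * (1 + norm x0) ^ m" for x x0 :: 'a
  proof -
    have "(1 + norm x) ^ m \<le> (1 + norm (x - x0)) ^ m * (1 + norm x0) ^ m"
      using weight_shift_power[of x m "- x0"] by simp
    then have "(1 + norm x) ^ m * exp (- ((norm (x - x0))\<^sup>2)) \<le> ((1 + norm (x - x0)) ^ m * (1 + norm x0) ^ m) * exp (- ((norm (x - x0))\<^sup>2))"
      by (intro mult_right_mono) auto
    also have "\<dots> = ((1 + norm (x - x0)) ^ m * exp (- ((norm (x - x0))\<^sup>2) / 1 ^ 2)) * (1 + norm x0) ^ m" by simp
    also have "\<dots> \<le> A * (1 + norm x0) ^ m"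
      unfolding A_def by (intro mult_right_mono gaussian_weight_bounded) auto
    finally show ?thesis .
  qed
  then show ?thesis by (intro exI[of _ A]) (auto simp: A_def)
qed

text \<open>The Gaussian factor makes \<open>F\<close> bounded on tubes over compact sets, so the three lines theorem
  shows that the set of \<open>y\<close> satisfying a fixed bound on \<open>\<real>\<^sup>n + i y\<close> is convex.\<close>

lemma hull_bound:
  fixes F :: "complex^'n::finite \<Rightarrow> complex"
  assumes \<Omega>: "open \<Omega>" "convex \<Omega>" and F: "lineholo F (tube \<Omega>)"
    and growth: "\<And>L. compact L \<Longrightarrow> L \<subseteq> \<Omega> \<Longrightarrow> \<exists>C. \<forall>y\<in>L. \<forall>x. cmod (F (cv x y)) \<le> C * (1 + norm x) ^ m"
    and K: "K \<subseteq> \<Omega>" "\<And>y. y \<in> K \<Longrightarrow> norm y \<le> R"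
    and A: "\<And>x y. y \<in> K \<Longrightarrow> cmod (F (cv x y)) * exp (- ((norm (x - x0))\<^sup>2)) \<le> A"
    and y: "y \<in> convex hull K"
  shows "cmod (F (cv x y)) * exp ((norm y)\<^sup>2 - (norm (x - x0))\<^sup>2) \<le> A * exp (R\<^sup>2)"
proof -
  define H where "H = (\<lambda>z. F z * gauss 1 (z - cv x0 0))"
  have nH: "cmod (H (cv x y)) = cmod (F (cv x y)) * exp ((norm y)\<^sup>2 - (norm (x - x0))\<^sup>2)" for x y
    unfolding H_def norm_mult gauss_1_cmod ..
  have H: "lineholo H (tube \<Omega>)" unfolding H_def by (intro lineholo_mult F gauss_shift_lineholo)
  define Y where "Y = {y \<in> \<Omega>. \<forall>x. cmod (H (cv x y)) \<le> A * exp (R\<^sup>2)}"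
  have "K \<subseteq> Y"
  proof
    fix y assume y: "y \<in> K"
    have "cmod (H (cv x y)) \<le> A * exp (R\<^sup>2)" for x
    proof -
      \<comment> \<open>At height \<open>y\<close> the modulus of the Gaussian exceeds its value at
        real arguments by the factor \<open>exp ((norm y)\<^sup>2)\<close>; this is the source of
        \<open>exp (R\<^sup>2)\<close> in the conclusion.\<close>
      have "cmod (H (cv x y)) = (cmod (F (cv x y)) * exp (- ((norm (x - x0))\<^sup>2))) * exp ((norm y)\<^sup>2)"
        unfolding nH by (simp add: exp_diff exp_minus divide_inverse)
      also have "\<dots> \<le> A * exp (R\<^sup>2)"
        using K(2)[OF y] A[OF y, of x] by (intro mult_mono) (auto intro: power_mono order_trans[of 0 "cmod (F (cv x y)) * exp (- ((norm (x - x0))\<^sup>2))"])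
      finally show ?thesis .
    qed
    then show "y \<in> Y" using K(1) y by (auto simp: Y_def)
  qed
  moreover have "convex Y"
    unfolding convex_contains_segment
  proof (intro ballI subsetI)
    fix y1 y2 y assume yy: "y1 \<in> Y" "y2 \<in> Y" "y \<in> closed_segment y1 y2"
    have seg: "closed_segment y1 y2 \<subseteq> \<Omega>" using yy \<Omega>(2) by (auto simp: Y_def convex_contains_segment)
    obtain C where C: "\<forall>y\<in>closed_segment y1 y2. \<forall>x. cmod (F (cv x y)) \<le> C * (1 + norm x) ^ m"
      using growth[OF compact_segment seg] by blast
    obtain Q where Q: "Q \<ge> 0" "\<forall>x x0::real^'n. (1 + norm x) ^ m * exp (- ((norm (x - x0))\<^sup>2)) \<le> Q * (1 + norm x0) ^ m"
      using poly_gauss_bounded by blast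
    obtain R' where R': "\<forall>y\<in>closed_segment y1 y2. norm y \<le> R'" using compact_imp_bounded[OF compact_segment] bounded_iff by metis
    have C0: "C \<ge> 0"
    proof -
      have "cmod (F (cv 0 y1)) \<le> C * (1 + norm (0::real^'n)) ^ m" using C by blast
      from order_trans[OF norm_ge_zero this] show ?thesis by simp
    qed
    have "cmod (H (cv x y)) \<le> A * exp (R\<^sup>2)" for x
    proof (rule three_lines_tube[OF \<Omega>(1) H seg _ _ _ yy(3)])
      fix x y assume y: "y \<in> closed_segment y1 y2"
      have "cmod (H (cv x y)) = cmod (F (cv x y)) * exp (- ((norm (x - x0))\<^sup>2)) * exp ((norm y)\<^sup>2)"
        unfolding nH by (simp add: exp_diff exp_minus divide_inverse)
      also have "\<dots> \<le> (C * (1 + norm x) ^ m) * exp (- ((norm (x - x0))\<^sup>2)) * exp (R'\<^sup>2)"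
        using C R' y C0 by (intro mult_mono) (auto intro: power_mono)
      also have "\<dots> = C * ((1 + norm x) ^ m * exp (- ((norm (x - x0))\<^sup>2))) * exp (R'\<^sup>2)" by simp
      also have "\<dots> \<le> C * (Q * (1 + norm x0) ^ m) * exp (R'\<^sup>2)"
        using Q C0 by (intro mult_right_mono mult_left_mono) auto
      finally show "cmod (H (cv x y)) \<le> C * (Q * (1 + norm x0) ^ m) * exp (R'\<^sup>2)" .
    qed (use yy in \<open>auto simp: Y_def\<close>)
    then show "y \<in> Y" using seg yy(3) by (auto simp: Y_def)
  qed
  ultimately have "convex hull K \<subseteq> Y" by (rule hull_minimal)
  then show ?thesis using y unfolding Y_def nH by blast
qed

section \<open>Polynomial growth from a mean value formula\<close>

lemma integral_pos_continuous:
  fixes f :: "'a::euclidean_space \<Rightarrow> real"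
  assumes f: "continuous_on UNIV f" "\<And>x. f x \<ge> 0" "f a > 0" "integrable lborel f"
  shows "(LINT x|lborel. f x) > 0"
proof (rule ccontr)
  assume "\<not> (LINT x|lborel. f x) > 0"
  then have "(LINT x|lborel. f x) = 0" using f by (simp add: antisym not_less)
  then have AE: "AE x in lborel. f x = 0" using integral_nonneg_eq_0_iff_AE[OF f(4)] f(2) by simp
  have "open {x. f x > 0}" using f(1) by (simp add: open_Collect_less)
  then obtain e where e: "e > 0" "ball a e \<subseteq> {x. f x > 0}" using f(3) open_contains_ball by blast
  have "AE x in lborel. x \<notin> ball a e" using AE by eventually_elim (use e(2) in auto)
  then have "emeasure lborel (ball a e) = 0"
    using AE_iff_null_sets[of "ball a e" lborel] by (simp add: null_sets_def)
  then have "measure lborel (ball a e) = 0" by (simp add: measure_def)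
  then show False using e content_ball_gt_0_iff[of a e] by simp
qed

section \<open>Invariance of Lebesgue measure on pairs of real vectors under shears and
  rotations\<close>

lemma nn_integral_shift:
  fixes f :: "'a::euclidean_space \<Rightarrow> ennreal"
  assumes [measurable]: "f \<in> borel_measurable borel"
  shows "(\<integral>\<^sup>+x. f (x + h) \<partial>lborel) = (\<integral>\<^sup>+x. f x \<partial>lborel)"
proof -
  have "(\<integral>\<^sup>+x. f x \<partial>lborel) = (\<integral>\<^sup>+x. f x \<partial>distr lborel borel ((+) h))" by (simp add: lborel_distr_plus)
  also have "\<dots> = (\<integral>\<^sup>+x. f (h + x) \<partial>lborel)" by (rule nn_integral_distr) auto
  finally show ?thesis by (simp add: add.commute)
qed

lemma nn_integral_lborel_prod:
  fixes g :: "'a::euclidean_space \<times> 'a \<Rightarrow> ennreal"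
  assumes "g \<in> borel_measurable borel"
  shows "(\<integral>\<^sup>+y. (\<integral>\<^sup>+x. g (x, y) \<partial>lborel) \<partial>lborel) = (\<integral>\<^sup>+p. g p \<partial>lborel)"
    and "(\<integral>\<^sup>+x. (\<integral>\<^sup>+y. g (x, y) \<partial>lborel) \<partial>lborel) = (\<integral>\<^sup>+p. g p \<partial>lborel)"
proof -
  have g: "g \<in> borel_measurable (lborel \<Otimes>\<^sub>M lborel)" using assms by (simp add: lborel_prod)
  show "(\<integral>\<^sup>+y. (\<integral>\<^sup>+x. g (x, y) \<partial>lborel) \<partial>lborel) = (\<integral>\<^sup>+p. g p \<partial>lborel)"
    using lborel_pair.nn_integral_snd[OF g] by (simp add: lborel_prod)
  show "(\<integral>\<^sup>+x. (\<integral>\<^sup>+y. g (x, y) \<partial>lborel) \<partial>lborel) = (\<integral>\<^sup>+p. g p \<partial>lborel)"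
    using lborel.nn_integral_fst[OF g] by (simp add: lborel_prod)
qed

text \<open>By Tonelli's theorem, integrating first over the sheared component turns the shear into
  a translation.\<close>

lemma distr_shear:
  fixes a :: real
  shows "distr lborel borel (\<lambda>p::'a::euclidean_space \<times> 'a. (fst p + a *\<^sub>R snd p, snd p)) = lborel" (is "distr lborel borel ?s = _")
    and "distr lborel borel (\<lambda>p::'a::euclidean_space \<times> 'a. (fst p, snd p + a *\<^sub>R fst p)) = lborel" (is "distr lborel borel ?u = _")
proof -
  have ms: "?s \<in> borel_measurable borel" and mu: "?u \<in> borel_measurable borel"
    by (intro borel_measurable_continuous_onI continuous_intros)+
  show "distr lborel borel ?s = lborel"
  proof (rule measure_eqI)
    fix A assume "A \<in> sets (distr lborel borel ?s)"
    then have A[measurable]: "A \<in> sets borel" by simp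
    have m: "(\<lambda>p. indicator A (?s p) :: ennreal) \<in> borel_measurable borel"
      using ms by (intro measurable_compose[OF _ borel_measurable_indicator]) auto
    have m1: "(\<lambda>x. indicator A (x, y) :: ennreal) \<in> borel_measurable borel" for y
      by (intro measurable_compose[OF _ borel_measurable_indicator[OF A]] borel_measurable_continuous_onI continuous_intros)
    have "emeasure (distr lborel borel ?s) A = (\<integral>\<^sup>+p. indicator A p \<partial>distr lborel borel ?s)" by simp
    also have "\<dots> = (\<integral>\<^sup>+p. indicator A (?s p) \<partial>lborel)"
      using ms by (intro nn_integral_distr) auto
    also have "\<dots> = (\<integral>\<^sup>+y. (\<integral>\<^sup>+x. indicator A (x + a *\<^sub>R y, y) \<partial>lborel) \<partial>lborel)"
      using nn_integral_lborel_prod(1)[OF m] by simp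
    also have "\<dots> = (\<integral>\<^sup>+y. (\<integral>\<^sup>+x. indicator A (x, y) \<partial>lborel) \<partial>lborel)"
      by (subst nn_integral_shift[OF m1]) simp
    also have "\<dots> = (\<integral>\<^sup>+p. indicator A p \<partial>lborel)"
      by (rule nn_integral_lborel_prod) simp
    finally show "emeasure (distr lborel borel ?s) A = emeasure lborel A" by simp
  qed simp
  show "distr lborel borel ?u = lborel"
  proof (rule measure_eqI)
    fix A assume "A \<in> sets (distr lborel borel ?u)"
    then have A[measurable]: "A \<in> sets borel" by simp
    have m: "(\<lambda>p. indicator A (?u p) :: ennreal) \<in> borel_measurable borel"
      using mu by (intro measurable_compose[OF _ borel_measurable_indicator]) auto
    have m1: "(\<lambda>y. indicator A (x, y) :: ennreal) \<in> borel_measurable borel" for x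
      by (intro measurable_compose[OF _ borel_measurable_indicator[OF A]] borel_measurable_continuous_onI continuous_intros)
    have "emeasure (distr lborel borel ?u) A = (\<integral>\<^sup>+p. indicator A p \<partial>distr lborel borel ?u)" by simp
    also have "\<dots> = (\<integral>\<^sup>+p. indicator A (?u p) \<partial>lborel)"
      using mu by (intro nn_integral_distr) auto
    also have "\<dots> = (\<integral>\<^sup>+x. (\<integral>\<^sup>+y. indicator A (x, y + a *\<^sub>R x) \<partial>lborel) \<partial>lborel)"
      using nn_integral_lborel_prod(2)[OF m] by simp
    also have "\<dots> = (\<integral>\<^sup>+x. (\<integral>\<^sup>+y. indicator A (x, y) \<partial>lborel) \<partial>lborel)"
      by (subst nn_integral_shift[OF m1]) simp
    also have "\<dots> = (\<integral>\<^sup>+p. indicator A p \<partial>lborel)"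
      by (rule nn_integral_lborel_prod) simp
    finally show "emeasure (distr lborel borel ?u) A = emeasure lborel A" by simp
  qed simp
qed

lemma integral_shear:
  fixes f :: "'a::euclidean_space \<times> 'a \<Rightarrow> complex"
  assumes f[measurable]: "f \<in> borel_measurable borel"
  shows "(LINT p|lborel. f (fst p + a *\<^sub>R snd p, snd p)) = (LINT p|lborel. f p)"
    and "(LINT p|lborel. f (fst p, snd p + a *\<^sub>R fst p)) = (LINT p|lborel. f p)"
proof -
  have ms: "(\<lambda>p::'a \<times> 'a. (fst p + a *\<^sub>R snd p, snd p)) \<in> borel_measurable borel" and mu: "(\<lambda>p::'a \<times> 'a. (fst p, snd p + a *\<^sub>R fst p)) \<in> borel_measurable borel"
    by (intro borel_measurable_continuous_onI continuous_intros)+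
  show "(LINT p|lborel. f (fst p + a *\<^sub>R snd p, snd p)) = (LINT p|lborel. f p)"
    using integral_distr[of "\<lambda>p::'a \<times> 'a. (fst p + a *\<^sub>R snd p, snd p)" lborel borel f] ms by (simp add: distr_shear)
  show "(LINT p|lborel. f (fst p, snd p + a *\<^sub>R fst p)) = (LINT p|lborel. f p)"
    using integral_distr[of "\<lambda>p::'a \<times> 'a. (fst p, snd p + a *\<^sub>R fst p)" lborel borel f] mu by (simp add: distr_shear)
qed

text \<open>Rotation by the unit complex number \<open>(1 - a\<^sup>2 - 2 a i) / (1 + a\<^sup>2)\<close> is a product of three shears.\<close>

lemma integral_rotate:
  fixes f :: "'a::euclidean_space \<times> 'a \<Rightarrow> complex" and a :: real
  assumes f: "continuous_on UNIV f"
  defines "c \<equiv> (1 - a\<^sup>2) / (1 + a\<^sup>2)" and "b \<equiv> - (2 * a) / (1 + a\<^sup>2)"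
  shows "(LINT p|lborel. f (c *\<^sub>R fst p - b *\<^sub>R snd p, b *\<^sub>R fst p + c *\<^sub>R snd p)) = (LINT p|lborel. f p)"
proof -
  have a: "1 + a\<^sup>2 \<noteq> 0" by (metis add_nonneg_eq_0_iff zero_le_one zero_le_power2 zero_neq_one)
  have c1: "1 + a * b = c" unfolding c_def b_def using a by (simp add: field_simps power2_eq_square)
  have c2: "a + a * c = - b" unfolding c_def b_def using a by (simp add: field_simps power2_eq_square)
  have c2': "a + (a + a * (a * b)) = - b" using c2 c1 by (metis distrib_left mult.right_neutral)
  define g1 where "g1 = (\<lambda>p. f (fst p + a *\<^sub>R snd p, snd p))"
  define g2 where "g2 = (\<lambda>p. g1 (fst p, snd p + b *\<^sub>R fst p))"
  have k1: "continuous_on UNIV g1" unfolding g1_def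
    by (rule continuous_on_compose2[OF f]) (auto intro!: continuous_intros)
  have k2: "continuous_on UNIV g2" unfolding g2_def
    by (rule continuous_on_compose2[OF k1]) (auto intro!: continuous_intros)
  have "g2 (fst p + a *\<^sub>R snd p, snd p) = f (c *\<^sub>R fst p - b *\<^sub>R snd p, b *\<^sub>R fst p + c *\<^sub>R snd p)" for p
  proof -
    obtain t s where p: "p = (t, s)" by force
    have 1: "t + a *\<^sub>R s + a *\<^sub>R (s + b *\<^sub>R (t + a *\<^sub>R s)) = (1 + a * b) *\<^sub>R t + (a + (a + a * (a * b))) *\<^sub>R s"
      by (simp only: scaleR_left_distrib scaleR_right_distrib scaleR_scaleR scaleR_one add_ac mult_ac)
    have 2: "s + b *\<^sub>R (t + a *\<^sub>R s) = b *\<^sub>R t + (1 + a * b) *\<^sub>R s" by (simp add: algebra_simps)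
    show ?thesis unfolding g2_def g1_def p fst_conv snd_conv 1 unfolding 2 c1 c2' by simp
  qed
  then have "(LINT p|lborel. f (c *\<^sub>R fst p - b *\<^sub>R snd p, b *\<^sub>R fst p + c *\<^sub>R snd p)) = (LINT p|lborel. g2 (fst p + a *\<^sub>R snd p, snd p))"
    by simp
  also have "\<dots> = (LINT p|lborel. g2 p)" by (intro integral_shear borel_measurable_continuous_onI k2)
  also have "\<dots> = (LINT p|lborel. g1 p)" unfolding g2_def by (intro integral_shear borel_measurable_continuous_onI k1)
  also have "\<dots> = (LINT p|lborel. f p)" unfolding g1_def by (intro integral_shear borel_measurable_continuous_onI f)
  finally show ?thesis .
qed

section \<open>The mean value formula with a smooth radial weight\<close>

definition mv_weight :: "real \<Rightarrow> 'a::real_inner \<Rightarrow> real" where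
  "mv_weight r p = flat_exp 1 (r\<^sup>2 - p \<bullet> p)"

lemma mv_weight_continuous [continuous_intros]:
  "continuous_on S f \<Longrightarrow> continuous_on S (\<lambda>x. mv_weight r (f x))"
  unfolding mv_weight_def by (intro continuous_on_compose2[OF flat_exp_continuous[of UNIV]] continuous_intros) auto

lemma mv_weight_nonneg: "mv_weight r p \<ge> 0"
  by (simp add: mv_weight_def flat_exp_def)

lemma mv_weight_outside:
  assumes "norm p \<ge> r" "r > 0" shows "mv_weight r p = 0"
proof -
  have "r\<^sup>2 \<le> p \<bullet> p" unfolding dot_square_norm using assms by (intro power_mono) auto
  then show ?thesis by (simp add: mv_weight_def flat_exp_def)
qed

lemma mv_weight_bounded: obtains M where "M \<ge> 0" "\<And>p. mv_weight r (p::'a::real_inner) \<le> M"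
proof -
  obtain B where B: "\<And>s. s \<le> r\<^sup>2 \<Longrightarrow> \<bar>flat_exp 1 s\<bar> \<le> B" using flat_exp_bounded by blast
  have "mv_weight r (p::'a) \<le> B" for p
    using B[of "r\<^sup>2 - p \<bullet> p"] by (simp add: mv_weight_def)
  moreover have "B \<ge> 0" using B[of "r\<^sup>2"] by linarith
  ultimately show ?thesis using that by blast
qed

lemma integrable_cball_bound:
  fixes f :: "'a::euclidean_space \<Rightarrow> 'b::{banach, second_countable_topology}"
  assumes "f \<in> borel_measurable borel" "\<And>x. norm (f x) \<le> B * indicator (cball 0 r) x"
  shows "integrable lborel f"
proof (rule Bochner_Integration.integrable_bound)
  show "integrable lborel (\<lambda>x::'a. B * indicator (cball 0 r) x)"
    by (intro integrable_mult_right integrable_real_indicator) (simp_all add: emeasure_lborel_cball_finite[unfolded infinity_ennreal_def])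
  show "AE x in lborel. norm (f x) \<le> norm (B * indicator (cball 0 r) x)"
    using assms(2) by (auto intro!: AE_I2 order_trans[OF _ abs_ge_self])
qed (use assms in simp)

text \<open>\<open>\<Phi> \<zeta>\<close> is the weighted mean of \<open>F\<close> over points
  \<open>z + \<zeta> p\<close>. The weight is radial, so \<open>\<Phi>\<close> takes the same value
  at all unit numbers reached by \<open>integral_rotate\<close>; by the identity theorem it is
  constant. At 0 it is a multiple of \<open>F z\<close>, at 1 it is, by Fubini, an integral over
  heights \<open>s\<close> of pairings of slices with bump functions, which \<open>A\<close>
  bounds.\<close>

lemma mean_value_bound:
  fixes F :: "complex^'n::finite \<Rightarrow> complex"
  assumes r: "r > 0" and F: "lineholo F (tube (ball y0 (2 * r)))" and cF: "continuous_on (tube (ball y0 (2 * r))) F"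
    and A: "\<And>s. norm s < r \<Longrightarrow> cmod (LINT t|lborel. F (cv t (y0 + s)) * of_real (flat_exp 1 (r\<^sup>2 - (t - x) \<bullet> (t - x) - s \<bullet> s))) \<le> A"
  shows "cmod (F (cv x y0)) * (LINT p|lborel. mv_weight r (p :: (real^'n) \<times> (real^'n))) \<le> A * measure lborel (ball (0::real^'n) r)"
proof -
  let ?w = "mv_weight r :: (real^'n) \<times> (real^'n) \<Rightarrow> real"
  let ?z = "cv x y0"
  define pt where "pt = (\<lambda>\<zeta> (p :: (real^'n) \<times> (real^'n)). ?z + \<zeta> *s cv (fst p) (snd p))"
  define Q where "Q = (\<lambda>\<zeta> p. of_real (?w p) * F (pt \<zeta> p))"
  have npair: "norm (cv (fst p) (snd p)) = norm p" for p :: "(real^'n) \<times> (real^'n)"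
    by (rule power2_eq_imp_eq) (simp_all add: norm_cv_power2 norm_prod_def)
  have in_tube: "pt \<zeta> p \<in> tube (ball y0 (2 * r))" if "cmod \<zeta> * norm p < 2 * r" for \<zeta> :: complex and p
  proof -
    have le: "norm (im_vec w) \<le> norm w" for w :: "complex^'n"
      using norm_cv_power2[of "re_vec w" "im_vec w"] by (simp add: power2_le_imp_le)
    have "im_vec (pt \<zeta> p) = y0 + im_vec (\<zeta> *s cv (fst p) (snd p))" by (simp add: pt_def imv_add)
    then have "dist y0 (im_vec (pt \<zeta> p)) \<le> cmod \<zeta> * norm p"
      using le[of "\<zeta> *s cv (fst p) (snd p)"] by (simp add: dist_norm norm_smult npair)
    then show ?thesis using that by (simp add: tube_iff)
  qed
  have pt_cont: "continuous_on S (\<lambda>p. pt (f p) (g p))" if "continuous_on S f" "continuous_on S g" for S :: "'b::topological_space set" and f :: "'b \<Rightarrow> complex" and g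
    unfolding pt_def by (intro continuous_intros that)
  have Qcont: "continuous_on UNIV (Q \<zeta>)" if \<zeta>: "cmod \<zeta> < 3 / 2" for \<zeta>
  proof -
    \<comment> \<open>\<open>F\<close> is controlled only inside its tube. For
      \<open>norm p < 4 r / 3\<close> the point stays there since \<open>3 / 2\<close> times
      \<open>4 r / 3\<close> is \<open>2 r\<close>; for \<open>norm p > r\<close> the weight
      vanishes. The two open sets cover everything.\<close>
    have "continuous_on (ball 0 (4 * r / 3) \<union> {p. norm p > r}) (Q \<zeta>)"
    proof (rule continuous_on_open_Un)
      show "open {p::(real^'n) \<times> (real^'n). norm p > r}" by (intro open_Collect_less continuous_intros)
      have "continuous_on {p. norm p > r} (\<lambda>p::(real^'n) \<times> (real^'n). 0::complex)" by simp
      then show "continuous_on {p. norm p > r} (Q \<zeta>)"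
        by (rule continuous_on_eq) (simp add: Q_def mv_weight_outside r)
      show "continuous_on (ball 0 (4 * r / 3)) (Q \<zeta>)"
        unfolding Q_def
      proof (intro continuous_intros continuous_on_compose2[OF cF] pt_cont subsetI)
        fix z assume "z \<in> (\<lambda>p. pt \<zeta> p) ` ball 0 (4 * r / 3)"
        then obtain p where p: "z = pt \<zeta> p" "norm p < 4 * r / 3" by auto
        have "cmod \<zeta> * norm p \<le> 3 / 2 * norm p" using \<zeta> by (intro mult_right_mono) auto
        also have "\<dots> < 2 * r" using p by simp
        finally show "z \<in> tube (ball y0 (2 * r))" unfolding p by (rule in_tube)
      qed
    qed simp
    moreover have "ball 0 (4 * r / 3) \<union> {p. norm p > r} = (UNIV :: ((real^'n) \<times> (real^'n)) set)" using r by (auto simp: not_less)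
    ultimately show ?thesis by simp
  qed
  obtain M where M: "M \<ge> 0" "\<And>p. ?w p \<le> M" using mv_weight_bounded by blast
  have "compact ((\<lambda>q. F (pt (fst q) (snd q))) ` (cball 0 (3 / 2) \<times> cball 0 r))"
  proof (intro compact_continuous_image continuous_on_compose2[OF cF] pt_cont continuous_intros subsetI compact_Times compact_cball)
    fix z assume "z \<in> (\<lambda>q. pt (fst q) (snd q)) ` (cball 0 (3 / 2) \<times> cball 0 r)"
    then obtain \<zeta> p where p: "z = pt \<zeta> p" "cmod \<zeta> \<le> 3 / 2" "norm p \<le> r" by auto
    have "cmod \<zeta> * norm p \<le> 3 / 2 * r" using p by (intro mult_mono) auto
    also have "\<dots> < 2 * r" using r by simp
    finally show "z \<in> tube (ball y0 (2 * r))" unfolding p by (rule in_tube)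
  qed
  then have "bounded ((\<lambda>q. F (pt (fst q) (snd q))) ` (cball 0 (3 / 2) \<times> cball 0 r))" by (rule compact_imp_bounded)
  then obtain B where B: "\<forall>v\<in>(\<lambda>q. F (pt (fst q) (snd q))) ` (cball 0 (3 / 2) \<times> cball 0 r). norm v \<le> B" by (auto simp only: bounded_iff)
  have Qb: "cmod (Q \<zeta> p) \<le> M * B * indicator (cball 0 r) p" if "cmod \<zeta> < 3 / 2" for \<zeta> p
  proof (cases "norm p \<le> r")
    case True
    then have "(\<zeta>, p) \<in> cball 0 (3 / 2) \<times> cball 0 r" using that by simp
    then have "norm (F (pt \<zeta> p)) \<le> B" using B by (metis (no_types, lifting) fst_conv snd_conv image_eqI)
    then show ?thesis using True M mv_weight_nonneg[of r p] by (simp add: Q_def norm_mult mult_mono)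
  qed (simp add: Q_def mv_weight_outside r)
  have Qint: "integrable lborel (Q \<zeta>)" if "cmod \<zeta> < 3 / 2" for \<zeta>
    by (rule integrable_cball_bound[OF borel_measurable_continuous_onI[OF Qcont[OF that]] Qb[OF that]])
  define \<Phi> where "\<Phi> = (\<lambda>\<zeta>. LINT p|lborel. Q \<zeta> p)"
  \<comment> \<open>The radius exceeds 1, so that 1 is an interior point, and is below 2, so that
    the support of the weight is mapped into the tube over the ball of radius
    \<open>2 r\<close>.\<close>
  have hol: "\<Phi> holomorphic_on ball 0 (3 / 2)"
    unfolding \<Phi>_def
  proof (rule holomorphic_integral[where B = "\<lambda>p. M * B * indicator (cball 0 r) p"])
    show "integrable lborel (\<lambda>p::(real^'n) \<times> (real^'n). M * B * indicator (cball 0 r) p)"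
      by (intro integrable_mult_right integrable_real_indicator) (simp_all add: emeasure_lborel_cball_finite[unfolded infinity_ennreal_def])
    show "(\<lambda>\<zeta>. Q \<zeta> p) holomorphic_on ball 0 (3 / 2)" for p
    proof (cases "norm p < r")
      case True
      have "(\<lambda>\<zeta>. F (pt \<zeta> p)) holomorphic_on ball 0 (3 / 2)"
        unfolding pt_def
      proof (rule lineholoD[OF F])
        fix \<zeta> assume "\<zeta> \<in> ball (0::complex) (3 / 2)"
        then have "cmod \<zeta> * norm p \<le> 3 / 2 * r" using True by (intro mult_mono) auto
        also have "\<dots> < 2 * r" using r by simp
        finally show "?z + \<zeta> *s cv (fst p) (snd p) \<in> tube (ball y0 (2 * r))" using in_tube[of \<zeta> p] by (simp add: pt_def)
      qed
      then show ?thesis unfolding Q_def by (intro holomorphic_intros)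
    qed (simp add: Q_def mv_weight_outside r not_less)
    show "(\<lambda>p. Q \<zeta> p) \<in> borel_measurable borel" if "\<zeta> \<in> ball 0 (3 / 2)" for \<zeta>
      by (rule borel_measurable_continuous_onI[OF Qcont]) (use that in simp)
    show "cmod (Q \<zeta> p) \<le> M * B * indicator (cball 0 r) p" if "\<zeta> \<in> ball 0 (3 / 2)" for \<zeta> p
      by (rule Qb) (use that in simp)
  qed simp
  have rot: "\<Phi> (Complex ((1 - a\<^sup>2) / (1 + a\<^sup>2)) (- (2 * a) / (1 + a\<^sup>2))) = \<Phi> 1" for a
  proof -
    define c b where "c = (1 - a\<^sup>2) / (1 + a\<^sup>2)" and "b = - (2 * a) / (1 + a\<^sup>2)"
    have a: "1 + a\<^sup>2 \<noteq> 0" by (metis add_nonneg_eq_0_iff zero_le_one zero_le_power2 zero_neq_one)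
    have cb: "c\<^sup>2 + b\<^sup>2 = 1"
    proof -
      have "c\<^sup>2 + b\<^sup>2 = ((1 - a\<^sup>2)\<^sup>2 + (2 * a)\<^sup>2) / (1 + a\<^sup>2)\<^sup>2" by (simp add: c_def b_def power_divide add_divide_distrib)
      also have "(1 - a\<^sup>2)\<^sup>2 + (2 * a)\<^sup>2 = (1 + a\<^sup>2)\<^sup>2" by (simp add: power2_eq_square algebra_simps)
      finally show ?thesis using a by simp
    qed
    have "Q (Complex c b) p = Q 1 (c *\<^sub>R fst p - b *\<^sub>R snd p, b *\<^sub>R fst p + c *\<^sub>R snd p)" for p
    proof -
      obtain t s where p: "p = (t, s)" by force
      have 1: "Complex c b *s cv t s = cv (c *\<^sub>R t - b *\<^sub>R s) (b *\<^sub>R t + c *\<^sub>R s)"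
        by (simp add: cv_def vec_eq_iff complex_eq_iff)
      have "(c *\<^sub>R t - b *\<^sub>R s) \<bullet> (c *\<^sub>R t - b *\<^sub>R s) + (b *\<^sub>R t + c *\<^sub>R s) \<bullet> (b *\<^sub>R t + c *\<^sub>R s) = (c\<^sup>2 + b\<^sup>2) * (t \<bullet> t + s \<bullet> s)"
        by (simp add: inner_simps power2_eq_square algebra_simps inner_commute)
      then have "?w (c *\<^sub>R t - b *\<^sub>R s, b *\<^sub>R t + c *\<^sub>R s) = ?w (t, s)"
        by (simp add: mv_weight_def cb)
      then show ?thesis by (simp add: Q_def pt_def p 1)
    qed
    then have "\<Phi> (Complex c b) = (LINT p|lborel. Q 1 (c *\<^sub>R fst p - b *\<^sub>R snd p, b *\<^sub>R fst p + c *\<^sub>R snd p))"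
      unfolding \<Phi>_def by (intro Bochner_Integration.integral_cong refl)
    also have "\<dots> = \<Phi> 1" unfolding \<Phi>_def c_def b_def by (rule integral_rotate) (rule Qcont, simp)
    finally show ?thesis by (simp add: c_def b_def)
  qed
  define \<gamma> where "\<gamma> = (\<lambda>a::real. Complex ((1 - a\<^sup>2) / (1 + a\<^sup>2)) (- (2 * a) / (1 + a\<^sup>2)))"
  have "\<Phi> 0 - \<Phi> 1 = 0"
  proof (rule analytic_continuation[where f = "\<lambda>\<zeta>. \<Phi> \<zeta> - \<Phi> 1" and S = "ball 0 (3 / 2)" and \<xi> = 1
        and U = "ball 0 (3 / 2) \<inter> range \<gamma>"])
    \<comment> \<open>The rational parametrisation \<open>\<gamma>\<close> of the unit circle passes
      through 1 at parameter 0; the parameters \<open>1 / (n + 1)\<close> supply points accumulating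
      there.\<close>
    show "1 islimpt ball 0 (3 / 2) \<inter> range \<gamma>"
      unfolding islimpt_sequential
    proof (intro exI conjI allI)
      let ?f = "\<lambda>n. \<gamma> (1 / real (Suc n))"
      have lim: "(\<lambda>n. 1 / real (Suc n)) \<longlonglongrightarrow> 0" using LIMSEQ_inverse_real_of_nat by (simp add: inverse_eq_divide)
      have "?f \<longlonglongrightarrow> Complex ((1 - 0\<^sup>2) / (1 + 0\<^sup>2)) (- (2 * 0) / (1 + 0\<^sup>2))"
        unfolding \<gamma>_def by (intro tendsto_intros lim) simp_all
      then show "?f \<longlonglongrightarrow> 1" by (simp add: complex_eq_iff one_complex.code)
      fix n
      have nm: "cmod (\<gamma> a) = 1" for a
      proof -
        have a: "1 + a\<^sup>2 > 0" by (simp add: add_pos_nonneg)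
        have "((1 - a\<^sup>2) / (1 + a\<^sup>2))\<^sup>2 + (- (2 * a) / (1 + a\<^sup>2))\<^sup>2 = ((1 - a\<^sup>2)\<^sup>2 + (2 * a)\<^sup>2) / (1 + a\<^sup>2)\<^sup>2"
          by (simp add: power_divide add_divide_distrib)
        also have "(1 - a\<^sup>2)\<^sup>2 + (2 * a)\<^sup>2 = (1 + a\<^sup>2)\<^sup>2" by (simp add: power2_eq_square algebra_simps)
        finally show ?thesis using a by (simp add: \<gamma>_def complex_norm)
      qed
      have ne: "?f n \<noteq> 1"
      proof
        assume "?f n = 1"
        then have "Im (?f n) = 0" by simp
        moreover have "Im (?f n) < 0"
          unfolding \<gamma>_def complex.sel by (intro divide_neg_pos) (auto simp: add_pos_nonneg)
        ultimately show False by simp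
      qed
      show "?f n \<in> ball 0 (3 / 2) \<inter> range \<gamma> - {1}"
        using nm ne by simp
    qed
    show "(\<lambda>\<zeta>. \<Phi> \<zeta> - \<Phi> 1) holomorphic_on ball 0 (3 / 2)" by (intro holomorphic_intros hol)
    show "\<Phi> z - \<Phi> 1 = 0" if "z \<in> ball 0 (3 / 2) \<inter> range \<gamma>" for z
      using that rot by (auto simp: \<gamma>_def)
  qed auto
  moreover have "\<Phi> 0 = of_real (LINT p|lborel. ?w p) * F ?z"
    by (simp add: \<Phi>_def Q_def pt_def)
  ultimately have eq: "of_real (LINT p|lborel. ?w p) * F ?z = \<Phi> 1" by simp
  have Q1: "integrable (lborel \<Otimes>\<^sub>M lborel) (case_prod (\<lambda>t s. Q 1 (t, s)))"
    using Qint[of 1] by (simp add: lborel_prod case_prod_unfold)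
  have "\<Phi> 1 = (LINT s|lborel. LINT t|lborel. Q 1 (t, s))"
    using lborel_pair.integral_snd[OF Q1] by (simp add: lborel_prod case_prod_unfold \<Phi>_def)
  also have "cmod \<dots> \<le> (LINT s|lborel. cmod (LINT t|lborel. Q 1 (t, s)))" by (rule integral_norm_bound)
  also have "\<dots> \<le> (LINT s|lborel. A * indicator (ball (0::real^'n) r) s)"
  proof (rule integral_mono)
    show "integrable lborel (\<lambda>s. cmod (LINT t|lborel. Q 1 (t, s)))"
      using lborel_pair.integrable_snd[OF Q1] by simp
    show "integrable lborel (\<lambda>s. A * indicator (ball (0::real^'n) r) s)"
      by (intro integrable_mult_right integrable_real_indicator) (simp_all add: emeasure_lborel_ball_finite[unfolded infinity_ennreal_def])
    fix s :: "real^'n"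
    show "cmod (LINT t|lborel. Q 1 (t, s)) \<le> A * indicator (ball 0 r) s"
    proof (cases "norm s < r")
      case True
      define f where "f = (\<lambda>t. F (cv t (y0 + s)) * of_real (flat_exp 1 (r\<^sup>2 - (t - x) \<bullet> (t - x) - s \<bullet> s)))"
      have "continuous_on UNIV f"
        unfolding f_def
      proof (intro continuous_intros continuous_on_compose2[OF cF] continuous_on_compose2[OF flat_exp_continuous[of UNIV]] subsetI)
        fix z assume "z \<in> range (\<lambda>t. cv t (y0 + s))"
        then show "z \<in> tube (ball y0 (2 * r))" using True r by (auto simp: tube_iff dist_norm)
      qed auto
      then have fm: "f \<in> borel_measurable borel" by (rule borel_measurable_continuous_onI)
      have "(LINT t|lborel. Q 1 (t, s)) = (LINT t|lborel. f (t + x))"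
        by (rule Bochner_Integration.integral_cong) (simp_all add: Q_def pt_def f_def cv_add mv_weight_def diff_diff_eq add.commute mult.commute)
      also have "\<dots> = (LINT t|lborel. f t)" by (rule integral_shift[OF fm])
      finally show ?thesis using A[OF True] True by (simp add: f_def)
    next
      case False
      have "Q 1 (t, s) = 0" for t
      proof -
        have "norm s \<le> norm (t, s)" by (metis norm_snd_le)
        then show ?thesis using False by (simp add: Q_def mv_weight_outside r)
      qed
      then show ?thesis using False by simp
    qed
  qed
  also have "\<dots> = A * measure lborel (ball (0::real^'n) r)" by simp
  finally have "cmod (of_real (LINT p|lborel. ?w p) * F ?z) \<le> A * measure lborel (ball (0::real^'n) r)" unfolding eq .
  moreover have "(LINT p|lborel. ?w p) \<ge> 0" by (intro integral_nonneg_AE AE_I2 mv_weight_nonneg)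
  ultimately show ?thesis by (simp add: norm_mult mult.commute)
qed

lemma mv_weight_integral_pos:
  assumes "r > 0" shows "(LINT p|lborel. mv_weight r (p::'a::euclidean_space)) > 0"
proof (rule integral_pos_continuous[where a = 0])
  show "continuous_on UNIV (mv_weight r :: 'a \<Rightarrow> real)" using mv_weight_continuous[OF continuous_on_id] by simp
  show "mv_weight r (0::'a) > 0" using assms by (simp add: mv_weight_def flat_exp_def)
  obtain M where M: "M \<ge> 0" "\<And>p. mv_weight r (p::'a) \<le> M" using mv_weight_bounded by blast
  show "integrable lborel (mv_weight r :: 'a \<Rightarrow> real)"
  proof (rule integrable_cball_bound[where B = M and r = r])
    show "norm (mv_weight r p) \<le> M * indicator (cball 0 r) p" for p :: 'a
      using M mv_weight_nonneg[of r p] mv_weight_outside[of r p] assms by (cases "norm p \<le> r") auto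
  qed (use mv_weight_continuous[OF continuous_on_id, of UNIV] borel_measurable_continuous_onI in auto)
qed (rule mv_weight_nonneg)

section \<open>Shifting the contour\<close>

text \<open>The integral is locally constant in the height. For nearby \<open>a\<close> and
  \<open>b\<close> put \<open>v = b - a\<close> and let \<open>J \<zeta>\<close> be the integral
  over the slice shifted by \<open>\<zeta> v\<close>: for real \<open>\<zeta>\<close> it is constant
  by translation invariance, it is holomorphic, hence \<open>J \<i> = J 0\<close>, and
  \<open>\<i> v\<close> leads from height \<open>a\<close> to height \<open>b\<close>.\<close>

lemma contour_shift:
  fixes \<Phi> :: "complex^'n::finite \<Rightarrow> complex"
  assumes V: "open V" "connected V" and \<Phi>: "lineholo \<Phi> (tube V)" and c\<Phi>: "continuous_on (tube V) \<Phi>"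
    and decay: "\<And>y. y \<in> V \<Longrightarrow> \<exists>d>0. \<exists>C. \<forall>y'\<in>ball y d. \<forall>x. (1 + norm x) ^ (CARD('n) + 2) * cmod (\<Phi> (cv x y')) \<le> C"
    and y: "y1 \<in> V" "y2 \<in> V"
  shows "(LINT x|lborel. \<Phi> (cv x y1)) = (LINT x|lborel. \<Phi> (cv x y2))"
proof (rule connected_local_const[OF V(2) y])
  show "\<forall>a\<in>V. \<forall>\<^sub>F b in at a within V. (LINT x|lborel. \<Phi> (cv x a)) = (LINT x|lborel. \<Phi> (cv x b))"
  proof
    fix a assume a: "a \<in> V"
    let ?N = "CARD('n) + 2"
    obtain d0 C where d0: "d0 > 0" "\<forall>y'\<in>ball a d0. \<forall>x. (1 + norm x) ^ ?N * cmod (\<Phi> (cv x y')) \<le> C" using decay[OF a] by blast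
    obtain d1 where d1: "d1 > 0" "ball a d1 \<subseteq> V" using V(1) a open_contains_ball by blast
    define d where "d = min d0 d1"
    have d: "d > 0" "ball a d \<subseteq> V" "\<And>y' x. y' \<in> ball a d \<Longrightarrow> (1 + norm x) ^ ?N * cmod (\<Phi> (cv x y')) \<le> C"
      using d0 d1 by (auto simp: d_def subset_iff)
    have meas: "(\<lambda>x. \<Phi> (cv x y')) \<in> borel_measurable borel" if "y' \<in> V" for y'
      by (intro borel_measurable_continuous_onI continuous_on_compose2[OF c\<Phi>] continuous_intros) (use that in \<open>auto simp: tube_iff\<close>)
    have "(LINT x|lborel. \<Phi> (cv x a)) = (LINT x|lborel. \<Phi> (cv x b))" if b: "b \<in> ball a d" for b
    proof (cases "b = a")
      case False
      define v where "v = b - a"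
      have v: "v \<noteq> 0" "norm v < d" using False b by (auto simp: v_def dist_norm norm_minus_commute)
      \<comment> \<open>Larger than 1, so the disc on which \<open>J\<close> is holomorphic contains
        \<open>\<i>\<close>.\<close>
      define \<rho> where "\<rho> = d / norm v"
      have \<rho>: "\<rho> > 1" "\<rho> * norm v = d" using v by (auto simp: \<rho>_def)
      have pt: "cv x a + \<zeta> *s cv v 0 = cv (x + Re \<zeta> *\<^sub>R v) (a + Im \<zeta> *\<^sub>R v)" for x \<zeta>
        using cv_smult_real[of "Re \<zeta>" "Im \<zeta>" v] by (simp add: cv_add)
      have small: "norm (Re \<zeta> *\<^sub>R v) \<le> d" "norm (Im \<zeta> *\<^sub>R v) < d" if "\<zeta> \<in> ball (0::complex) \<rho>" for \<zeta>
      proof -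
        have "\<bar>Re \<zeta>\<bar> < \<rho>" "\<bar>Im \<zeta>\<bar> < \<rho>" using that abs_Re_le_cmod[of \<zeta>] abs_Im_le_cmod[of \<zeta>] by auto
        then have "\<bar>Re \<zeta>\<bar> * norm v < \<rho> * norm v" "\<bar>Im \<zeta>\<bar> * norm v < \<rho> * norm v" using v by (auto intro: mult_strict_right_mono)
        then show "norm (Re \<zeta> *\<^sub>R v) \<le> d" "norm (Im \<zeta> *\<^sub>R v) < d" using \<rho> by auto
      qed
      have in_ball: "a + Im \<zeta> *\<^sub>R v \<in> ball a d" if "\<zeta> \<in> ball (0::complex) \<rho>" for \<zeta>
        using small(2)[OF that] by (simp add: dist_norm)
      have in_V: "a + Im \<zeta> *\<^sub>R v \<in> V" if "\<zeta> \<in> ball (0::complex) \<rho>" for \<zeta>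
        using in_ball[OF that] d(2) by blast
      define J where "J = (\<lambda>\<zeta>. LINT x|lborel. \<Phi> (cv x a + \<zeta> *s cv v 0))"
      have hol: "J holomorphic_on ball 0 \<rho>"
        unfolding J_def
      proof (rule holomorphic_integral[where B = "\<lambda>x. (C * (1 + d) ^ ?N) * (1 / (1 + norm x) ^ ?N)"])
        show "(\<lambda>\<zeta>. \<Phi> (cv x a + \<zeta> *s cv v 0)) holomorphic_on ball 0 \<rho>" for x
          by (rule lineholoD[OF \<Phi>]) (simp only: pt tube_iff imv_cv in_V)
        show "(\<lambda>x. \<Phi> (cv x a + \<zeta> *s cv v 0)) \<in> borel_measurable borel" if "\<zeta> \<in> ball (0::complex) \<rho>" for \<zeta>
          by (intro borel_measurable_continuous_onI continuous_on_compose2[OF c\<Phi>] continuous_intros)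
            (use in_V[OF that] in \<open>auto simp: tube_iff pt\<close>)
        show "integrable lborel (\<lambda>x::real^'n. (C * (1 + d) ^ ?N) * (1 / (1 + norm x) ^ ?N))"
          by (intro integrable_mult_right integrable_weight)
        fix x and \<zeta> :: complex assume z: "\<zeta> \<in> ball 0 \<rho>"
        have "(1 + norm x) ^ ?N * cmod (\<Phi> (cv x a + \<zeta> *s cv v 0)) \<le>
          ((1 + norm (x + Re \<zeta> *\<^sub>R v)) ^ ?N * (1 + norm (Re \<zeta> *\<^sub>R v)) ^ ?N) * cmod (\<Phi> (cv (x + Re \<zeta> *\<^sub>R v) (a + Im \<zeta> *\<^sub>R v)))"
          unfolding pt by (intro mult_right_mono weight_shift_power) auto
        also have "\<dots> = ((1 + norm (x + Re \<zeta> *\<^sub>R v)) ^ ?N * cmod (\<Phi> (cv (x + Re \<zeta> *\<^sub>R v) (a + Im \<zeta> *\<^sub>R v)))) * (1 + norm (Re \<zeta> *\<^sub>R v)) ^ ?N"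
          by (simp only: mult_ac)
        also have "\<dots> \<le> C * (1 + d) ^ ?N"
          using small(1)[OF z] d(3)[OF in_ball[OF z], of 0]
          by (intro mult_mono d(3)[OF in_ball[OF z]] power_mono) (auto intro: order_trans[OF norm_ge_zero])
        finally show "cmod (\<Phi> (cv x a + \<zeta> *s cv v 0)) \<le> (C * (1 + d) ^ ?N) * (1 / (1 + norm x) ^ ?N)"
          using weight_pos[of x ?N] by (simp only: mult_1_right times_divide_eq_right pos_le_divide_eq mult.commute)
      qed simp
      have real_const: "J (of_real t) = J 0" if "\<bar>t\<bar> < \<rho>" for t
      proof -
        have "J (of_real t) = (LINT x|lborel. \<Phi> (cv (x + t *\<^sub>R v) a))" unfolding J_def pt by simp
        also have "\<dots> = (LINT x|lborel. \<Phi> (cv x a))" by (rule integral_shift[OF meas[OF a]])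
        also have "\<dots> = J 0" unfolding J_def pt by simp
        finally show ?thesis .
      qed
      have "J \<i> - J 0 = 0"
      proof (rule analytic_continuation[where f = "\<lambda>\<zeta>. J \<zeta> - J 0" and S = "ball 0 \<rho>" and \<xi> = 0 and U = "of_real ` {t. \<bar>t\<bar> < \<rho>}"])
        show "(\<lambda>\<zeta>. J \<zeta> - J 0) holomorphic_on ball 0 \<rho>" by (intro holomorphic_intros hol)
        show "0 islimpt complex_of_real ` {t. \<bar>t\<bar> < \<rho>}"
          unfolding islimpt_approachable
        proof (intro allI impI)
          fix e :: real assume e: "e > 0"
          define t where "t = min (e / 2) (\<rho> / 2)"
          have "0 < t" "t < e" "t < \<rho>" using e \<rho> by (auto simp: t_def)
          then show "\<exists>x'\<in>complex_of_real ` {t. \<bar>t\<bar> < \<rho>}. x' \<noteq> 0 \<and> dist x' 0 < e" by (intro bexI[of _ "of_real t"]) auto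
        qed
        show "J z - J 0 = 0" if "z \<in> of_real ` {t. \<bar>t\<bar> < \<rho>}" for z using that real_const by auto
      qed (use \<rho> in auto)
      then show ?thesis unfolding J_def pt by (simp add: v_def)
    qed simp
    then have "\<forall>b\<in>V. b \<noteq> a \<and> dist b a < d \<longrightarrow> (LINT x|lborel. \<Phi> (cv x a)) = (LINT x|lborel. \<Phi> (cv x b))"
      by (simp add: dist_commute)
    then show "\<forall>\<^sub>F b in at a within V. (LINT x|lborel. \<Phi> (cv x a)) = (LINT x|lborel. \<Phi> (cv x b))"
      unfolding eventually_at using d(1) by blast
  qed
qed

section \<open>Compact subsets of the convex hull of two open sets\<close>

text \<open>A point of the hull is a convex combination of finitely many points. Replacing these by
  small closed balls inside \<open>V1\<close> and \<open>V2\<close> covers a whole neighbourhood of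
  the point, and finitely many neighbourhoods cover \<open>K\<close>.\<close>

lemma compact_in_hull:
  fixes V1 V2 :: "'a::euclidean_space set"
  assumes V: "open V1" "open V2" and K: "compact K" "K \<subseteq> convex hull (V1 \<union> V2)"
  shows "\<exists>K1 K2. compact K1 \<and> K1 \<subseteq> V1 \<and> compact K2 \<and> K2 \<subseteq> V2 \<and> K \<subseteq> convex hull (K1 \<union> K2)"
proof -
  have "\<exists>d K1 K2. d > 0 \<and> compact K1 \<and> K1 \<subseteq> V1 \<and> compact K2 \<and> K2 \<subseteq> V2 \<and> ball y d \<subseteq> convex hull (K1 \<union> K2)"
    if y: "y \<in> convex hull (V1 \<union> V2)" for y
  proof -
    obtain P where P: "finite P" "P \<subseteq> V1 \<union> V2" "y \<in> convex hull P"
      using y unfolding caratheodory[of "V1 \<union> V2"] by blast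
    have c: "compact (P \<inter> V1)" "compact (P - V1)" using P(1) by (auto intro: finite_imp_compact)
    obtain d1 where d1: "d1 > 0" "(\<Union>x\<in>P \<inter> V1. ball x d1) \<subseteq> V1"
      by (rule compact_subset_open_imp_ball_epsilon_subset[OF c(1) V(1)]) auto
    obtain d2 where d2: "d2 > 0" "(\<Union>x\<in>P - V1. ball x d2) \<subseteq> V2"
      by (rule compact_subset_open_imp_ball_epsilon_subset[OF c(2) V(2)]) (use P(2) in auto)
    define d where "d = min d1 d2 / 2"
    define K1 K2 where "K1 = (\<Union>x\<in>P \<inter> V1. cball x d)" and "K2 = (\<Union>x\<in>P - V1. cball x d)"
    have dd: "d > 0" "d < d1" "d < d2" using d1(1) d2(1) by (auto simp: d_def)
    have "compact K1" "compact K2" unfolding K1_def K2_def using P(1) by (intro compact_UN; auto)+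
    moreover have "cball x d \<subseteq> ball x d1" "cball x d \<subseteq> ball x d2" for x :: 'a using dd by auto
    then have "K1 \<subseteq> (\<Union>x\<in>P \<inter> V1. ball x d1)" "K2 \<subseteq> (\<Union>x\<in>P - V1. ball x d2)"
      unfolding K1_def K2_def by (intro UN_mono; simp)+
    then have "K1 \<subseteq> V1" "K2 \<subseteq> V2" using d1(2) d2(2) by simp_all
    moreover have "ball y d \<subseteq> convex hull (K1 \<union> K2)"
    proof
      fix u assume u: "u \<in> ball y d"
      \<comment> \<open>To reach \<open>u\<close> near \<open>y\<close>, the whole configuration
        \<open>P\<close> is translated by \<open>u - y\<close>; each of its points stays in its own
        closed ball.\<close>
      have "(+) (u - y) ` P \<subseteq> K1 \<union> K2"
      proof
        fix q assume "q \<in> (+) (u - y) ` P"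
        then obtain p where p: "p \<in> P" "q = (u - y) + p" by auto
        have "q \<in> cball p d" using u p by (simp add: dist_norm norm_minus_commute)
        then show "q \<in> K1 \<union> K2" using p by (auto simp: K1_def K2_def)
      qed
      then have "convex hull ((+) (u - y) ` P) \<subseteq> convex hull (K1 \<union> K2)" by (rule hull_mono)
      moreover have "u \<in> convex hull ((+) (u - y) ` P)"
        unfolding convex_hull_translation by (rule image_eqI[of _ _ y]) (simp, rule P(3))
      ultimately show "u \<in> convex hull (K1 \<union> K2)" by (rule subsetD)
    qed
    ultimately show ?thesis using dd(1) by blast
  qed
  note nbh = this
  define good where "good = (\<lambda>S. \<exists>K1 K2. compact K1 \<and> K1 \<subseteq> V1 \<and> compact K2 \<and> K2 \<subseteq> V2 \<and> S \<subseteq> convex hull (K1 \<union> K2))"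
  have good_empty: "good {}" unfolding good_def by (rule exI[of _ "{}"], rule exI[of _ "{}"]) simp
  have good_Un: "good (S \<union> T)" if S: "good S" and T: "good T" for S T
  proof -
    obtain K1 K2 where 1: "compact K1" "K1 \<subseteq> V1" "compact K2" "K2 \<subseteq> V2" "S \<subseteq> convex hull (K1 \<union> K2)"
      using S unfolding good_def by (elim exE conjE) (rule that)
    obtain L1 L2 where 2: "compact L1" "L1 \<subseteq> V1" "compact L2" "L2 \<subseteq> V2" "T \<subseteq> convex hull (L1 \<union> L2)"
      using T unfolding good_def by (elim exE conjE) (rule that)
    have "convex hull (K1 \<union> K2) \<subseteq> convex hull ((K1 \<union> L1) \<union> (K2 \<union> L2))"
      "convex hull (L1 \<union> L2) \<subseteq> convex hull ((K1 \<union> L1) \<union> (K2 \<union> L2))" by (intro hull_mono; blast)+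
    then show ?thesis unfolding good_def using 1 2
      by (intro exI[of _ "K1 \<union> L1"] exI[of _ "K2 \<union> L2"] conjI compact_Un Un_least) (simp_all add: subset_trans)
  qed
  have good_ball: "\<exists>d>0. good (ball y d)" if "y \<in> K" for y
  proof -
    have "y \<in> convex hull (V1 \<union> V2)" using K(2) that by blast
    from nbh[OF this] obtain d K1 K2 where "d > 0" "compact K1" "K1 \<subseteq> V1" "compact K2" "K2 \<subseteq> V2" "ball y d \<subseteq> convex hull (K1 \<union> K2)"
      by (elim exE conjE) (rule that)
    then show ?thesis unfolding good_def by (intro exI[of _ d] conjI) auto
  qed
  define \<G> where "\<G> = {S. open S \<and> good S}"
  have "K \<subseteq> \<Union>\<G>"
  proof
    fix y assume "y \<in> K"
    then obtain d where "d > 0" "good (ball y d)" using good_ball by blast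
    then show "y \<in> \<Union>\<G>" unfolding \<G>_def by (intro UnionI[of "ball y d"]) auto
  qed
  then obtain D where D: "D \<subseteq> \<G>" "finite D" "K \<subseteq> \<Union>D"
    using compactE[OF K(1), of \<G>] unfolding \<G>_def by (metis (no_types, lifting) mem_Collect_eq)
  from D(2,1) have "good (\<Union>D)"
    by induction (auto simp: good_empty \<G>_def intro: good_Un)
  then show ?thesis unfolding good_def using D(3) by (meson subset_trans)
qed

section \<open>Extension to the convex hull\<close>

lemma gauss_real: "gauss 1 (cv t 0) = of_real (exp (- (norm t)\<^sup>2))"
proof -
  have "cv t 0 $ i = of_real (t $ i)" for i by (simp add: cv_def Complex_eq)
  then have "(\<Sum>i\<in>UNIV. (cv t 0 $ i)\<^sup>2) = of_real ((norm t)\<^sup>2)" by (simp add: norm_vec_power2)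
  then have "gauss 1 (cv t 0) = exp (of_real (- (norm t)\<^sup>2))" by (simp add: gauss_def)
  then show ?thesis by (simp only: exp_of_real)
qed

lemma gauss_real_schwartz: "(\<lambda>t::real^'n::finite. gauss 1 (cv t 0)) \<in> schwartz"
proof -
  have "gauss 1 (0 - cv t 0) = gauss 1 (cv t 0)" for t :: "real^'n" by (simp add: gauss_def)
  then show ?thesis using gauss_schwartz[of 1 "0 :: complex^'n"] by simp
qed

lemma growth_gauss_integrable:
  "integrable lborel (\<lambda>t::real^'n::finite. (1 + norm t) ^ m * exp (- (norm t)\<^sup>2))"
proof -
  have "integrable lborel (\<lambda>t::real^'n. of_real ((1 + norm t) ^ m) * gauss 1 (cv t 0))"
  proof (rule schwartz_growth_integrable[where C = 1 and m = m])
    show "(\<lambda>t::real^'n. complex_of_real ((1 + norm t) ^ m)) \<in> borel_measurable borel"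
      by (intro borel_measurable_continuous_onI continuous_intros)
    show "cmod (complex_of_real ((1 + norm t) ^ m)) \<le> 1 * (1 + norm t) ^ m" for t :: "real^'n"
      unfolding norm_of_real by simp
  qed (rule gauss_real_schwartz)
  then have "integrable lborel (\<lambda>t::real^'n. Re (of_real ((1 + norm t) ^ m) * gauss 1 (cv t 0)))" by (rule integrable_Re)
  then show ?thesis by (simp only: gauss_real flip: of_real_mult) simp
qed

lemma gauss_mass_nonzero: "(LINT t::real^'n::finite|lborel. gauss 1 (cv t 0)) \<noteq> 0"
proof -
  have i: "integrable lborel (\<lambda>t::real^'n. exp (- (norm t)\<^sup>2))" using growth_gauss_integrable[of 0] by simp
  have "(LINT t::real^'n|lborel. exp (- (norm t)\<^sup>2)) > 0"
    by (rule integral_pos_continuous[where a = 0]) (auto intro!: continuous_intros i)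
  then show ?thesis by (simp add: gauss_real)
qed

text \<open>The Gaussian convolution of width \<open>e\<close> after the substitution that puts all
  dependence on \<open>e\<close> into the argument of \<open>F\<close>. It converges to
  \<open>F\<close> times the mass of \<open>gauss 1\<close>.\<close>

definition gaussian_average :: "(complex^'n::finite \<Rightarrow> complex) \<Rightarrow> real \<Rightarrow> real^'n \<Rightarrow> real^'n \<Rightarrow> complex" where
  "gaussian_average F e x y = (LINT t|lborel. F (cv (x + e *\<^sub>R t) y) * gauss 1 (cv t 0))"

lemma growth_dilate:
  assumes "0 \<le> e" "e \<le> 1" shows "(1 + norm (x + e *\<^sub>R t)) ^ m \<le> (1 + norm x) ^ m * (1 + norm t) ^ m"
proof -
  have "norm (e *\<^sub>R t) \<le> norm t" using assms by (simp add: mult_left_le_one_le)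
  then have "1 + norm (x + e *\<^sub>R t) \<le> 1 + norm x + norm t" using norm_triangle_ineq[of x "e *\<^sub>R t"] by linarith
  also have "\<dots> \<le> (1 + norm x) * (1 + norm t)" by (simp add: distrib_left distrib_right)
  finally show ?thesis unfolding power_mult_distrib[symmetric] by (intro power_mono) auto
qed

lemma gaussian_average_integrand:
  fixes F :: "complex^'n::finite \<Rightarrow> complex"
  assumes "0 \<le> e" "e \<le> 1" and C: "C \<ge> 0" "\<And>x. cmod (F (cv x y)) \<le> C * (1 + norm x) ^ m"
  shows "cmod (F (cv (x + e *\<^sub>R t) y) * gauss 1 (cv t 0)) \<le> C * (1 + norm x) ^ m * ((1 + norm t) ^ m * exp (- (norm t)\<^sup>2))"
proof -
  have "cmod (F (cv (x + e *\<^sub>R t) y)) \<le> C * ((1 + norm x) ^ m * (1 + norm t) ^ m)"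
    using order_trans[OF C(2) mult_left_mono[OF growth_dilate[OF assms(1,2)] C(1)]] .
  then have "cmod (F (cv (x + e *\<^sub>R t) y)) * exp (- (norm t)\<^sup>2) \<le> C * ((1 + norm x) ^ m * (1 + norm t) ^ m) * exp (- (norm t)\<^sup>2)"
    by (intro mult_right_mono) auto
  then show ?thesis by (simp add: norm_mult gauss_real mult_ac)
qed

lemma gaussian_average_bound:
  fixes F :: "complex^'n::finite \<Rightarrow> complex"
  assumes e: "0 \<le> e" "e \<le> 1" and C: "C \<ge> 0" "\<And>x. cmod (F (cv x y)) \<le> C * (1 + norm x) ^ m"
    and cont: "continuous_on UNIV (\<lambda>x. F (cv x y))"
  shows "cmod (gaussian_average F e x y) \<le> C * (1 + norm x) ^ m * (LINT t::real^'n|lborel. (1 + norm t) ^ m * exp (- (norm t)\<^sup>2))"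
proof -
  have i: "integrable lborel (\<lambda>t::real^'n. C * (1 + norm x) ^ m * ((1 + norm t) ^ m * exp (- (norm t)\<^sup>2)))"
    by (intro integrable_mult_right growth_gauss_integrable)
  have m: "(\<lambda>t. F (cv (x + e *\<^sub>R t) y) * gauss 1 (cv t 0)) \<in> borel_measurable lborel"
  proof -
    have "continuous_on UNIV (\<lambda>t. F (cv (x + e *\<^sub>R t) y))"
      by (rule continuous_on_compose2[OF cont]) (auto intro!: continuous_intros)
    then have "continuous_on UNIV (\<lambda>t. F (cv (x + e *\<^sub>R t) y) * gauss 1 (cv t 0))" by (intro continuous_intros)
    then show ?thesis by (simp add: borel_measurable_continuous_onI)
  qed
  have "integrable lborel (\<lambda>t. F (cv (x + e *\<^sub>R t) y) * gauss 1 (cv t 0))"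
    by (rule Bochner_Integration.integrable_bound[OF i m])
      (auto intro!: AE_I2 order_trans[OF gaussian_average_integrand[OF e C]] abs_ge_self)
  then have "cmod (gaussian_average F e x y) \<le> (LINT t::real^'n|lborel. C * (1 + norm x) ^ m * ((1 + norm t) ^ m * exp (- (norm t)\<^sup>2)))"
    unfolding gaussian_average_def
    by (intro order_trans[OF integral_norm_bound] integral_mono i gaussian_average_integrand e C) simp
  then show ?thesis by simp
qed

text \<open>By contradiction: violating scales tend to 0, heights lie in the compact
  \<open>K\<close>, and the weight confines the violating \<open>x\<close> to a ball. Along a
  convergent subsequence the average and the value have the same limit by dominated
  convergence.\<close>

lemma gaussian_average_converges:
  fixes F :: "complex^'n::finite \<Rightarrow> complex"
  assumes cont: "continuous_on (tube V) F" and K: "compact K" "K \<subseteq> V"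
    and C: "\<And>y x. y \<in> K \<Longrightarrow> cmod (F (cv x y)) \<le> C * (1 + norm x) ^ m" and \<eta>: "\<eta> > 0"
  shows "\<exists>e0>0. \<forall>e. 0 < e \<and> e < e0 \<longrightarrow> (\<forall>y\<in>K. \<forall>x.
    cmod (gaussian_average F e x y - F (cv x y) * (LINT t|lborel. gauss 1 (cv (t::real^'n) 0))) * exp (- (norm x)\<^sup>2) \<le> \<eta>)"
proof (rule ccontr)
  define c where "c = (LINT t|lborel. gauss 1 (cv (t::real^'n) 0))"
  define D where "D = (\<lambda>e x y. cmod (gaussian_average F e x y - F (cv x y) * c) * exp (- (norm x)\<^sup>2))"
  assume "\<not> ?thesis"
  then have no: "\<not> (\<exists>e0>0. \<forall>e. 0 < e \<and> e < e0 \<longrightarrow> (\<forall>y\<in>K. \<forall>x. D e x y \<le> \<eta>))" by (simp add: D_def c_def)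
  have "\<exists>q. 0 < fst q \<and> fst q < 1 / real (Suc k) \<and> snd (snd q) \<in> K \<and> \<eta> < D (fst q) (fst (snd q)) (snd (snd q))" for k
  proof -
    have "1 / real (Suc k) > 0" by simp
    then have "\<not> (\<forall>e. 0 < e \<and> e < 1 / real (Suc k) \<longrightarrow> (\<forall>y\<in>K. \<forall>x. D e x y \<le> \<eta>))" using no by blast
    then obtain e y x where "0 < e" "e < 1 / real (Suc k)" "y \<in> K" "\<not> D e x y \<le> \<eta>" by blast
    then show ?thesis by (intro exI[of _ "(e, x, y)"]) simp
  qed
  then have "\<forall>k. \<exists>q. 0 < fst q \<and> fst q < 1 / real (Suc k) \<and> snd (snd q) \<in> K \<and> \<eta> < D (fst q) (fst (snd q)) (snd (snd q))" by (rule allI)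
  from choice[OF this] obtain q where q: "\<forall>k. 0 < fst (q k) \<and> fst (q k) < 1 / real (Suc k) \<and> snd (snd (q k)) \<in> K \<and> \<eta> < D (fst (q k)) (fst (snd (q k))) (snd (snd (q k)))"
    by (elim exE) (rule that)
  define E X Y where "E = (\<lambda>k. fst (q k))" and "X = (\<lambda>k. fst (snd (q k)))" and "Y = (\<lambda>k. snd (snd (q k)))"
  have E: "0 < E k" "E k < 1 / real (Suc k)" and Y: "Y k \<in> K" and big: "\<eta> < D (E k) (X k) (Y k)" for k
    using q by (auto simp: E_def X_def Y_def)
  have E1: "0 \<le> E k" "E k \<le> 1" for k
  proof -
    have "1 / real (Suc k) \<le> 1" by simp
    then show "0 \<le> E k" "E k \<le> 1" using E[of k] by linarith+
  qed
  define I where "I = (LINT t::real^'n|lborel. (1 + norm t) ^ m * exp (- (norm t)\<^sup>2))"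
  have C0: "C \<ge> 0"
  proof -
    have "cmod (F (cv 0 (Y 0))) \<le> C * (1 + norm (0::real^'n)) ^ m" using C[OF Y] .
    from order_trans[OF norm_ge_zero this] show ?thesis by simp
  qed
  have Fc: "continuous_on UNIV (\<lambda>x. F (cv x y))" if "y \<in> K" for y
    by (intro continuous_on_compose2[OF cont] continuous_intros) (use that K in \<open>auto simp: tube_iff\<close>)
  have I: "cmod c \<le> I" "I \<ge> 0"
  proof -
    have "cmod c \<le> (LINT t::real^'n|lborel. cmod (gauss 1 (cv t 0)))" unfolding c_def by (rule integral_norm_bound)
    also have "\<dots> \<le> I" unfolding I_def
    proof (rule integral_mono)
      show "integrable lborel (\<lambda>t::real^'n. cmod (gauss 1 (cv t 0)))" by (intro integrable_norm schwartz_integrable gauss_real_schwartz)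
      show "cmod (gauss 1 (cv t 0)) \<le> (1 + norm t) ^ m * exp (- (norm t)\<^sup>2)" for t :: "real^'n"
        using mult_right_mono[of 1 "(1 + norm t) ^ m" "exp (- (norm t)\<^sup>2)"] by (simp add: gauss_real)
    qed (rule growth_gauss_integrable)
    finally show "cmod c \<le> I" .
    then show "I \<ge> 0" using norm_ge_zero[of c] by linarith
  qed
  \<comment> \<open>The power is \<open>Suc m\<close>, one more than the growth of \<open>F\<close>.
    The surplus factor \<open>1 + norm (X k)\<close> is what bounds \<open>X k\<close> by
    \<open>\<rho>\<close>.\<close>
  obtain Q where Q: "Q \<ge> 0" "\<forall>x a::real^'n. (1 + norm x) ^ Suc m * exp (- ((norm (x - a))\<^sup>2)) \<le> Q * (1 + norm a) ^ Suc m"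
    using poly_gauss_bounded[of "Suc m"] by blast
  define \<rho> where "\<rho> = 2 * C * I * Q / \<eta>"
  have Xb: "norm (X k) \<le> \<rho>" for k
  proof -
    let ?x = "X k"
    have "D (E k) ?x (Y k) \<le> (C * (1 + norm ?x) ^ m * I + C * (1 + norm ?x) ^ m * I) * exp (- (norm ?x)\<^sup>2)"
    proof -
      have "cmod (gaussian_average F (E k) ?x (Y k)) \<le> C * (1 + norm ?x) ^ m * I"
        unfolding I_def by (rule gaussian_average_bound[OF E1 C0 C[OF Y] Fc[OF Y]])
      moreover have "cmod (F (cv ?x (Y k)) * c) \<le> C * (1 + norm ?x) ^ m * I"
        unfolding norm_mult using C[OF Y] I C0 by (intro mult_mono) auto
      ultimately have "cmod (gaussian_average F (E k) ?x (Y k) - F (cv ?x (Y k)) * c) \<le> C * (1 + norm ?x) ^ m * I + C * (1 + norm ?x) ^ m * I"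
        by (intro order_trans[OF norm_triangle_ineq4] add_mono)
      then show ?thesis unfolding D_def by (intro mult_right_mono) auto
    qed
    then have "\<eta> \<le> 2 * C * I * ((1 + norm ?x) ^ m * exp (- (norm ?x)\<^sup>2))" using big[of k] by (simp add: algebra_simps)
    then have "\<eta> * (1 + norm ?x) \<le> 2 * C * I * ((1 + norm ?x) ^ m * exp (- (norm ?x)\<^sup>2)) * (1 + norm ?x)"
      by (intro mult_right_mono) auto
    also have "\<dots> = 2 * C * I * ((1 + norm ?x) ^ Suc m * exp (- (norm (?x - 0))\<^sup>2))" by (simp add: mult_ac)
    also have "\<dots> \<le> 2 * C * I * (Q * (1 + norm (0::real^'n)) ^ Suc m)"
      by (intro mult_left_mono Q(2)[rule_format]) (use C0 I(2) in simp)
    finally have "\<eta> * (1 + norm ?x) \<le> 2 * C * I * Q" by simp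
    then have "1 + norm ?x \<le> \<rho>" unfolding \<rho>_def using \<eta> by (simp add: pos_le_divide_eq mult.commute)
    then show ?thesis by simp
  qed
  let ?S = "cball (0::real^'n) \<rho> \<times> K"
  have cS: "compact ?S" using K(1) by (intro compact_Times) auto
  have inS: "\<forall>k. (X k, Y k) \<in> ?S" using Xb Y by simp
  have "\<exists>l\<in>?S. \<exists>r. strict_mono r \<and> ((\<lambda>k. (X k, Y k)) \<circ> r) \<longlonglongrightarrow> l"
    using cS[unfolded compact_def, THEN spec, of "\<lambda>k. (X k, Y k)"] inS by blast
  then obtain l r where l: "l \<in> ?S" "strict_mono r" "((\<lambda>k. (X k, Y k)) \<circ> r) \<longlonglongrightarrow> l"
    by (elim bexE exE conjE) (rule that)
  define x y where "x = fst l" and "y = snd l"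
  have lim: "(\<lambda>k. X (r k)) \<longlonglongrightarrow> x" "(\<lambda>k. Y (r k)) \<longlonglongrightarrow> y"
    using tendsto_fst[OF l(3)] tendsto_snd[OF l(3)] by (simp_all add: x_def y_def o_def)
  have yK: "y \<in> K" using l(1) by (auto simp: y_def)
  have Elim: "(\<lambda>k. E (r k)) \<longlonglongrightarrow> 0"
  proof -
    have "E \<longlonglongrightarrow> 0"
    proof (rule tendsto_sandwich[of "\<lambda>k. 0" _ _ "\<lambda>k. 1 / real (Suc k)"])
      show "(\<lambda>k. 1 / real (Suc k)) \<longlonglongrightarrow> 0" using LIMSEQ_inverse_real_of_nat by (simp add: inverse_eq_divide)
      show "\<forall>\<^sub>F k in sequentially. 0 \<le> E k" "\<forall>\<^sub>F k in sequentially. E k \<le> 1 / real (Suc k)"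
        by (intro always_eventually allI less_imp_le E)+
    qed simp
    from LIMSEQ_subseq_LIMSEQ[OF this l(2)] show ?thesis by (simp add: o_def)
  qed
  have cvlim: "(\<lambda>k. cv (X (r k) + E (r k) *\<^sub>R t) (Y (r k))) \<longlonglongrightarrow> cv x y" for t
  proof -
    have "continuous_on UNIV (\<lambda>p. cv (fst p) (snd p))" by (intro continuous_intros)
    moreover have "(\<lambda>k. (X (r k) + E (r k) *\<^sub>R t, Y (r k))) \<longlonglongrightarrow> (x + 0 *\<^sub>R t, y)" by (intro tendsto_intros lim Elim)
    ultimately have "(\<lambda>k. (\<lambda>p. cv (fst p) (snd p)) (X (r k) + E (r k) *\<^sub>R t, Y (r k))) \<longlonglongrightarrow> (\<lambda>p. cv (fst p) (snd p)) (x + 0 *\<^sub>R t, y)"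
      by (rule continuous_on_tendsto_compose) auto
    then show ?thesis by simp
  qed
  have Flim: "(\<lambda>k. F (cv (X (r k) + E (r k) *\<^sub>R t) (Y (r k)))) \<longlonglongrightarrow> F (cv x y)" for t
    by (rule continuous_on_tendsto_compose[OF cont cvlim])
      (use yK Y K(2) in \<open>auto simp: tube_iff subset_iff intro!: always_eventually\<close>)
  have "(\<lambda>k. gaussian_average F (E (r k)) (X (r k)) (Y (r k))) \<longlonglongrightarrow> (LINT (t::real^'n)|lborel. F (cv x y) * gauss 1 (cv t 0))"
    unfolding gaussian_average_def
  proof (rule integral_dominated_convergence)
    show "integrable lborel (\<lambda>t::real^'n. C * (1 + \<rho>) ^ m * ((1 + norm t) ^ m * exp (- (norm t)\<^sup>2)))"
      by (intro integrable_mult_right growth_gauss_integrable)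
    show "AE t in lborel. (\<lambda>k. F (cv (X (r k) + E (r k) *\<^sub>R t) (Y (r k))) * gauss 1 (cv t 0)) \<longlonglongrightarrow> F (cv x y) * gauss 1 (cv t 0)"
      by (intro AE_I2 tendsto_intros Flim)
    show "(\<lambda>t::real^'n. F (cv x y) * gauss 1 (cv t 0)) \<in> borel_measurable lborel"
      using schwartz_measurable[OF gauss_real_schwartz] by (intro borel_measurable_times) simp_all
    fix k
    have "continuous_on UNIV (\<lambda>t. F (cv (X (r k) + E (r k) *\<^sub>R t) (Y (r k))))"
      by (rule continuous_on_compose2[OF Fc[OF Y]]) (auto intro!: continuous_intros)
    then have "continuous_on UNIV (\<lambda>t. F (cv (X (r k) + E (r k) *\<^sub>R t) (Y (r k))) * gauss 1 (cv t 0))" by (intro continuous_intros)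
    then show "(\<lambda>t. F (cv (X (r k) + E (r k) *\<^sub>R t) (Y (r k))) * gauss 1 (cv t 0)) \<in> borel_measurable lborel"
      by (simp add: borel_measurable_continuous_onI)
    show "AE t in lborel. norm (F (cv (X (r k) + E (r k) *\<^sub>R t) (Y (r k))) * gauss 1 (cv t 0)) \<le> C * (1 + \<rho>) ^ m * ((1 + norm t) ^ m * exp (- (norm t)\<^sup>2))"
    proof (rule AE_I2)
      fix t :: "real^'n"
      have "norm (F (cv (X (r k) + E (r k) *\<^sub>R t) (Y (r k))) * gauss 1 (cv t 0)) \<le> C * (1 + norm (X (r k))) ^ m * ((1 + norm t) ^ m * exp (- (norm t)\<^sup>2))"
        by (rule gaussian_average_integrand[OF E1 C0 C[OF Y]])
      also have "\<dots> \<le> C * (1 + \<rho>) ^ m * ((1 + norm t) ^ m * exp (- (norm t)\<^sup>2))"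
        using Xb[of "r k"] C0 by (intro mult_right_mono mult_left_mono power_mono) auto
      finally show "norm (F (cv (X (r k) + E (r k) *\<^sub>R t) (Y (r k))) * gauss 1 (cv t 0)) \<le> C * (1 + \<rho>) ^ m * ((1 + norm t) ^ m * exp (- (norm t)\<^sup>2))" .
    qed
  qed
  then have "(\<lambda>k. gaussian_average F (E (r k)) (X (r k)) (Y (r k))) \<longlonglongrightarrow> F (cv x y) * c" by (simp add: c_def)
  moreover have "(\<lambda>k. F (cv (X (r k)) (Y (r k))) * c) \<longlonglongrightarrow> F (cv x y) * c"
    using Flim[of 0] by (intro tendsto_intros) simp
  ultimately have "(\<lambda>k. gaussian_average F (E (r k)) (X (r k)) (Y (r k)) - F (cv (X (r k)) (Y (r k))) * c) \<longlonglongrightarrow> F (cv x y) * c - F (cv x y) * c"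
    by (rule tendsto_diff)
  then have "(\<lambda>k. gaussian_average F (E (r k)) (X (r k)) (Y (r k)) - F (cv (X (r k)) (Y (r k))) * c) \<longlonglongrightarrow> 0" by simp
  then have "(\<lambda>k. cmod (gaussian_average F (E (r k)) (X (r k)) (Y (r k)) - F (cv (X (r k)) (Y (r k))) * c)) \<longlonglongrightarrow> 0"
    by (rule tendsto_norm_zero)
  moreover have "\<eta> \<le> cmod (gaussian_average F (E (r k)) (X (r k)) (Y (r k)) - F (cv (X (r k)) (Y (r k))) * c)" for k
  proof -
    have "D (E (r k)) (X (r k)) (Y (r k)) \<le> cmod (gaussian_average F (E (r k)) (X (r k)) (Y (r k)) - F (cv (X (r k)) (Y (r k))) * c)"
      unfolding D_def by (intro mult_left_le) auto
    then show ?thesis using big[of "r k"] by linarith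
  qed
  ultimately have "\<eta> \<le> 0" by (intro LIMSEQ_le_const) auto
  then show False using \<eta> by simp
qed

text \<open>The function theory of the extension, free of distributions: the boundary values enter
  only through the assumption that one entire function \<open>U e\<close> reproduces the Gaussian
  averages over both open sets.\<close>

theorem tube_extension:
  fixes F0 :: "complex^'n::finite \<Rightarrow> complex" and U :: "real \<Rightarrow> complex^'n \<Rightarrow> complex" and V1 V2 :: "(real^'n) set"
  defines "V \<equiv> V1 \<union> V2" and "\<Omega> \<equiv> convex hull (V1 \<union> V2)"
  assumes V: "open V1" "open V2" and cF0: "continuous_on (tube V) F0"
    and growth0: "\<And>K. compact K \<Longrightarrow> K \<subseteq> V \<Longrightarrow> \<exists>C. \<forall>y\<in>K. \<forall>x. cmod (F0 (cv x y)) \<le> C * (1 + norm x) ^ m"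
    and U: "\<And>e. e \<in> {0<..1} \<Longrightarrow> lineholo (U e) UNIV" "\<And>e. e \<in> {0<..1} \<Longrightarrow> continuous_on UNIV (U e)"
      "\<And>e L. e \<in> {0<..1} \<Longrightarrow> compact L \<Longrightarrow> \<exists>C. \<forall>y\<in>L. \<forall>x. cmod (U e (cv x y)) \<le> C * (1 + norm x) ^ m"
    and avg: "\<And>e y x. e \<in> {0<..1} \<Longrightarrow> y \<in> V \<Longrightarrow> U e (cv x y) = gaussian_average F0 e x y"
  shows "\<exists>F. lineholo F (tube \<Omega>) \<and> continuous_on (tube \<Omega>) F \<and> (\<forall>z\<in>tube V. F z = F0 z) \<and>
    (\<forall>K. compact K \<longrightarrow> K \<subseteq> \<Omega> \<longrightarrow> (\<exists>C. \<forall>y\<in>K. \<forall>x. cmod (F (cv x y)) \<le> C * (1 + norm x) ^ m))"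
proof -
  define c where "c = (LINT t|lborel. gauss 1 (cv (t::real^'n) 0))"
  have c0: "c \<noteq> 0" unfolding c_def by (rule gauss_mass_nonzero)
  \<comment> \<open>Scale \<open>1 / (k + 1)\<close>, divided by the mass of the Gaussian, so that
    \<open>u k\<close> converges to \<open>F0\<close> itself.\<close>
  define u where "u = (\<lambda>(k::nat) z. U (1 / real (Suc k)) z / c)"
  have ek: "1 / real (Suc k) \<in> {0<..1}" for k by simp
  have V\<Omega>: "V \<subseteq> \<Omega>" unfolding V_def \<Omega>_def by (rule hull_subset)
  have \<Omega>: "open \<Omega>" unfolding \<Omega>_def using V by (intro open_convex_hull open_Un)
  have tube_mono: "A \<subseteq> B \<Longrightarrow> tube A \<subseteq> tube B" for A B :: "(real^'n) set" by (auto simp: tube_iff)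
  have hull: "\<exists>K. compact K \<and> K \<subseteq> V \<and> L \<subseteq> convex hull K" if L: "compact L" "L \<subseteq> \<Omega>" for L
  proof -
    obtain K1 K2 where "compact K1" "K1 \<subseteq> V1" "compact K2" "K2 \<subseteq> V2" "L \<subseteq> convex hull (K1 \<union> K2)"
      using compact_in_hull[OF V L[unfolded \<Omega>_def]] by (elim exE conjE) (rule that)
    then show ?thesis unfolding V_def by (intro exI[of _ "K1 \<union> K2"]) auto
  qed
  have uh: "lineholo (u k) UNIV" for k
    using U(1)[OF ek[of k]] c0 unfolding u_def lineholo_def by (auto intro!: holomorphic_on_divide)
  have uc: "continuous_on S (u k)" for k S
    unfolding u_def using c0 by (intro continuous_intros continuous_on_subset[OF U(2)[OF ek]]) auto
  have ug: "\<exists>C. \<forall>y\<in>L. \<forall>x. cmod (u k (cv x y)) \<le> C * (1 + norm x) ^ m" if L: "compact L" for L k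
  proof -
    obtain C where C: "\<forall>y\<in>L. \<forall>x. cmod (U (1 / real (Suc k)) (cv x y)) \<le> C * (1 + norm x) ^ m" using U(3)[OF ek L] by blast
    have "cmod (u k (cv x y)) \<le> C / cmod c * (1 + norm x) ^ m" if "y \<in> L" for x y
      using divide_right_mono[OF C[rule_format, OF that], of "cmod c"] by (simp add: u_def norm_divide)
    then show ?thesis by blast
  qed
  have conv_K: "\<exists>N. \<forall>k\<ge>N. \<forall>y\<in>K. \<forall>x. cmod (u k (cv x y) - F0 (cv x y)) * exp (- (norm x)\<^sup>2) \<le> \<eta>"
    if K: "compact K" "K \<subseteq> V" and \<eta>: "\<eta> > 0" for K \<eta>
  proof -
    obtain C where C: "\<forall>y\<in>K. \<forall>x. cmod (F0 (cv x y)) \<le> C * (1 + norm x) ^ m" using growth0[OF K] by blast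
    have "\<eta> * cmod c > 0" using \<eta> c0 by simp
    have C': "cmod (F0 (cv x y)) \<le> C * (1 + norm x) ^ m" if "y \<in> K" for y x using C that by blast
    have "\<exists>e0>0. \<forall>e. 0 < e \<and> e < e0 \<longrightarrow> (\<forall>y\<in>K. \<forall>x. cmod (gaussian_average F0 e x y - F0 (cv x y) * c) * exp (- (norm x)\<^sup>2) \<le> \<eta> * cmod c)"
      using \<open>\<eta> * cmod c > 0\<close> unfolding c_def by (intro gaussian_average_converges[OF cF0 K C'])
    then obtain e0 where e0: "e0 > 0" "\<forall>e. 0 < e \<and> e < e0 \<longrightarrow> (\<forall>y\<in>K. \<forall>x. cmod (gaussian_average F0 e x y - F0 (cv x y) * c) * exp (- (norm x)\<^sup>2) \<le> \<eta> * cmod c)"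
      by (elim exE conjE) (rule that)
    obtain N where N: "1 / real (Suc N) < e0" using nat_approx_posE[OF e0(1)] by metis
    have "cmod (u k (cv x y) - F0 (cv x y)) * exp (- (norm x)\<^sup>2) \<le> \<eta>" if k: "k \<ge> N" and y: "y \<in> K" for k x y
    proof -
      have "1 / real (Suc k) \<le> 1 / real (Suc N)" using k by (intro divide_left_mono) auto
      then have "1 / real (Suc k) < e0" using N by linarith
      then have "cmod (gaussian_average F0 (1 / real (Suc k)) x y - F0 (cv x y) * c) * exp (- (norm x)\<^sup>2) \<le> \<eta> * cmod c"
        using e0(2) y by simp
      moreover have "gaussian_average F0 (1 / real (Suc k)) x y - F0 (cv x y) * c = (u k (cv x y) - F0 (cv x y)) * c"
        using avg[OF ek, of y k x] y K(2) c0 by (auto simp: u_def left_diff_distrib)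
      ultimately have "cmod c * (cmod (u k (cv x y) - F0 (cv x y)) * exp (- (norm x)\<^sup>2)) \<le> cmod c * \<eta>"
        by (simp add: norm_mult mult_ac)
      then show ?thesis using c0 by simp
    qed
    then show ?thesis by (intro exI[of _ N]) simp
  qed
  \<comment> \<open>The functions \<open>u k\<close> are entire and of polynomial growth for each
    \<open>k\<close>, so \<open>hull_bound\<close> applies on the tube over the whole space, and
    closeness on \<open>K\<close> becomes closeness on its hull. Dividing by the weight leaves the
    factor \<open>exp ((norm x)\<^sup>2)\<close>.\<close>
  have cauchy: "\<exists>N. \<forall>k\<ge>N. \<forall>l\<ge>N. \<forall>y\<in>convex hull K. \<forall>x. cmod (u k (cv x y) - u l (cv x y)) \<le> \<eta> * exp ((norm x)\<^sup>2)"
    if K: "compact K" "K \<subseteq> V" and \<eta>: "\<eta> > 0" for K \<eta>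
  proof -
    obtain R where R: "\<forall>y\<in>K. norm y \<le> R" using compact_imp_bounded[OF K(1)] bounded_iff by metis
    define \<delta> where "\<delta> = \<eta> / 2 / exp (R\<^sup>2)"
    have \<delta>: "\<delta> > 0" using \<eta> by (simp add: \<delta>_def)
    obtain N where N: "\<forall>k\<ge>N. \<forall>y\<in>K. \<forall>x. cmod (u k (cv x y) - F0 (cv x y)) * exp (- (norm x)\<^sup>2) \<le> \<delta>"
      using conv_K[OF K \<delta>] by blast
    have "cmod (u k (cv x y) - u l (cv x y)) \<le> \<eta> * exp ((norm x)\<^sup>2)" if kl: "k \<ge> N" "l \<ge> N" and y: "y \<in> convex hull K" for k l x y
    proof -
      have "cmod ((\<lambda>z. u k z - u l z) (cv x y)) * exp ((norm y)\<^sup>2 - (norm (x - 0))\<^sup>2) \<le> (2 * \<delta>) * exp (R\<^sup>2)"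
      proof (rule hull_bound[where \<Omega> = UNIV and K = K and m = m])
        show "lineholo (\<lambda>z. u k z - u l z) (tube UNIV)" by (intro lineholo_diff lineholo_subset[OF uh]) auto
        show "\<exists>C. \<forall>y\<in>L. \<forall>x. cmod (u k (cv x y) - u l (cv x y)) \<le> C * (1 + norm x) ^ m" if L: "compact L" for L
        proof -
          obtain C where C: "\<forall>y\<in>L. \<forall>x. cmod (u k (cv x y)) \<le> C * (1 + norm x) ^ m" using ug[OF L] by blast
          obtain C' where C': "\<forall>y\<in>L. \<forall>x. cmod (u l (cv x y)) \<le> C' * (1 + norm x) ^ m" using ug[OF L] by blast
          have "cmod (u k (cv x y) - u l (cv x y)) \<le> (C + C') * (1 + norm x) ^ m" if "y \<in> L" for x y
            unfolding distrib_right using C C' that by (intro order_trans[OF norm_triangle_ineq4] add_mono) auto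
          then show ?thesis by blast
        qed
        show "cmod (u k (cv x y) - u l (cv x y)) * exp (- ((norm (x - 0))\<^sup>2)) \<le> 2 * \<delta>" if "y \<in> K" for x y
        proof -
          have "cmod (u k (cv x y) - u l (cv x y)) \<le> cmod (u k (cv x y) - F0 (cv x y)) + cmod (u l (cv x y) - F0 (cv x y))"
            using norm_triangle_ineq4[of "u k (cv x y) - F0 (cv x y)" "u l (cv x y) - F0 (cv x y)"] by simp
          then have "cmod (u k (cv x y) - u l (cv x y)) * exp (- ((norm x)\<^sup>2)) \<le>
             (cmod (u k (cv x y) - F0 (cv x y)) + cmod (u l (cv x y) - F0 (cv x y))) * exp (- ((norm x)\<^sup>2))"
            by (intro mult_right_mono) auto
          also have "\<dots> \<le> \<delta> + \<delta>" unfolding distrib_right using N kl that by (intro add_mono) auto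
          finally show ?thesis by simp
        qed
      qed (use R y in auto)
      then have "cmod (u k (cv x y) - u l (cv x y)) * exp ((norm y)\<^sup>2 - (norm x)\<^sup>2) \<le> \<eta>" by (simp add: \<delta>_def)
      moreover have "exp (- ((norm x)\<^sup>2)) \<le> exp ((norm y)\<^sup>2 - (norm x)\<^sup>2)" by simp
      ultimately have "cmod (u k (cv x y) - u l (cv x y)) * exp (- ((norm x)\<^sup>2)) \<le> \<eta>"
        by (meson mult_left_mono norm_ge_zero order_trans)
      then show ?thesis by (simp add: exp_minus pos_divide_le_eq flip: divide_inverse)
    qed
    then show ?thesis by (intro exI[of _ N]) simp
  qed
  define F where "F = (\<lambda>z. lim (\<lambda>k. u k z))"
  have point: "(\<lambda>k. u k z) \<longlonglongrightarrow> F z" if z: "z \<in> tube \<Omega>" for z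
  proof -
    have "compact {im_vec z}" "{im_vec z} \<subseteq> \<Omega>" using z by (auto simp: tube_iff)
    from hull[OF this] obtain K where K: "compact K" "K \<subseteq> V" "im_vec z \<in> convex hull K" by auto
    have "Cauchy (\<lambda>k. u k z)"
    proof (rule metric_CauchyI)
      fix \<eta> :: real assume \<eta>: "\<eta> > 0"
      define \<delta> where "\<delta> = \<eta> / 2 / exp ((norm (re_vec z))\<^sup>2)"
      have \<delta>: "\<delta> > 0" using \<eta> by (simp add: \<delta>_def)
      from cauchy[OF K(1,2) \<delta>] obtain N where
        N: "\<forall>k\<ge>N. \<forall>l\<ge>N. \<forall>y\<in>convex hull K. \<forall>x. cmod (u k (cv x y) - u l (cv x y)) \<le> \<delta> * exp ((norm x)\<^sup>2)" by blast
      have "dist (u k z) (u l z) < \<eta>" if "k \<ge> N" "l \<ge> N" for k l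
      proof -
        have "cmod (u k (cv (re_vec z) (im_vec z)) - u l (cv (re_vec z) (im_vec z))) \<le> \<delta> * exp ((norm (re_vec z))\<^sup>2)"
          using N that K(3) by blast
        then show ?thesis using \<eta> by (simp add: \<delta>_def dist_norm)
      qed
      then show "\<exists>M. \<forall>k\<ge>M. \<forall>l\<ge>M. dist (u k z) (u l z) < \<eta>" by blast
    qed
    then show ?thesis unfolding F_def by (simp add: Cauchy_convergent_iff convergent_LIMSEQ_iff)
  qed
  \<comment> \<open>On bounded sets of points with heights in a compact subset of
    \<open>\<Omega>\<close> the factor \<open>exp ((norm x)\<^sup>2)\<close> is bounded, so the
    weighted estimate becomes uniform convergence.\<close>
  have unif: "uniform_limit W u F sequentially" if W: "bounded W" "compact L" "L \<subseteq> \<Omega>" "im_vec ` W \<subseteq> L" for W L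
  proof (rule uniform_limitI)
    fix \<eta> :: real assume \<eta>: "\<eta> > 0"
    obtain K where K: "compact K" "K \<subseteq> V" "L \<subseteq> convex hull K" using hull[OF W(2,3)] by blast
    obtain X where X: "\<forall>z\<in>W. norm z \<le> X" using W(1) bounded_iff by metis
    define \<delta> where "\<delta> = \<eta> / 2 / exp (X\<^sup>2)"
    have \<delta>: "\<delta> > 0" using \<eta> by (simp add: \<delta>_def)
    from cauchy[OF K(1,2) \<delta>] obtain N where
      N: "\<forall>k\<ge>N. \<forall>l\<ge>N. \<forall>y\<in>convex hull K. \<forall>x. cmod (u k (cv x y) - u l (cv x y)) \<le> \<delta> * exp ((norm x)\<^sup>2)" by blast
    have "dist (u k z) (F z) < \<eta>" if k: "k \<ge> N" and z: "z \<in> W" for k z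
    proof -
      have zt: "z \<in> tube \<Omega>" using z W by (auto simp: tube_iff)
      have iz: "im_vec z \<in> convex hull K" using z W(4) K(3) by blast
      have "norm (re_vec z) \<le> norm z" using norm_cv_power2[of "re_vec z" "im_vec z"] by (simp add: power2_le_imp_le)
      then have rx: "(norm (re_vec z))\<^sup>2 \<le> X\<^sup>2" using X z by (intro power_mono) force+
      have "cmod (u k z - u l z) \<le> \<eta> / 2" if "l \<ge> N" for l
      proof -
        have "cmod (u k (cv (re_vec z) (im_vec z)) - u l (cv (re_vec z) (im_vec z))) \<le> \<delta> * exp ((norm (re_vec z))\<^sup>2)"
          using N that k iz by blast
        also have "\<dots> \<le> \<delta> * exp (X\<^sup>2)" using \<delta> rx by (intro mult_left_mono) auto
        finally show ?thesis by (simp add: \<delta>_def)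
      qed
      moreover have "(\<lambda>l. cmod (u k z - u l z)) \<longlonglongrightarrow> cmod (u k z - F z)" by (intro tendsto_intros point zt)
      ultimately have "cmod (u k z - F z) \<le> \<eta> / 2" by (intro LIMSEQ_le_const2) auto
      then show ?thesis using \<eta> by (simp add: dist_norm)
    qed
    then show "\<forall>\<^sub>F k in sequentially. \<forall>z\<in>W. dist (u k z) (F z) < \<eta>" by (auto simp: eventually_sequentially)
  qed
  have im_cont: "continuous_on S im_vec" for S :: "(complex^'n) set" using continuous_imv[OF continuous_on_id] by simp
  have "continuous_on (tube \<Omega>) F"
  proof (rule continuous_at_imp_continuous_on, rule ballI)
    fix z assume "z \<in> tube \<Omega>"
    then obtain d where d: "d > 0" "cball z d \<subseteq> tube \<Omega>" using open_tube[OF \<Omega>] open_contains_cball by blast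
    have "uniform_limit (cball z d) u F sequentially"
      by (rule unif[where L = "im_vec ` cball z d"]) (use d(2) in \<open>auto simp: tube_iff subset_iff intro!: compact_continuous_image im_cont\<close>)
    then have "continuous_on (cball z d) F" by (rule uniform_limit_theorem[rotated]) (auto intro: always_eventually uc)
    then show "continuous (at z) F" using d(1) by (intro continuous_on_interior[of "cball z d"]) auto
  qed
  moreover have "lineholo F (tube \<Omega>)"
    unfolding lineholo_def
  proof (intro allI)
    fix z v :: "complex^'n"
    let ?l = "\<lambda>\<zeta>. z + \<zeta> *s v" and ?S = "{\<zeta>. z + \<zeta> *s v \<in> tube \<Omega>}"
    have lc: "continuous_on T ?l" for T by (intro continuous_intros)
    have oS: "open ?S" using open_vimage[OF open_tube[OF \<Omega>] lc[of UNIV]] by (simp add: vimage_def)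
    show "(\<lambda>\<zeta>. F (?l \<zeta>)) holomorphic_on ?S"
    proof (rule holomorphic_uniform_sequence[OF oS])
      show "(\<lambda>\<zeta>. u k (?l \<zeta>)) holomorphic_on ?S" for k by (rule lineholoD[OF uh]) simp
      fix \<zeta> assume "\<zeta> \<in> ?S"
      then obtain d where d: "d > 0" "cball \<zeta> d \<subseteq> ?S" using oS open_contains_cball by blast
      have cl: "compact (?l ` cball \<zeta> d)" by (intro compact_continuous_image lc compact_cball)
      have sub: "?l ` cball \<zeta> d \<subseteq> tube \<Omega>" using d(2) by blast
      have "uniform_limit (?l ` cball \<zeta> d) u F sequentially"
      proof (rule unif[where L = "im_vec ` ?l ` cball \<zeta> d"])
        show "bounded (?l ` cball \<zeta> d)" using cl by (rule compact_imp_bounded)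
        show "compact (im_vec ` ?l ` cball \<zeta> d)" by (intro compact_continuous_image im_cont cl)
        show "im_vec ` ?l ` cball \<zeta> d \<subseteq> \<Omega>" using sub by (auto simp: tube_iff)
      qed simp
      then have "uniform_limit (cball \<zeta> d) (\<lambda>k \<zeta>. u k (?l \<zeta>)) (\<lambda>\<zeta>. F (?l \<zeta>)) sequentially"
        by (simp add: uniform_limit_iff)
      then show "\<exists>d>0. cball \<zeta> d \<subseteq> ?S \<and> uniform_limit (cball \<zeta> d) (\<lambda>k \<zeta>. u k (?l \<zeta>)) (\<lambda>\<zeta>. F (?l \<zeta>)) sequentially"
        using d by blast
    qed
  qed
  moreover have "F z = F0 z" if z: "z \<in> tube V" for z
  proof -
    have K: "compact {im_vec z}" "{im_vec z} \<subseteq> V" using z by (auto simp: tube_iff)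
    have "(\<lambda>k. u k z) \<longlonglongrightarrow> F0 z"
    proof (rule metric_LIMSEQ_I)
      fix \<eta> :: real assume \<eta>: "\<eta> > 0"
      define \<delta> where "\<delta> = \<eta> / 2 * exp (- (norm (re_vec z))\<^sup>2)"
      have \<delta>: "\<delta> > 0" using \<eta> by (simp add: \<delta>_def)
      from conv_K[OF K \<delta>] obtain N where N: "\<forall>k\<ge>N. \<forall>y\<in>{im_vec z}. \<forall>x. cmod (u k (cv x y) - F0 (cv x y)) * exp (- (norm x)\<^sup>2) \<le> \<delta>" by blast
      have "dist (u k z) (F0 z) < \<eta>" if "k \<ge> N" for k
      proof -
        have "cmod (u k (cv (re_vec z) (im_vec z)) - F0 (cv (re_vec z) (im_vec z))) * exp (- (norm (re_vec z))\<^sup>2) \<le> \<delta>"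
          using N that by blast
        then show ?thesis using \<eta> by (simp add: \<delta>_def dist_norm)
      qed
      then show "\<exists>N. \<forall>k\<ge>N. dist (u k z) (F0 z) < \<eta>" by blast
    qed
    moreover have "z \<in> tube \<Omega>" using z tube_mono[OF V\<Omega>] by blast
    ultimately show ?thesis using point LIMSEQ_unique by blast
  qed
  moreover have "\<exists>C. \<forall>y\<in>L. \<forall>x. cmod (F (cv x y)) \<le> C * (1 + norm x) ^ m" if L: "compact L" "L \<subseteq> \<Omega>" for L
  proof -
    obtain K where K: "compact K" "K \<subseteq> V" "L \<subseteq> convex hull K" using hull[OF L] by blast
    obtain C0 where C0: "\<forall>y\<in>K. \<forall>x. cmod (F0 (cv x y)) \<le> C0 * (1 + norm x) ^ m" using growth0[OF K(1,2)] by blast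
    define C where "C = max C0 0"
    have C: "C \<ge> 0" "\<And>x y. y \<in> K \<Longrightarrow> cmod (F0 (cv x y)) \<le> C * (1 + norm x) ^ m"
    proof -
      show "C \<ge> 0" by (simp add: C_def)
      fix x y assume "y \<in> K"
      then have "cmod (F0 (cv x y)) \<le> C0 * (1 + norm x) ^ m" using C0 by blast
      also have "\<dots> \<le> C * (1 + norm x) ^ m" by (intro mult_right_mono) (auto simp: C_def)
      finally show "cmod (F0 (cv x y)) \<le> C * (1 + norm x) ^ m" .
    qed
    obtain R where R: "\<forall>y\<in>K. norm y \<le> R" using compact_imp_bounded[OF K(1)] bounded_iff by metis
    define I where "I = (LINT t::real^'n|lborel. (1 + norm t) ^ m * exp (- (norm t)\<^sup>2))"
    have I0: "I \<ge> 0" unfolding I_def by (intro integral_nonneg_AE AE_I2) auto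
    obtain Q where Q: "Q \<ge> 0" "\<forall>x a::real^'n. (1 + norm x) ^ m * exp (- ((norm (x - a))\<^sup>2)) \<le> Q * (1 + norm a) ^ m"
      using poly_gauss_bounded[of m] by blast
    define M where "M = C * I / cmod c * Q * exp (R\<^sup>2)"
    \<comment> \<open>The Gaussian is centred at the very point \<open>a\<close> where the bound is
      wanted: there the weight is at least 1, and the supremum of the weighted averages contributes
      only \<open>(1 + norm a) ^ m\<close>.\<close>
    have "cmod (u k (cv a y)) \<le> M * (1 + norm a) ^ m" if y: "y \<in> L" for a y k
    proof -
      have "cmod (u k (cv a y)) * exp ((norm y)\<^sup>2 - (norm (a - a))\<^sup>2) \<le> (C * I / cmod c * (Q * (1 + norm a) ^ m)) * exp (R\<^sup>2)"
      proof (rule hull_bound[where \<Omega> = UNIV and K = K and m = m])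
        show "lineholo (u k) (tube UNIV)" by (intro lineholo_subset[OF uh]) auto
        show "cmod (u k (cv x y)) * exp (- ((norm (x - a))\<^sup>2)) \<le> C * I / cmod c * (Q * (1 + norm a) ^ m)" if "y \<in> K" for x y
        proof -
          have yV: "y \<in> V" using that K(2) by blast
          have "continuous_on UNIV (\<lambda>x. F0 (cv x y))"
            by (intro continuous_on_compose2[OF cF0] continuous_intros) (use yV in \<open>auto simp: tube_iff\<close>)
          then have "cmod (gaussian_average F0 (1 / real (Suc k)) x y) \<le> C * (1 + norm x) ^ m * I"
            unfolding I_def using ek[of k] by (intro gaussian_average_bound C that) auto
          then have "cmod (u k (cv x y)) \<le> C * (1 + norm x) ^ m * I / cmod c"
            using avg[OF ek yV] by (simp add: u_def norm_divide divide_right_mono)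
          then have "cmod (u k (cv x y)) * exp (- ((norm (x - a))\<^sup>2)) \<le> C * (1 + norm x) ^ m * I / cmod c * exp (- ((norm (x - a))\<^sup>2))"
            by (intro mult_right_mono) auto
          also have "\<dots> = C * I / cmod c * ((1 + norm x) ^ m * exp (- ((norm (x - a))\<^sup>2)))" by simp
          also have "\<dots> \<le> C * I / cmod c * (Q * (1 + norm a) ^ m)"
            by (intro mult_left_mono Q(2)[rule_format]) (use C(1) I0 in simp)
          finally show ?thesis .
        qed
        show "y \<in> convex hull K" using y K(3) by blast
      qed (use R ug in auto)
      moreover have "1 \<le> exp ((norm y)\<^sup>2 - (norm (a - a))\<^sup>2)" by simp
      then have "cmod (u k (cv a y)) \<le> cmod (u k (cv a y)) * exp ((norm y)\<^sup>2 - (norm (a - a))\<^sup>2)"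
        using mult_left_mono[of 1 _ "cmod (u k (cv a y))"] by simp
      ultimately show ?thesis by (simp add: M_def mult_ac)
    qed
    then have "cmod (F (cv a y)) \<le> M * (1 + norm a) ^ m" if y: "y \<in> L" for a y
    proof -
      have "cv a y \<in> tube \<Omega>" using y L(2) by (auto simp: tube_iff)
      from tendsto_norm[OF point[OF this]] show ?thesis
        by (rule LIMSEQ_le_const2) (use \<open>\<And>y k a. y \<in> L \<Longrightarrow> cmod (u k (cv a y)) \<le> M * (1 + norm a) ^ m\<close> y in blast)
    qed
    then show ?thesis by blast
  qed
  ultimately show ?thesis by (intro exI[of _ F] conjI) auto
qed

section \<open>Translation-invariant Banach spaces\<close>

lemma schwartz_seminorm_mono:
  fixes f :: "real^'n::finite \<Rightarrow> complex"
  assumes "f \<in> schwartz" "M \<le> N" shows "schwartz_seminorm M f \<le> schwartz_seminorm N f"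
proof (rule schwartz_seminorm_le)
  fix "is" :: "'n list" and x :: "real^'n" assume "length is \<le> M"
  have "(1 + norm x) ^ M * cmod (partials is f x) \<le> (1 + norm x) ^ N * cmod (partials is f x)"
    using assms(2) by (intro mult_right_mono power_increasing) auto
  also have "\<dots> \<le> schwartz_seminorm N f"
    using assms \<open>length is \<le> M\<close> by (intro schwartz_seminorm_ge) auto
  finally show "(1 + norm x) ^ M * cmod (partials is f x) \<le> schwartz_seminorm N f" .
qed

lemma schwartz_seminorm_partials:
  fixes f :: "real^'n::finite \<Rightarrow> complex"
  assumes "f \<in> schwartz" shows "schwartz_seminorm N (partials js f) \<le> schwartz_seminorm (N + length js) f"
proof (rule schwartz_seminorm_le)
  fix "is" :: "'n list" and x :: "real^'n" assume l: "length is \<le> N"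
  have "(1 + norm x) ^ N * cmod (partials is (partials js f) x) \<le> (1 + norm x) ^ (N + length js) * cmod (partials (is @ js) f x)"
    unfolding partials_append by (intro mult_right_mono power_increasing) auto
  also have "\<dots> \<le> schwartz_seminorm (N + length js) f"
    using assms l by (intro schwartz_seminorm_ge) auto
  finally show "(1 + norm x) ^ N * cmod (partials is (partials js f) x) \<le> schwartz_seminorm (N + length js) f" .
qed

lemma schwartz_shift_seminorm:
  fixes f :: "real^'n::finite \<Rightarrow> complex"
  assumes f: "f \<in> schwartz"
  shows "\<exists>C\<ge>0. \<forall>h. norm h \<le> 1 \<longrightarrow> schwartz_seminorm N (\<lambda>x. f (x + h) - f x) \<le> C * norm h"
proof -
  define B where "B = schwartz_seminorm (N + Suc N) f"
  have B0: "B \<ge> 0" unfolding B_def by (rule schwartz_seminorm_nonneg[OF f])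
  have "schwartz_seminorm N (\<lambda>x. f (x + h) - f x) \<le> (2 ^ N * real CARD('n) * B) * norm h" if h: "norm h \<le> 1" for h
  proof (rule schwartz_seminorm_le)
    fix "is" :: "'n list" and x :: "real^'n" assume l: "length is \<le> N"
    have "partials is (\<lambda>x. f (x + h) - f x) = (\<lambda>x. partials is f (x + h) - partials is f x)"
      using f by (subst partials_diff) (auto intro: smooth_shift schwartz_smooth simp: partials_shift)
    moreover have "(1 + norm x) ^ N * cmod (partials is f (x + h) - partials is f x) \<le> 2 ^ N * real CARD('n) * B * norm h"
    proof (rule shift_estimate[OF _ _ h])
      show "partials is f differentiable (at x)" for x by (rule smooth_differentiable[OF schwartz_smooth[OF f]])
      fix i x
      have "(1 + norm x) ^ N * cmod (partials (i # is) f x) \<le> (1 + norm x) ^ (N + Suc N) * cmod (partials (i # is) f x)"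
        by (intro mult_right_mono power_increasing) auto
      also have "\<dots> \<le> B" unfolding B_def using f l by (intro schwartz_seminorm_ge) auto
      finally show "(1 + norm x) ^ N * cmod (partial i (partials is f) x) \<le> B" by simp
    qed
    ultimately show "(1 + norm x) ^ N * cmod (partials is (\<lambda>x. f (x + h) - f x) x) \<le> (2 ^ N * real CARD('n) * B) * norm h" by simp
  qed
  then show ?thesis using B0 by (intro exI[of _ "2 ^ N * real CARD('n) * B"]) auto
qed

lemma tempered_bound:
  assumes "u \<in> tempered"
  obtains N C where "C \<ge> 0" "\<And>f. f \<in> schwartz \<Longrightarrow> cmod (u f) \<le> C * schwartz_seminorm N f"
proof -
  obtain N C where C: "\<forall>f\<in>schwartz. cmod (u f) \<le> C * schwartz_seminorm N f"
    using assms unfolding tempered_def continuous_forms_def by blast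
  have "cmod (u f) \<le> max C 0 * schwartz_seminorm N f" if "f \<in> schwartz" for f
    using C[rule_format, OF that] mult_right_mono[of C "max C 0" "schwartz_seminorm N f"] schwartz_seminorm_nonneg[OF that, of N] by linarith
  then show ?thesis using that[of "max C 0" N] by simp
qed

lemma linear_formsD:
  assumes "L \<in> linear_forms X"
  shows "u \<notin> X \<Longrightarrow> L u = 0" "u \<in> X \<Longrightarrow> v \<in> X \<Longrightarrow> L (\<lambda>x. u x + v x) = L u + L v" "u \<in> X \<Longrightarrow> L (\<lambda>x. c * u x) = c * L u"
  using assms by (auto simp: linear_forms_def)

lemma linear_forms_diff:
  assumes X: "complex_subspace X" and L: "L \<in> linear_forms X" and u: "u \<in> X" and v: "v \<in> X"
  shows "L (\<lambda>x. u x - v x) = L u - L v"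
proof -
  have "(\<lambda>x. (-1) * v x) \<in> X" using X v unfolding complex_subspace_def by blast
  from linear_formsD(2)[OF L u this] linear_formsD(3)[OF L v, of "-1"] show ?thesis by simp
qed

lemma tempered_linear: "u \<in> tempered \<Longrightarrow> u \<in> linear_forms schwartz"
  by (simp add: tempered_def continuous_forms_def)

lemma tempered_eqI:
  fixes u v :: "(real^'n::finite \<Rightarrow> complex) \<Rightarrow> complex"
  assumes u: "u \<in> tempered" and v: "v \<in> tempered" and eq: "\<And>f. f \<in> test_functions \<Longrightarrow> u f = v f"
  shows "u = v"
proof
  fix f
  show "u f = v f"
  proof (cases "f \<in> schwartz")
    case f: True
    obtain N C where C: "C \<ge> 0" "\<And>f. f \<in> schwartz \<Longrightarrow> cmod (u f) \<le> C * schwartz_seminorm N f" using tempered_bound[OF u] by blast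
    obtain M D where D: "D \<ge> 0" "\<And>f. f \<in> schwartz \<Longrightarrow> cmod (v f) \<le> D * schwartz_seminorm M f" using tempered_bound[OF v] by blast
    have "cmod (u f - v f) \<le> 0"
    proof (rule field_le_epsilon)
      fix e :: real assume e: "e > 0"
      define d where "d = e / (C + D + 1)"
      have d: "d > 0" using e C D by (simp add: d_def)
      obtain g where g: "g \<in> test_functions" "schwartz_seminorm (max N M) (\<lambda>x. f x - g x) < d"
        using test_functions_dense[OF f d] by blast
      have gs: "g \<in> schwartz" and fg: "(\<lambda>x. f x - g x) \<in> schwartz" using test_schwartz[OF g(1)] schwartz_diff[OF f] by auto
      have "cmod (u (\<lambda>x. f x - g x)) \<le> C * d"
      proof -
        have "schwartz_seminorm N (\<lambda>x. f x - g x) \<le> d" using schwartz_seminorm_mono[OF fg, of N "max N M"] g(2) by simp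
        then show ?thesis using C(2)[OF fg] mult_left_mono[OF _ C(1)] by (meson order_trans)
      qed
      moreover have "cmod (v (\<lambda>x. f x - g x)) \<le> D * d"
      proof -
        have "schwartz_seminorm M (\<lambda>x. f x - g x) \<le> d" using schwartz_seminorm_mono[OF fg, of M "max N M"] g(2) by simp
        then show ?thesis using D(2)[OF fg] mult_left_mono[OF _ D(1)] by (meson order_trans)
      qed
      moreover have "cmod (u f - v f) = cmod (u (\<lambda>x. f x - g x) - v (\<lambda>x. f x - g x))"
        using eq[OF g(1)] linear_forms_diff[OF schwartz_subspace tempered_linear[OF u] f gs]
          linear_forms_diff[OF schwartz_subspace tempered_linear[OF v] f gs] by simp
      ultimately have "cmod (u f - v f) \<le> C * d + D * d" using norm_triangle_ineq4[of "u (\<lambda>x. f x - g x)" "v (\<lambda>x. f x - g x)"] by linarith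
      also have "\<dots> \<le> (C + D + 1) * d" using d by (simp add: distrib_right)
      also have "\<dots> = e" using C D by (simp add: d_def)
      finally show "cmod (u f - v f) \<le> 0 + e" by simp
    qed
    then show ?thesis by simp
  next
    case False
    then show ?thesis using linear_formsD(1)[OF tempered_linear[OF u]] linear_formsD(1)[OF tempered_linear[OF v]] by simp
  qed
qed

section \<open>Translations, distributional derivatives and Riemann sums of translates\<close>

lemma translate_translate: "translate h (translate k u) = translate (h + k) u"
  by (simp add: translate_def fun_eq_iff algebra_simps)

lemma translate_diff: "translate h (\<lambda>p. u p - v p) = (\<lambda>p. translate h u p - translate h v p)"
  by (simp add: translate_def fun_eq_iff)

lemma translate_dist_partial: "dist_partial i (translate h u) = translate h (dist_partial i u)"
proof
  fix f :: "real^'a \<Rightarrow> complex"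
  have "partial i (\<lambda>x. f (x - h)) = (\<lambda>x. partial i f (x - h))"
    using partials_shift[of "[i]" f "-h"] by simp
  then show "dist_partial i (translate h u) f = translate h (dist_partial i u) f"
    by (simp add: dist_partial_def translate_def schwartz_shift_iff)
qed

lemma dist_partial_diff: "dist_partial i (\<lambda>p. u p - v p) = (\<lambda>p. dist_partial i u p - dist_partial i v p)"
  by (auto simp: dist_partial_def fun_eq_iff)

lemma dist_partials_diff: "dist_partials is (\<lambda>p. u p - v p) = (\<lambda>p. dist_partials is u p - dist_partials is v p)"
  by (induction "is") (simp_all add: dist_partial_diff)

lemma dist_partial_add: "dist_partial i (\<lambda>p. u p + v p) = (\<lambda>p. dist_partial i u p + dist_partial i v p)"
  by (auto simp: dist_partial_def fun_eq_iff)

lemma dist_partial_cmult: "dist_partial i (\<lambda>p. c * u p) = (\<lambda>p. c * dist_partial i u p)"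
  by (auto simp: dist_partial_def fun_eq_iff)

lemma dist_partials_add: "dist_partials is (\<lambda>p. u p + v p) = (\<lambda>p. dist_partials is u p + dist_partials is v p)"
  by (induction "is") (simp_all add: dist_partial_add)

lemma dist_partials_cmult: "dist_partials is (\<lambda>p. c * u p) = (\<lambda>p. c * dist_partials is u p)"
  by (induction "is") (simp_all add: dist_partial_cmult)

lemma translate_dist_partials: "dist_partials is (translate h u) = translate h (dist_partials is u)"
  by (induction "is") (simp_all add: translate_dist_partial)

text \<open>Riemann sum of the integral of \<open>translate (s h) u\<close> over \<open>s\<close>
  from 0 to 1. Finite sums commute with derivatives and map Schwartz functions to Schwartz
  functions.\<close>

definition riemann_average :: "nat \<Rightarrow> real^'n::finite \<Rightarrow> ((real^'n \<Rightarrow> complex) \<Rightarrow> complex) \<Rightarrow> (real^'n \<Rightarrow> complex) \<Rightarrow> complex" where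
  "riemann_average n h u = (\<lambda>p. (1 / of_nat n) * (\<Sum>j<n. translate ((real j / real n) *\<^sub>R h) u p))"

lemma riemann_average_diff:
  "riemann_average n h (\<lambda>p. u p - v p) = (\<lambda>p. riemann_average n h u p - riemann_average n h v p)"
  by (simp add: riemann_average_def translate_diff sum_subtractf right_diff_distrib)

lemma dist_partial_sum:
  "dist_partial i (\<lambda>p. \<Sum>j\<in>J. f j p) = (\<lambda>p. \<Sum>j\<in>J. dist_partial i (f j) p)"
  by (auto simp: dist_partial_def fun_eq_iff sum_negf)

lemma riemann_average_partial: "dist_partial i (riemann_average n h u) = riemann_average n h (dist_partial i u)"
  unfolding riemann_average_def by (subst dist_partial_cmult) (simp add: dist_partial_sum translate_dist_partial)

lemma riemann_average_partials: "dist_partials is (riemann_average n h u) = riemann_average n h (dist_partials is u)"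
  by (induction "is") (simp_all add: riemann_average_partial)

lemma riemann_average_schwartz:
  fixes f :: "real^'n::finite \<Rightarrow> complex"
  assumes f: "f \<in> schwartz"
  shows "\<exists>g\<in>schwartz. riemann_average n h (schwartz_dist f) = schwartz_dist g"
proof -
  have "\<exists>g\<in>schwartz. (\<lambda>p. \<Sum>j<m. translate ((real j / real n) *\<^sub>R h) (schwartz_dist f) p) = schwartz_dist g" for m
  proof (induction m)
    case 0
    have "(\<lambda>p. 0) = schwartz_dist (\<lambda>x::real^'n. 0)" by (simp add: schwartz_dist_def fun_eq_iff)
    then show ?case using schwartz_zero by auto
  next
    case (Suc m)
    then obtain g where g: "g \<in> schwartz" "(\<lambda>p. \<Sum>j<m. translate ((real j / real n) *\<^sub>R h) (schwartz_dist f) p) = schwartz_dist g" by blast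
    have t: "(\<lambda>x. f (x + (real m / real n) *\<^sub>R h)) \<in> schwartz" by (rule schwartz_shift[OF f])
    have "(\<lambda>p. \<Sum>j<Suc m. translate ((real j / real n) *\<^sub>R h) (schwartz_dist f) p) =
        schwartz_dist (\<lambda>x. g x + f (x + (real m / real n) *\<^sub>R h))"
      unfolding schwartz_dist_add[OF g(1) t] g(2)[symmetric] by (simp add: schwartz_dist_translate[OF f])
    then show ?case using schwartz_add[OF g(1) t] by blast
  qed
  then obtain g where g: "g \<in> schwartz" "(\<lambda>p. \<Sum>j<n. translate ((real j / real n) *\<^sub>R h) (schwartz_dist f) p) = schwartz_dist g" by blast
  have "riemann_average n h (schwartz_dist f) = schwartz_dist (\<lambda>x. (1 / of_nat n) * g x)"
    unfolding riemann_average_def schwartz_dist_cmult g(2)[symmetric] ..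
  then show ?thesis using schwartz_cmult[OF g(1)] by blast
qed

text \<open>Telescoping: the Riemann sums of \<open>\<partial>\<^sub>i f\<close> along \<open>-e\<^sub>i\<close> converge uniformly to a difference quotient.\<close>

lemma riemann_partial_estimate:
  fixes f :: "real^'n::finite \<Rightarrow> complex"
  assumes f: "f \<in> schwartz" and e: "0 < e" "e \<le> 1"
  shows "\<exists>C\<ge>0. \<forall>n>0. \<forall>x. cmod ((1 / of_nat n) * (\<Sum>j<n. partial i f (x - (real j / real n) *\<^sub>R (e *\<^sub>R axis i 1)))
      + (f (x - e *\<^sub>R axis i 1) - f x) / of_real e) \<le> C / real n"
proof -
  obtain B where B: "B \<ge> 0" "\<And>j x. (1 + norm x) ^ 0 * cmod (partial j (partials [i] f) x) \<le> B"
    using schwartz_partial_sup[OF f] by metis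
  define C where "C = real CARD('n) * B"
  have est: "cmod (f (x - s *\<^sub>R axis i 1) - f x + of_real s * partial i f x) \<le> C * s^2" if "0 \<le> s" "s \<le> 1" for s x
    using shift_estimate2[of f i 0 B s x] B that smooth_differentiable0[OF schwartz_smooth[OF f]]
      smooth_differentiable0[OF schwartz_smooth[OF schwartz_partial[OF f]]] by (simp add: C_def)
  have "cmod ((1 / of_nat n) * (\<Sum>j<n. partial i f (x - (real j / real n) *\<^sub>R (e *\<^sub>R axis i 1)))
      + (f (x - e *\<^sub>R axis i 1) - f x) / of_real e) \<le> C / real n" if n: "n > 0" for n x
  proof -
    define s where "s = e / real n"
    have "s \<le> e / 1" unfolding s_def using n e by (intro divide_left_mono) auto
    then have s: "0 \<le> s" "s \<le> 1" using e by (auto simp: s_def)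
    define y where "y = (\<lambda>j. x - (real j * s) *\<^sub>R (axis i 1 :: real^'n))"
    have step: "y j - s *\<^sub>R axis i 1 = y (Suc j)" for j by (simp add: y_def algebra_simps)
    have pt: "x - (real j / real n) *\<^sub>R (e *\<^sub>R axis i 1) = y j" for j by (simp add: y_def s_def)
    have yn: "y n = x - e *\<^sub>R axis i 1" "y 0 = x" using n by (simp_all add: y_def s_def)
    have tel: "(\<Sum>j<n. f (y (Suc j)) - f (y j)) = f (y n) - f (y 0)" by (rule sum_lessThan_telescope)
    have "(1 / of_nat n) * (\<Sum>j<n. partial i f (y j)) + (f (y n) - f (y 0)) / of_real e =
       (\<Sum>j<n. f (y j - s *\<^sub>R axis i 1) - f (y j) + of_real s * partial i f (y j)) / of_real e"
      unfolding step sum.distrib tel sum_distrib_left[symmetric] using e n by (simp add: s_def field_simps)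
    also have "cmod \<dots> \<le> (\<Sum>j<n. C * s^2) / e"
    proof -
      have "cmod (\<Sum>j<n. f (y j - s *\<^sub>R axis i 1) - f (y j) + of_real s * partial i f (y j)) \<le> (\<Sum>j<n. C * s^2)"
        by (intro sum_norm_le est s)
      then show ?thesis unfolding norm_divide norm_of_real using e by (simp only: abs_of_pos) (intro divide_right_mono, auto)
    qed
    also have "\<dots> = C * e / real n" using e n by (simp add: s_def power2_eq_square)
    also have "\<dots> \<le> C * 1 / real n" using e B by (intro divide_right_mono mult_left_mono) (auto simp: C_def)
    finally show ?thesis unfolding pt yn by simp
  qed
  then show ?thesis using B by (intro exI[of _ C]) (auto simp: C_def)
qed

locale tib =
  fixes E :: "((real^'n::finite \<Rightarrow> complex) \<Rightarrow> complex) set" and nrm :: "((real^'n \<Rightarrow> complex) \<Rightarrow> complex) \<Rightarrow> real"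
  assumes tib: "translation_invariant_banach E nrm"
begin

lemma banach: "banach_norm_on E nrm"
  using tib by (simp add: translation_invariant_banach_def)

lemma subspace: "complex_subspace E"
  using banach by (simp add: banach_norm_on_def)

lemma E_zero: "(\<lambda>_. 0) \<in> E" and E_add: "u \<in> E \<Longrightarrow> v \<in> E \<Longrightarrow> (\<lambda>p. u p + v p) \<in> E"
  and E_cmult: "u \<in> E \<Longrightarrow> (\<lambda>p. c * u p) \<in> E"
  using subspace by (auto simp: complex_subspace_def)

lemma E_diff: "u \<in> E \<Longrightarrow> v \<in> E \<Longrightarrow> (\<lambda>p. u p - v p) \<in> E"
  using E_add[of u "\<lambda>p. (-1) * v p"] E_cmult[of v "-1"] by simp

lemma nrm_nonneg: "u \<in> E \<Longrightarrow> 0 \<le> nrm u" and nrm_eq_0: "u \<in> E \<Longrightarrow> nrm u = 0 \<longleftrightarrow> u = (\<lambda>_. 0)"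
  and nrm_add: "u \<in> E \<Longrightarrow> v \<in> E \<Longrightarrow> nrm (\<lambda>p. u p + v p) \<le> nrm u + nrm v"
  and nrm_cmult: "u \<in> E \<Longrightarrow> nrm (\<lambda>p. c * u p) = cmod c * nrm u"
  using banach by (auto simp: banach_norm_on_def)

lemma nrm_diff: "u \<in> E \<Longrightarrow> v \<in> E \<Longrightarrow> nrm (\<lambda>p. u p - v p) \<le> nrm u + nrm v"
  using nrm_add[of u "\<lambda>p. (-1) * v p"] E_cmult[of v "-1"] nrm_cmult[of v "-1"] by simp

lemma nrm_minus_commute: "u \<in> E \<Longrightarrow> v \<in> E \<Longrightarrow> nrm (\<lambda>p. u p - v p) = nrm (\<lambda>p. v p - u p)"
  using nrm_cmult[OF E_diff[of u v], of "-1"] by simp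

lemma nrm_triangle3:
  "u \<in> E \<Longrightarrow> v \<in> E \<Longrightarrow> w \<in> E \<Longrightarrow> nrm (\<lambda>p. u p - w p) \<le> nrm (\<lambda>p. u p - v p) + nrm (\<lambda>p. v p - w p)"
  using nrm_add[OF E_diff[of u v] E_diff[of v w]] by simp

lemma complete:
  assumes "\<And>k. s k \<in> E" "\<And>e. e > 0 \<Longrightarrow> \<exists>M. \<forall>j\<ge>M. \<forall>k\<ge>M. nrm (\<lambda>x. s j x - s k x) < e"
  shows "\<exists>u\<in>E. (\<lambda>k. nrm (\<lambda>x. s k x - u x)) \<longlonglongrightarrow> 0"
  using banach assms unfolding banach_norm_on_def by blast

lemma S_in: "f \<in> schwartz \<Longrightarrow> schwartz_dist f \<in> E"
  using tib by (auto simp: translation_invariant_banach_def)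

lemma S_bound: obtains N C where "C \<ge> 0" "\<And>f. f \<in> schwartz \<Longrightarrow> nrm (schwartz_dist f) \<le> C * schwartz_seminorm N f"
proof -
  have "\<exists>N C. \<forall>f\<in>schwartz. nrm (schwartz_dist f) \<le> C * schwartz_seminorm N f"
    using tib unfolding translation_invariant_banach_def by (elim conjE)
  then obtain N C where C: "\<forall>f\<in>schwartz. nrm (schwartz_dist f) \<le> C * schwartz_seminorm N f" by blast
  have "nrm (schwartz_dist f) \<le> max C 0 * schwartz_seminorm N f" if "f \<in> schwartz" for f
    using C[rule_format, OF that] mult_right_mono[of C "max C 0" "schwartz_seminorm N f"] schwartz_seminorm_nonneg[OF that, of N] by linarith
  then show ?thesis using that[of "max C 0" N] by simp
qed

lemma S_dense: "u \<in> E \<Longrightarrow> e > 0 \<Longrightarrow> \<exists>f\<in>schwartz. nrm (\<lambda>p. u p - schwartz_dist f p) < e"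
proof -
  have "\<forall>u\<in>E. \<forall>e>0. \<exists>\<phi>\<in>schwartz. nrm (\<lambda>\<psi>. u \<psi> - schwartz_dist \<phi> \<psi>) < e"
    using tib unfolding translation_invariant_banach_def by (elim conjE)
  then show "u \<in> E \<Longrightarrow> e > 0 \<Longrightarrow> \<exists>f\<in>schwartz. nrm (\<lambda>p. u p - schwartz_dist f p) < e" by blast
qed

lemma E_tempered: "u \<in> E \<Longrightarrow> u \<in> tempered"
  using tib by (auto simp: translation_invariant_banach_def)

lemma eval_bound:
  assumes f: "f \<in> schwartz" obtains C where "C \<ge> 0" "\<And>u. u \<in> E \<Longrightarrow> cmod (u f) \<le> C * nrm u"
proof -
  have "bounded_subset schwartz schwartz_seminorm {f}" using f by (auto simp: bounded_subset_def)
  moreover have "\<forall>B. bounded_subset schwartz schwartz_seminorm B \<longrightarrow> (\<exists>C. \<forall>u\<in>E. \<forall>\<phi>\<in>B. cmod (u \<phi>) \<le> C * nrm u)"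
    using tib unfolding translation_invariant_banach_def by (elim conjE)
  ultimately obtain C where C: "\<forall>u\<in>E. cmod (u f) \<le> C * nrm u" by blast
  have "cmod (u f) \<le> max C 0 * nrm u" if "u \<in> E" for u
    using C[rule_format, OF that] mult_right_mono[of C "max C 0" "nrm u"] nrm_nonneg[OF that] by linarith
  then show ?thesis using that[of "max C 0"] by simp
qed

lemma translate_in: "u \<in> E \<Longrightarrow> translate h u \<in> E"
proof -
  have "\<forall>h. translate h ` E = E" using tib unfolding translation_invariant_banach_def by (elim conjE)
  then show "u \<in> E \<Longrightarrow> translate h u \<in> E" by blast
qed

lemma translate_poly_bound: "\<exists>M\<ge>1. \<exists>m::nat. \<forall>h. \<forall>u\<in>E. nrm (translate h u) \<le> M * (1 + norm h) ^ m * nrm u"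
proof -
  have "\<exists>M>0. \<exists>\<tau>\<ge>0. \<forall>h. \<forall>u\<in>E. nrm (translate (- h) u) \<le> M * (1 + norm h) powr \<tau> * nrm u"
    using tib unfolding translation_invariant_banach_def by (elim conjE)
  then obtain M \<tau> where M: "M > 0" "\<tau> \<ge> 0" "\<forall>h. \<forall>u\<in>E. nrm (translate (- h) u) \<le> M * (1 + norm h) powr \<tau> * nrm u"
    by (elim exE conjE) (rule that)
  define m where "m = nat \<lceil>\<tau>\<rceil>"
  have "nrm (translate h u) \<le> max M 1 * (1 + norm h) ^ m * nrm u" if u: "u \<in> E" for h u
  proof -
    have p: "0 < 1 + norm h" by (simp add: add_pos_nonneg)
    have "(1 + norm h) powr \<tau> \<le> (1 + norm h) powr (real m)"
      using M(2) by (intro powr_mono) (auto simp: m_def)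
    also have "\<dots> = (1 + norm h) ^ m" using p by (rule powr_realpow)
    finally have le: "M * (1 + norm h) powr \<tau> \<le> max M 1 * (1 + norm h) ^ m" using M(1) by (intro mult_mono) auto
    have "nrm (translate (- (- h)) u) \<le> M * (1 + norm (- h)) powr \<tau> * nrm u" using M(3) u by blast
    then show ?thesis using mult_right_mono[OF le nrm_nonneg[OF u]] by simp
  qed
  then show ?thesis by (intro exI[of _ "max M 1"] conjI exI[of _ m]) auto
qed

text \<open>Constants for the polynomial bound on translations, with the real exponent of the
  hypothesis rounded up. The exponent \<open>trm\<close> reappears as the degree of growth of all
  slices.\<close>

definition trM where "trM = (SOME M. M \<ge> 1 \<and> (\<exists>m::nat. \<forall>h. \<forall>u\<in>E. nrm (translate h u) \<le> M * (1 + norm h) ^ m * nrm u))"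
definition trm where "trm = (SOME m::nat. \<forall>h. \<forall>u\<in>E. nrm (translate h u) \<le> trM * (1 + norm h) ^ m * nrm u)"

lemma trM_ge: "trM \<ge> 1" and translate_bound: "u \<in> E \<Longrightarrow> nrm (translate h u) \<le> trM * (1 + norm h) ^ trm * nrm u"
proof -
  have 1: "trM \<ge> 1 \<and> (\<exists>m::nat. \<forall>h. \<forall>u\<in>E. nrm (translate h u) \<le> trM * (1 + norm h) ^ m * nrm u)"
    unfolding trM_def by (rule someI_ex) (rule translate_poly_bound)
  then show "trM \<ge> 1" by (rule conjunct1)
  have "\<forall>h. \<forall>u\<in>E. nrm (translate h u) \<le> trM * (1 + norm h) ^ trm * nrm u"
    unfolding trm_def by (rule someI_ex) (rule conjunct2[OF 1])
  then show "u \<in> E \<Longrightarrow> nrm (translate h u) \<le> trM * (1 + norm h) ^ trm * nrm u" by blast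
qed

definition trK :: "real^'n \<Rightarrow> real" where "trK h = trM * (1 + norm h) ^ trm"

lemma trK_ge: "trK h \<ge> 1"
  unfolding trK_def using mult_mono[of 1 trM 1 "(1 + norm h) ^ trm"] trM_ge by simp

lemma trK_mono: "norm h \<le> norm k \<Longrightarrow> trK h \<le> trK k"
  unfolding trK_def using trM_ge by (intro mult_left_mono power_mono) auto

lemma translate_trK: "u \<in> E \<Longrightarrow> nrm (translate h u) \<le> trK h * nrm u"
  unfolding trK_def by (rule translate_bound)

text \<open>Strong continuity of translations: clear for Schwartz functions by
  \<open>schwartz_shift_seminorm\<close>, and transferred to \<open>E\<close> by density because
  translations by \<open>norm h \<le> 1\<close> are uniformly bounded.\<close>

lemma translate_continuous:
  assumes u: "u \<in> E" and e: "e > 0"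
  shows "\<exists>d>0. \<forall>h. norm h < d \<longrightarrow> nrm (\<lambda>p. translate h u p - u p) < e"
proof -
  \<comment> \<open>\<open>trK\<close> depends only on the norm, so its value at an arbitrary unit
    vector bounds it on the unit ball.\<close>
  define K where "K = trK (axis undefined 1)"
  have K: "K \<ge> 1" by (simp add: K_def trK_ge)
  have Kh: "trK h \<le> K" if "norm h \<le> 1" for h unfolding K_def using that by (intro trK_mono) simp
  obtain f where f: "f \<in> schwartz" "nrm (\<lambda>p. u p - schwartz_dist f p) < e / (3 * K)"
    using S_dense[OF u, of "e / (3 * K)"] e K by auto
  obtain N C where C: "C \<ge> 0" "\<And>f. f \<in> schwartz \<Longrightarrow> nrm (schwartz_dist f) \<le> C * schwartz_seminorm N f" using S_bound by blast
  obtain D where D: "D \<ge> 0" "\<forall>h. norm h \<le> 1 \<longrightarrow> schwartz_seminorm N (\<lambda>x. f (x + h) - f x) \<le> D * norm h"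
    using schwartz_shift_seminorm[OF f(1)] by blast
  define d where "d = min 1 (e / (3 * (C * D + 1)))"
  have CD: "C * D \<ge> 0" using C D by simp
  have d: "d > 0" using e CD by (simp add: d_def)
  let ?f = "schwartz_dist f"
  have fE: "?f \<in> E" by (rule S_in[OF f(1)])
  have "nrm (\<lambda>p. translate h u p - u p) < e" if h: "norm h < d" for h
  proof -
    have h1: "norm h \<le> 1" "norm h < e / (3 * (C * D + 1))" using h by (auto simp: d_def)
    have uf: "(\<lambda>p. u p - ?f p) \<in> E" by (intro E_diff u fE)
    have a: "nrm (\<lambda>p. translate h u p - translate h ?f p) \<le> e / 3"
    proof -
      have "nrm (translate h (\<lambda>p. u p - ?f p)) \<le> K * (e / (3 * K))"
        using order_trans[OF translate_trK[OF uf] mult_mono[OF Kh[OF h1(1)] less_imp_le[OF f(2)]]] K nrm_nonneg[OF uf] by simp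
      then show ?thesis using K by (simp add: translate_diff)
    qed
    have b: "nrm (\<lambda>p. translate h ?f p - ?f p) < e / 3"
    proof -
      have fs: "(\<lambda>x. f (x + h)) \<in> schwartz" by (rule schwartz_shift[OF f(1)])
      have "nrm (schwartz_dist (\<lambda>x. f (x + h) - f x)) \<le> C * (D * norm h)"
        using order_trans[OF C(2)[OF schwartz_diff[OF fs f(1)]] mult_left_mono[OF D(2)[rule_format, OF h1(1)] C(1)]] .
      also have "\<dots> \<le> (C * D + 1) * norm h" by (simp add: distrib_right)
      also have "\<dots> < e / 3" using h1(2) CD by (simp add: pos_less_divide_eq mult_ac)
      finally show ?thesis unfolding schwartz_dist_diff[OF fs f(1)] schwartz_dist_translate[OF f(1)] .
    qed
    have c: "nrm (\<lambda>p. ?f p - u p) \<le> e / 3"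
    proof -
      have "e / (3 * K) \<le> e / (3 * 1)" using e K by (intro divide_left_mono) auto
      then show ?thesis using f(2) nrm_minus_commute[OF fE u] by simp
    qed
    have "nrm (\<lambda>p. translate h u p - u p) \<le> nrm (\<lambda>p. translate h u p - translate h ?f p) + nrm (\<lambda>p. translate h ?f p - u p)"
      by (intro nrm_triangle3 translate_in u fE)
    also have "\<dots> \<le> nrm (\<lambda>p. translate h u p - translate h ?f p) + (nrm (\<lambda>p. translate h ?f p - ?f p) + nrm (\<lambda>p. ?f p - u p))"
      by (intro add_left_mono nrm_triangle3 translate_in u fE)
    finally show ?thesis using a b c by linarith
  qed
  then show ?thesis using d by blast
qed

lemma sum_in:
  assumes "\<And>j. j \<in> J \<Longrightarrow> f j \<in> E" "finite J"
  shows "(\<lambda>p. \<Sum>j\<in>J. f j p) \<in> E" "nrm (\<lambda>p. \<Sum>j\<in>J. f j p) \<le> (\<Sum>j\<in>J. nrm (f j))"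
proof -
  have "(\<lambda>p. \<Sum>j\<in>J. f j p) \<in> E \<and> nrm (\<lambda>p. \<Sum>j\<in>J. f j p) \<le> (\<Sum>j\<in>J. nrm (f j))"
    using assms(2,1)
  proof induction
    case empty
    then show ?case using E_zero nrm_eq_0[OF E_zero] by simp
  next
    case (insert j J)
    then have 1: "(\<lambda>p. \<Sum>j\<in>J. f j p) \<in> E" "nrm (\<lambda>p. \<Sum>j\<in>J. f j p) \<le> (\<Sum>j\<in>J. nrm (f j))" "f j \<in> E" by auto
    show ?case using E_add[OF 1(3) 1(1)] nrm_add[OF 1(3) 1(1)] 1(2) insert by simp
  qed
  then show "(\<lambda>p. \<Sum>j\<in>J. f j p) \<in> E" "nrm (\<lambda>p. \<Sum>j\<in>J. f j p) \<le> (\<Sum>j\<in>J. nrm (f j))" by auto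
qed

lemma riemann_in:
  assumes u: "u \<in> E" and n: "n > 0"
  shows "riemann_average n h u \<in> E" "nrm (riemann_average n h u) \<le> trK h * nrm u"
proof -
  let ?f = "\<lambda>j. translate ((real j / real n) *\<^sub>R h) u"
  have fE: "?f j \<in> E" for j by (rule translate_in[OF u])
  note s = sum_in[of "{..<n}" ?f, OF fE finite_lessThan]
  show "riemann_average n h u \<in> E" unfolding riemann_average_def by (rule E_cmult[OF s(1)])
  have "nrm (?f j) \<le> trK h * nrm u" if "j < n" for j
  proof -
    have "real j / real n * norm h \<le> 1 * norm h" using that n by (intro mult_right_mono) auto
    then have "norm ((real j / real n) *\<^sub>R h) \<le> norm h" by simp
    then show ?thesis using translate_trK[OF u, of "(real j / real n) *\<^sub>R h"] trK_mono mult_right_mono[OF _ nrm_nonneg[OF u]] by (meson order_trans)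
  qed
  then have "(\<Sum>j<n. nrm (?f j)) \<le> real n * (trK h * nrm u)" using sum_bounded_above[of "{..<n}" "\<lambda>j. nrm (?f j)"] by simp
  then have "nrm (\<lambda>p. \<Sum>j<n. ?f j p) \<le> real n * (trK h * nrm u)" using s(2) by linarith
  then show "nrm (riemann_average n h u) \<le> trK h * nrm u"
    unfolding riemann_average_def nrm_cmult[OF s(1)] using n by (simp add: norm_divide pos_divide_le_eq mult.commute)
qed

lemma riemann_near:
  assumes u: "u \<in> E" and n: "n > 0" and h: "\<And>s. 0 \<le> s \<Longrightarrow> s \<le> 1 \<Longrightarrow> nrm (\<lambda>p. translate (s *\<^sub>R h) u p - u p) \<le> e"
  shows "nrm (\<lambda>p. riemann_average n h u p - u p) \<le> e"
proof -
  let ?f = "\<lambda>j p. translate ((real j / real n) *\<^sub>R h) u p - u p"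
  have fE: "?f j \<in> E" for j by (intro E_diff translate_in u)
  note s = sum_in[of "{..<n}" ?f, OF fE finite_lessThan]
  have eq: "(\<lambda>p. riemann_average n h u p - u p) = (\<lambda>p. (1 / of_nat n) * (\<Sum>j<n. ?f j p))"
    unfolding riemann_average_def using n by (simp add: fun_eq_iff sum_subtractf right_diff_distrib)
  have "nrm (?f j) \<le> e" if "j < n" for j using that n by (intro h) auto
  then have "(\<Sum>j<n. nrm (?f j)) \<le> real n * e" using sum_bounded_above[of "{..<n}" "\<lambda>j. nrm (?f j)"] by simp
  then have "nrm (\<lambda>p. \<Sum>j<n. ?f j p) \<le> real n * e" using s(2) by linarith
  then show ?thesis unfolding eq nrm_cmult[OF s(1)] using n by (simp add: norm_divide pos_divide_le_eq mult.commute)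
qed

text \<open>A subdivision into \<open>n * p\<close> pieces is \<open>n\<close> coarse steps, each
  subdivided into \<open>p\<close>. This compares a Riemann sum with its refinements.\<close>

lemma riemann_refine:
  assumes n: "n > 0" and p: "p > 0"
  shows "riemann_average (n * p) h u = riemann_average n h (riemann_average p ((1 / real n) *\<^sub>R h) u)"
proof
  fix f
  have "(\<Sum>j<n * p. translate ((real j / real (n * p)) *\<^sub>R h) u f) =
      (\<Sum>m<n. \<Sum>j\<in>{m * p..<m * p + p}. translate ((real j / real (n * p)) *\<^sub>R h) u f)"
    by (rule sum.nat_group[symmetric])
  also have "\<dots> = (\<Sum>m<n. \<Sum>j<p. translate ((real m / real n) *\<^sub>R h) (translate ((real j / real p) *\<^sub>R ((1 / real n) *\<^sub>R h)) u) f)"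
  proof (rule sum.cong[OF refl])
    fix m
    have "(\<Sum>j\<in>{m * p..<m * p + p}. translate ((real j / real (n * p)) *\<^sub>R h) u f) =
       (\<Sum>j\<in>{0..<p}. translate ((real (j + m * p) / real (n * p)) *\<^sub>R h) u f)"
      using sum.shift_bounds_nat_ivl[of "\<lambda>j. translate ((real j / real (n * p)) *\<^sub>R h) u f" 0 "m * p" p] by (simp add: add.commute)
    also have "\<dots> = (\<Sum>j<p. translate ((real m / real n) *\<^sub>R h) (translate ((real j / real p) *\<^sub>R ((1 / real n) *\<^sub>R h)) u) f)"
      using n p by (intro sum.cong) (auto simp: translate_translate atLeast0LessThan add_divide_distrib scaleR_left_distrib add.commute mult.commute[of "real p"])
    finally show "(\<Sum>j\<in>{m * p..<m * p + p}. translate ((real j / real (n * p)) *\<^sub>R h) u f) =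
       (\<Sum>j<p. translate ((real m / real n) *\<^sub>R h) (translate ((real j / real p) *\<^sub>R ((1 / real n) *\<^sub>R h)) u) f)" .
  qed
  finally have eq: "(\<Sum>j<n * p. translate ((real j / real (n * p)) *\<^sub>R h) u f) =
      (\<Sum>m<n. \<Sum>j<p. translate ((real m / real n) *\<^sub>R h) (translate ((real j / real p) *\<^sub>R ((1 / real n) *\<^sub>R h)) u) f)" .
  have "riemann_average n h (riemann_average p ((1 / real n) *\<^sub>R h) u) f =
      (1 / of_nat (n * p)) * (\<Sum>m<n. \<Sum>j<p. translate ((real m / real n) *\<^sub>R h) (translate ((real j / real p) *\<^sub>R ((1 / real n) *\<^sub>R h)) u) f)"
    by (simp add: riemann_average_def translate_def sum_distrib_left)
  then show "riemann_average (n * p) h u f = riemann_average n h (riemann_average p ((1 / real n) *\<^sub>R h) u) f"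
    unfolding eq[symmetric] by (simp only: riemann_average_def)
qed

text \<open>Once the pieces are so short that translations along them hardly move \<open>u\<close>,
  refining changes the sum little. Two subdivisions are compared through the common refinement into
  \<open>Suc j * Suc k\<close> pieces.\<close>

lemma riemann_Cauchy:
  assumes u: "u \<in> E" and e: "e > 0"
  shows "\<exists>N. \<forall>j\<ge>N. \<forall>k\<ge>N. nrm (\<lambda>p. riemann_average (Suc j) h u p - riemann_average (Suc k) h u p) < e"
proof -
  define \<delta> where "\<delta> = e / (3 * trK h)"
  have K: "trK h > 0" using trK_ge[of h] by linarith
  have \<delta>: "\<delta> > 0" using e K by (simp add: \<delta>_def)
  obtain d where d: "d > 0" "\<forall>h. norm h < d \<longrightarrow> nrm (\<lambda>p. translate h u p - u p) < \<delta>" using translate_continuous[OF u \<delta>] by blast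
  obtain N where N: "norm h / d < real N" using reals_Archimedean2 by blast
  have close: "nrm (\<lambda>p. riemann_average (Suc j * q) h u p - riemann_average (Suc j) h u p) \<le> e / 3" if j: "j \<ge> N" and q: "q > 0" for j q
  proof -
    let ?h = "(1 / real (Suc j)) *\<^sub>R h"
    have hd: "norm ?h < d"
    proof -
      have "norm h < d * real N" using N d by (simp add: pos_divide_less_eq mult.commute)
      also have "\<dots> \<le> d * real (Suc j)" using j d by (intro mult_left_mono) auto
      finally show ?thesis by (simp add: pos_divide_less_eq)
    qed
    have near: "nrm (\<lambda>p. riemann_average q ?h u p - u p) \<le> \<delta>"
    proof (rule riemann_near[OF u q])
      fix s :: real assume s: "0 \<le> s" "s \<le> 1"
      have "\<bar>s\<bar> * norm ?h \<le> norm ?h" using s by (intro mult_left_le_one_le) auto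
      then have "norm (s *\<^sub>R ?h) \<le> norm ?h" by (simp only: norm_scaleR)
      then have "norm (s *\<^sub>R ?h) < d" using hd by linarith
      then show "nrm (\<lambda>p. translate (s *\<^sub>R ?h) u p - u p) \<le> \<delta>" using d(2) less_imp_le by blast
    qed
    have w: "(\<lambda>p. riemann_average q ?h u p - u p) \<in> E" by (intro E_diff riemann_in u q)
    have "nrm (riemann_average (Suc j) h (\<lambda>p. riemann_average q ?h u p - u p)) \<le> trK h * \<delta>"
      using order_trans[OF riemann_in(2)[OF w, of "Suc j"] mult_left_mono[OF near]] K by simp
    then show ?thesis unfolding riemann_refine[OF zero_less_Suc q] riemann_average_diff using K by (simp add: \<delta>_def)
  qed
  have "nrm (\<lambda>p. riemann_average (Suc j) h u p - riemann_average (Suc k) h u p) < e" if jk: "j \<ge> N" "k \<ge> N" for j k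
  proof -
    let ?R = "\<lambda>n. riemann_average n h u"
    have in_E: "?R (Suc j) \<in> E" "?R (Suc k) \<in> E" "?R (Suc j * Suc k) \<in> E" by (intro riemann_in u; simp)+
    have "nrm (\<lambda>p. ?R (Suc j) p - ?R (Suc k) p) \<le> nrm (\<lambda>p. ?R (Suc j) p - ?R (Suc j * Suc k) p) + nrm (\<lambda>p. ?R (Suc j * Suc k) p - ?R (Suc k) p)"
      by (rule nrm_triangle3[OF in_E(1,3,2)])
    also have "nrm (\<lambda>p. ?R (Suc j) p - ?R (Suc j * Suc k) p) \<le> e / 3"
      using close[OF jk(1) zero_less_Suc, of k] nrm_minus_commute[OF in_E(1,3)] by simp
    also have "nrm (\<lambda>p. ?R (Suc j * Suc k) p - ?R (Suc k) p) \<le> e / 3"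
      using close[OF jk(2) zero_less_Suc, of j] by (simp only: mult.commute)
    finally show ?thesis using e by simp
  qed
  then show ?thesis by blast
qed

text \<open>The integral of \<open>translate (s h) u\<close> over \<open>s\<close> from 0 to 1, as
  an element of \<open>E\<close>. Completeness of \<open>E\<close> supplies the limit of the Riemann
  sums.\<close>

definition Av where
  "Av h u = (SOME v. v \<in> E \<and> (\<lambda>k. nrm (\<lambda>p. riemann_average (Suc k) h u p - v p)) \<longlonglongrightarrow> 0)"

lemma Av:
  assumes u: "u \<in> E"
  shows Av_in: "Av h u \<in> E" and Av_lim: "(\<lambda>k. nrm (\<lambda>p. riemann_average (Suc k) h u p - Av h u p)) \<longlonglongrightarrow> 0"
proof -
  have "\<exists>v\<in>E. (\<lambda>k. nrm (\<lambda>p. riemann_average (Suc k) h u p - v p)) \<longlonglongrightarrow> 0"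
    by (rule complete) (simp_all add: riemann_in u riemann_Cauchy)
  then have "\<exists>v. v \<in> E \<and> (\<lambda>k. nrm (\<lambda>p. riemann_average (Suc k) h u p - v p)) \<longlonglongrightarrow> 0" by blast
  from someI_ex[OF this] show "Av h u \<in> E" "(\<lambda>k. nrm (\<lambda>p. riemann_average (Suc k) h u p - Av h u p)) \<longlonglongrightarrow> 0"
    unfolding Av_def[symmetric] by auto
qed

lemma E_outside: "u \<in> E \<Longrightarrow> f \<notin> schwartz \<Longrightarrow> u f = 0"
  using linear_formsD(1)[OF tempered_linear[OF E_tempered]] by blast

lemma Av_pointwise:
  assumes u: "u \<in> E"
  shows "(\<lambda>k. riemann_average (Suc k) h u f) \<longlonglongrightarrow> Av h u f"
proof (cases "f \<in> schwartz")
  case True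
  obtain C where C: "C \<ge> 0" "\<And>u. u \<in> E \<Longrightarrow> cmod (u f) \<le> C * nrm u" using eval_bound[OF True] by blast
  have "(\<lambda>k. C * nrm (\<lambda>p. riemann_average (Suc k) h u p - Av h u p)) \<longlonglongrightarrow> C * 0" by (intro tendsto_intros Av_lim u)
  then have "(\<lambda>k. C * nrm (\<lambda>p. riemann_average (Suc k) h u p - Av h u p)) \<longlonglongrightarrow> 0" by simp
  moreover have "norm (riemann_average (Suc k) h u f - Av h u f) \<le> C * nrm (\<lambda>p. riemann_average (Suc k) h u p - Av h u p)" for k
    using C(2)[OF E_diff[OF riemann_in(1)[OF u zero_less_Suc] Av_in[OF u]]] by blast
  ultimately have "(\<lambda>k. riemann_average (Suc k) h u f - Av h u f) \<longlonglongrightarrow> 0"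
    by (intro Lim_null_comparison[of "\<lambda>k. riemann_average (Suc k) h u f - Av h u f" "\<lambda>k. C * nrm (\<lambda>p. riemann_average (Suc k) h u p - Av h u p)"]) (auto intro: always_eventually)
  then show ?thesis by (rule LIM_zero_cancel)
next
  case False
  then have "riemann_average (Suc k) h u f = 0" "Av h u f = 0" for k
    using E_outside[OF riemann_in(1)[OF u zero_less_Suc]] E_outside[OF Av_in[OF u]] by auto
  then show ?thesis by simp
qed

text \<open>Convergence in \<open>E\<close> implies convergence at every test function, so the
  average may be identified pointwise.\<close>

lemma Av_eqI:
  assumes u: "u \<in> E" and "\<And>f. (\<lambda>k. riemann_average (Suc k) h u f) \<longlonglongrightarrow> v f"
  shows "Av h u = v"
  using LIMSEQ_unique[OF Av_pointwise[OF u] assms(2)] by blast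

lemma Av_diff:
  assumes "u \<in> E" "v \<in> E" shows "Av h (\<lambda>p. u p - v p) = (\<lambda>p. Av h u p - Av h v p)"
  by (rule Av_eqI) (auto simp: riemann_average_diff assms intro!: E_diff tendsto_diff Av_pointwise)

lemma nrm_limit_le:
  assumes "\<And>k. s k \<in> E" "v \<in> E" "(\<lambda>k. nrm (\<lambda>p. s k p - v p)) \<longlonglongrightarrow> 0" "w \<in> E" "\<And>k. nrm (\<lambda>p. s k p - w p) \<le> C"
  shows "nrm (\<lambda>p. v p - w p) \<le> C"
proof -
  have "(\<lambda>k. nrm (\<lambda>p. s k p - v p) + C) \<longlonglongrightarrow> 0 + C" by (intro tendsto_intros assms)
  moreover have "nrm (\<lambda>p. v p - w p) \<le> nrm (\<lambda>p. s k p - v p) + C" for k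
    using nrm_triangle3[OF assms(2) assms(1)[of k] assms(4)] nrm_minus_commute[OF assms(2) assms(1)[of k]] assms(5)[of k] by linarith
  ultimately show ?thesis by (intro LIMSEQ_le_const[of _ C]) auto
qed

lemma Av_bound:
  assumes u: "u \<in> E" shows "nrm (Av h u) \<le> trK h * nrm u"
  using nrm_limit_le[of "\<lambda>k. riemann_average (Suc k) h u" "Av h u" "\<lambda>_. 0" "trK h * nrm u"]
  by (simp add: riemann_in u Av_in Av_lim E_zero)

lemma Av_near:
  assumes u: "u \<in> E" and h: "\<And>s. 0 \<le> s \<Longrightarrow> s \<le> 1 \<Longrightarrow> nrm (\<lambda>p. translate (s *\<^sub>R h) u p - u p) \<le> e"
  shows "nrm (\<lambda>p. Av h u p - u p) \<le> e"
  by (rule nrm_limit_le[of "\<lambda>k. riemann_average (Suc k) h u"]) (simp_all add: riemann_in u Av_in Av_lim riemann_near h)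

lemma Av_partial:
  assumes u: "u \<in> E" "dist_partial i u \<in> E"
  shows "dist_partial i (Av h u) = Av h (dist_partial i u)"
proof (rule Av_eqI[symmetric, OF u(2)])
  fix f
  show "(\<lambda>k. riemann_average (Suc k) h (dist_partial i u) f) \<longlonglongrightarrow> dist_partial i (Av h u) f"
  proof (cases "f \<in> schwartz")
    case True
    have "(\<lambda>k. - riemann_average (Suc k) h u (partial i f)) \<longlonglongrightarrow> - Av h u (partial i f)"
      by (intro tendsto_minus Av_pointwise u)
    then show ?thesis using True by (simp add: dist_partial_def flip: riemann_average_partial)
  qed (simp add: dist_partial_def flip: riemann_average_partial)
qed

text \<open>The fundamental theorem of calculus: differentiating the average over a segment along
  that segment gives the difference of its end points. In effect averaging gains one derivative in
  direction \<open>i\<close>, measured in the norm of \<open>E\<close> alone.\<close>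

lemma Av_smoothing:
  assumes u: "u \<in> E" and e: "0 < e" "e \<le> 1"
  shows "dist_partial i (Av (e *\<^sub>R axis i 1) u) = (\<lambda>p. (1 / of_real e) * (translate (e *\<^sub>R axis i 1) u p - u p))"
proof
  fix f :: "real^'n \<Rightarrow> complex"
  let ?h = "e *\<^sub>R axis i 1 :: real^'n"
  show "dist_partial i (Av ?h u) f = (1 / of_real e) * (translate ?h u f - u f)"
  proof (cases "f \<in> schwartz")
    case False
    then show ?thesis using E_outside[OF u] by (simp add: dist_partial_def translate_def schwartz_shift_iff)
  next
    case f: True
    \<comment> \<open>The defect of the identity at \<open>f\<close>, with the sign of
      \<open>dist_partial\<close> absorbed. It is linear and bounded by the norm of
      \<open>E\<close>, so it suffices to see it vanish on Schwartz functions.\<close>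
    define T where "T = (\<lambda>u. Av ?h u (partial i f) + (1 / of_real e) * (u (\<lambda>x. f (x - ?h)) - u f))"
    have TS: "T (schwartz_dist g) = 0" if g: "g \<in> schwartz" for g
    proof -
      \<comment> \<open>Riemann sum of \<open>partial i f\<close> plus the difference quotient of
        \<open>f\<close>. It tends to 0 uniformly in \<open>x\<close>, hence so does its integral
        against \<open>g\<close>.\<close>
      define D where "D = (\<lambda>n x. (1 / of_nat n) * (\<Sum>j<n. partial i f (x - (real j / real n) *\<^sub>R ?h)) + (f (x - ?h) - f x) / of_real e)"
      obtain C where C: "C \<ge> 0" "\<forall>n>0. \<forall>x. cmod (D n x) \<le> C / real n"
        using riemann_partial_estimate[OF f e, of i] unfolding D_def by blast
      have gi: "integrable lborel (\<lambda>x. g x * q x)" if "q \<in> schwartz" for q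
        by (intro schwartz_integrable schwartz_mult g that)
      have pf: "(\<lambda>x. partial i f (x - h)) \<in> schwartz" for h by (intro schwartz_shift_minus schwartz_partial f)
      have eq: "riemann_average (Suc k) ?h (schwartz_dist g) (partial i f) + (1 / of_real e) * (schwartz_dist g (\<lambda>x. f (x - ?h)) - schwartz_dist g f)
          = (LINT x|lborel. g x * D (Suc k) x)" for k
      proof -
        have i1: "integrable lborel (\<lambda>x. g x * (\<Sum>j<Suc k. partial i f (x - (real j / real (Suc k)) *\<^sub>R ?h)))"
          unfolding sum_distrib_left by (intro Bochner_Integration.integrable_sum gi pf)
        have "riemann_average (Suc k) ?h (schwartz_dist g) (partial i f) = (1 / of_nat (Suc k)) * (\<Sum>j<Suc k. LINT x|lborel. g x * partial i f (x - (real j / real (Suc k)) *\<^sub>R ?h))"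
          unfolding riemann_average_def translate_def schwartz_dist_def using pf by simp
        also have "(\<Sum>j<Suc k. LINT x|lborel. g x * partial i f (x - (real j / real (Suc k)) *\<^sub>R ?h)) =
            (LINT x|lborel. g x * (\<Sum>j<Suc k. partial i f (x - (real j / real (Suc k)) *\<^sub>R ?h)))"
          unfolding sum_distrib_left by (rule Bochner_Integration.integral_sum[symmetric]) (intro gi pf)
        finally have 1: "riemann_average (Suc k) ?h (schwartz_dist g) (partial i f) =
            (LINT x|lborel. (1 / of_nat (Suc k)) * (g x * (\<Sum>j<Suc k. partial i f (x - (real j / real (Suc k)) *\<^sub>R ?h))))"
          by (simp only: integral_mult_right_zero)
        have fs: "(\<lambda>x. f (x - ?h)) \<in> schwartz" by (rule schwartz_shift_minus[OF f])
        have 2: "(1 / of_real e) * (schwartz_dist g (\<lambda>x. f (x - ?h)) - schwartz_dist g f) = (LINT x|lborel. (1 / of_real e) * (g x * f (x - ?h) - g x * f x))"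
          unfolding schwartz_dist_def using f fs by (simp only: if_True Bochner_Integration.integral_diff[OF gi[OF fs] gi[OF f]] integral_mult_right_zero)
        have 3: "(1 / of_nat (Suc k)) * (g x * (\<Sum>j<Suc k. partial i f (x - (real j / real (Suc k)) *\<^sub>R ?h))) + (1 / of_real e) * (g x * f (x - ?h) - g x * f x) = g x * D (Suc k) x" for x
          by (simp add: D_def algebra_simps diff_divide_distrib del: of_nat_Suc sum.lessThan_Suc)
        have I1: "integrable lborel (\<lambda>x. (1 / of_nat (Suc k)) * (g x * (\<Sum>j<Suc k. partial i f (x - (real j / real (Suc k)) *\<^sub>R ?h))))"
          by (intro integrable_mult_right i1)
        have I2: "integrable lborel (\<lambda>x. (1 / of_real e) * (g x * f (x - ?h) - g x * f x))"
          by (intro integrable_mult_right Bochner_Integration.integrable_diff gi fs f)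
        show ?thesis unfolding 1 2 Bochner_Integration.integral_add[OF I1 I2, symmetric] 3 ..
      qed
      have gint: "integrable lborel (\<lambda>x. cmod (g x))" by (intro integrable_norm schwartz_integrable g)
      have bd: "cmod (LINT x|lborel. g x * D (Suc k) x) \<le> (LINT x|lborel. cmod (g x)) * C * (1 / real (Suc k))" for k
      proof -
        have "(LINT x|lborel. cmod (g x * D (Suc k) x)) \<le> (LINT x|lborel. cmod (g x) * (C / real (Suc k)))"
        proof (rule integral_mono')
          show "integrable lborel (\<lambda>x. cmod (g x) * (C / real (Suc k)))" using gint by (rule integrable_mult_left)
          show "cmod (g x * D (Suc k) x) \<le> cmod (g x) * (C / real (Suc k))" for x
            unfolding norm_mult by (intro mult_left_mono C(2)[rule_format]) auto
          show "0 \<le> cmod (g x) * (C / real (Suc k))" for x using C(1) by simp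
        qed
        from order_trans[OF integral_norm_bound this] show ?thesis by simp
      qed
      have "(\<lambda>k. (LINT x|lborel. cmod (g x)) * C * (1 / real (Suc k))) \<longlonglongrightarrow> (LINT x|lborel. cmod (g x)) * C * 0"
        using LIMSEQ_inverse_real_of_nat by (intro tendsto_intros) (simp add: inverse_eq_divide)
      then have "(\<lambda>k. LINT x|lborel. g x * D (Suc k) x) \<longlonglongrightarrow> 0"
        by (intro Lim_null_comparison[OF always_eventually[OF allI[OF bd]]]) simp
      then have "(\<lambda>k. riemann_average (Suc k) ?h (schwartz_dist g) (partial i f) + (1 / of_real e) * (schwartz_dist g (\<lambda>x. f (x - ?h)) - schwartz_dist g f)) \<longlonglongrightarrow> 0"
        unfolding eq .
      moreover have "(\<lambda>k. riemann_average (Suc k) ?h (schwartz_dist g) (partial i f) + (1 / of_real e) * (schwartz_dist g (\<lambda>x. f (x - ?h)) - schwartz_dist g f)) \<longlonglongrightarrow> T (schwartz_dist g)"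
        unfolding T_def by (intro tendsto_add tendsto_const Av_pointwise S_in g)
      ultimately show ?thesis using LIMSEQ_unique by blast
    qed
    have Tdiff: "T (\<lambda>p. v p - w p) = T v - T w" if "v \<in> E" "w \<in> E" for v w
      by (simp add: T_def Av_diff that algebra_simps diff_divide_distrib)
    obtain C1 where C1: "C1 \<ge> 0" "\<And>u. u \<in> E \<Longrightarrow> cmod (u (partial i f)) \<le> C1 * nrm u" using eval_bound[OF schwartz_partial[OF f]] by blast
    obtain C2 where C2: "C2 \<ge> 0" "\<And>u. u \<in> E \<Longrightarrow> cmod (u (\<lambda>x. f (x - ?h))) \<le> C2 * nrm u" using eval_bound[OF schwartz_shift_minus[OF f]] by blast
    obtain C3 where C3: "C3 \<ge> 0" "\<And>u. u \<in> E \<Longrightarrow> cmod (u f) \<le> C3 * nrm u" using eval_bound[OF f] by blast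
    define K where "K = C1 * trK ?h + (1 / e) * (C2 + C3)"
    have K: "K \<ge> 0" unfolding K_def using C1 C2 C3 e trK_ge[of ?h] by (intro add_nonneg_nonneg mult_nonneg_nonneg) auto
    have Tb: "cmod (T v) \<le> K * nrm v" if v: "v \<in> E" for v
    proof -
      have "cmod (Av ?h v (partial i f)) \<le> C1 * (trK ?h * nrm v)"
        using order_trans[OF C1(2)[OF Av_in[OF v]] mult_left_mono[OF Av_bound[OF v] C1(1)]] .
      moreover have "cmod ((1 / of_real e) * (v (\<lambda>x. f (x - ?h)) - v f)) \<le> (1 / e) * (C2 * nrm v + C3 * nrm v)"
        unfolding norm_mult using e C2(2)[OF v] C3(2)[OF v]
        by (intro mult_mono order_trans[OF norm_triangle_ineq4] add_mono) (auto simp: norm_divide)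
      ultimately have "cmod (T v) \<le> C1 * (trK ?h * nrm v) + (1 / e) * (C2 * nrm v + C3 * nrm v)"
        unfolding T_def by (intro order_trans[OF norm_triangle_ineq] add_mono)
      also have "\<dots> = K * nrm v" by (simp add: K_def algebra_simps add_divide_distrib)
      finally show ?thesis .
    qed
    have "cmod (T u) \<le> 0"
    proof (rule field_le_epsilon)
      fix d :: real assume d: "d > 0"
      then have "d / (K + 1) > 0" using K by simp
      from S_dense[OF u this] obtain g where g: "g \<in> schwartz" "nrm (\<lambda>p. u p - schwartz_dist g p) < d / (K + 1)" by blast
      have "T u = T (\<lambda>p. u p - schwartz_dist g p)" using Tdiff[OF u S_in[OF g(1)]] TS[OF g(1)] by simp
      then have "cmod (T u) \<le> K * (d / (K + 1))"
        using order_trans[OF Tb[OF E_diff[OF u S_in[OF g(1)]]] mult_left_mono[OF less_imp_le[OF g(2)] K]] by simp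
      also have "\<dots> = d * (K / (K + 1))" by simp
      also have "\<dots> \<le> d * 1" using d K by (intro mult_left_mono) auto
      finally show "cmod (T u) \<le> 0 + d" by simp
    qed
    then have "Av ?h u (partial i f) + (1 / of_real e) * (u (\<lambda>x. f (x - ?h)) - u f) = 0" by (simp add: T_def)
    then have "- Av ?h u (partial i f) = (1 / of_real e) * (u (\<lambda>x. f (x - ?h)) - u f)" by (rule minus_unique)
    then show ?thesis unfolding dist_partial_def translate_def if_P[OF f] .
  qed
qed

end

section \<open>Functionals on \<open>E\<close> and \<open>D\<^sub>E\<close>\<close>

lemma test_functions_add:
  assumes "f \<in> test_functions" "g \<in> test_functions"
  shows "(\<lambda>x. f x + g x) \<in> test_functions"
proof -
  obtain r where r: "\<And>x. norm x > r \<Longrightarrow> f x = 0" by (rule test_function_support[OF assms(1)]) blast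
  obtain s where s: "\<And>x. norm x > s \<Longrightarrow> g x = 0" by (rule test_function_support[OF assms(2)]) blast
  have "f x + g x = 0" if "norm x > max r s" for x using r[of x] s[of x] that by simp
  then show ?thesis
    by (rule test_functions_support[OF smooth_add[OF test_function_smooth[OF assms(1)] test_function_smooth[OF assms(2)]]])
qed

lemma test_functions_cmult:
  assumes "f \<in> test_functions" shows "(\<lambda>x. c * f x) \<in> test_functions"
proof -
  obtain r where r: "\<And>x. norm x > r \<Longrightarrow> f x = 0" by (rule test_function_support[OF assms]) blast
  have "c * f x = 0" if "norm x > r" for x using r[OF that] by simp
  then show ?thesis by (rule test_functions_support[OF smooth_cmult[OF test_function_smooth[OF assms]]])
qed

lemma continuous_formsD:
  assumes "L \<in> continuous_forms X p" "\<And>N u. u \<in> X \<Longrightarrow> 0 \<le> p N u"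
  obtains N C where "C \<ge> 0" "\<And>u. u \<in> X \<Longrightarrow> cmod (L u) \<le> C * p N u"
proof -
  obtain N C where C: "\<forall>u\<in>X. cmod (L u) \<le> C * p N u" using assms(1) unfolding continuous_forms_def by blast
  have "cmod (L u) \<le> max C 0 * p N u" if "u \<in> X" for u
    using C[rule_format, OF that] mult_right_mono[of C "max C 0" "p N u"] assms(2)[OF that, of N] by linarith
  then show ?thesis using that[of "max C 0" N] by simp
qed

lemma growth_pairing_bound:
  fixes f g :: "real^'n::finite \<Rightarrow> complex"
  assumes f: "f \<in> borel_measurable borel" "\<And>x. cmod (f x) \<le> C * (1 + norm x) ^ m" and g: "g \<in> schwartz"
  shows "cmod (LINT x|lborel. f x * g x) \<le> C * schwartz_seminorm (m + (CARD('n) + 2)) g * (LINT x::real^'n|lborel. 1 / (1 + norm x) ^ (CARD('n) + 2))"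
proof -
  let ?N = "CARD('n) + 2"
  let ?s = "schwartz_seminorm (m + ?N) g"
  have C0: "C \<ge> 0" using order_trans[OF norm_ge_zero f(2)[of 0]] by simp
  have i: "integrable lborel (\<lambda>x::real^'n. C * ?s * (1 / (1 + norm x) ^ ?N))"
    by (intro integrable_mult_right integrable_weight)
  have "cmod (f x * g x) \<le> C * ?s * (1 / (1 + norm x) ^ ?N)" for x
  proof -
    have "cmod (f x * g x) * (1 + norm x) ^ ?N \<le> (C * (1 + norm x) ^ m * cmod (g x)) * (1 + norm x) ^ ?N"
      unfolding norm_mult by (intro mult_right_mono f) auto
    also have "\<dots> = C * ((1 + norm x) ^ (m + ?N) * cmod (partials [] g x))" by (simp only: power_add mult_ac partials_Nil)
    also have "\<dots> \<le> C * ?s" by (intro mult_left_mono schwartz_seminorm_ge g C0) auto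
    finally show ?thesis using weight_pos[of x ?N] by (simp only: mult_1_right times_divide_eq_right pos_le_divide_eq)
  qed
  then have "cmod (LINT x|lborel. f x * g x) \<le> (LINT x::real^'n|lborel. C * ?s * (1 / (1 + norm x) ^ ?N))"
    by (intro order_trans[OF integral_norm_bound] integral_mono i integrable_norm schwartz_growth_integrable[OF f g])
  then show ?thesis by (simp only: integral_mult_right_zero)
qed

text \<open>Stated for an increasing sequence of seminorms, so that it serves both the constant
  sequence on \<open>E\<close> and the sequence on \<open>DE E\<close>. Passing to
  \<open>max N M\<close> makes one approximation good for both forms.\<close>

lemma forms_eqI:
  fixes X :: "((real^'n::finite \<Rightarrow> complex) \<Rightarrow> complex) set"
  assumes X: "complex_subspace X" "schwartz_dist ` schwartz \<subseteq> X"
    and nn: "\<And>N u. u \<in> X \<Longrightarrow> 0 \<le> p N u" and mono: "\<And>M N u. u \<in> X \<Longrightarrow> M \<le> N \<Longrightarrow> p M u \<le> p N u"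
    and dense: "\<And>N u e. u \<in> X \<Longrightarrow> e > 0 \<Longrightarrow> \<exists>g\<in>test_functions. p N (\<lambda>q. u q - schwartz_dist g q) < e"
    and L: "L \<in> continuous_forms X p" and L': "L' \<in> continuous_forms X p"
    and eq: "\<And>g. g \<in> test_functions \<Longrightarrow> L (schwartz_dist g) = L' (schwartz_dist g)"
  shows "L = L'"
proof
  fix u
  have lin: "L \<in> linear_forms X" "L' \<in> linear_forms X" using L L' by (auto simp: continuous_forms_def)
  show "L u = L' u"
  proof (cases "u \<in> X")
    case u: True
    obtain N C where C: "C \<ge> 0" "\<And>u. u \<in> X \<Longrightarrow> cmod (L u) \<le> C * p N u" using continuous_formsD[OF L nn] by metis
    obtain M D where D: "D \<ge> 0" "\<And>u. u \<in> X \<Longrightarrow> cmod (L' u) \<le> D * p M u" using continuous_formsD[OF L' nn] by metis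
    have "cmod (L u - L' u) \<le> 0"
    proof (rule field_le_epsilon)
      fix e :: real assume e: "e > 0"
      define d where "d = e / (C + D + 1)"
      have d: "d > 0" using e C D by (simp add: d_def)
      obtain g where g: "g \<in> test_functions" "p (max N M) (\<lambda>q. u q - schwartz_dist g q) < d" using dense[OF u d] by blast
      let ?v = "\<lambda>q. u q - schwartz_dist g q"
      have gX: "schwartz_dist g \<in> X" using X(2) test_schwartz[OF g(1)] by blast
      have m: "(\<lambda>q. (-1) * schwartz_dist g q) \<in> X" using X(1) gX unfolding complex_subspace_def by blast
      have add: "\<forall>u\<in>X. \<forall>v\<in>X. (\<lambda>x. u x + v x) \<in> X" using X(1) unfolding complex_subspace_def by blast
      have "(\<lambda>q. u q + (-1) * schwartz_dist g q) \<in> X" by (rule bspec[OF bspec[OF add u] m])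
      then have vX: "?v \<in> X" by simp
      have "p N ?v \<le> d" "p M ?v \<le> d" using mono[OF vX, of N "max N M"] mono[OF vX, of M "max N M"] g(2) by auto
      then have "cmod (L ?v) \<le> C * d" "cmod (L' ?v) \<le> D * d"
        using order_trans[OF C(2)[OF vX] mult_left_mono[OF _ C(1)]] order_trans[OF D(2)[OF vX] mult_left_mono[OF _ D(1)]] by auto
      moreover have "cmod (L u - L' u) = cmod (L ?v - L' ?v)"
        using linear_forms_diff[OF X(1) lin(1) u gX] linear_forms_diff[OF X(1) lin(2) u gX] eq[OF g(1)] by simp
      ultimately have "cmod (L u - L' u) \<le> C * d + D * d" using norm_triangle_ineq4[of "L ?v" "L' ?v"] by linarith
      also have "\<dots> \<le> (C + D + 1) * d" using d by (simp add: distrib_right)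
      also have "\<dots> = e" using C D by (simp add: d_def)
      finally show "cmod (L u - L' u) \<le> 0 + e" by simp
    qed
    then show ?thesis by simp
  qed (use lin linear_formsD(1) in metis)
qed

context tib begin

lemma DE_E: "u \<in> DE E \<Longrightarrow> u \<in> E"
  by (simp add: DE_def)

lemma DE_partials_E: "u \<in> DE E \<Longrightarrow> dist_partials is u \<in> E"
  by (simp add: DE_def)

lemma DE_partials: "u \<in> DE E \<Longrightarrow> dist_partials is u \<in> DE E"
  by (simp add: DE_def flip: dist_partials_append)

lemma dist_partials_zero: "dist_partials is (\<lambda>_. 0) = (\<lambda>_. 0)"
  using dist_partials_cmult[of "is" 0 "\<lambda>_. 0"] by simp

lemma DE_subspace: "complex_subspace (DE E)"
  unfolding complex_subspace_def
  by (auto simp: DE_def E_zero E_add E_cmult dist_partials_zero dist_partials_add dist_partials_cmult)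

lemma DE_add: "u \<in> DE E \<Longrightarrow> v \<in> DE E \<Longrightarrow> (\<lambda>p. u p + v p) \<in> DE E"
  using DE_subspace unfolding complex_subspace_def by blast

lemma DE_cmult: "u \<in> DE E \<Longrightarrow> (\<lambda>p. c * u p) \<in> DE E"
  using DE_subspace unfolding complex_subspace_def by blast

lemma DE_diff: "u \<in> DE E \<Longrightarrow> v \<in> DE E \<Longrightarrow> (\<lambda>p. u p - v p) \<in> DE E"
  by (auto simp: DE_def E_diff dist_partials_diff)

lemma S_in_DE: "f \<in> schwartz \<Longrightarrow> schwartz_dist f \<in> DE E"
  by (auto simp: DE_def S_in schwartz_dist_partials schwartz_partials)

lemma DE_norm_le:
  assumes "\<And>is::'n list. length is \<le> N \<Longrightarrow> nrm (dist_partials is u) \<le> C"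
  shows "DE_norm nrm N u \<le> C"
  unfolding DE_norm_def using finite_lists_le assms by (subst Max_le_iff) (auto intro!: exI[of _ "[]"])

lemma DE_norm_less:
  assumes "\<And>is::'n list. length is \<le> N \<Longrightarrow> nrm (dist_partials is u) < C"
  shows "DE_norm nrm N u < C"
  unfolding DE_norm_def using finite_lists_le assms by (subst Max_less_iff) (auto intro!: exI[of _ "[]"])

lemma DE_norm_ge:
  fixes "is" :: "'n list"
  assumes "length is \<le> N" shows "nrm (dist_partials is u) \<le> DE_norm nrm N u"
  unfolding DE_norm_def using finite_lists_le assms by (intro Max_ge) auto

lemma nrm_le_DE_norm: "nrm u \<le> DE_norm nrm N u"
  using DE_norm_ge[of "[]" N u] by simp

lemma DE_norm_nonneg: "u \<in> DE E \<Longrightarrow> 0 \<le> DE_norm nrm N u"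
  using nrm_nonneg[OF DE_E] nrm_le_DE_norm order_trans by blast

lemma DE_norm_mono: "M \<le> N \<Longrightarrow> DE_norm nrm M u \<le> DE_norm nrm N u"
  by (intro DE_norm_le DE_norm_ge) simp

lemma DE_norm_triangle3:
  assumes "u \<in> DE E" "v \<in> DE E" "w \<in> DE E"
  shows "DE_norm nrm N (\<lambda>p. u p - w p) \<le> DE_norm nrm N (\<lambda>p. u p - v p) + DE_norm nrm N (\<lambda>p. v p - w p)"
proof (rule DE_norm_le)
  fix "is" :: "'n list" assume l: "length is \<le> N"
  have "nrm (dist_partials is (\<lambda>p. u p - w p)) \<le> nrm (dist_partials is (\<lambda>p. u p - v p)) + nrm (dist_partials is (\<lambda>p. v p - w p))"
    unfolding dist_partials_diff by (intro nrm_triangle3 DE_partials_E assms)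
  then show "nrm (dist_partials is (\<lambda>p. u p - w p)) \<le> DE_norm nrm N (\<lambda>p. u p - v p) + DE_norm nrm N (\<lambda>p. v p - w p)"
    using DE_norm_ge[OF l, of "\<lambda>p. u p - v p"] DE_norm_ge[OF l, of "\<lambda>p. v p - w p"] by linarith
qed

lemma DE_norm_minus_commute:
  assumes "u \<in> DE E" "v \<in> DE E"
  shows "DE_norm nrm N (\<lambda>p. u p - v p) = DE_norm nrm N (\<lambda>p. v p - u p)"
  unfolding DE_norm_def dist_partials_diff
  using nrm_minus_commute[OF DE_partials_E[OF assms(1)] DE_partials_E[OF assms(2)]] by simp

lemma DE_norm_cmult:
  assumes "u \<in> DE E" shows "DE_norm nrm N (\<lambda>p. c * u p) \<le> cmod c * DE_norm nrm N u"
proof (rule DE_norm_le)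
  fix "is" :: "'n list" assume "length is \<le> N"
  from mult_left_mono[OF DE_norm_ge[OF this], of "cmod c" u]
  show "nrm (dist_partials is (\<lambda>p. c * u p)) \<le> cmod c * DE_norm nrm N u"
    by (simp add: dist_partials_cmult nrm_cmult DE_partials_E assms)
qed

lemma DE_norm_translate:
  assumes u: "u \<in> DE E" shows "DE_norm nrm N (translate h u) \<le> trK h * DE_norm nrm N u"
proof (rule DE_norm_le)
  fix "is" :: "'n list" assume "length is \<le> N"
  then have "trK h * nrm (dist_partials is u) \<le> trK h * DE_norm nrm N u"
    using trK_ge[of h] by (intro mult_left_mono DE_norm_ge) auto
  then show "nrm (dist_partials is (translate h u)) \<le> trK h * DE_norm nrm N u"
    using translate_trK[OF DE_partials_E[OF u], of h "is"] by (simp add: translate_dist_partials)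
qed

lemma DE_norm_schwartz:
  obtains M C where "C \<ge> 0" "\<And>f. f \<in> schwartz \<Longrightarrow> DE_norm nrm N (schwartz_dist f) \<le> C * schwartz_seminorm M f"
proof -
  obtain N0 C where C: "C \<ge> 0" "\<And>f. f \<in> schwartz \<Longrightarrow> nrm (schwartz_dist f) \<le> C * schwartz_seminorm N0 f" by (rule S_bound) blast
  have "DE_norm nrm N (schwartz_dist f) \<le> C * schwartz_seminorm (N0 + N) f" if f: "f \<in> schwartz" for f
  proof (rule DE_norm_le)
    fix "is" :: "'n list" assume l: "length is \<le> N"
    have "nrm (dist_partials is (schwartz_dist f)) \<le> C * schwartz_seminorm N0 (partials is f)"
      unfolding schwartz_dist_partials[OF f] by (intro C schwartz_partials f)
    also have "\<dots> \<le> C * schwartz_seminorm (N0 + N) f"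
    proof (intro mult_left_mono C)
      have "schwartz_seminorm N0 (partials is f) \<le> schwartz_seminorm (N0 + length is) f" by (rule schwartz_seminorm_partials[OF f])
      also have "\<dots> \<le> schwartz_seminorm (N0 + N) f" using l by (intro schwartz_seminorm_mono f) simp
      finally show "schwartz_seminorm N0 (partials is f) \<le> schwartz_seminorm (N0 + N) f" .
    qed
    finally show "nrm (dist_partials is (schwartz_dist f)) \<le> C * schwartz_seminorm (N0 + N) f" .
  qed
  then show ?thesis using that C(1) by blast
qed

lemma Av_partials:
  assumes u: "u \<in> DE E" shows "dist_partials is (Av h u) = Av h (dist_partials is u)"
proof (induction "is")
  case (Cons i "is")
  have "dist_partial i (dist_partials is u) \<in> E" using DE_partials_E[OF u, of "i # is"] by simp
  then show ?case using Cons Av_partial[OF DE_partials_E[OF u]] by simp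
qed simp

lemma Av_DE: "u \<in> DE E \<Longrightarrow> Av h u \<in> DE E"
  by (subst DE_def) (auto simp: Av_partials Av_in DE_E DE_partials_E)

lemma DE_norm_Av:
  assumes u: "u \<in> DE E" shows "DE_norm nrm N (Av h u) \<le> trK h * DE_norm nrm N u"
proof (rule DE_norm_le)
  fix "is" :: "'n list" assume "length is \<le> N"
  then have "trK h * nrm (dist_partials is u) \<le> trK h * DE_norm nrm N u"
    using trK_ge[of h] by (intro mult_left_mono DE_norm_ge) auto
  then show "nrm (dist_partials is (Av h u)) \<le> trK h * DE_norm nrm N u"
    using Av_bound[OF DE_partials_E[OF u], of h "is"] by (simp add: Av_partials u)
qed

section \<open>Density of the Schwartz functions in \<open>DE E\<close>\<close>

definition approximable where
  "approximable N u \<longleftrightarrow> (\<forall>e>0. \<exists>f\<in>schwartz. DE_norm nrm N (\<lambda>p. u p - schwartz_dist f p) < e)"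

lemma approximable_closed:
  assumes u: "u \<in> DE E" and v: "\<And>e. e > 0 \<Longrightarrow> \<exists>v\<in>DE E. approximable N v \<and> DE_norm nrm N (\<lambda>p. u p - v p) < e"
  shows "approximable N u"
  unfolding approximable_def
proof (intro allI impI)
  fix e :: real assume e: "e > 0"
  obtain v where v: "v \<in> DE E" "approximable N v" "DE_norm nrm N (\<lambda>p. u p - v p) < e / 2" using v[of "e / 2"] e by auto
  have "\<forall>e>0. \<exists>f\<in>schwartz. DE_norm nrm N (\<lambda>p. v p - schwartz_dist f p) < e" using v(2) by (simp add: approximable_def)
  then obtain f where f: "f \<in> schwartz" "DE_norm nrm N (\<lambda>p. v p - schwartz_dist f p) < e / 2" using e half_gt_zero by blast
  have "DE_norm nrm N (\<lambda>p. u p - schwartz_dist f p) < e"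
    using DE_norm_triangle3[OF u v(1) S_in_DE[OF f(1)], of N] v(3) f(2) by simp
  then show "\<exists>f\<in>schwartz. DE_norm nrm N (\<lambda>p. u p - schwartz_dist f p) < e" using f(1) by blast
qed

lemma DE_norm_zero: "DE_norm nrm N (\<lambda>_. 0) \<le> 0"
  using nrm_eq_0[OF E_zero] by (intro DE_norm_le) (simp add: dist_partials_zero)

lemma approximable_schwartz: "f \<in> schwartz \<Longrightarrow> approximable N (schwartz_dist f)"
  unfolding approximable_def using DE_norm_zero[of N] by (force intro!: bexI[of _ f])

text \<open>The Riemann sums are Schwartz functions. Derivatives commute with them and with the
  average, so they converge in each of the finitely many norms that make up
  \<open>DE_norm nrm N\<close>.\<close>

lemma approximable_Av_schwartz:
  assumes f: "f \<in> schwartz" shows "approximable N (Av h (schwartz_dist f))"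
proof (rule approximable_closed)
  let ?u = "schwartz_dist f"
  have u: "?u \<in> DE E" by (rule S_in_DE[OF f])
  show "Av h ?u \<in> DE E" by (rule Av_DE[OF u])
  fix e :: real assume e: "e > 0"
  have "\<forall>\<^sub>F k in sequentially. \<forall>is\<in>{is::'n list. length is \<le> N}. nrm (dist_partials is (\<lambda>p. riemann_average (Suc k) h ?u p - Av h ?u p)) < e"
  proof (rule eventually_ball_finite[OF finite_lists_le], rule ballI)
    fix "is" :: "'n list"
    have "(\<lambda>k. nrm (\<lambda>p. riemann_average (Suc k) h (dist_partials is ?u) p - Av h (dist_partials is ?u) p)) \<longlonglongrightarrow> 0"
      by (rule Av_lim[OF DE_partials_E[OF u]])
    from order_tendstoD(2)[OF this e]
    show "\<forall>\<^sub>F k in sequentially. nrm (dist_partials is (\<lambda>p. riemann_average (Suc k) h ?u p - Av h ?u p)) < e"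
      by (simp add: dist_partials_diff riemann_average_partials Av_partials u)
  qed
  then obtain k where k: "\<forall>is\<in>{is::'n list. length is \<le> N}. nrm (dist_partials is (\<lambda>p. riemann_average (Suc k) h ?u p - Av h ?u p)) < e"
    unfolding eventually_sequentially by blast
  obtain g where g: "g \<in> schwartz" "riemann_average (Suc k) h ?u = schwartz_dist g" using riemann_average_schwartz[OF f] by blast
  have "DE_norm nrm N (\<lambda>p. riemann_average (Suc k) h ?u p - Av h ?u p) < e" by (rule DE_norm_less) (use k in blast)
  then have "DE_norm nrm N (\<lambda>p. Av h ?u p - schwartz_dist g p) < e"
    unfolding g(2) using DE_norm_minus_commute[OF S_in_DE[OF g(1)] Av_DE[OF u]] by simp
  then show "\<exists>v\<in>DE E. approximable N v \<and> DE_norm nrm N (\<lambda>p. Av h ?u p - v p) < e"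
    using approximable_schwartz[OF g(1)] S_in_DE[OF g(1)] by blast
qed

lemma approximable_Av:
  assumes u: "u \<in> DE E" "approximable N u" shows "approximable N (Av h u)"
proof (rule approximable_closed[OF Av_DE[OF u(1)]])
  fix e :: real assume e: "e > 0"
  have K: "trK h > 0" using trK_ge[of h] by linarith
  then have "e / trK h > 0" using e by simp
  moreover have "\<forall>e>0. \<exists>f\<in>schwartz. DE_norm nrm N (\<lambda>p. u p - schwartz_dist f p) < e" using u(2) by (simp add: approximable_def)
  ultimately obtain f where f: "f \<in> schwartz" "DE_norm nrm N (\<lambda>p. u p - schwartz_dist f p) < e / trK h" by blast
  have "DE_norm nrm N (Av h (\<lambda>p. u p - schwartz_dist f p)) \<le> trK h * DE_norm nrm N (\<lambda>p. u p - schwartz_dist f p)"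
    by (intro DE_norm_Av DE_diff u S_in_DE f)
  also have "\<dots> < e" using f(2) K by (simp add: pos_less_divide_eq mult.commute)
  finally have "DE_norm nrm N (\<lambda>p. Av h u p - Av h (schwartz_dist f) p) < e"
    by (simp add: Av_diff DE_E u S_in f)
  then show "\<exists>v\<in>DE E. approximable N v \<and> DE_norm nrm N (\<lambda>p. Av h u p - v p) < e"
    using approximable_Av_schwartz[OF f(1)] Av_DE[OF S_in_DE[OF f(1)]] by blast
qed

text \<open>Averages over shrinking segments converge to \<open>u\<close> in all derivative norms,
  by strong continuity of translations applied to each derivative. One average can thus be
  removed.\<close>

lemma approximable_peel:
  assumes u: "u \<in> DE E" and ap: "\<And>e. e \<in> {0<..1} \<Longrightarrow> approximable N (Av (e *\<^sub>R axis i 1) u)"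
  shows "approximable N u"
proof (rule approximable_closed[OF u])
  fix e :: real assume e: "e > 0"
  have "\<forall>is. \<exists>d>0. \<forall>h::real^'n. norm h < d \<longrightarrow> nrm (\<lambda>p. translate h (dist_partials is u) p - dist_partials is u p) < e / 2"
    using translate_continuous[OF DE_partials_E[OF u], of "e / 2"] e by simp
  from choice[OF this] obtain d where d: "\<forall>is. d is > 0 \<and> (\<forall>h::real^'n. norm h < d is \<longrightarrow> nrm (\<lambda>p. translate h (dist_partials is u) p - dist_partials is u p) < e / 2)"
    by (elim exE) (rule that)
  define D where "D = Min (d ` {is::'n list. length is \<le> N})"
  have ne: "{is::'n list. length is \<le> N} \<noteq> {}" by (auto intro: exI[of _ "[]"])
  have D0: "D > 0" unfolding D_def using finite_lists_le ne d by (subst Min_gr_iff) auto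
  have D: "D \<le> d is" if "length is \<le> N" for "is" :: "'n list" unfolding D_def using finite_lists_le that by (intro Min_le) auto
  define \<epsilon> where "\<epsilon> = min 1 (D / 2)"
  have \<epsilon>: "\<epsilon> \<in> {0<..1}" "\<epsilon> < D" using D0 by (auto simp: \<epsilon>_def)
  let ?h = "\<epsilon> *\<^sub>R axis i 1 :: real^'n"
  have "DE_norm nrm N (\<lambda>p. Av ?h u p - u p) \<le> e / 2"
  proof (rule DE_norm_le)
    fix "is" :: "'n list" assume l: "length is \<le> N"
    have "nrm (\<lambda>p. Av ?h (dist_partials is u) p - dist_partials is u p) \<le> e / 2"
    proof (rule Av_near[OF DE_partials_E[OF u]])
      fix s :: real assume s: "0 \<le> s" "s \<le> 1"
      have "s * \<epsilon> \<le> 1 * \<epsilon>" using s \<epsilon> by (intro mult_right_mono) auto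
      moreover have "norm (s *\<^sub>R ?h) = s * \<epsilon>" using s \<epsilon> by simp
      ultimately have "norm (s *\<^sub>R ?h) < d is" using \<epsilon> D[OF l] by linarith
      then show "nrm (\<lambda>p. translate (s *\<^sub>R ?h) (dist_partials is u) p - dist_partials is u p) \<le> e / 2" using d less_imp_le by blast
    qed
    then show "nrm (dist_partials is (\<lambda>p. Av ?h u p - u p)) \<le> e / 2" by (simp add: dist_partials_diff Av_partials u)
  qed
  then have "DE_norm nrm N (\<lambda>p. u p - Av ?h u p) < e" using e DE_norm_minus_commute[OF u Av_DE[OF u]] by simp
  then show "\<exists>v\<in>DE E. approximable N v \<and> DE_norm nrm N (\<lambda>p. u p - v p) < e" using ap[OF \<epsilon>(1)] Av_DE[OF u] by blast
qed

text \<open>Each entry is a coordinate direction with the length of the segment. The head of the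
  list is the outermost average and the first to be peeled off.\<close>

definition averages :: "('n \<times> real) list \<Rightarrow> ((real^'n \<Rightarrow> complex) \<Rightarrow> complex) \<Rightarrow> (real^'n \<Rightarrow> complex) \<Rightarrow> complex" where
  "averages xs u = foldr (\<lambda>x. Av (snd x *\<^sub>R axis (fst x) 1)) xs u"

lemma averages_simps [simp]:
  "averages [] u = u" "averages (x # xs) u = Av (snd x *\<^sub>R axis (fst x) 1) (averages xs u)"
  "averages (xs @ ys) u = averages xs (averages ys u)"
  by (simp_all add: averages_def)

lemma averages_DE: "u \<in> DE E \<Longrightarrow> averages xs u \<in> DE E"
  by (induction xs) (auto intro: Av_DE)

lemma averages_diff:
  "u \<in> DE E \<Longrightarrow> v \<in> DE E \<Longrightarrow> averages xs (\<lambda>p. u p - v p) = (\<lambda>p. averages xs u p - averages xs v p)"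
  by (induction xs) (auto simp: Av_diff DE_E averages_DE)

lemma averages_partials: "u \<in> DE E \<Longrightarrow> dist_partials is (averages xs u) = averages xs (dist_partials is u)"
  by (induction xs) (auto simp: Av_partials averages_DE)

lemma averages_bound: "\<exists>C\<ge>0. \<forall>u\<in>DE E. nrm (averages xs u) \<le> C * nrm u"
proof (induction xs)
  case Nil
  then show ?case by (intro exI[of _ 1]) simp
next
  case (Cons x xs)
  then obtain C where C: "C \<ge> 0" "\<forall>u\<in>DE E. nrm (averages xs u) \<le> C * nrm u" by blast
  let ?K = "trK (snd x *\<^sub>R axis (fst x) 1)"
  have K: "?K \<ge> 0" using trK_ge order_trans zero_le_one by blast
  have "nrm (averages (x # xs) u) \<le> ?K * C * nrm u" if u: "u \<in> DE E" for u
    using order_trans[OF Av_bound[OF DE_E[OF averages_DE[OF u]]] mult_left_mono[OF C(2)[rule_format, OF u] K]] by (simp add: mult.assoc)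
  then show ?case using K C(1) by (intro exI[of _ "?K * C"]) auto
qed

text \<open>The derivative is carried inwards, past averages in other directions, to the outermost
  one in direction \<open>i\<close>, where \<open>Av_smoothing\<close> turns it into a difference
  quotient. The constant depends on the lengths of the segments.\<close>

lemma averages_smoothing:
  assumes "i \<in> fst ` set xs" "\<forall>x\<in>set xs. snd x \<in> {0<..1}"
  shows "\<exists>C\<ge>0. \<forall>u\<in>DE E. nrm (dist_partial i (averages xs u)) \<le> C * nrm u"
  using assms
proof (induction xs)
  case (Cons x xs)
  obtain j e where x: "x = (j, e)" by force
  have e: "0 < e" "e \<le> 1" using Cons.prems x by auto
  let ?h = "e *\<^sub>R axis j 1 :: real^'n"
  have K: "trK ?h \<ge> 0" using trK_ge order_trans zero_le_one by blast
  show ?case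
  proof (cases "i = j")
    case True
    obtain C where C: "C \<ge> 0" "\<forall>u\<in>DE E. nrm (averages xs u) \<le> C * nrm u" using averages_bound by blast
    have "nrm (dist_partial i (averages (x # xs) u)) \<le> ((1 / e) * (trK ?h + 1) * C) * nrm u" if u: "u \<in> DE E" for u
    proof -
      let ?w = "averages xs u"
      have w: "?w \<in> E" by (intro DE_E averages_DE u)
      have "nrm (\<lambda>p. translate ?h ?w p - ?w p) \<le> trK ?h * nrm ?w + nrm ?w"
        by (intro order_trans[OF nrm_diff] add_right_mono translate_trK translate_in w)
      also have "\<dots> = (trK ?h + 1) * nrm ?w" by (simp add: distrib_right)
      also have "\<dots> \<le> (trK ?h + 1) * (C * nrm u)" using K C(2) u by (intro mult_left_mono) auto
      finally have "(1 / e) * nrm (\<lambda>p. translate ?h ?w p - ?w p) \<le> (1 / e) * ((trK ?h + 1) * (C * nrm u))"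
        using e by (intro mult_left_mono) auto
      then show ?thesis
        using e True Av_smoothing[OF w e, of j] nrm_cmult[OF E_diff[OF translate_in[OF w] w], of "1 / of_real e" ?h]
        by (simp add: x norm_divide mult.assoc)
    qed
    then show ?thesis using e K C(1) by (intro exI[of _ "(1 / e) * (trK ?h + 1) * C"]) auto
  next
    case False
    then have "i \<in> fst ` set xs" using Cons.prems x by auto
    then obtain C where C: "C \<ge> 0" "\<forall>u\<in>DE E. nrm (dist_partial i (averages xs u)) \<le> C * nrm u" using Cons by auto
    have "nrm (dist_partial i (averages (x # xs) u)) \<le> (trK ?h * C) * nrm u" if u: "u \<in> DE E" for u
    proof -
      have p: "dist_partial i (averages xs u) \<in> E" using DE_partials_E[OF averages_DE[OF u], of "[i]"] by simp
      have "nrm (Av ?h (dist_partial i (averages xs u))) \<le> trK ?h * (C * nrm u)"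
        using order_trans[OF Av_bound[OF p] mult_left_mono[OF C(2)[rule_format, OF u] K]] .
      then show ?thesis using Av_partial[OF DE_E[OF averages_DE[OF u]] p] by (simp add: x mult.assoc)
    qed
    then show ?thesis using K C(1) by (intro exI[of _ "trK ?h * C"]) auto
  qed
qed simp

text \<open>One block through all directions absorbs one derivative, whatever its direction, so
  \<open>N\<close> blocks absorb every multi-index of order at most \<open>N\<close>.\<close>

lemma averages_smoothing_order:
  fixes enum :: "'n list"
  assumes enum: "set enum = UNIV"
  shows "map fst xs = concat (replicate N enum) \<Longrightarrow> \<forall>x\<in>set xs. snd x \<in> {0<..1} \<Longrightarrow> length is \<le> N \<Longrightarrow>
    \<exists>C\<ge>0. \<forall>u\<in>DE E. nrm (dist_partials is (averages xs u)) \<le> C * nrm u"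
proof (induction N arbitrary: xs "is")
  case 0
  then show ?case using averages_bound[of xs] by simp
next
  case (Suc N)
  define zs ys where "zs = take (length enum) xs" and "ys = drop (length enum) xs"
  have xs: "xs = zs @ ys" by (simp add: zs_def ys_def)
  have zs: "map fst zs = enum" and ys: "map fst ys = concat (replicate N enum)"
    using Suc.prems(1) by (simp_all add: zs_def ys_def flip: take_map drop_map)
  have e: "\<forall>x\<in>set zs. snd x \<in> {0<..1}" "\<forall>x\<in>set ys. snd x \<in> {0<..1}" using Suc.prems(2) xs by auto
  show ?case
  proof (cases "is")
    case Nil
    then show ?thesis using averages_bound[of xs] by simp
  next
    case (Cons i js)
    have "i \<in> fst ` set zs" using zs enum by (metis UNIV_I set_map)
    from averages_smoothing[OF this e(1)] obtain C where C: "C \<ge> 0" "\<forall>u\<in>DE E. nrm (dist_partial i (averages zs u)) \<le> C * nrm u" by blast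
    have "length js \<le> N" using Suc.prems(3) Cons by simp
    from Suc.IH[OF ys e(2) this] obtain D where D: "D \<ge> 0" "\<forall>u\<in>DE E. nrm (dist_partials js (averages ys u)) \<le> D * nrm u" by blast
    have "nrm (dist_partials is (averages xs u)) \<le> (C * D) * nrm u" if u: "u \<in> DE E" for u
    proof -
      let ?w = "dist_partials js (averages ys u)"
      have w: "?w \<in> DE E" by (intro DE_partials averages_DE u)
      have "dist_partials is (averages xs u) = dist_partial i (averages zs ?w)"
        by (simp add: Cons xs averages_partials averages_DE u)
      then show ?thesis using order_trans[OF C(2)[rule_format, OF w] mult_left_mono[OF D(2)[rule_format, OF u] C(1)]] by (simp add: mult.assoc)
    qed
    then show ?thesis using C(1) D(1) by (intro exI[of _ "C * D"]) auto
  qed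
qed

lemma approximable_averages_schwartz: "f \<in> schwartz \<Longrightarrow> approximable N (averages xs (schwartz_dist f))"
  by (induction xs) (auto simp: approximable_schwartz intro!: approximable_Av averages_DE S_in_DE)

lemma approximable_averages_peel:
  assumes u: "u \<in> DE E"
  shows "(\<And>xs. map fst xs = ds \<Longrightarrow> \<forall>x\<in>set xs. snd x \<in> {0<..1} \<Longrightarrow> approximable N (averages xs u)) \<Longrightarrow> approximable N u"
proof (induction ds)
  case Nil
  then show ?case using Nil[of "[]"] by simp
next
  case (Cons d ds)
  show ?case
  proof (rule Cons.IH)
    fix xs :: "('n \<times> real) list" assume xs: "map fst xs = ds" "\<forall>x\<in>set xs. snd x \<in> {0<..1}"
    show "approximable N (averages xs u)"
    proof (rule approximable_peel[OF averages_DE[OF u]])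
      fix e :: real assume "e \<in> {0<..1}"
      then show "approximable N (Av (e *\<^sub>R axis d 1) (averages xs u))" using Cons.prems[of "(d, e) # xs"] xs by simp
    qed
  qed
qed

text \<open>After \<open>N\<close> blocks of averages the norm of order \<open>N\<close> is bounded
  by the norm of \<open>E\<close>, where density is part of the hypotheses. So the averaged element
  is approximable for all lengths of the segments, and the averages are then peeled off one at a
  time.\<close>

theorem approximable_DE:
  assumes u: "u \<in> DE E" shows "approximable N u"
proof -
  obtain enum :: "'n list" where enum: "set enum = UNIV" using finite_list[of "UNIV :: 'n set"] by auto
  show ?thesis
  proof (rule approximable_averages_peel[OF u, of "concat (replicate N enum)"])
    fix xs :: "('n \<times> real) list" assume xs: "map fst xs = concat (replicate N enum)" "\<forall>x\<in>set xs. snd x \<in> {0<..1}"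
    have "\<forall>is. \<exists>C. length is \<le> N \<longrightarrow> C \<ge> 0 \<and> (\<forall>u\<in>DE E. nrm (dist_partials is (averages xs u)) \<le> C * nrm u)"
      using averages_smoothing_order[OF enum xs] by blast
    from choice[OF this] obtain C where C: "\<forall>is. length is \<le> N \<longrightarrow> C is \<ge> 0 \<and> (\<forall>u\<in>DE E. nrm (dist_partials is (averages xs u)) \<le> C is * nrm u)"
      by (elim exE) (rule that)
    define K where "K = Max (C ` {is::'n list. length is \<le> N})"
    have CK: "C is \<le> K" if "length is \<le> N" for "is" unfolding K_def using that finite_lists_le by (intro Max_ge) auto
    have K0: "K \<ge> 0" using C CK[of "[]"] by (force intro: order_trans)
    have bound: "DE_norm nrm N (averages xs v) \<le> K * nrm v" if v: "v \<in> DE E" for v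
    proof (rule DE_norm_le)
      fix "is" :: "'n list" assume l: "length is \<le> N"
      have "nrm (dist_partials is (averages xs v)) \<le> C is * nrm v" using C l v by blast
      also have "\<dots> \<le> K * nrm v" by (intro mult_right_mono CK l nrm_nonneg DE_E v)
      finally show "nrm (dist_partials is (averages xs v)) \<le> K * nrm v" .
    qed
    show "approximable N (averages xs u)"
    proof (rule approximable_closed[OF averages_DE[OF u]])
      fix e :: real assume e: "e > 0"
      then have "e / (K + 1) > 0" using K0 by simp
      from S_dense[OF DE_E[OF u] this] obtain f where f: "f \<in> schwartz" "nrm (\<lambda>p. u p - schwartz_dist f p) < e / (K + 1)" by blast
      have "DE_norm nrm N (averages xs (\<lambda>p. u p - schwartz_dist f p)) \<le> K * nrm (\<lambda>p. u p - schwartz_dist f p)"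
        by (intro bound DE_diff u S_in_DE f)
      also have "\<dots> \<le> K * (e / (K + 1))" using K0 f(2) by (intro mult_left_mono) auto
      also have "\<dots> = e * (K / (K + 1))" by simp
      also have "\<dots> < e * 1" using K0 e by (intro mult_strict_left_mono) auto
      finally have "DE_norm nrm N (\<lambda>p. averages xs u p - averages xs (schwartz_dist f) p) < e"
        by (simp add: averages_diff u S_in_DE f)
      then show "\<exists>v\<in>DE E. approximable N v \<and> DE_norm nrm N (\<lambda>p. averages xs u p - v p) < e"
        using approximable_averages_schwartz[OF f(1)] averages_DE[OF S_in_DE[OF f(1)]] by blast
    qed
  qed
qed

section \<open>Test functions determine, bound and extend functionals\<close>

lemma tests_dense_DE:
  assumes u: "u \<in> DE E" and e: "e > 0"
  shows "\<exists>g\<in>test_functions. DE_norm nrm N (\<lambda>p. u p - schwartz_dist g p) < e"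
proof -
  have "\<forall>e>0. \<exists>f\<in>schwartz. DE_norm nrm N (\<lambda>p. u p - schwartz_dist f p) < e" using approximable_DE[OF u] by (simp add: approximable_def)
  then obtain f where f: "f \<in> schwartz" "DE_norm nrm N (\<lambda>p. u p - schwartz_dist f p) < e / 2" using e half_gt_zero by blast
  obtain M C where C: "C \<ge> 0" "\<And>f. f \<in> schwartz \<Longrightarrow> DE_norm nrm N (schwartz_dist f) \<le> C * schwartz_seminorm M f"
    by (rule DE_norm_schwartz[of N]) blast
  have "e / 2 / (C + 1) > 0" using e C by simp
  from test_functions_dense[OF f(1) this] obtain g where g: "g \<in> test_functions" "schwartz_seminorm M (\<lambda>x. f x - g x) < e / 2 / (C + 1)" by blast
  have gs: "g \<in> schwartz" by (rule test_schwartz[OF g(1)])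
  have "DE_norm nrm N (schwartz_dist (\<lambda>x. f x - g x)) \<le> C * (e / 2 / (C + 1))"
    using order_trans[OF C(2)[OF schwartz_diff[OF f(1) gs]] mult_left_mono[OF less_imp_le[OF g(2)] C(1)]] .
  also have "\<dots> = e / 2 * (C / (C + 1))" by simp
  also have "\<dots> \<le> e / 2 * 1" using e C by (intro mult_left_mono) auto
  finally have "DE_norm nrm N (\<lambda>p. schwartz_dist f p - schwartz_dist g p) \<le> e / 2" by (simp add: schwartz_dist_diff f gs)
  then have "DE_norm nrm N (\<lambda>p. u p - schwartz_dist g p) < e"
    using DE_norm_triangle3[OF u S_in_DE[OF f(1)] S_in_DE[OF gs], of N] f(2) by linarith
  then show ?thesis using g(1) by blast
qed

lemma tests_dense_E:
  assumes u: "u \<in> E" and e: "e > 0"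
  shows "\<exists>g\<in>test_functions. nrm (\<lambda>p. u p - schwartz_dist g p) < e"
proof -
  obtain f where f: "f \<in> schwartz" "nrm (\<lambda>p. u p - schwartz_dist f p) < e / 2" using S_dense[OF u, of "e / 2"] e by auto
  obtain g where g: "g \<in> test_functions" "DE_norm nrm 0 (\<lambda>p. schwartz_dist f p - schwartz_dist g p) < e / 2"
    using tests_dense_DE[OF S_in_DE[OF f(1)], of "e / 2" 0] e by auto
  have "nrm (\<lambda>p. schwartz_dist f p - schwartz_dist g p) < e / 2" using nrm_le_DE_norm g(2) by (rule le_less_trans)
  then show ?thesis
    using nrm_triangle3[OF u S_in[OF f(1)] S_in[OF test_schwartz[OF g(1)]]] f(2) g(1) by (intro bexI[of _ g]) linarith+
qed

text \<open>Gives meaning to the definite description in \<open>form_of\<close>: the integrals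
  against test functions fix the form, since test functions are dense.\<close>

lemma form_unique_E:
  assumes L: "L \<in> continuous_forms E (\<lambda>_. nrm)" and L': "L' \<in> continuous_forms E (\<lambda>_. nrm)"
    and eq: "\<And>g. g \<in> test_functions \<Longrightarrow> L (schwartz_dist g) = L' (schwartz_dist g)"
  shows "L = L'"
  by (rule forms_eqI[OF subspace _ _ _ _ L L' eq]) (auto simp: nrm_nonneg S_in tests_dense_E)

lemma form_unique_DE:
  assumes L: "L \<in> continuous_forms (DE E) (DE_norm nrm)" and L': "L' \<in> continuous_forms (DE E) (DE_norm nrm)"
    and eq: "\<And>g. g \<in> test_functions \<Longrightarrow> L (schwartz_dist g) = L' (schwartz_dist g)"
  shows "L = L'"
  by (rule forms_eqI[OF DE_subspace _ _ _ _ L L' eq]) (auto simp: DE_norm_nonneg S_in_DE tests_dense_DE DE_norm_mono)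

lemma defines_dist_tests:
  "defines_dist f (restrict_form L) \<Longrightarrow> g \<in> test_functions \<Longrightarrow> L (schwartz_dist g) = (LINT x|lborel. f x * g x)"
  unfolding defines_dist_def using test_schwartz[of g] by (auto simp: restrict_form_def)

lemma form_of_E:
  assumes "L \<in> continuous_forms E (\<lambda>_. nrm)" "defines_dist f (restrict_form L)"
  shows "form_of E (\<lambda>_. nrm) f = L"
  unfolding form_of_def
  using assms by (intro the_equality) (auto intro!: form_unique_E simp: defines_dist_tests)

lemma form_of_DE:
  assumes "L \<in> continuous_forms (DE E) (DE_norm nrm)" "defines_dist f (restrict_form L)"
  shows "form_of (DE E) (DE_norm nrm) f = L"
  unfolding form_of_def
  using assms by (intro the_equality) (auto intro!: form_unique_DE simp: defines_dist_tests)

lemma in_dual_form: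
  assumes "in_dual E (\<lambda>_. nrm) f"
  shows "form_of E (\<lambda>_. nrm) f \<in> continuous_forms E (\<lambda>_. nrm)" "defines_dist f (restrict_form (form_of E (\<lambda>_. nrm) f))"
proof -
  obtain L where L: "L \<in> continuous_forms E (\<lambda>_. nrm)" "defines_dist f (restrict_form L)" using assms by (auto simp: in_dual_def)
  then show "form_of E (\<lambda>_. nrm) f \<in> continuous_forms E (\<lambda>_. nrm)" "defines_dist f (restrict_form (form_of E (\<lambda>_. nrm) f))"
    by (simp_all add: form_of_E)
qed

lemma E_form_bound:
  assumes "L \<in> continuous_forms E (\<lambda>_. nrm)"
  obtains C where "C \<ge> 0" "\<And>u. u \<in> E \<Longrightarrow> cmod (L u) \<le> C * nrm u"
  using continuous_formsD[OF assms] nrm_nonneg by metis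

text \<open>The form on \<open>E\<close> restricted to \<open>DE E\<close> is continuous already for
  the norm of order 0. A slice is therefore represented on both spaces by one functional.\<close>

lemma form_of_DE_restrict:
  assumes L: "L \<in> continuous_forms E (\<lambda>_. nrm)" and f: "defines_dist f (restrict_form L)"
  shows "form_of (DE E) (DE_norm nrm) f = (\<lambda>u. if u \<in> DE E then L u else 0)" (is "_ = ?L")
    and "(\<lambda>u. if u \<in> DE E then L u else 0) \<in> continuous_forms (DE E) (DE_norm nrm)"
proof -
  have lin: "L \<in> linear_forms E" using L by (simp add: continuous_forms_def)
  obtain C where C: "C \<ge> 0" "\<And>u. u \<in> E \<Longrightarrow> cmod (L u) \<le> C * nrm u" by (rule E_form_bound[OF L]) blast
  have "?L \<in> linear_forms (DE E)"
    using linear_formsD[OF lin] by (auto simp: linear_forms_def DE_add DE_cmult DE_E)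
  moreover have "cmod (?L u) \<le> C * DE_norm nrm 0 u" if "u \<in> DE E" for u
    using that order_trans[OF C(2)[OF DE_E[OF that]] mult_left_mono[OF nrm_le_DE_norm C(1)]] by simp
  ultimately show cont: "?L \<in> continuous_forms (DE E) (DE_norm nrm)" unfolding continuous_forms_def by blast
  have "restrict_form ?L = restrict_form L" by (auto simp: restrict_form_def S_in_DE fun_eq_iff)
  then show "form_of (DE E) (DE_norm nrm) f = ?L" using f by (intro form_of_DE cont) simp
qed

text \<open>A set of functionals that is bounded on bounded sets is equicontinuous, because \<open>D\<^sub>E\<close> is
  metrizable: otherwise normalised counterexamples \<open>u\<^sub>N\<close> with \<open>p\<^sub>N u\<^sub>N \<le> 1\<close> form a bounded set.\<close>

lemma strongly_bounded_equicontinuous: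
  assumes H: "strongly_bounded (DE E) (DE_norm nrm) H"
  shows "\<exists>N. \<exists>C\<ge>0. \<forall>L\<in>H. \<forall>u\<in>DE E. cmod (L u) \<le> C * DE_norm nrm N u"
proof (rule ccontr)
  assume no: "\<not> ?thesis"
  have Hc: "H \<subseteq> continuous_forms (DE E) (DE_norm nrm)"
    and Hb: "\<And>B. bounded_subset (DE E) (DE_norm nrm) B \<Longrightarrow> \<exists>C. \<forall>L\<in>H. \<forall>u\<in>B. cmod (L u) \<le> C"
    using H by (auto simp: strongly_bounded_def)
  have "\<exists>v\<in>DE E. DE_norm nrm N v \<le> 1 \<and> (\<exists>L\<in>H. cmod (L v) > real N)" for N
  proof -
    have "\<not> (\<forall>L\<in>H. \<forall>u\<in>DE E. cmod (L u) \<le> real N * DE_norm nrm N u)"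
    proof
      assume "\<forall>L\<in>H. \<forall>u\<in>DE E. cmod (L u) \<le> real N * DE_norm nrm N u"
      then have "\<exists>C\<ge>0. \<forall>L\<in>H. \<forall>u\<in>DE E. cmod (L u) \<le> C * DE_norm nrm N u" by (intro exI[of _ "real N"]) simp
      then show False using no by (elim notE) (rule exI[of _ N])
    qed
    then obtain L u where L: "L \<in> H" "u \<in> DE E" "cmod (L u) > real N * DE_norm nrm N u" by (auto simp: not_le)
    have lin: "L \<in> linear_forms (DE E)" using L(1) Hc by (auto simp: continuous_forms_def)
    have pos: "DE_norm nrm N u > 0"
    proof (rule ccontr)
      assume "\<not> DE_norm nrm N u > 0"
      then have "nrm u = 0" using nrm_le_DE_norm[of u N] nrm_nonneg[OF DE_E[OF L(2)]] by linarith
      then have u0: "u = (\<lambda>_. 0)" using nrm_eq_0[OF DE_E[OF L(2)]] by simp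
      have "L (\<lambda>p. 0 * u p) = 0 * L u" by (rule linear_formsD(3)[OF lin L(2)])
      then have "L u = 0" by (simp add: u0)
      then show False using L(3) DE_norm_nonneg[OF L(2), of N] by (simp add: mult_less_0_iff)
    qed
    define c where "c = complex_of_real (1 / DE_norm nrm N u)"
    have cc: "cmod c = 1 / DE_norm nrm N u" unfolding c_def norm_of_real using pos by simp
    have "DE_norm nrm N (\<lambda>p. c * u p) \<le> 1" using DE_norm_cmult[OF L(2), of N c] pos by (simp add: cc)
    moreover have "cmod (L (\<lambda>p. c * u p)) > real N"
      using L(3) pos by (simp add: linear_formsD(3)[OF lin L(2)] norm_mult cc pos_less_divide_eq)
    ultimately show ?thesis using DE_cmult[OF L(2)] L(1) by (intro bexI[of _ "\<lambda>p. c * u p"]) auto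
  qed
  then have "\<forall>N. \<exists>v. v \<in> DE E \<and> DE_norm nrm N v \<le> 1 \<and> (\<exists>L\<in>H. cmod (L v) > real N)" by blast
  from choice[OF this] obtain v where v: "\<forall>N. v N \<in> DE E \<and> DE_norm nrm N (v N) \<le> 1 \<and> (\<exists>L\<in>H. cmod (L (v N)) > real N)"
    by (elim exE) (rule that)
  have "bounded_subset (DE E) (DE_norm nrm) (range v)"
    unfolding bounded_subset_def
  proof (intro conjI allI)
    show "range v \<subseteq> DE E" using v by blast
    fix M
    \<comment> \<open>For a fixed order \<open>M\<close> only the finitely many \<open>v k\<close>
      with \<open>k \<le> M\<close> can have norm above 1; for later \<open>k\<close> the norm of
      order \<open>M\<close> is below that of order \<open>k\<close>.\<close>
    define C where "C = Max ((\<lambda>k. DE_norm nrm M (v k)) ` {..M})"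
    have "DE_norm nrm M (v k) \<le> max C 1" for k
    proof (cases "k \<le> M")
      case True
      then have "DE_norm nrm M (v k) \<le> C" unfolding C_def by (intro Max_ge) auto
      then show ?thesis by simp
    next
      case False
      then have "DE_norm nrm M (v k) \<le> DE_norm nrm k (v k)" by (intro DE_norm_mono) simp
      also have "\<dots> \<le> 1" using v by blast
      finally show ?thesis by simp
    qed
    then show "\<exists>C. \<forall>u\<in>range v. DE_norm nrm M u \<le> C" by (intro exI[of _ "max C 1"]) simp
  qed
  from Hb[OF this] obtain C where C: "\<forall>L\<in>H. \<forall>u\<in>range v. cmod (L u) \<le> C" by blast
  obtain N where N: "C \<le> real N" using real_arch_simple by blast
  have "\<exists>L\<in>H. cmod (L (v N)) > real N" using v by simp
  then obtain L where L: "L \<in> H" "cmod (L (v N)) > real N" by (elim bexE) (rule that)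
  have "cmod (L (v N)) \<le> C" using C L(1) by simp
  then show False using L(2) N by linarith
qed

lemma equicontinuous_strongly_bounded:
  assumes "H \<subseteq> continuous_forms (DE E) (DE_norm nrm)" "C \<ge> 0" "\<And>L u. L \<in> H \<Longrightarrow> u \<in> DE E \<Longrightarrow> cmod (L u) \<le> C * DE_norm nrm N u"
  shows "strongly_bounded (DE E) (DE_norm nrm) H"
  unfolding strongly_bounded_def
proof (intro conjI allI impI assms(1))
  fix B assume B: "bounded_subset (DE E) (DE_norm nrm) B"
  then obtain D where D: "\<forall>u\<in>B. DE_norm nrm N u \<le> D" unfolding bounded_subset_def by blast
  have "cmod (L u) \<le> C * D" if "L \<in> H" "u \<in> B" for L u
  proof -
    have "u \<in> DE E" using B that(2) unfolding bounded_subset_def by blast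
    then show ?thesis using order_trans[OF assms(3)[OF that(1)] mult_left_mono[OF D[rule_format, OF that(2)] assms(2)]] by blast
  qed
  then show "\<exists>C. \<forall>L\<in>H. \<forall>u\<in>B. cmod (L u) \<le> C" by blast
qed

lemma restrict_form_tempered:
  assumes L: "L \<in> continuous_forms E (\<lambda>_. nrm)" shows "restrict_form L \<in> tempered"
proof -
  have lin: "L \<in> linear_forms E" using L by (simp add: continuous_forms_def)
  obtain C where C: "C \<ge> 0" "\<And>u. u \<in> E \<Longrightarrow> cmod (L u) \<le> C * nrm u" by (rule E_form_bound[OF L]) blast
  obtain N D where D: "D \<ge> 0" "\<And>f. f \<in> schwartz \<Longrightarrow> nrm (schwartz_dist f) \<le> D * schwartz_seminorm N f" by (rule S_bound) blast
  have "cmod (restrict_form L f) \<le> (C * D) * schwartz_seminorm N f" if f: "f \<in> schwartz" for f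
    using order_trans[OF C(2)[OF S_in[OF f]] mult_left_mono[OF D(2)[OF f] C(1)]] f by (simp add: restrict_form_def mult.assoc)
  moreover have "restrict_form L \<in> linear_forms schwartz"
    unfolding linear_forms_def restrict_form_def using linear_formsD[OF lin]
    by (auto simp: schwartz_dist_add schwartz_dist_cmult schwartz_add schwartz_cmult S_in)
  ultimately show ?thesis unfolding tempered_def continuous_forms_def by blast
qed

text \<open>Extension by continuity from the dense set of test functions. The bound \<open>C\<close>
  is kept exactly, because it becomes the bound on the dual norm of the slice.\<close>

lemma extend_form:
  fixes f :: "real^'n \<Rightarrow> complex"
  assumes cf: "continuous_on UNIV f" and growth: "\<And>x. cmod (f x) \<le> M * (1 + norm x) ^ m"
    and C0: "C \<ge> 0" and C: "\<And>g. g \<in> test_functions \<Longrightarrow> cmod (LINT x|lborel. f x * g x) \<le> C * nrm (schwartz_dist g)"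
  shows "\<exists>L\<in>continuous_forms E (\<lambda>_. nrm). defines_dist f (restrict_form L) \<and> (\<forall>u\<in>E. cmod (L u) \<le> C * nrm u)"
proof -
  define l where "l = (\<lambda>g. LINT x|lborel. f x * g x)"
  have int: "integrable lborel (\<lambda>x. f x * g x)" if "g \<in> schwartz" for g
    by (rule schwartz_growth_integrable[OF borel_measurable_continuous_onI[OF cf] growth that])
  have l_add: "l (\<lambda>x. g x + h x) = l g + l h" if "g \<in> schwartz" "h \<in> schwartz" for g h
    unfolding l_def distrib_left by (rule Bochner_Integration.integral_add[OF int[OF that(1)] int[OF that(2)]])
  have l_cmult: "l (\<lambda>x. c * g x) = c * l g" for c g
    unfolding l_def mult.left_commute[of _ c] by simp
  note ts = test_schwartz
  have l_diff: "cmod (l g - l h) \<le> C * nrm (\<lambda>p. schwartz_dist g p - schwartz_dist h p)" if "g \<in> test_functions" "h \<in> test_functions" for g h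
  proof -
    have h': "(\<lambda>x. (-1) * h x) \<in> test_functions" by (rule test_functions_cmult[OF that(2)])
    have "cmod (l (\<lambda>x. g x + (-1) * h x)) \<le> C * nrm (schwartz_dist (\<lambda>x. g x + (-1) * h x))"
      unfolding l_def by (rule C[OF test_functions_add[OF that(1) h']])
    then show ?thesis
      unfolding l_add[OF ts[OF that(1)] ts[OF h']] l_cmult schwartz_dist_add[OF ts[OF that(1)] ts[OF h']] schwartz_dist_cmult by simp
  qed
  \<comment> \<open>An approximating sequence of test functions is fixed for every \<open>u\<close>;
    \<open>L u\<close> is the limit of the integrals along it.\<close>
  have "\<forall>u. \<exists>G. u \<in> E \<longrightarrow> (\<forall>k. G k \<in> test_functions \<and> nrm (\<lambda>p. u p - schwartz_dist (G k) p) < 1 / real (Suc k))"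
  proof
    fix u
    show "\<exists>G. u \<in> E \<longrightarrow> (\<forall>k. G k \<in> test_functions \<and> nrm (\<lambda>p. u p - schwartz_dist (G k) p) < 1 / real (Suc k))"
    proof (cases "u \<in> E")
      case True
      then have "\<forall>k. \<exists>g. g \<in> test_functions \<and> nrm (\<lambda>p. u p - schwartz_dist g p) < 1 / real (Suc k)"
        using tests_dense_E[OF True, of "1 / real (Suc k)" for k] by (simp add: Bex_def)
      from choice[OF this] show ?thesis by blast
    qed simp
  qed
  from choice[OF this] obtain G where G: "\<forall>u. u \<in> E \<longrightarrow> (\<forall>k. G u k \<in> test_functions \<and> nrm (\<lambda>p. u p - schwartz_dist (G u k) p) < 1 / real (Suc k))"
    by (elim exE) (rule that)
  have inv: "(\<lambda>k. 1 / real (Suc k)) \<longlonglongrightarrow> 0" using LIMSEQ_inverse_real_of_nat by (simp add: inverse_eq_divide)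
  have near: "cmod (l g - l (G u k)) \<le> C * (nrm (\<lambda>p. schwartz_dist g p - u p) + 1 / real (Suc k))" if u: "u \<in> E" and g: "g \<in> test_functions" for u g k
  proof -
    have Gk: "G u k \<in> test_functions" "nrm (\<lambda>p. u p - schwartz_dist (G u k) p) < 1 / real (Suc k)" using G u by auto
    have "nrm (\<lambda>p. schwartz_dist g p - schwartz_dist (G u k) p) \<le> nrm (\<lambda>p. schwartz_dist g p - u p) + 1 / real (Suc k)"
      using nrm_triangle3[OF S_in[OF ts[OF g]] u S_in[OF ts[OF Gk(1)]]] Gk(2) by linarith
    then show ?thesis by (rule order_trans[OF l_diff[OF g Gk(1)] mult_left_mono[OF _ C0]])
  qed
  define L where "L = (\<lambda>u. if u \<in> E then lim (\<lambda>k. l (G u k)) else 0)"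
  have lim: "(\<lambda>k. l (G u k)) \<longlonglongrightarrow> L u" if u: "u \<in> E" for u
  proof -
    have "Cauchy (\<lambda>k. l (G u k))"
    proof (rule metric_CauchyI)
      fix e :: real assume e: "e > 0"
      define a where "a = e / (C + 1)"
      have "a / 2 > 0" using e C0 by (simp add: a_def)
      then obtain N where N: "1 / real (Suc N) < a / 2" using nat_approx_posE by blast
      have inv_le: "1 / real (Suc j) \<le> a / 2" if "j \<ge> N" for j
        using order_trans[OF _ less_imp_le[OF N], of "1 / real (Suc j)"] that by (simp add: frac_le)
      have "dist (l (G u j)) (l (G u k)) < e" if jk: "j \<ge> N" "k \<ge> N" for j k
      proof -
        have Gj: "G u j \<in> test_functions" "nrm (\<lambda>p. u p - schwartz_dist (G u j) p) < 1 / real (Suc j)" using G u by auto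
        have "nrm (\<lambda>p. schwartz_dist (G u j) p - u p) \<le> a / 2"
          unfolding nrm_minus_commute[OF u S_in[OF ts[OF Gj(1)]], symmetric]
          by (rule order_trans[OF less_imp_le[OF Gj(2)] inv_le[OF jk(1)]])
        from add_mono[OF this inv_le[OF jk(2)]]
        have "nrm (\<lambda>p. schwartz_dist (G u j) p - u p) + 1 / real (Suc k) \<le> e / (C + 1)"
          unfolding a_def field_sum_of_halves .
        then have "dist (l (G u j)) (l (G u k)) \<le> C * (e / (C + 1))"
          unfolding dist_norm by (rule order_trans[OF near[OF u Gj(1), of k] mult_left_mono[OF _ C0]])
        also have "\<dots> = e * (C / (C + 1))" by simp
        also have "\<dots> < e * 1" using C0 e by (intro mult_strict_left_mono) auto
        finally show ?thesis by simp
      qed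
      then show "\<exists>N. \<forall>j\<ge>N. \<forall>k\<ge>N. dist (l (G u j)) (l (G u k)) < e" by blast
    qed
    then show ?thesis using u by (simp add: L_def Cauchy_convergent_iff convergent_LIMSEQ_iff)
  qed
  \<comment> \<open>The estimate compares \<open>L u\<close> with the integral of any test function
    near \<open>u\<close>, not only of those in the chosen sequence. Linearity and the bound of
    \<open>L\<close> follow from it by approximation.\<close>
  have key: "cmod (l g - L u) \<le> C * nrm (\<lambda>p. schwartz_dist g p - u p)" if u: "u \<in> E" and g: "g \<in> test_functions" for u g
  proof -
    have "(\<lambda>k. cmod (l g - l (G u k))) \<longlonglongrightarrow> cmod (l g - L u)" by (intro tendsto_intros lim u)
    moreover have "(\<lambda>k. C * (nrm (\<lambda>p. schwartz_dist g p - u p) + 1 / real (Suc k))) \<longlonglongrightarrow> C * (nrm (\<lambda>p. schwartz_dist g p - u p) + 0)"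
      by (intro tendsto_intros inv)
    ultimately show ?thesis using near[OF u g] by (intro LIMSEQ_le[where X = "\<lambda>k. cmod (l g - l (G u k))"]) auto
  qed
  have small: "\<exists>g\<in>test_functions. nrm (\<lambda>p. schwartz_dist g p - u p) < e" if u: "u \<in> E" and e: "e > 0" for u e
    using tests_dense_E[OF u e] nrm_minus_commute[OF u S_in[OF ts]] by auto
  have zeroI: "a = 0" if "\<And>e. e > 0 \<Longrightarrow> cmod a \<le> K * e" "K \<ge> 0" for a K
  proof -
    have "cmod a \<le> 0"
    proof (rule field_le_epsilon)
      fix e :: real assume e: "e > 0"
      have "cmod a \<le> K * (e / (K + 1))" using e that(2) by (intro that(1)) simp
      also have "\<dots> = e * (K / (K + 1))" by simp
      also have "\<dots> \<le> e * 1" using e that(2) by (intro mult_left_mono) auto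
      finally show "cmod a \<le> 0 + e" by simp
    qed
    then show ?thesis by simp
  qed
  have L_test: "L (schwartz_dist g) = l g" if g: "g \<in> test_functions" for g
    using key[OF S_in[OF ts[OF g]] g] nrm_eq_0[OF E_zero] by simp
  have L_add: "L (\<lambda>p. u p + v p) = L u + L v" if u: "u \<in> E" and v: "v \<in> E" for u v
  proof -
    have "L (\<lambda>p. u p + v p) - (L u + L v) = 0"
    proof (rule zeroI[where K = "4 * C"])
      fix e :: real assume e: "e > 0"
      obtain g where g: "g \<in> test_functions" "nrm (\<lambda>p. schwartz_dist g p - u p) < e" using small[OF u e] by blast
      obtain h where h: "h \<in> test_functions" "nrm (\<lambda>p. schwartz_dist h p - v p) < e" using small[OF v e] by blast
      have gh: "(\<lambda>x. g x + h x) \<in> test_functions" by (rule test_functions_add[OF g(1) h(1)])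
      have "nrm (\<lambda>p. schwartz_dist (\<lambda>x. g x + h x) p - (u p + v p)) \<le> nrm (\<lambda>p. schwartz_dist g p - u p) + nrm (\<lambda>p. schwartz_dist h p - v p)"
        using nrm_add[OF E_diff[OF S_in[OF ts[OF g(1)]] u] E_diff[OF S_in[OF ts[OF h(1)]] v]]
        by (simp add: schwartz_dist_add ts g h algebra_simps)
      then have "C * nrm (\<lambda>p. schwartz_dist (\<lambda>x. g x + h x) p - (u p + v p)) \<le> C * (2 * e)"
        using g(2) h(2) by (intro mult_left_mono C0) linarith
      then have 1: "cmod (l (\<lambda>x. g x + h x) - L (\<lambda>p. u p + v p)) \<le> C * (2 * e)"
        using key[OF E_add[OF u v] gh] by linarith
      have 2: "cmod (l g - L u) \<le> C * e" using order_trans[OF key[OF u g(1)] mult_left_mono[OF less_imp_le[OF g(2)] C0]] .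
      have 3: "cmod (l h - L v) \<le> C * e" using order_trans[OF key[OF v h(1)] mult_left_mono[OF less_imp_le[OF h(2)] C0]] .
      have "L (\<lambda>p. u p + v p) - (L u + L v) = (l g - L u) + (l h - L v) - (l (\<lambda>x. g x + h x) - L (\<lambda>p. u p + v p))"
        by (simp add: l_add ts g h)
      then have "cmod (L (\<lambda>p. u p + v p) - (L u + L v)) \<le> cmod (l g - L u) + cmod (l h - L v) + cmod (l (\<lambda>x. g x + h x) - L (\<lambda>p. u p + v p))"
        by (simp only:) (rule order_trans[OF norm_triangle_ineq4 add_right_mono[OF norm_triangle_ineq]])
      then show "cmod (L (\<lambda>p. u p + v p) - (L u + L v)) \<le> 4 * C * e" using 1 2 3 by (simp add: algebra_simps)
    qed (use C0 in simp)
    then show ?thesis by simp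
  qed
  have L_cmult: "L (\<lambda>p. c * u p) = c * L u" if u: "u \<in> E" for c u
  proof -
    have "L (\<lambda>p. c * u p) - c * L u = 0"
    proof (rule zeroI[where K = "2 * C * cmod c"])
      fix e :: real assume e: "e > 0"
      obtain g where g: "g \<in> test_functions" "nrm (\<lambda>p. schwartz_dist g p - u p) < e" using small[OF u e] by blast
      have "nrm (\<lambda>p. schwartz_dist (\<lambda>x. c * g x) p - c * u p) = cmod c * nrm (\<lambda>p. schwartz_dist g p - u p)"
        using nrm_cmult[OF E_diff[OF S_in[OF ts[OF g(1)]] u], of c] by (simp add: schwartz_dist_cmult right_diff_distrib)
      also have "\<dots> \<le> cmod c * e" using g(2) by (intro mult_left_mono) auto
      finally have "C * nrm (\<lambda>p. schwartz_dist (\<lambda>x. c * g x) p - c * u p) \<le> C * (cmod c * e)" by (intro mult_left_mono C0)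
      then have 1: "cmod (c * l g - L (\<lambda>p. c * u p)) \<le> C * (cmod c * e)"
        using key[OF E_cmult[OF u] test_functions_cmult[OF g(1)], of c c] by (simp add: l_cmult)
      have "cmod (l g - L u) \<le> C * e" using order_trans[OF key[OF u g(1)] mult_left_mono[OF less_imp_le[OF g(2)] C0]] .
      then have 2: "cmod (c * (l g - L u)) \<le> cmod c * (C * e)" unfolding norm_mult by (intro mult_left_mono) auto
      have "L (\<lambda>p. c * u p) - c * L u = c * (l g - L u) - (c * l g - L (\<lambda>p. c * u p))" by (simp add: algebra_simps)
      then have "cmod (L (\<lambda>p. c * u p) - c * L u) \<le> cmod (c * (l g - L u)) + cmod (c * l g - L (\<lambda>p. c * u p))"
        by (simp only:) (rule norm_triangle_ineq4)
      then show "cmod (L (\<lambda>p. c * u p) - c * L u) \<le> 2 * C * cmod c * e" using 1 2 by (simp add: mult_ac)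
    qed (use C0 in simp)
    then show ?thesis by simp
  qed
  have L_bound: "cmod (L u) \<le> C * nrm u" if u: "u \<in> E" for u
  proof (rule field_le_epsilon)
    fix e :: real assume e: "e > 0"
    have "e / (2 * C + 1) > 0" using e C0 by simp
    from small[OF u this] obtain g where g: "g \<in> test_functions" "nrm (\<lambda>p. schwartz_dist g p - u p) < e / (2 * C + 1)" by blast
    have "nrm (schwartz_dist g) \<le> nrm (\<lambda>p. schwartz_dist g p - u p) + nrm u"
      using nrm_add[OF E_diff[OF S_in[OF ts[OF g(1)]] u] u] by simp
    then have "cmod (l g) \<le> C * (nrm (\<lambda>p. schwartz_dist g p - u p) + nrm u)"
      unfolding l_def by (rule order_trans[OF C[OF g(1)] mult_left_mono[OF _ C0]])
    moreover have "cmod (L u) \<le> cmod (l g) + cmod (l g - L u)" using norm_triangle_ineq4[of "l g" "l g - L u"] by simp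
    ultimately have "cmod (L u) \<le> C * nrm u + (2 * C) * nrm (\<lambda>p. schwartz_dist g p - u p)" using key[OF u g(1)] by (simp add: algebra_simps)
    also have "\<dots> \<le> C * nrm u + (2 * C) * (e / (2 * C + 1))" using g(2) C0 by (intro add_left_mono mult_left_mono) auto
    also have "(2 * C) * (e / (2 * C + 1)) = e * ((2 * C) / (2 * C + 1))" by simp
    also have "\<dots> \<le> e * 1" using e C0 by (intro mult_left_mono) auto
    finally show "cmod (L u) \<le> C * nrm u + e" by simp
  qed
  have Lc: "L \<in> continuous_forms E (\<lambda>_. nrm)"
  proof -
    have "L u = 0" if "u \<notin> E" for u using that by (simp add: L_def)
    then have "L \<in> linear_forms E" unfolding linear_forms_def using L_add L_cmult by simp
    moreover have "\<forall>u\<in>E. cmod (L u) \<le> C * nrm u" using L_bound by simp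
    ultimately show ?thesis unfolding continuous_forms_def by blast
  qed
  have "defines_dist f (restrict_form L)"
    unfolding defines_dist_def
  proof (intro conjI allI impI ballI restrict_form_tempered Lc)
    show "set_integrable lborel K f" if "compact K" for K
      unfolding set_integrable_def using that continuous_on_subset[OF cf] by (intro borel_integrable_compact) auto
    show "restrict_form L g = (LINT x|lborel. f x * g x)" if "g \<in> test_functions" for g
      using L_test[OF that] ts[OF that] by (simp add: restrict_form_def l_def)
  qed
  then have "defines_dist f (restrict_form L) \<and> (\<forall>u\<in>E. cmod (L u) \<le> C * nrm u)" using L_bound by simp
  then show ?thesis by (rule bexI[OF _ Lc])
qed

end

section \<open>Gaussian transforms\<close>

text \<open>The radius \<open>2 r\<close> is that of the ball of heights required by
  \<open>mean_value_bound\<close>; the compact \<open>K'\<close> holds the heights within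
  \<open>r\<close>, over which slices are averaged there.\<close>

lemma compact_thickening:
  fixes V :: "'a::euclidean_space set"
  assumes K: "compact K" "K \<subseteq> V" and V: "open V"
  obtains r K' where "r > 0" "compact K'" "K' \<subseteq> V" "\<And>y. y \<in> K \<Longrightarrow> cball y r \<subseteq> K'" "\<And>y. y \<in> K \<Longrightarrow> ball y (2 * r) \<subseteq> V"
proof -
  obtain \<epsilon> where e: "\<epsilon> > 0" "(\<Union>x\<in>K. ball x \<epsilon>) \<subseteq> V"
    using compact_subset_open_imp_ball_epsilon_subset[OF K(1) V K(2)] by metis
  let ?K = "{x + y | x y. x \<in> K \<and> y \<in> cball 0 (\<epsilon> / 2)}"
  have sub: "cball y (\<epsilon> / 2) \<subseteq> ?K" if "y \<in> K" for y
  proof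
    fix w assume "w \<in> cball y (\<epsilon> / 2)"
    then have "w = y + (w - y) \<and> y \<in> K \<and> w - y \<in> cball 0 (\<epsilon> / 2)" using that by (simp add: dist_norm norm_minus_commute)
    then show "w \<in> ?K" by blast
  qed
  have "?K \<subseteq> V"
  proof
    fix w assume "w \<in> ?K"
    then obtain x y where "w = x + y" "x \<in> K" "norm y \<le> \<epsilon> / 2" by auto
    then have "w \<in> ball x \<epsilon>" using e(1) by (simp add: dist_norm)
    then show "w \<in> V" using e(2) \<open>x \<in> K\<close> by blast
  qed
  then show ?thesis
    using e compact_sums[OF K(1) compact_cball, of 0 "\<epsilon> / 2"] sub by (intro that[of "\<epsilon> / 2" ?K]) auto
qed

text \<open>The compact set \<open>K - V1\<close> lies in \<open>V2\<close>. A thickening of it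
  becomes \<open>K2\<close>, and removing the open thickening from \<open>K\<close> leaves a compact
  part inside \<open>V1\<close>.\<close>

lemma compact_split:
  fixes V1 V2 :: "'a::euclidean_space set"
  assumes V: "open V1" "open V2" and K: "compact K" "K \<subseteq> V1 \<union> V2"
  obtains K1 K2 where "compact K1" "K1 \<subseteq> V1" "compact K2" "K2 \<subseteq> V2" "K \<subseteq> K1 \<union> K2"
proof -
  have "compact (K - V1)" "K - V1 \<subseteq> V2" using K V by (auto intro: compact_diff)
  then obtain r K2 where r: "r > 0" "compact K2" "K2 \<subseteq> V2" "\<And>y. y \<in> K - V1 \<Longrightarrow> cball y r \<subseteq> K2"
    by (rule compact_thickening[OF _ _ V(2)]) blast
  let ?B = "\<Union>y\<in>K - V1. ball y r"
  have "compact (K - ?B)" using K(1) by (intro compact_diff open_UN) auto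
  moreover have "K - ?B \<subseteq> V1" using r(1) by auto
  moreover have "?B \<subseteq> K2" using r(4) ball_subset_cball by blast
  then have "K \<subseteq> (K - ?B) \<union> K2" by blast
  ultimately show ?thesis using r(2,3) by (intro that)
qed

lemma gauss_even: "gauss e (- w) = gauss e w"
  by (simp add: gauss_def)

lemma gauss_dilate:
  assumes "e > 0" shows "gauss e (cv (e *\<^sub>R t) 0) = gauss 1 (cv t 0)"
proof -
  have "(\<Sum>i\<in>UNIV. (cv (e *\<^sub>R t) 0 $ i)\<^sup>2) = of_real (e\<^sup>2) * (\<Sum>i\<in>UNIV. (cv t 0 $ i)\<^sup>2)"
    unfolding sum_distrib_left by (intro sum.cong) (auto simp: cv_def Complex_eq power_mult_distrib)
  then show ?thesis using assms by (simp add: gauss_def)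
qed

text \<open>With both heights bounded by \<open>M\<close> the imaginary part of the argument is at
  most \<open>2 M\<close>, where Gaussians decay; \<open>weight_shift_power\<close> moves the weight
  from \<open>x\<close> to \<open>z\<close>.\<close>

lemma gauss_decay:
  assumes e: "e > 0"
  obtains C where "C \<ge> 0" "\<And>x y z::complex^'n::finite. norm y \<le> M \<Longrightarrow> norm (im_vec z) \<le> M \<Longrightarrow>
    (1 + norm x) ^ N * cmod (gauss e (z - cv x y)) \<le> C * (1 + norm z) ^ N"
proof -
  have "\<exists>C\<ge>0. \<forall>w::complex^'n. norm (im_vec w) \<le> 2 * M \<longrightarrow> (1 + norm w) ^ N * cmod (gauss e w) \<le> C"
    using gauss_family_decay[OF gauss_family.base e, of "2 * M"] by blast
  then obtain C where C: "C \<ge> 0" "\<And>w::complex^'n. norm (im_vec w) \<le> 2 * M \<Longrightarrow> (1 + norm w) ^ N * cmod (gauss e w) \<le> C" by blast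
  have "(1 + norm x) ^ N * cmod (gauss e (z - cv x y)) \<le> C * (1 + norm z) ^ N" if y: "norm y \<le> M" and z: "norm (im_vec z) \<le> M" for x y and z :: "complex^'n"
  proof -
    have "norm (im_vec (z - cv x y)) \<le> 2 * M" using y z norm_triangle_ineq4[of "im_vec z" y] by (simp add: imv_diff)
    note b = C(2)[OF this]
    have "norm x ^ 2 \<le> norm (cv x y) ^ 2" by (simp add: norm_cv_power2)
    then have "norm x \<le> norm (cv x y)" by (rule power2_le_imp_le) simp
    then have "(1 + norm x) ^ N \<le> (1 + norm (- cv x y)) ^ N" by (intro power_mono) auto
    also have "\<dots> \<le> (1 + norm (- cv x y + z)) ^ N * (1 + norm z) ^ N" by (rule weight_shift_power)
    finally have "(1 + norm x) ^ N * cmod (gauss e (z - cv x y)) \<le> (1 + norm (z - cv x y)) ^ N * (1 + norm z) ^ N * cmod (gauss e (z - cv x y))"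
      by (intro mult_right_mono) auto
    also have "\<dots> = ((1 + norm (z - cv x y)) ^ N * cmod (gauss e (z - cv x y))) * (1 + norm z) ^ N" by (simp only: mult_ac)
    also have "\<dots> \<le> C * (1 + norm z) ^ N" by (intro mult_right_mono b) auto
    finally show ?thesis .
  qed
  then show ?thesis using that[of C] C(1) by blast
qed

lemma gauss_shift_lineholo': "lineholo (\<lambda>z. gauss e (a - z)) U" for a :: "complex^'n::finite"
proof -
  have "(\<lambda>z. gauss e (a - z)) = (\<lambda>z. gauss e (z - a))" using gauss_even[of e "z - a" for z] by simp
  then show ?thesis using gauss_shift_lineholo by simp
qed

text \<open>Convolution of the slice at height \<open>b\<close> with a Gaussian, evaluated at a
  complex point. The height enters the Gaussian so that the integral is one over the contour at
  height \<open>b\<close>.\<close>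

definition gauss_transform :: "(real^'n::finite \<Rightarrow> complex) \<Rightarrow> real^'n \<Rightarrow> real \<Rightarrow> complex^'n \<Rightarrow> complex" where
  "gauss_transform g b e z = (LINT t|lborel. g t * gauss e (z - cv t b))"

text \<open>What is retained of a single slice: continuity and a polynomial bound already make its
  Gaussian transform entire.\<close>

locale slowly_growing =
  fixes g :: "real^'n::finite \<Rightarrow> complex" and C :: real and m :: nat
  assumes continuous: "continuous_on UNIV g" and growth: "\<And>t. cmod (g t) \<le> C * (1 + norm t) ^ m"
begin

lemma C_nonneg: "C \<ge> 0"
  using order_trans[OF norm_ge_zero growth[of 0]] by simp

lemma integrand_measurable: "(\<lambda>t. g t * gauss e (z - cv t b)) \<in> borel_measurable borel"
  by (intro borel_measurable_continuous_onI continuous_intros continuous)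

lemma integrand_bound:
  assumes e: "e > 0"
  obtains D where "D \<ge> 0" "\<And>z t. norm (im_vec z) \<le> M \<Longrightarrow>
    cmod (g t * gauss e (z - cv t b)) \<le> D * (1 + norm z) ^ (m + (CARD('n) + 2)) * (1 / (1 + norm t) ^ (CARD('n) + 2))"
proof -
  let ?N = "CARD('n) + 2"
  obtain D where D: "D \<ge> 0" "\<And>x y z::complex^'n. norm y \<le> max M (norm b) \<Longrightarrow> norm (im_vec z) \<le> max M (norm b) \<Longrightarrow>
    (1 + norm x) ^ (m + ?N) * cmod (gauss e (z - cv x y)) \<le> D * (1 + norm z) ^ (m + ?N)"
    by (rule gauss_decay[OF e]) blast
  have "cmod (g t * gauss e (z - cv t b)) \<le> C * D * (1 + norm z) ^ (m + ?N) * (1 / (1 + norm t) ^ ?N)"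
    if "norm (im_vec z) \<le> M" for z t
  proof -
    have "cmod (g t * gauss e (z - cv t b)) * (1 + norm t) ^ ?N \<le> (C * (1 + norm t) ^ m * cmod (gauss e (z - cv t b))) * (1 + norm t) ^ ?N"
      unfolding norm_mult by (intro mult_right_mono growth) auto
    also have "\<dots> = C * ((1 + norm t) ^ (m + ?N) * cmod (gauss e (z - cv t b)))" by (simp only: power_add mult_ac)
    also have "\<dots> \<le> C * (D * (1 + norm z) ^ (m + ?N))" using that by (intro mult_left_mono D C_nonneg) auto
    finally show ?thesis using weight_pos[of t ?N] by (simp only: mult_1_right times_divide_eq_right pos_le_divide_eq mult.assoc)
  qed
  then show ?thesis using that[of "C * D"] D(1) C_nonneg by simp
qed

lemma gauss_transform_growth:
  assumes e: "e > 0" and L: "compact L"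
  shows "\<exists>D. \<forall>y\<in>L. \<forall>x. cmod (gauss_transform g b e (cv x y)) \<le> D * (1 + norm x) ^ (m + (CARD('n) + 2))"
proof -
  let ?N = "CARD('n) + 2" and ?W = "LINT t::real^'n|lborel. 1 / (1 + norm t) ^ (CARD('n) + 2)"
  obtain R where R: "\<forall>y\<in>L. norm y \<le> R" using compact_imp_bounded[OF L] bounded_iff by metis
  obtain D where D: "D \<ge> 0" "\<And>z t. norm (im_vec z) \<le> R \<Longrightarrow>
    cmod (g t * gauss e (z - cv t b)) \<le> D * (1 + norm z) ^ (m + ?N) * (1 / (1 + norm t) ^ ?N)"
    by (rule integrand_bound[OF e]) blast
  have W: "?W \<ge> 0" by simp
  have "cmod (gauss_transform g b e (cv x y)) \<le> D * (1 + R) ^ (m + ?N) * ?W * (1 + norm x) ^ (m + ?N)" if y: "y \<in> L" for x y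
  proof -
    have R0: "R \<ge> 0" using R y norm_ge_zero order_trans by blast
    have "1 + norm (cv x y) \<le> 1 + norm x + R" using norm_cv_le[of x y] R y by force
    also have "\<dots> \<le> (1 + R) * (1 + norm x)" using R0 by (simp add: algebra_simps)
    finally have "(1 + norm (cv x y)) ^ (m + ?N) \<le> ((1 + R) * (1 + norm x)) ^ (m + ?N)" by (intro power_mono) auto
    then have w: "(1 + norm (cv x y)) ^ (m + ?N) \<le> (1 + R) ^ (m + ?N) * (1 + norm x) ^ (m + ?N)" by (simp only: power_mult_distrib)
    have b: "norm (g t * gauss e (cv x y - cv t b)) \<le> D * (1 + norm (cv x y)) ^ (m + ?N) * (1 / (1 + norm t) ^ ?N)" for t
      using R y by (intro D(2)) auto
    have i: "integrable lborel (\<lambda>t::real^'n. D * (1 + norm (cv x y)) ^ (m + ?N) * (1 / (1 + norm t) ^ ?N))"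
      by (intro integrable_mult_right integrable_weight)
    have "integrable lborel (\<lambda>t. g t * gauss e (cv x y - cv t b))"
    proof (rule Bochner_Integration.integrable_bound[OF i])
      show "AE t in lborel. norm (g t * gauss e (cv x y - cv t b)) \<le> norm (D * (1 + norm (cv x y)) ^ (m + ?N) * (1 / (1 + norm t) ^ ?N))"
        unfolding real_norm_def by (intro AE_I2 order_trans[OF b abs_ge_self])
    qed (use integrand_measurable in simp)
    then have "cmod (gauss_transform g b e (cv x y)) \<le> (LINT t::real^'n|lborel. D * (1 + norm (cv x y)) ^ (m + ?N) * (1 / (1 + norm t) ^ ?N))"
      unfolding gauss_transform_def by (intro order_trans[OF integral_norm_bound] integral_mono i integrable_norm b)
    also have "\<dots> = D * (1 + norm (cv x y)) ^ (m + ?N) * ?W" by (simp only: integral_mult_right_zero)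
    also have "\<dots> \<le> D * ((1 + R) ^ (m + ?N) * (1 + norm x) ^ (m + ?N)) * ?W" by (intro mult_right_mono mult_left_mono w D W)
    finally show ?thesis by (simp only: mult_ac)
  qed
  then show ?thesis by blast
qed

lemma gauss_transform_continuous:
  assumes e: "e > 0" shows "continuous_on UNIV (gauss_transform g b e)"
proof (rule continuous_at_imp_continuous_on, rule ballI, unfold continuous_at_sequentially, intro allI impI)
  fix z X assume X: "X \<longlonglongrightarrow> (z :: complex^'n)"
  let ?N = "CARD('n) + 2"
  obtain R where R: "\<And>k. norm (X k) \<le> R" using convergent_imp_Bseq[OF convergentI[OF X]] by (auto simp: Bseq_def)
  have im: "norm (im_vec w) \<le> norm w" for w :: "complex^'n"
    by (rule power2_le_imp_le) (use norm_cv_power2[of "re_vec w" "im_vec w"] in simp_all)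
  obtain D where D: "D \<ge> 0" "\<And>z t. norm (im_vec z) \<le> R \<Longrightarrow>
    cmod (g t * gauss e (z - cv t b)) \<le> D * (1 + norm z) ^ (m + ?N) * (1 / (1 + norm t) ^ ?N)"
    by (rule integrand_bound[OF e]) blast
  show "(gauss_transform g b e \<circ> X) \<longlonglongrightarrow> gauss_transform g b e z"
    unfolding o_def gauss_transform_def
  proof (rule integral_dominated_convergence)
    show "integrable lborel (\<lambda>t::real^'n. D * (1 + R) ^ (m + ?N) * (1 / (1 + norm t) ^ ?N))"
      by (intro integrable_mult_right integrable_weight)
    show "AE t in lborel. (\<lambda>k. g t * gauss e (X k - cv t b)) \<longlonglongrightarrow> g t * gauss e (z - cv t b)"
    proof (intro AE_I2 tendsto_mult tendsto_const)
      fix t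
      have "isCont (\<lambda>w. gauss e (w - cv t b)) z"
        by (rule continuous_on_interior[of UNIV]) (auto intro!: continuous_intros)
      then show "(\<lambda>k. gauss e (X k - cv t b)) \<longlonglongrightarrow> gauss e (z - cv t b)" using X by (rule isCont_tendsto_compose)
    qed
    show "AE t in lborel. norm (g t * gauss e (X k - cv t b)) \<le> D * (1 + R) ^ (m + ?N) * (1 / (1 + norm t) ^ ?N)" for k
    proof (intro AE_I2)
      fix t
      have "norm (g t * gauss e (X k - cv t b)) \<le> D * (1 + norm (X k)) ^ (m + ?N) * (1 / (1 + norm t) ^ ?N)"
        by (rule D(2)[OF order_trans[OF im R]])
      also have "\<dots> \<le> D * (1 + R) ^ (m + ?N) * (1 / (1 + norm t) ^ ?N)"
        using R[of k] by (intro mult_right_mono mult_left_mono power_mono D) auto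
      finally show "norm (g t * gauss e (X k - cv t b)) \<le> D * (1 + R) ^ (m + ?N) * (1 / (1 + norm t) ^ ?N)" .
    qed
  qed (use integrand_measurable in simp_all)
qed

lemma gauss_transform_lineholo:
  assumes e: "e > 0" shows "lineholo (gauss_transform g b e) UNIV"
  unfolding lineholo_def
proof (intro allI)
  fix z v :: "complex^'n"
  let ?N = "CARD('n) + 2"
  have ball: "(\<lambda>\<zeta>. gauss_transform g b e (z + \<zeta> *s v)) holomorphic_on ball 0 r" for r
  proof -
    let ?R = "norm z + r * norm v"
    have im: "norm (im_vec w) \<le> norm w" for w :: "complex^'n"
      by (rule power2_le_imp_le) (use norm_cv_power2[of "re_vec w" "im_vec w"] in simp_all)
    have le: "norm (z + \<zeta> *s v) \<le> ?R" if "\<zeta> \<in> ball 0 r" for \<zeta>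
    proof -
      have "norm (\<zeta> *s v) \<le> r * norm v" unfolding norm_smult using that by (intro mult_right_mono) auto
      then show ?thesis using norm_triangle_ineq[of z "\<zeta> *s v"] by linarith
    qed
    obtain D where D: "D \<ge> 0" "\<And>z t. norm (im_vec z) \<le> ?R \<Longrightarrow>
      cmod (g t * gauss e (z - cv t b)) \<le> D * (1 + norm z) ^ (m + ?N) * (1 / (1 + norm t) ^ ?N)"
      by (rule integrand_bound[OF e]) blast
    have i: "integrable lborel (\<lambda>t::real^'n. D * (1 + ?R) ^ (m + ?N) * (1 / (1 + norm t) ^ ?N))"
      by (intro integrable_mult_right integrable_weight)
    have bd: "cmod (g t * gauss e (z + \<zeta> *s v - cv t b)) \<le> D * (1 + ?R) ^ (m + ?N) * (1 / (1 + norm t) ^ ?N)" if "\<zeta> \<in> ball 0 r" for t \<zeta>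
    proof -
      have "cmod (g t * gauss e (z + \<zeta> *s v - cv t b)) \<le> D * (1 + norm (z + \<zeta> *s v)) ^ (m + ?N) * (1 / (1 + norm t) ^ ?N)"
        by (rule D(2)[OF order_trans[OF im le[OF that]]])
      also have "\<dots> \<le> D * (1 + ?R) ^ (m + ?N) * (1 / (1 + norm t) ^ ?N)"
        using le[OF that] by (intro mult_right_mono mult_left_mono power_mono D) auto
      finally show ?thesis .
    qed
    have hol: "(\<lambda>\<zeta>. g t * gauss e (z + \<zeta> *s v - cv t b)) holomorphic_on ball 0 r" for t
      by (intro holomorphic_intros lineholoD[OF gauss_shift_lineholo[of e "cv t b" UNIV]]) auto
    show ?thesis
      unfolding gauss_transform_def by (rule holomorphic_integral[OF open_ball hol integrand_measurable i bd])
  qed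
  have "(\<lambda>\<zeta>. gauss_transform g b e (z + \<zeta> *s v)) holomorphic_on (\<Union>k::nat. ball 0 (real k))"
    using ball by (intro holomorphic_on_UN_open) auto
  then show "(\<lambda>\<zeta>. gauss_transform g b e (z + \<zeta> *s v)) holomorphic_on {\<zeta>. z + \<zeta> *s v \<in> UNIV}"
    by (rule holomorphic_on_subset) (auto intro: reals_Archimedean2)
qed

end

text \<open>At a point of height \<open>y\<close> the Gaussian has the real argument
  \<open>x - t\<close>; dilating by \<open>e\<close> gives the average and the Jacobian
  \<open>e ^ CARD('n)\<close>.\<close>

lemma gauss_transform_average:
  fixes F :: "complex^'n::finite \<Rightarrow> complex"
  assumes e: "e > 0" and F: "continuous_on UNIV (\<lambda>t. F (cv t y))"
  shows "gauss_transform (\<lambda>t. F (cv t y)) y e (cv x y) = e ^ CARD('n) *\<^sub>R gaussian_average F e x y"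
proof -
  have m: "(\<lambda>t. F (cv t y) * gauss e (cv x y - cv t y)) \<in> borel_measurable borel"
    by (intro borel_measurable_continuous_onI continuous_intros F)
  have "gauss e (cv x y - cv (x + e *\<^sub>R t) y) = gauss 1 (cv t 0)" for t :: "real^'n"
  proof -
    have "cv x y - cv (x + e *\<^sub>R t) y = - cv (e *\<^sub>R t) 0" by (simp add: cv_def vec_eq_iff complex_eq_iff)
    then show ?thesis by (simp add: gauss_even gauss_dilate[OF e])
  qed
  then show ?thesis unfolding gauss_transform_def gaussian_average_def by (subst integral_dilate[OF m e, of x]) simp
qed

lemma tests_shift:
  assumes "g \<in> test_functions" shows "(\<lambda>t. g (t - x)) \<in> test_functions"
proof -
  obtain r where r: "\<And>t. norm t > r \<Longrightarrow> g t = 0" by (rule test_function_support[OF assms]) blast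
  have "g (t - x) = 0" if "norm t > r + norm x" for t
    using norm_triangle_ineq2[of t x] that by (intro r) linarith
  then show ?thesis
    using smooth_shift[OF test_function_smooth[OF assms], of "- x"] by (intro test_functions_support) auto
qed

lemma tube_slice_continuous:
  assumes "continuous_on (tube V) F" "y \<in> V" shows "continuous_on UNIV (\<lambda>t. F (cv t y))"
  by (rule continuous_on_compose2[OF assms(1), where f = "\<lambda>t. cv t y"]) (use assms(2) in \<open>auto intro!: continuous_intros simp: tube_iff\<close>)

text \<open>The three lines theorem is applied to \<open>z \<mapsto> \<integral> F(t + z) g(t) dt\<close>.\<close>

lemma hull_pairing_bound:
  fixes F :: "complex^'n::finite \<Rightarrow> complex" and q :: nat
  assumes A: "A \<ge> 0" "\<And>x x0::real^'n. (1 + norm x) ^ q * exp (- ((norm (x - x0))\<^sup>2)) \<le> A * (1 + norm x0) ^ q"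
    and \<Omega>: "open \<Omega>" "convex \<Omega>" and F: "lineholo F (tube \<Omega>)" and cF: "continuous_on (tube \<Omega>) F"
    and growth: "\<And>L. compact L \<Longrightarrow> L \<subseteq> \<Omega> \<Longrightarrow> \<exists>C. \<forall>y\<in>L. \<forall>x. cmod (F (cv x y)) \<le> C * (1 + norm x) ^ m"
    and K: "K \<subseteq> \<Omega>" "\<And>y. y \<in> K \<Longrightarrow> norm y \<le> R" and g: "g \<in> test_functions" and B: "B \<ge> 0"
    and bd: "\<And>x y. y \<in> K \<Longrightarrow> cmod (LINT t|lborel. F (cv t y) * g (t - x)) \<le> B * (1 + norm x) ^ q" and y: "y \<in> convex hull K"
  shows "cmod (LINT t|lborel. F (cv t y) * g t) \<le> A * exp (R\<^sup>2) * B"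
proof -
  have gs: "g \<in> schwartz" by (rule test_schwartz[OF g])
  \<comment> \<open>The pairing of \<open>g\<close> with \<open>F\<close> translated by a complex
    vector. Real translations move to the test function, imaginary ones change the slice.\<close>
  define h where "h = (\<lambda>z. LINT t|lborel. F (cv t 0 + z) * g t)"
  have cg: "continuous_on UNIV g" using smooth_differentiable[OF schwartz_smooth[OF gs], of "[]"]
    by (intro continuous_at_imp_continuous_on ballI differentiable_imp_continuous_within) simp
  have meas: "(\<lambda>t. F (cv t 0 + z) * g t) \<in> borel_measurable borel" if z: "im_vec z \<in> \<Omega>" for z
  proof (intro borel_measurable_continuous_onI continuous_on_mult cg)
    show "continuous_on UNIV (\<lambda>t. F (cv t 0 + z))"
      by (rule continuous_on_compose2[OF cF, where f = "\<lambda>t. cv t 0 + z"]) (use z in \<open>auto intro!: continuous_intros simp: tube_iff imv_add\<close>)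
  qed
  have cvadd: "cv t 0 + cv x y = cv (t + x) y" for t x y :: "real^'n" by (simp add: cv_add)
  have hol: "lineholo h (tube \<Omega>)"
    unfolding lineholo_def
  proof (intro allI)
    fix z v :: "complex^'n"
    let ?S = "{\<zeta>. z + \<zeta> *s v \<in> tube \<Omega>}"
    have cont: "continuous_on UNIV (\<lambda>\<zeta>. z + \<zeta> *s v)"
      unfolding vector_scalar_mult_def by (intro continuous_intros)
    then have oS: "open ?S" using open_vimage[OF open_tube[OF \<Omega>(1)]] by (simp add: vimage_def)
    \<comment> \<open>Holomorphy is local: over a closed disc of parameters the points
      \<open>z + \<zeta> *s v\<close> have real and imaginary parts in compact sets, so the growth
      bound yields one integrable majorant.\<close>
    have loc: "\<exists>d>0. (\<lambda>\<zeta>. h (z + \<zeta> *s v)) holomorphic_on ball \<zeta>0 d \<and> ball \<zeta>0 d \<subseteq> ?S" if "\<zeta>0 \<in> ?S" for \<zeta>0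
    proof -
      obtain d where d: "d > 0" "cball \<zeta>0 d \<subseteq> ?S" using oS \<open>\<zeta>0 \<in> ?S\<close> open_contains_cball by metis
      let ?T = "(\<lambda>\<zeta>. z + \<zeta> *s v) ` cball \<zeta>0 d"
      have cT: "compact ?T" by (intro compact_continuous_image continuous_on_subset[OF cont]) auto
      have T: "?T \<subseteq> tube \<Omega>" using d(2) by blast
      have cI: "compact (im_vec ` ?T)" and cR: "compact (re_vec ` ?T)"
        by (intro compact_continuous_image cT continuous_intros)+
      have "im_vec ` ?T \<subseteq> \<Omega>" using T by (auto simp: tube_iff)
      from growth[OF cI this] obtain C where C: "\<forall>y\<in>im_vec ` ?T. \<forall>x. cmod (F (cv x y)) \<le> C * (1 + norm x) ^ m" by blast
      obtain r where r: "\<forall>x\<in>re_vec ` ?T. norm x \<le> r" using compact_imp_bounded[OF cR] bounded_iff by metis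
      have C0: "C \<ge> 0"
      proof -
        have "im_vec (z + \<zeta>0 *s v) \<in> im_vec ` ?T" using d(1) by (intro imageI) simp
        then have "cmod (F (cv 0 (im_vec (z + \<zeta>0 *s v)))) \<le> C * (1 + norm (0::real^'n)) ^ m" using C by blast
        then show ?thesis using order_trans[OF norm_ge_zero] by fastforce
      qed
      have B: "cmod (F (cv t 0 + (z + \<zeta> *s v)) * g t) \<le> C * (1 + r) ^ m * cmod ((1 + norm t) ^ m * g t)" if "\<zeta> \<in> ball \<zeta>0 d" for t \<zeta>
      proof -
        let ?w = "z + \<zeta> *s v"
        have w: "?w \<in> ?T" using that by auto
        have eq: "cv t 0 + ?w = cv (t + re_vec ?w) (im_vec ?w)" using cvadd[of t "re_vec ?w" "im_vec ?w"] by simp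
        have rw: "norm (re_vec ?w) \<le> r" using r w by blast
        then have r0: "0 \<le> r" using norm_ge_zero order_trans by blast
        have "1 + norm (t + re_vec ?w) \<le> 1 + norm t + r" using norm_triangle_ineq[of t "re_vec ?w"] rw by linarith
        also have "\<dots> \<le> (1 + r) * (1 + norm t)" using r0 by (simp add: algebra_simps)
        finally have "(1 + norm (t + re_vec ?w)) ^ m \<le> ((1 + r) * (1 + norm t)) ^ m" by (intro power_mono) auto
        then have p: "(1 + norm (t + re_vec ?w)) ^ m \<le> (1 + r) ^ m * (1 + norm t) ^ m" by (simp only: power_mult_distrib)
        have "cmod (F (cv t 0 + ?w)) \<le> C * (1 + norm (t + re_vec ?w)) ^ m" unfolding eq using C w by blast
        also have "\<dots> \<le> C * ((1 + r) ^ m * (1 + norm t) ^ m)" by (intro mult_left_mono p C0)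
        finally have "cmod (F (cv t 0 + ?w)) * cmod (g t) \<le> C * ((1 + r) ^ m * (1 + norm t) ^ m) * cmod (g t)" by (intro mult_right_mono) auto
        moreover have "cmod (((1 + norm t) ^ m :: real) * g t) = (1 + norm t) ^ m * cmod (g t)"
          unfolding norm_mult norm_of_real by simp
        ultimately show ?thesis by (simp only: norm_mult mult_ac)
      qed
      have "integrable lborel (\<lambda>t. complex_of_real ((1 + norm t) ^ m) * g t)"
        by (rule schwartz_growth_integrable[where C = 1 and m = m]) (auto intro!: borel_measurable_continuous_onI continuous_intros gs simp: norm_power simp del: of_real_power of_real_add)
      then have iB: "integrable lborel (\<lambda>t. C * (1 + r) ^ m * cmod ((1 + norm t) ^ m * g t))"
        by (intro integrable_mult_right integrable_norm)
      have sub: "ball \<zeta>0 d \<subseteq> ?S" using d(2) ball_subset_cball by blast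
      have "(\<lambda>\<zeta>. h (z + \<zeta> *s v)) holomorphic_on ball \<zeta>0 d"
        unfolding h_def
      proof (rule holomorphic_integral[OF open_ball _ _ iB B])
        show "(\<lambda>\<zeta>. F (cv t 0 + (z + \<zeta> *s v)) * g t) holomorphic_on ball \<zeta>0 d" for t
        proof (intro holomorphic_intros)
          have "(\<lambda>\<zeta>. F ((cv t 0 + z) + \<zeta> *s v)) holomorphic_on ball \<zeta>0 d"
            using sub by (intro lineholoD[OF F]) (auto simp: tube_iff imv_add add.assoc)
          then show "(\<lambda>\<zeta>. F (cv t 0 + (z + \<zeta> *s v))) holomorphic_on ball \<zeta>0 d" by (simp only: add.assoc)
        qed
        show "(\<lambda>t. F (cv t 0 + (z + \<zeta> *s v)) * g t) \<in> borel_measurable borel" if "\<zeta> \<in> ball \<zeta>0 d" for \<zeta>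
          using sub that by (intro meas) (auto simp: tube_iff)
      qed
      then show ?thesis using d(1) sub by blast
    qed
    show "(\<lambda>\<zeta>. h (z + \<zeta> *s v)) holomorphic_on ?S"
    proof (rule holomorphic_onI)
      fix \<zeta> assume "\<zeta> \<in> ?S"
      from loc[OF this] obtain d where "d > 0" "(\<lambda>\<zeta>. h (z + \<zeta> *s v)) holomorphic_on ball \<zeta> d" by blast
      then have "(\<lambda>\<zeta>. h (z + \<zeta> *s v)) field_differentiable (at \<zeta>)" using holomorphic_on_imp_differentiable_at open_ball centre_in_ball by blast
      then show "(\<lambda>\<zeta>. h (z + \<zeta> *s v)) field_differentiable (at \<zeta> within ?S)" by (rule field_differentiable_at_within)
    qed
  qed
  have hg: "\<exists>C. \<forall>y\<in>L. \<forall>x. cmod (h (cv x y)) \<le> C * (1 + norm x) ^ m" if L: "compact L" "L \<subseteq> \<Omega>" for L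
  proof -
    obtain C where C: "\<forall>y\<in>L. \<forall>x. cmod (F (cv x y)) \<le> C * (1 + norm x) ^ m" using growth[OF L] by blast
    let ?D = "schwartz_seminorm (m + (CARD('n) + 2)) g * (LINT x::real^'n|lborel. 1 / (1 + norm x) ^ (CARD('n) + 2))"
    have "cmod (h (cv x y)) \<le> C * ?D * (1 + norm x) ^ m" if y: "y \<in> L" for x y
    proof -
      have "0 \<le> C * (1 + norm (0::real^'n)) ^ m" using C y norm_ge_zero order_trans by blast
      then have C0: "C \<ge> 0" by simp
      have y\<Omega>: "y \<in> \<Omega>" using y L by blast
      have "cmod (LINT t|lborel. F (cv (t + x) y) * g t) \<le> (C * (1 + norm x) ^ m) * schwartz_seminorm (m + (CARD('n) + 2)) g * (LINT x::real^'n|lborel. 1 / (1 + norm x) ^ (CARD('n) + 2))"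
      proof (rule growth_pairing_bound[OF _ _ gs])
        show "(\<lambda>t. F (cv (t + x) y)) \<in> borel_measurable borel"
          by (intro borel_measurable_continuous_onI continuous_on_compose2[OF tube_slice_continuous[OF cF y\<Omega>], where f = "\<lambda>t. t + x"] continuous_intros) auto
        fix t
        have "1 + norm (t + x) \<le> (1 + norm x) * (1 + norm t)"
          using norm_triangle_ineq[of t x] mult_nonneg_nonneg[OF norm_ge_zero norm_ge_zero, of t x] unfolding distrib_left distrib_right mult.commute[of "norm x" "norm t"] by linarith
        then have "(1 + norm (t + x)) ^ m \<le> (1 + norm x) ^ m * (1 + norm t) ^ m" unfolding power_mult_distrib[symmetric] by (intro power_mono) auto
        then have "C * (1 + norm (t + x)) ^ m \<le> C * ((1 + norm x) ^ m * (1 + norm t) ^ m)" by (intro mult_left_mono C0)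
        moreover have "cmod (F (cv (t + x) y)) \<le> C * (1 + norm (t + x)) ^ m" using C y by blast
        ultimately show "cmod (F (cv (t + x) y)) \<le> (C * (1 + norm x) ^ m) * (1 + norm t) ^ m" by (simp only: mult.assoc) 
      qed
      then show ?thesis unfolding h_def cvadd by (simp only: mult_ac)
    qed
    then show ?thesis by blast
  qed
  \<comment> \<open>For heights in \<open>K\<close> the value of \<open>h\<close> at
    \<open>cv x y\<close> is a pairing with the translate of \<open>g\<close> by \<open>x\<close>.
    Its growth of order \<open>q\<close> in \<open>x\<close> is absorbed by the Gaussian centred at
    0.\<close>
  have bd': "cmod (h (cv x y)) * exp (- ((norm (x - 0))\<^sup>2)) \<le> B * A" if y: "y \<in> K" for x y
  proof -
    have y\<Omega>: "y \<in> \<Omega>" using y K by blast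
    have "h (cv x y) = (LINT t|lborel. (\<lambda>t. F (cv t y) * g (t - x)) (t + x))" unfolding h_def cvadd by simp
    also have "\<dots> = (LINT t|lborel. F (cv t y) * g (t - x))"
    proof (rule integral_shift)
      have "continuous_on UNIV (\<lambda>t. g (t - x))" by (rule continuous_on_compose2[OF cg]) (auto intro!: continuous_intros)
      then show "(\<lambda>t. F (cv t y) * g (t - x)) \<in> borel_measurable borel"
        by (intro borel_measurable_continuous_onI continuous_on_mult tube_slice_continuous[OF cF y\<Omega>])
    qed
    finally have "cmod (h (cv x y)) \<le> B * (1 + norm x) ^ q" using bd[OF y] by simp
    then have "cmod (h (cv x y)) * exp (- ((norm (x - 0))\<^sup>2)) \<le> (B * (1 + norm x) ^ q) * exp (- ((norm (x - 0))\<^sup>2))" by (intro mult_right_mono) auto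
    also have "\<dots> = B * ((1 + norm x) ^ q * exp (- ((norm (x - 0))\<^sup>2)))" by (simp only: mult.assoc)
    also have "\<dots> \<le> B * (A * (1 + norm (0::real^'n)) ^ q)" by (intro mult_left_mono A B)
    finally show ?thesis by simp
  qed
  \<comment> \<open>At \<open>x = 0\<close> the function \<open>h\<close> is the pairing with
    \<open>g\<close> itself, and the weight is at least 1.\<close>
  have "cmod (h (cv 0 y)) * exp ((norm y)\<^sup>2 - (norm (0 - 0 :: real^'n))\<^sup>2) \<le> (B * A) * exp (R\<^sup>2)"
    by (rule hull_bound[OF \<Omega> hol hg K bd' y])
  moreover have "cmod (h (cv 0 y)) * 1 \<le> cmod (h (cv 0 y)) * exp ((norm y)\<^sup>2 - (norm (0 - 0 :: real^'n))\<^sup>2)" by (intro mult_left_mono) auto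
  ultimately have "cmod (h (cv 0 y)) \<le> A * exp (R\<^sup>2) * B" by (simp add: mult_ac)
  then show ?thesis unfolding h_def cvadd by simp
qed

section \<open>Slices and boundary values\<close>

context tib begin

lemma dual_norm_bound:
  assumes L: "L \<in> continuous_forms E (\<lambda>_. nrm)" and u: "u \<in> E"
  shows "cmod (L u) \<le> dual_norm E nrm L * nrm u"
proof -
  have lin: "L \<in> linear_forms E" using L by (simp add: continuous_forms_def)
  obtain C where C: "C \<ge> 0" "\<And>u. u \<in> E \<Longrightarrow> cmod (L u) \<le> C * nrm u" by (rule E_form_bound[OF L]) blast
  have bdd: "bdd_above ((\<lambda>u. cmod (L u)) ` {u \<in> E. nrm u \<le> 1})"
  proof (rule bdd_aboveI2)
    fix v assume v: "v \<in> {u \<in> E. nrm u \<le> 1}"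
    then have "C * nrm v \<le> C * 1" by (intro mult_left_mono C) auto
    then show "cmod (L v) \<le> C" using C(2)[of v] v by simp
  qed
  show ?thesis
  proof (cases "nrm u = 0")
    case True
    then show ?thesis using C(2)[OF u] by simp
  next
    case False
    then have pos: "nrm u > 0" using nrm_nonneg[OF u] by simp
    define c where "c = complex_of_real (1 / nrm u)"
    have cc: "cmod c = 1 / nrm u" unfolding c_def norm_of_real using pos by simp
    have "(\<lambda>p. c * u p) \<in> {u \<in> E. nrm u \<le> 1}" using E_cmult[OF u] pos by (simp add: nrm_cmult[OF u] cc)
    from cSUP_upper[OF this bdd] have "cmod (L u) / nrm u \<le> dual_norm E nrm L"
      unfolding dual_norm_def by (simp add: linear_formsD(3)[OF lin u] norm_mult cc)
    then show ?thesis using pos by (simp only: pos_divide_le_eq)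
  qed
qed

lemma dual_norm_le:
  assumes "C \<ge> 0" "\<And>u. u \<in> E \<Longrightarrow> cmod (L u) \<le> C * nrm u"
  shows "dual_norm E nrm L \<le> C"
  unfolding dual_norm_def
proof (rule cSUP_least)
  have "(\<lambda>_. 0) \<in> {u \<in> E. nrm u \<le> 1}" using E_zero nrm_eq_0[OF E_zero] by simp
  then show "{u \<in> E. nrm u \<le> 1} \<noteq> {}" by blast
  fix v assume v: "v \<in> {u \<in> E. nrm u \<le> 1}"
  then have "C * nrm v \<le> C * 1" by (intro mult_left_mono assms) auto
  then show "cmod (L v) \<le> C" using assms(2)[of v] v by simp
qed

text \<open>The functional of the slice on \<open>E\<close>. By \<open>slice_form_DE\<close> it also
  gives the values on \<open>DE E\<close>, so the estimates in both norms concern the same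
  object.\<close>

definition slice_form where "slice_form F y = form_of E (\<lambda>_. nrm) (slice F y)"

lemma slice_form_continuous:
  assumes "F \<in> O_dual E nrm V" "y \<in> V"
  shows "slice_form F y \<in> continuous_forms E (\<lambda>_. nrm)" "defines_dist (slice F y) (restrict_form (slice_form F y))"
  using assms in_dual_form[of "slice F y"] by (auto simp: O_dual_def slice_form_def)

lemma slice_form_test:
  assumes "F \<in> O_dual E nrm V" "y \<in> V" "g \<in> test_functions"
  shows "slice_form F y (schwartz_dist g) = (LINT t|lborel. F (cv t y) * g t)"
  using defines_dist_tests[OF slice_form_continuous(2)[OF assms(1,2)] assms(3)] by (simp add: slice_cv)

lemma slice_form_locally_bounded:
  assumes F: "F \<in> O_dual E nrm V" and K: "compact K" "K \<subseteq> V"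
  obtains C where "C \<ge> 0" "\<And>y u. y \<in> K \<Longrightarrow> u \<in> E \<Longrightarrow> cmod (slice_form F y u) \<le> C * nrm u"
proof -
  have "bdd_above ((\<lambda>y. dual_norm E nrm (slice_form F y)) ` K)" using F K by (simp add: O_dual_def slice_form_def)
  then obtain C where C: "\<And>y. y \<in> K \<Longrightarrow> dual_norm E nrm (slice_form F y) \<le> C" by (auto simp: bdd_above_def)
  have "cmod (slice_form F y u) \<le> max C 0 * nrm u" if y: "y \<in> K" and u: "u \<in> E" for y u
  proof -
    have "cmod (slice_form F y u) \<le> dual_norm E nrm (slice_form F y) * nrm u"
      using y K by (intro dual_norm_bound slice_form_continuous(1)[OF F] u) auto
    also have "\<dots> \<le> max C 0 * nrm u" using C[OF y] by (intro mult_right_mono nrm_nonneg u) auto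
    finally show ?thesis .
  qed
  then show ?thesis using that[of "max C 0"] by simp
qed

lemma O_dual_lineholo: "F \<in> O_dual E nrm V \<Longrightarrow> lineholo F (tube V)"
  and O_dual_continuous: "F \<in> O_dual E nrm V \<Longrightarrow> continuous_on (tube V) F"
  by (auto simp: O_dual_def intro: holomorphic_on_Cn_lineholo holomorphic_on_Cn_continuous)

lemma schwartz_dist_shift: "g \<in> schwartz \<Longrightarrow> schwartz_dist (\<lambda>t. g (t - x)) = translate (- x) (schwartz_dist g)"
  by (simp add: schwartz_dist_translate)

text \<open>The mean value property bounds \<open>F (x + i y)\<close> by pairings of the slices near \<open>y\<close> with
  translates by \<open>x\<close> of a bounded set of test functions.\<close>

lemma O_dual_growth:
  assumes F: "F \<in> O_dual E nrm V" and V: "open V" and K: "compact K" "K \<subseteq> V"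
  shows "\<exists>C. \<forall>y\<in>K. \<forall>x. cmod (F (cv x y)) \<le> C * (1 + norm x) ^ trm"
proof -
  obtain r K' where r: "r > 0" "compact K'" "K' \<subseteq> V" "\<And>y. y \<in> K \<Longrightarrow> cball y r \<subseteq> K'" "\<And>y. y \<in> K \<Longrightarrow> ball y (2 * r) \<subseteq> V"
    by (rule compact_thickening[OF K V]) blast
  obtain C where C: "C \<ge> 0" "\<And>y u. y \<in> K' \<Longrightarrow> u \<in> E \<Longrightarrow> cmod (slice_form F y u) \<le> C * nrm u"
    by (rule slice_form_locally_bounded[OF F r(2,3)]) blast
  obtain N D where D: "D \<ge> 0" "\<And>f. f \<in> schwartz \<Longrightarrow> nrm (schwartz_dist f) \<le> D * schwartz_seminorm N f" by (rule S_bound) blast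
  \<comment> \<open>Sections of \<open>mv_weight\<close> at height \<open>s\<close> are the members
    with \<open>c = s \<bullet> s\<close>; \<open>bump_family_seminorm\<close> bounds their norms in
    \<open>E\<close> independently of \<open>s\<close>.\<close>
  define g where "g = (\<lambda>c t::real^'n. complex_of_real (flat_exp 1 (r\<^sup>2 - t \<bullet> t - c)))"
  have g: "g \<in> bump_family (r\<^sup>2)" unfolding g_def by (rule bump_family.base)
  have r2: "r\<^sup>2 > 0" using r(1) by simp
  from bump_family_seminorm[OF g r2, of N] obtain B where B: "\<forall>c\<ge>0. schwartz_seminorm N (g c) \<le> B" by blast
  let ?W = "LINT p|lborel. mv_weight r (p::(real^'n) \<times> (real^'n))" and ?m = "measure lborel (ball (0::real^'n) r)"
  have W: "?W > 0" by (rule mv_weight_integral_pos[OF r(1)])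
  have "cmod (F (cv x y)) \<le> C * trM * (D * B) * ?m / ?W * (1 + norm x) ^ trm" if y: "y \<in> K" for x y
  proof -
    \<comment> \<open>Only the factor \<open>trK (- x)\<close>, the cost of translating the test
      function to \<open>x\<close>, depends on \<open>x\<close>; it supplies the exponent
      \<open>trm\<close>.\<close>
    let ?A = "C * (trK (- x) * (D * B))"
    have sub: "tube (ball y (2 * r)) \<subseteq> tube V" using r(5)[OF y] by (auto simp: tube_iff)
    have "cmod (F (cv x y)) * ?W \<le> ?A * ?m"
    proof (rule mean_value_bound[OF r(1) lineholo_subset[OF O_dual_lineholo[OF F] sub] continuous_on_subset[OF O_dual_continuous[OF F] sub]])
      fix s :: "real^'n" assume s: "norm s < r"
      have "y + s \<in> cball y r" using s by (simp add: dist_norm)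
      then have ys: "y + s \<in> K'" using r(4)[OF y] by blast
      then have ysV: "y + s \<in> V" using r(3) by blast
      have gt: "g (s \<bullet> s) \<in> test_functions" by (rule bump_family_test[OF g r2]) simp
      note gs = test_schwartz[OF gt]
      have "(LINT t|lborel. F (cv t (y + s)) * of_real (flat_exp 1 (r\<^sup>2 - (t - x) \<bullet> (t - x) - s \<bullet> s))) = slice_form F (y + s) (schwartz_dist (\<lambda>t. g (s \<bullet> s) (t - x)))"
        unfolding slice_form_test[OF F ysV tests_shift[OF gt]] by (simp add: g_def)
      also have "\<dots> = slice_form F (y + s) (translate (- x) (schwartz_dist (g (s \<bullet> s))))" by (simp only: schwartz_dist_shift[OF gs])
      finally have "cmod (LINT t|lborel. F (cv t (y + s)) * of_real (flat_exp 1 (r\<^sup>2 - (t - x) \<bullet> (t - x) - s \<bullet> s))) \<le> C * nrm (translate (- x) (schwartz_dist (g (s \<bullet> s))))"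
        using C(2)[OF ys translate_in[OF S_in[OF gs]]] by simp
      also have "\<dots> \<le> C * (trK (- x) * (D * B))"
      proof (intro mult_left_mono C(1))
        have "nrm (schwartz_dist (g (s \<bullet> s))) \<le> D * B" using B by (intro order_trans[OF D(2)[OF gs] mult_left_mono[OF _ D(1)]]) simp
        then have "trK (- x) * nrm (schwartz_dist (g (s \<bullet> s))) \<le> trK (- x) * (D * B)" using trK_ge[of "- x"] by (intro mult_left_mono) auto
        then show "nrm (translate (- x) (schwartz_dist (g (s \<bullet> s)))) \<le> trK (- x) * (D * B)" using translate_trK[OF S_in[OF gs], of "- x"] by linarith
      qed
      finally show "cmod (LINT t|lborel. F (cv t (y + s)) * of_real (flat_exp 1 (r\<^sup>2 - (t - x) \<bullet> (t - x) - s \<bullet> s))) \<le> ?A" .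
    qed
    then have "cmod (F (cv x y)) \<le> ?A * ?m / ?W" using W by (simp only: pos_le_divide_eq)
    then show ?thesis by (simp add: trK_def mult_ac)
  qed
  then show ?thesis by blast
qed

lemma O_dual_slowly_growing:
  assumes F: "F \<in> O_dual E nrm V" and V: "open V" and y: "y \<in> V"
  obtains C where "slowly_growing (\<lambda>t. F (cv t y)) C trm"
proof -
  obtain C where "\<forall>y\<in>{y}. \<forall>x. cmod (F (cv x y)) \<le> C * (1 + norm x) ^ trm" using O_dual_growth[OF F V, of "{y}"] y by auto
  then have "slowly_growing (\<lambda>t. F (cv t y)) C trm"
    using tube_slice_continuous[OF O_dual_continuous[OF F] y] by (simp add: slowly_growing_def)
  then show ?thesis by (rule that)
qed

text \<open>The functional is tied to the slice by test functions only, while Gaussians have full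
  support. Polynomial growth makes the integral against Schwartz functions a tempered distribution,
  and two tempered distributions that agree on test functions are equal.\<close>

lemma slice_form_schwartz:
  assumes F: "F \<in> O_dual E nrm V" and V: "open V" and y: "y \<in> V" and f: "f \<in> schwartz"
  shows "slice_form F y (schwartz_dist f) = (LINT t|lborel. F (cv t y) * f t)"
proof -
  obtain C where "slowly_growing (\<lambda>t. F (cv t y)) C trm" by (rule O_dual_slowly_growing[OF F V y])
  then interpret slowly_growing "\<lambda>t. F (cv t y)" C trm .
  let ?l = "\<lambda>f. if f \<in> schwartz then LINT t|lborel. F (cv t y) * f t else 0"
  let ?N = "trm + (CARD('n) + 2)" and ?W = "LINT x::real^'n|lborel. 1 / (1 + norm x) ^ (CARD('n) + 2)"
  note m = borel_measurable_continuous_onI[OF continuous]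
  have int: "integrable lborel (\<lambda>t. F (cv t y) * f t)" if "f \<in> schwartz" for f
    by (rule schwartz_growth_integrable[OF m growth that])
  have "?l \<in> linear_forms schwartz"
    by (auto simp: linear_forms_def distrib_left schwartz_add schwartz_cmult int mult.left_commute[of _ c for c :: complex])
  moreover have "cmod (?l f) \<le> (C * ?W) * schwartz_seminorm ?N f" if "f \<in> schwartz" for f
    using growth_pairing_bound[OF m growth that] that by (simp add: mult_ac)
  ultimately have "?l \<in> tempered" unfolding tempered_def continuous_forms_def by blast
  moreover have "restrict_form (slice_form F y) g = ?l g" if "g \<in> test_functions" for g
    using slice_form_test[OF F y that] test_schwartz[OF that] by (simp add: restrict_form_def)
  ultimately have "restrict_form (slice_form F y) = ?l"
    by (intro tempered_eqI restrict_form_tempered slice_form_continuous(1)[OF F y])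
  from fun_cong[OF this, of f] show ?thesis using f by (simp add: restrict_form_def)
qed

text \<open>The integrand is \<open>F w * gauss e (z - w)\<close> on the contour at height
  \<open>y\<close>. It is holomorphic in \<open>w\<close>, and the Gaussian outweighs the growth of
  \<open>F\<close> locally uniformly in the height, so the contour may be moved.\<close>

lemma gauss_transform_const:
  assumes F: "F \<in> O_dual E nrm V" and V: "open V" "connected V" and y: "y1 \<in> V" "y2 \<in> V" and e: "e > 0"
  shows "gauss_transform (\<lambda>t. F (cv t y1)) y1 e z = gauss_transform (\<lambda>t. F (cv t y2)) y2 e z"
  unfolding gauss_transform_def
proof (rule contour_shift[OF V _ _ _ y, where \<Phi> = "\<lambda>w. F w * gauss e (z - w)"])
  show "lineholo (\<lambda>w. F w * gauss e (z - w)) (tube V)"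
    by (intro lineholo_mult O_dual_lineholo[OF F] gauss_shift_lineholo')
  show "continuous_on (tube V) (\<lambda>w. F w * gauss e (z - w))"
    by (intro continuous_intros O_dual_continuous[OF F])
  let ?N = "CARD('n) + 2"
  fix y assume "y \<in> V"
  then obtain d where d: "d > 0" "cball y d \<subseteq> V" using V(1) open_contains_cball by metis
  obtain C where C: "\<forall>y'\<in>cball y d. \<forall>x. cmod (F (cv x y')) \<le> C * (1 + norm x) ^ trm"
    using O_dual_growth[OF F V(1) compact_cball d(2)] by blast
  obtain D where D: "D \<ge> 0" "\<And>x y' z'::complex^'n. norm y' \<le> max (norm y + d) (norm (im_vec z)) \<Longrightarrow> norm (im_vec z') \<le> max (norm y + d) (norm (im_vec z)) \<Longrightarrow>
    (1 + norm x) ^ (?N + trm) * cmod (gauss e (z' - cv x y')) \<le> D * (1 + norm z') ^ (?N + trm)"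
    by (rule gauss_decay[OF e]) blast
  have "0 \<le> C * (1 + norm (0::real^'n)) ^ trm" using C d(1) norm_ge_zero order_trans centre_in_cball less_imp_le by metis
  then have C0: "C \<ge> 0" by simp
  have "(1 + norm x) ^ ?N * cmod (F (cv x y') * gauss e (z - cv x y')) \<le> C * (D * (1 + norm z) ^ (?N + trm))" if y': "y' \<in> ball y d" for x y'
  proof -
    have "norm y' \<le> norm y + d" using y' norm_triangle_ineq2[of y' y] by (simp add: dist_norm norm_minus_commute)
    then have b: "(1 + norm x) ^ (?N + trm) * cmod (gauss e (z - cv x y')) \<le> D * (1 + norm z) ^ (?N + trm)" by (intro D(2)) auto
    have "cmod (F (cv x y')) \<le> C * (1 + norm x) ^ trm" using C y' ball_subset_cball by blast
    then have "(1 + norm x) ^ ?N * cmod (F (cv x y') * gauss e (z - cv x y')) \<le> (1 + norm x) ^ ?N * ((C * (1 + norm x) ^ trm) * cmod (gauss e (z - cv x y')))"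
      unfolding norm_mult by (intro mult_left_mono mult_right_mono) auto
    also have "\<dots> = C * ((1 + norm x) ^ (?N + trm) * cmod (gauss e (z - cv x y')))" by (simp only: power_add mult_ac)
    also have "\<dots> \<le> C * (D * (1 + norm z) ^ (?N + trm))" by (intro mult_left_mono b C0)
    finally show ?thesis .
  qed
  then have "\<forall>y'\<in>ball y d. \<forall>x. (1 + norm x) ^ ?N * cmod (F (cv x y') * gauss e (z - cv x y')) \<le> C * (D * (1 + norm z) ^ (?N + trm))" by blast
  then show "\<exists>d>0. \<exists>C. \<forall>y'\<in>ball y d. \<forall>x. (1 + norm x) ^ ?N * cmod (F (cv x y') * gauss e (z - cv x y')) \<le> C"
    using d(1) by (intro exI[of _ d] conjI exI[of _ "C * (D * (1 + norm z) ^ (?N + trm))"])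
qed

lemma slice_form_DE:
  assumes F: "F \<in> O_dual E nrm V" and y: "y \<in> V" and u: "u \<in> DE E"
  shows "form_of (DE E) (DE_norm nrm) (slice F y) u = slice_form F y u"
  using form_of_DE_restrict(1)[OF slice_form_continuous[OF F y]] u by simp

lemma Ob_O: "F \<in> Ob_DE_dual E nrm V \<Longrightarrow> F \<in> O_dual E nrm V"
  by (simp add: Ob_DE_dual_def)

text \<open>One order \<open>N\<close> and one constant for all heights in \<open>V\<close>,
  including those near the boundary.\<close>

lemma Ob_equicontinuous:
  assumes F: "F \<in> Ob_DE_dual E nrm V"
  obtains N C where "C \<ge> 0" "\<And>y u. y \<in> V \<Longrightarrow> u \<in> DE E \<Longrightarrow> cmod (slice_form F y u) \<le> C * DE_norm nrm N u"
proof -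
  have "strongly_bounded (DE E) (DE_norm nrm) ((\<lambda>y. form_of (DE E) (DE_norm nrm) (slice F y)) ` V)"
    using F by (simp add: Ob_DE_dual_def)
  from strongly_bounded_equicontinuous[OF this] obtain N C where C: "C \<ge> 0"
    "\<forall>L\<in>(\<lambda>y. form_of (DE E) (DE_norm nrm) (slice F y)) ` V. \<forall>u\<in>DE E. cmod (L u) \<le> C * DE_norm nrm N u"
    by (elim exE conjE) (rule that)
  have "cmod (slice_form F y u) \<le> C * DE_norm nrm N u" if "y \<in> V" "u \<in> DE E" for y u
    using bspec[OF bspec[OF C(2) imageI[OF that(1)]] that(2)] unfolding slice_form_DE[OF Ob_O[OF F] that] .
  then show ?thesis using that C(1) by blast
qed

text \<open>The Gaussian transform of a slice does not depend on the slice, so it can be computed in the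
  limit \<open>y \<rightarrow> 0\<close>, where only the boundary value enters.\<close>

lemma gauss_transform_boundary:
  assumes F: "F \<in> Ob_DE_dual E nrm V" and V: "open V" "connected V" "0 \<in> frontier V" and f: "has_weak_boundary_value E nrm V F f"
    and y0: "y0 \<in> V" and e: "e > 0"
  shows "gauss_transform (\<lambda>t. F (cv t y0)) y0 e z = f (schwartz_dist (\<lambda>t. gauss e (z - cv t 0)))"
proof -
  note FO = Ob_O[OF F]
  \<comment> \<open>Seen from the slice at height \<open>y\<close>, the Gaussian is centred at
    \<open>z - i y\<close>: the test function moves together with the slice.\<close>
  let ?u = "\<lambda>y. schwartz_dist (\<lambda>t. gauss e (z - cv 0 y - cv t 0))"
  have gs: "(\<lambda>t. gauss e (z - cv 0 y - cv t 0)) \<in> schwartz" for y by (rule gauss_schwartz[OF e])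
  have u: "?u y \<in> DE E" for y by (rule S_in_DE[OF gs])
  have cv0: "cv 0 (0::real^'n) = 0" by (simp add: cv_def vec_eq_iff complex_eq_iff)
  have eq: "gauss_transform (\<lambda>t. F (cv t y0)) y0 e z = slice_form F y (?u y)" if y: "y \<in> V" for y
  proof -
    have h: "gauss e (z - cv t y) = gauss e (z - cv 0 y - cv t 0)" for t
      by (rule arg_cong[where f = "gauss e"]) (simp add: cv_def vec_eq_iff complex_eq_iff)
    show ?thesis
      unfolding slice_form_schwartz[OF FO V(1) y gs] gauss_transform_const[OF FO V(1,2) y0 y e]
      unfolding gauss_transform_def
      by (rule Bochner_Integration.integral_cong[OF refl]) (rule arg_cong[OF h])
  qed
  obtain N C where C: "C \<ge> 0" "\<And>y u. y \<in> V \<Longrightarrow> u \<in> DE E \<Longrightarrow> cmod (slice_form F y u) \<le> C * DE_norm nrm N u"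
    by (rule Ob_equicontinuous[OF F]) blast
  obtain M D where D: "D \<ge> 0" "\<And>f. f \<in> schwartz \<Longrightarrow> DE_norm nrm N (schwartz_dist f) \<le> D * schwartz_seminorm M f"
    by (rule DE_norm_schwartz[of N]) blast
  obtain B where B: "\<forall>y. norm y \<le> 1 \<longrightarrow> schwartz_seminorm M (\<lambda>t. gauss e (z - cv 0 y - cv t 0) - gauss e (z - cv t 0)) \<le> B * norm y"
    using gauss_shift_seminorm[OF e] by blast
  \<comment> \<open>Equicontinuity makes the cost of replacing the moving Gaussian by the fixed one
    of order \<open>norm y\<close>, so weak convergence at the fixed one decides the limit.\<close>
  have near: "norm (slice_form F y (?u y) - slice_form F y (?u 0)) \<le> C * D * B * norm y" if y: "y \<in> V" "norm y \<le> 1" for y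
  proof -
    have lin: "slice_form F y \<in> linear_forms E" using slice_form_continuous(1)[OF FO y(1)] by (simp add: continuous_forms_def)
    have "slice_form F y (?u y) - slice_form F y (?u 0) = slice_form F y (\<lambda>p. ?u y p - ?u 0 p)"
      using linear_forms_diff[OF subspace lin DE_E[OF u] DE_E[OF u]] by simp
    also have "cmod \<dots> \<le> C * DE_norm nrm N (\<lambda>p. ?u y p - ?u 0 p)" by (intro C y DE_diff u)
    also have "(\<lambda>p. ?u y p - ?u 0 p) = schwartz_dist (\<lambda>t. gauss e (z - cv 0 y - cv t 0) - gauss e (z - cv t 0))"
      using schwartz_dist_diff[OF gs[of y] gs[of 0]] by (simp add: cv0)
    also have "C * DE_norm nrm N \<dots> \<le> C * (D * (B * norm y))"
    proof (intro mult_left_mono C order_trans[OF D(2) mult_left_mono[OF _ D(1)]])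
      show "(\<lambda>t. gauss e (z - cv 0 y - cv t 0) - gauss e (z - cv t 0)) \<in> schwartz"
        using schwartz_diff[OF gs[of y] gs[of 0]] by (simp add: cv0)
    qed (use B y in simp)
    finally show ?thesis by (simp only: mult.assoc)
  qed
  have "((\<lambda>y. form_of (DE E) (DE_norm nrm) (slice F y) (?u 0)) \<longlongrightarrow> f (?u 0)) (at 0 within V)"
    using f u unfolding has_weak_boundary_value_def by blast
  then have l1: "((\<lambda>y. slice_form F y (?u 0)) \<longlongrightarrow> f (?u 0)) (at 0 within V)"
    by (rule Lim_transform_eventually) (auto simp: eventually_at_filter slice_form_DE[OF FO _ u])
  have l2: "((\<lambda>y. slice_form F y (?u y) - slice_form F y (?u 0)) \<longlongrightarrow> 0) (at 0 within V)"
  proof (rule Lim_null_comparison)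
    show "\<forall>\<^sub>F y in at 0 within V. norm (slice_form F y (?u y) - slice_form F y (?u 0)) \<le> C * D * B * norm y"
      unfolding eventually_at using near by (intro exI[of _ 1]) auto
    have "((\<lambda>y::real^'n. C * D * B * norm y) \<longlongrightarrow> C * D * B * norm (0::real^'n)) (at 0 within V)" by (intro tendsto_intros)
    then show "((\<lambda>y::real^'n. C * D * B * norm y) \<longlongrightarrow> 0) (at 0 within V)" by simp
  qed
  have "((\<lambda>y. slice_form F y (?u y)) \<longlongrightarrow> f (?u 0)) (at 0 within V)" using tendsto_add[OF l2 l1] by simp
  then have "((\<lambda>y. gauss_transform (\<lambda>t. F (cv t y0)) y0 e z) \<longlongrightarrow> f (?u 0)) (at 0 within V)"
    by (rule Lim_transform_eventually) (auto simp: eventually_at_filter eq)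
  \<comment> \<open>As \<open>V\<close> is open, the boundary point 0 is not in \<open>V\<close> and
    hence an accumulation point, so limits along \<open>V\<close> are unique.\<close>
  moreover have "at 0 within V \<noteq> bot"
  proof -
    have "0 \<notin> V" "0 \<in> closure V" using V(1,3) by (auto simp: frontier_def interior_open)
    then show ?thesis by (auto simp: trivial_limit_within closure_def)
  qed
  ultimately have "gauss_transform (\<lambda>t. F (cv t y0)) y0 e z = f (?u 0)" by (intro tendsto_unique[OF _ tendsto_const])
  then show ?thesis by (simp add: cv0)
qed

end

section \<open>The edge of the wedge\<close>

text \<open>The averages converge to the values times the nonzero mass of the Gaussian. This settles
  the consistency of \<open>F1\<close> and \<open>F2\<close> at heights in both \<open>V1\<close>
  and \<open>V2\<close>.\<close>

lemma gaussian_average_determines: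
  fixes F G :: "complex^'n::finite \<Rightarrow> complex"
  assumes F: "continuous_on (tube V) F" and G: "continuous_on (tube V) G" and y: "y \<in> V"
    and CF: "\<And>x. cmod (F (cv x y)) \<le> C * (1 + norm x) ^ m" and CG: "\<And>x. cmod (G (cv x y)) \<le> D * (1 + norm x) ^ m"
    and eq: "\<And>e. e > 0 \<Longrightarrow> gaussian_average F e x y = gaussian_average G e x y"
  shows "F (cv x y) = G (cv x y)"
proof -
  let ?M = "LINT t|lborel. gauss 1 (cv (t::real^'n) 0)" and ?E = "exp (- (norm x)\<^sup>2)"
  have "cmod (F (cv x y) * ?M - G (cv x y) * ?M) * ?E \<le> 0"
  proof (rule field_le_epsilon)
    fix \<eta> :: real assume "\<eta> > 0"
    then have h: "\<eta> / 2 > 0" by simp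
    have K: "compact {y}" "{y} \<subseteq> V" using y by auto
    obtain d where d: "d > 0" "\<forall>e. 0 < e \<and> e < d \<longrightarrow> (\<forall>y\<in>{y}. \<forall>x. cmod (gaussian_average F e x y - F (cv x y) * ?M) * exp (- (norm x)\<^sup>2) \<le> \<eta> / 2)"
      using gaussian_average_converges[OF F K, of C m, OF _ h] CF by auto
    obtain d' where d': "d' > 0" "\<forall>e. 0 < e \<and> e < d' \<longrightarrow> (\<forall>y\<in>{y}. \<forall>x. cmod (gaussian_average G e x y - G (cv x y) * ?M) * exp (- (norm x)\<^sup>2) \<le> \<eta> / 2)"
      using gaussian_average_converges[OF G K, of D m, OF _ h] CG by auto
    define e where "e = min d d' / 2"
    have e: "0 < e" "e < d" "e < d'" using d(1) d'(1) by (auto simp: e_def)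
    let ?A = "gaussian_average F e x y"
    have 1: "cmod (?A - F (cv x y) * ?M) * ?E \<le> \<eta> / 2" using d(2)[rule_format, of e y x] e by simp
    have 2: "cmod (?A - G (cv x y) * ?M) * ?E \<le> \<eta> / 2"
      unfolding eq[OF e(1)] using d'(2)[rule_format, of e y x] e by simp
    have "cmod (F (cv x y) * ?M - G (cv x y) * ?M) \<le> cmod (?A - G (cv x y) * ?M) + cmod (?A - F (cv x y) * ?M)"
      using norm_triangle_ineq4[of "?A - G (cv x y) * ?M" "?A - F (cv x y) * ?M"] by simp
    then have "cmod (F (cv x y) * ?M - G (cv x y) * ?M) * ?E \<le> (cmod (?A - G (cv x y) * ?M) + cmod (?A - F (cv x y) * ?M)) * ?E" by (intro mult_right_mono) auto
    also have "\<dots> = cmod (?A - G (cv x y) * ?M) * ?E + cmod (?A - F (cv x y) * ?M) * ?E" by (rule distrib_right)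
    also have "\<dots> \<le> \<eta> / 2 + \<eta> / 2" by (rule add_mono[OF 2 1])
    finally show "cmod (F (cv x y) * ?M - G (cv x y) * ?M) * ?E \<le> 0 + \<eta>" by simp
  qed
  then have "cmod (F (cv x y) * ?M - G (cv x y) * ?M) = 0" by (simp add: mult_le_0_iff not_le)
  then show ?thesis using gauss_mass_nonzero[where 'n = 'n] by simp
qed

context tib begin

text \<open>The constants \<open>D\<close> and \<open>M\<close> from the continuity of
  \<open>L\<close> serve only to pass to the limit. The bound obtained involves \<open>C\<close> and
  \<open>N\<close> alone, so it is uniform over a family of forms.\<close>

lemma DE_bound_from_tests:
  assumes L: "L \<in> continuous_forms (DE E) (DE_norm nrm)" and C: "C \<ge> 0"
    and tests: "\<And>g. g \<in> test_functions \<Longrightarrow> cmod (L (schwartz_dist g)) \<le> C * DE_norm nrm N (schwartz_dist g)" and u: "u \<in> DE E"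
  shows "cmod (L u) \<le> C * DE_norm nrm N u"
proof (rule field_le_epsilon)
  fix e :: real assume e: "e > 0"
  have lin: "L \<in> linear_forms (DE E)" using L by (simp add: continuous_forms_def)
  obtain M D where D: "D \<ge> 0" "\<And>u. u \<in> DE E \<Longrightarrow> cmod (L u) \<le> D * DE_norm nrm M u"
    using continuous_formsD[OF L] DE_norm_nonneg by metis
  define d where "d = e / (C + D + 1)"
  have d: "d > 0" using e C D(1) by (simp add: d_def)
  obtain g where g: "g \<in> test_functions" "DE_norm nrm (max N M) (\<lambda>p. u p - schwartz_dist g p) < d" using tests_dense_DE[OF u d] by blast
  have gD: "schwartz_dist g \<in> DE E" by (rule S_in_DE[OF test_schwartz[OF g(1)]])
  have dM: "DE_norm nrm M (\<lambda>p. u p - schwartz_dist g p) \<le> d" and dN: "DE_norm nrm N (\<lambda>p. u p - schwartz_dist g p) \<le> d"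
    using DE_norm_mono[of M "max N M"] DE_norm_mono[of N "max N M"] g(2) less_imp_le order_trans max.cobounded1 max.cobounded2 by metis+
  have "(\<lambda>_. 0) \<in> DE E" using DE_subspace by (simp add: complex_subspace_def)
  from DE_norm_triangle3[OF gD u this, of N] have "DE_norm nrm N (schwartz_dist g) \<le> d + DE_norm nrm N u"
    using dN DE_norm_minus_commute[OF u gD, of N] by simp
  then have "C * DE_norm nrm N (schwartz_dist g) \<le> C * (d + DE_norm nrm N u)" by (intro mult_left_mono C)
  then have 1: "cmod (L (schwartz_dist g)) \<le> C * d + C * DE_norm nrm N u" using tests[OF g(1)] unfolding distrib_left by linarith
  have "cmod (L u - L (schwartz_dist g)) \<le> D * d"
    unfolding linear_forms_diff[OF DE_subspace lin u gD, symmetric] by (rule order_trans[OF D(2)[OF DE_diff[OF u gD]] mult_left_mono[OF dM D(1)]])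
  then have "cmod (L u) \<le> C * DE_norm nrm N u + (C * d + D * d)" using 1 norm_triangle_sub[of "L u" "L (schwartz_dist g)"] by linarith
  also have "C * d + D * d \<le> (C + D + 1) * d" using d by (simp add: distrib_right)
  also have "(C + D + 1) * d = e" using C D by (simp add: d_def)
  finally show "cmod (L u) \<le> C * DE_norm nrm N u + e" by simp
qed

text \<open>Membership reduced to integrals against test functions: the bounds in the norm of
  \<open>E\<close>, locally uniform in the height, produce the functionals and their dual norms; the
  bound in one norm of \<open>DE E\<close>, uniform over all heights, produces strong
  boundedness.\<close>

lemma Ob_DE_dualI:
  assumes \<Omega>: "open \<Omega>" and F: "lineholo F (tube \<Omega>)" and cF: "continuous_on (tube \<Omega>) F"
    and growth: "\<And>K. compact K \<Longrightarrow> K \<subseteq> \<Omega> \<Longrightarrow> \<exists>C. \<forall>y\<in>K. \<forall>x. cmod (F (cv x y)) \<le> C * (1 + norm x) ^ m"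
    and bE: "\<And>K. compact K \<Longrightarrow> K \<subseteq> \<Omega> \<Longrightarrow> \<exists>C\<ge>0. \<forall>y\<in>K. \<forall>g\<in>test_functions. cmod (LINT t|lborel. F (cv t y) * g t) \<le> C * nrm (schwartz_dist g)"
    and D: "D \<ge> 0" and bDE: "\<And>y g. y \<in> \<Omega> \<Longrightarrow> g \<in> test_functions \<Longrightarrow> cmod (LINT t|lborel. F (cv t y) * g t) \<le> D * DE_norm nrm N (schwartz_dist g)"
  shows "F \<in> Ob_DE_dual E nrm \<Omega>"
proof -
  have ext: "\<exists>L\<in>continuous_forms E (\<lambda>_. nrm). defines_dist (slice F y) (restrict_form L) \<and> (\<forall>u\<in>E. cmod (L u) \<le> C * nrm u)"
    if y: "y \<in> \<Omega>" and C: "C \<ge> 0" "\<forall>g\<in>test_functions. cmod (LINT t|lborel. F (cv t y) * g t) \<le> C * nrm (schwartz_dist g)" for y C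
  proof -
    have eq: "slice F y = (\<lambda>t. F (cv t y))" by (simp add: fun_eq_iff slice_cv)
    obtain M where M: "\<forall>y\<in>{y}. \<forall>x. cmod (F (cv x y)) \<le> M * (1 + norm x) ^ m" using growth[of "{y}"] y by auto
    show ?thesis unfolding eq
      by (rule extend_form[OF tube_slice_continuous[OF cF y] _ C(1)]) (use M C(2) in auto)
  qed
  have O: "F \<in> O_dual E nrm \<Omega>"
    unfolding O_dual_def mem_Collect_eq
  proof (intro conjI ballI allI impI)
    show "holomorphic_on_Cn F (tube \<Omega>)" by (rule osgood[OF open_tube[OF \<Omega>] cF F])
    show "in_dual E (\<lambda>_. nrm) (slice F y)" if y: "y \<in> \<Omega>" for y
    proof -
      obtain C where C: "C \<ge> 0" "\<forall>y\<in>{y}. \<forall>g\<in>test_functions. cmod (LINT t|lborel. F (cv t y) * g t) \<le> C * nrm (schwartz_dist g)"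
        using bE[of "{y}"] y by auto
      then show ?thesis using ext[OF y C(1)] by (auto simp: in_dual_def)
    qed
    fix K assume K: "compact K \<and> K \<subseteq> \<Omega>"
    then obtain C where C: "C \<ge> 0" "\<forall>y\<in>K. \<forall>g\<in>test_functions. cmod (LINT t|lborel. F (cv t y) * g t) \<le> C * nrm (schwartz_dist g)"
      using bE[of K] by auto
    show "bdd_above ((\<lambda>y. dual_norm E nrm (form_of E (\<lambda>_. nrm) (slice F y))) ` K)"
    proof (rule bdd_aboveI2)
      fix y assume y: "y \<in> K"
      then have y\<Omega>: "y \<in> \<Omega>" using K by blast
      obtain L where L: "L \<in> continuous_forms E (\<lambda>_. nrm)" "defines_dist (slice F y) (restrict_form L)" "\<forall>u\<in>E. cmod (L u) \<le> C * nrm u"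
        using ext[OF y\<Omega> C(1) bspec[OF C(2) y]] by auto
      show "dual_norm E nrm (form_of E (\<lambda>_. nrm) (slice F y)) \<le> C"
        unfolding form_of_E[OF L(1,2)] by (rule dual_norm_le[OF C(1)]) (use L(3) in blast)
    qed
  qed
  have "strongly_bounded (DE E) (DE_norm nrm) ((\<lambda>y. form_of (DE E) (DE_norm nrm) (slice F y)) ` \<Omega>)"
  proof (rule equicontinuous_strongly_bounded[OF _ D])
    have cont: "form_of (DE E) (DE_norm nrm) (slice F y) \<in> continuous_forms (DE E) (DE_norm nrm)" if y: "y \<in> \<Omega>" for y
      using form_of_DE_restrict[OF slice_form_continuous[OF O y]] by simp
    then show "(\<lambda>y. form_of (DE E) (DE_norm nrm) (slice F y)) ` \<Omega> \<subseteq> continuous_forms (DE E) (DE_norm nrm)" by blast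
    fix L u assume L: "L \<in> (\<lambda>y. form_of (DE E) (DE_norm nrm) (slice F y)) ` \<Omega>" and u: "u \<in> DE E"
    then obtain y where y: "y \<in> \<Omega>" "L = form_of (DE E) (DE_norm nrm) (slice F y)" by blast
    show "cmod (L u) \<le> D * DE_norm nrm N u"
    proof (rule DE_bound_from_tests[OF _ D _ u])
      show "L \<in> continuous_forms (DE E) (DE_norm nrm)" unfolding y(2) by (rule cont[OF y(1)])
      fix g :: "real^'n \<Rightarrow> complex" assume g: "g \<in> test_functions"
      show "cmod (L (schwartz_dist g)) \<le> D * DE_norm nrm N (schwartz_dist g)"
        unfolding y(2) slice_form_DE[OF O y(1) S_in_DE[OF test_schwartz[OF g]]] slice_form_test[OF O y(1) g] by (rule bDE[OF y(1) g])
    qed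
  qed
  then show ?thesis using O by (simp add: Ob_DE_dual_def)
qed

text \<open>Translating the test function by \<open>x\<close> costs \<open>trK (- x)\<close>. This
  provides the polynomial growth that \<open>hull_pairing_bound\<close> expects, with exponent
  \<open>trm\<close>; the next lemma does the same for \<open>DE E\<close>.\<close>

lemma translated_pairing_E:
  assumes F: "F \<in> O_dual E nrm V" and y: "y \<in> V" and C: "C \<ge> 0" "\<And>u. u \<in> E \<Longrightarrow> cmod (slice_form F y u) \<le> C * nrm u" and g: "g \<in> test_functions"
  shows "cmod (LINT t|lborel. F (cv t y) * g (t - x)) \<le> (C * trM * nrm (schwartz_dist g)) * (1 + norm x) ^ trm"
proof -
  note gs = test_schwartz[OF g]
  have "cmod (slice_form F y (translate (- x) (schwartz_dist g))) \<le> C * (trK (- x) * nrm (schwartz_dist g))"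
    by (rule order_trans[OF C(2)[OF translate_in[OF S_in[OF gs]]] mult_left_mono[OF translate_trK[OF S_in[OF gs]] C(1)]])
  then show ?thesis using slice_form_test[OF F y tests_shift[OF g, of x]] by (simp add: schwartz_dist_shift[OF gs] trK_def mult_ac)
qed

lemma translated_pairing_DE:
  assumes F: "F \<in> O_dual E nrm V" and y: "y \<in> V" and C: "C \<ge> 0" "\<And>u. u \<in> DE E \<Longrightarrow> cmod (slice_form F y u) \<le> C * DE_norm nrm N u" and g: "g \<in> test_functions"
  shows "cmod (LINT t|lborel. F (cv t y) * g (t - x)) \<le> (C * trM * DE_norm nrm N (schwartz_dist g)) * (1 + norm x) ^ trm"
proof -
  note gs = test_schwartz[OF g]
  have "translate (- x) (schwartz_dist g) \<in> DE E" using S_in_DE[OF schwartz_shift_minus[OF gs, of x]] by (simp add: schwartz_dist_shift[OF gs])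
  then have "cmod (slice_form F y (translate (- x) (schwartz_dist g))) \<le> C * (trK (- x) * DE_norm nrm N (schwartz_dist g))"
    by (rule order_trans[OF C(2) mult_left_mono[OF DE_norm_translate[OF S_in_DE[OF gs]] C(1)]])
  then show ?thesis using slice_form_test[OF F y tests_shift[OF g, of x]] by (simp add: schwartz_dist_shift[OF gs] trK_def mult_ac)
qed

text \<open>Both bounds are carried to the hull by \<open>hull_pairing_bound\<close>, whose factor
  \<open>exp (R\<^sup>2)\<close> depends on the size of the heights. Boundedness of
  \<open>V1\<close> and \<open>V2\<close> gives one \<open>R\<close> for all heights, as strong
  boundedness over the whole hull demands.\<close>

lemma Ob_DE_dual_hull:
  fixes V1 V2 :: "(real^'n) set" and F F1 F2 :: "complex^'n \<Rightarrow> complex"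
  defines "\<Omega> \<equiv> convex hull (V1 \<union> V2)"
  assumes V1: "open V1" "bounded V1" and V2: "open V2" "bounded V2"
    and F1: "F1 \<in> Ob_DE_dual E nrm V1" and F2: "F2 \<in> Ob_DE_dual E nrm V2"
    and F: "lineholo F (tube \<Omega>)" and cF: "continuous_on (tube \<Omega>) F"
    and growth: "\<And>K. compact K \<Longrightarrow> K \<subseteq> \<Omega> \<Longrightarrow> \<exists>C. \<forall>y\<in>K. \<forall>x. cmod (F (cv x y)) \<le> C * (1 + norm x) ^ m"
    and eq1: "\<And>z. z \<in> tube V1 \<Longrightarrow> F z = F1 z" and eq2: "\<And>z. z \<in> tube V2 \<Longrightarrow> F z = F2 z"
  shows "F \<in> Ob_DE_dual E nrm \<Omega>"
proof -
  have \<Omega>: "open \<Omega>" "convex \<Omega>" unfolding \<Omega>_def using V1 V2 by (auto intro: open_convex_hull)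
  have sub: "V1 \<union> V2 \<subseteq> \<Omega>" unfolding \<Omega>_def by (rule hull_subset)
  note O1 = Ob_O[OF F1] and O2 = Ob_O[OF F2]
  have "bounded (V1 \<union> V2)" using V1(2) V2(2) by simp
  then obtain R where "\<forall>y\<in>V1 \<union> V2. norm y \<le> R" unfolding bounded_iff by (elim exE) (rule that)
  then have R: "norm y \<le> R" if "y \<in> V1 \<union> V2" for y using that by (rule bspec)
  obtain A where A: "A \<ge> 0" "\<forall>x x0::real^'n. (1 + norm x) ^ trm * exp (- ((norm (x - x0))\<^sup>2)) \<le> A * (1 + norm x0) ^ trm"
    using poly_gauss_bounded[of trm] by blast
  define P where "P = A * exp (R\<^sup>2)"
  have P: "P \<ge> 0" using A(1) by (simp add: P_def)
  note hull = hull_pairing_bound[OF A(1) A(2)[rule_format] \<Omega> F cF growth]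
  have trM0: "trM \<ge> 0" using trM_ge by linarith
  have sl: "F (cv t y) = F1 (cv t y)" if "y \<in> V1" for t y using eq1 that by (simp add: tube_iff)
  have sl2: "F (cv t y) = F2 (cv t y)" if "y \<in> V2" for t y using eq2 that by (simp add: tube_iff)
  have bE: "\<exists>C\<ge>0. \<forall>y\<in>K. \<forall>g\<in>test_functions. cmod (LINT t|lborel. F (cv t y) * g t) \<le> C * nrm (schwartz_dist g)"
    if K: "compact K" "K \<subseteq> \<Omega>" for K
  proof -
    \<comment> \<open>In the norm of \<open>E\<close> the slices are bounded only over compact sets
      of heights, so the hull of \<open>V1 \<union> V2\<close> is exhausted by hulls of compact
      sets.\<close>
    obtain K1 K2 where K12: "compact K1" "K1 \<subseteq> V1" "compact K2" "K2 \<subseteq> V2" "K \<subseteq> convex hull (K1 \<union> K2)"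
      using compact_in_hull[OF V1(1) V2(1) K[unfolded \<Omega>_def]] by (elim exE conjE) (rule that)
    obtain C1 where C1: "C1 \<ge> 0" "\<And>y u. y \<in> K1 \<Longrightarrow> u \<in> E \<Longrightarrow> cmod (slice_form F1 y u) \<le> C1 * nrm u"
      by (rule slice_form_locally_bounded[OF O1 K12(1,2)]) blast
    obtain C2 where C2: "C2 \<ge> 0" "\<And>y u. y \<in> K2 \<Longrightarrow> u \<in> E \<Longrightarrow> cmod (slice_form F2 y u) \<le> C2 * nrm u"
      by (rule slice_form_locally_bounded[OF O2 K12(3,4)]) blast
    define C where "C = max C1 C2"
    have C: "C \<ge> 0" using C1(1) by (simp add: C_def)
    have le1: "cmod (slice_form F1 y u) \<le> C * nrm u" if "y \<in> K1" "u \<in> E" for y u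
      using C1(2)[OF that] mult_right_mono[OF max.cobounded1[of C1 C2] nrm_nonneg[OF that(2)]] by (simp add: C_def)
    have le2: "cmod (slice_form F2 y u) \<le> C * nrm u" if "y \<in> K2" "u \<in> E" for y u
      using C2(2)[OF that] mult_right_mono[OF max.cobounded2[of C2 C1] nrm_nonneg[OF that(2)]] by (simp add: C_def)
    have "cmod (LINT t|lborel. F (cv t y) * g t) \<le> (P * (C * trM)) * nrm (schwartz_dist g)" if y: "y \<in> K" and g: "g \<in> test_functions" for y g
    proof -
      have "cmod (LINT t|lborel. F (cv t y) * g t) \<le> P * (C * trM * nrm (schwartz_dist g))"
      proof (rule hull[where K = "K1 \<union> K2" and R = R, folded P_def, OF _ _ _ R g])
        show "K1 \<union> K2 \<subseteq> \<Omega>" using K12 sub by blast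
        show "y' \<in> V1 \<union> V2" if "y' \<in> K1 \<union> K2" for y' using that K12 by blast
        show "0 \<le> C * trM * nrm (schwartz_dist g)" using C trM0 nrm_nonneg[OF S_in[OF test_schwartz[OF g]]] by simp
        show "y \<in> convex hull (K1 \<union> K2)" using y K12(5) by blast
        show "cmod (LINT t|lborel. F (cv t y') * g (t - x)) \<le> (C * trM * nrm (schwartz_dist g)) * (1 + norm x) ^ trm" if y': "y' \<in> K1 \<union> K2" for x y'
        proof (cases "y' \<in> K1")
          case True
          then have "y' \<in> V1" using K12 by blast
          then show ?thesis unfolding sl[OF \<open>y' \<in> V1\<close>] using translated_pairing_E[OF O1 _ C le1[OF True] g] by simp
        next
          case False
          then have k: "y' \<in> K2" "y' \<in> V2" using K12 y' by auto
          then show ?thesis unfolding sl2[OF k(2)] using translated_pairing_E[OF O2 _ C le2[OF k(1)] g] by simp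
        qed
      qed
      then show ?thesis by (simp only: mult.assoc)
    qed
    then show ?thesis using P C trM0 by (intro exI[of _ "P * (C * trM)"]) simp
  qed
  obtain N1 C1 where C1: "C1 \<ge> 0" "\<And>y u. y \<in> V1 \<Longrightarrow> u \<in> DE E \<Longrightarrow> cmod (slice_form F1 y u) \<le> C1 * DE_norm nrm N1 u"
    by (rule Ob_equicontinuous[OF F1]) blast
  obtain N2 C2 where C2: "C2 \<ge> 0" "\<And>y u. y \<in> V2 \<Longrightarrow> u \<in> DE E \<Longrightarrow> cmod (slice_form F2 y u) \<le> C2 * DE_norm nrm N2 u"
    by (rule Ob_equicontinuous[OF F2]) blast
  \<comment> \<open>A common order and constant for both families, possible because the norms
    increase with the order. In this norm the bound holds at all heights, so \<open>K\<close> can be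
    \<open>V1 \<union> V2\<close> itself.\<close>
  define C and N where "C = max C1 C2" and "N = max N1 N2"
  have C: "C \<ge> 0" using C1(1) by (simp add: C_def)
  have le1: "cmod (slice_form F1 y u) \<le> C * DE_norm nrm N u" if "y \<in> V1" "u \<in> DE E" for y u
  proof -
    have "C1 * DE_norm nrm N1 u \<le> C * DE_norm nrm N u"
      using C1(1) C that by (intro mult_mono DE_norm_mono DE_norm_nonneg) (auto simp: C_def N_def)
    then show ?thesis using C1(2)[OF that] by linarith
  qed
  have le2: "cmod (slice_form F2 y u) \<le> C * DE_norm nrm N u" if "y \<in> V2" "u \<in> DE E" for y u
  proof -
    have "C2 * DE_norm nrm N2 u \<le> C * DE_norm nrm N u"
      using C2(1) C that by (intro mult_mono DE_norm_mono DE_norm_nonneg) (auto simp: C_def N_def)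
    then show ?thesis using C2(2)[OF that] by linarith
  qed
  have bDE: "cmod (LINT t|lborel. F (cv t y) * g t) \<le> (P * (C * trM)) * DE_norm nrm N (schwartz_dist g)" if y: "y \<in> \<Omega>" and g: "g \<in> test_functions" for y g
  proof -
    have "cmod (LINT t|lborel. F (cv t y) * g t) \<le> P * (C * trM * DE_norm nrm N (schwartz_dist g))"
    proof (rule hull[where K = "V1 \<union> V2" and R = R, folded P_def, OF _ _ sub R g])
      show "0 \<le> C * trM * DE_norm nrm N (schwartz_dist g)" using C trM0 DE_norm_nonneg[OF S_in_DE[OF test_schwartz[OF g]]] by simp
      show "y \<in> convex hull (V1 \<union> V2)" using y by (simp add: \<Omega>_def)
      show "cmod (LINT t|lborel. F (cv t y') * g (t - x)) \<le> (C * trM * DE_norm nrm N (schwartz_dist g)) * (1 + norm x) ^ trm" if y': "y' \<in> V1 \<union> V2" for x y'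
      proof (cases "y' \<in> V1")
        case True
        then show ?thesis unfolding sl[OF True] by (intro translated_pairing_DE[OF O1 _ C le1 g]) auto
      next
        case False
        then have k: "y' \<in> V2" using y' by blast
        then show ?thesis unfolding sl2[OF k] by (intro translated_pairing_DE[OF O2 _ C le2 g]) auto
      qed
    qed
    then show ?thesis by (simp only: mult.assoc)
  qed
  show ?thesis using P C trM0 by (intro Ob_DE_dualI[OF \<Omega>(1) F cF growth bE _ bDE]) auto
qed

theorem edge_of_the_wedge:
  assumes V1: "open V1" "connected V1" "bounded V1" and V2: "open V2" "connected V2" "bounded V2"
    and fr: "0 \<in> frontier V1 \<inter> frontier V2"
    and F1: "F1 \<in> Ob_DE_dual E nrm V1" and F2: "F2 \<in> Ob_DE_dual E nrm V2"
    and f1: "has_weak_boundary_value E nrm V1 F1 f" and f2: "has_weak_boundary_value E nrm V2 F2 f"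
  shows "\<exists>F \<in> Ob_DE_dual E nrm (convex hull (V1 \<union> V2)). (\<forall>z \<in> tube V1. F z = F1 z) \<and> (\<forall>z \<in> tube V2. F z = F2 z)"
proof -
  note O1 = Ob_O[OF F1] and O2 = Ob_O[OF F2]
  note c1 = O_dual_continuous[OF O1] and c2 = O_dual_continuous[OF O2]
  \<comment> \<open>Slices grow with exponent \<open>trm\<close>, Gaussian transforms with the
    larger \<open>?N\<close>; \<open>tube_extension\<close> works with one exponent for
    both.\<close>
  let ?N = "trm + (CARD('n) + 2)"
  have "V1 \<noteq> {}" using fr by auto
  then obtain b where b: "b \<in> V1" by blast
  obtain C where C: "slowly_growing (\<lambda>t. F1 (cv t b)) C trm" by (rule O_dual_slowly_growing[OF O1 V1(1) b])
  interpret slowly_growing "\<lambda>t. F1 (cv t b)" C trm by (rule C)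
  \<comment> \<open>Built from a single slice of \<open>F1\<close>; the factor removes the Jacobian
    between transform and average.\<close>
  define U where "U = (\<lambda>e z. of_real (1 / e ^ CARD('n)) * gauss_transform (\<lambda>t. F1 (cv t b)) b e z)"
  have avg1: "U e (cv x y) = gaussian_average F1 e x y" if e: "e > 0" and y: "y \<in> V1" for e x y
    using gauss_transform_const[OF O1 V1(1,2) b y e] gauss_transform_average[OF e tube_slice_continuous[OF c1 y]] e
    by (simp add: U_def scaleR_conv_of_real)
  \<comment> \<open>The transforms of \<open>F1\<close> and of \<open>F2\<close> both equal the
    common boundary value \<open>f\<close> at the same Gaussian test function. Only here do the
    boundary values meet.\<close>
  have avg2: "U e (cv x y) = gaussian_average F2 e x y" if e: "e > 0" and y: "y \<in> V2" for e x y
    using gauss_transform_boundary[OF F1 V1(1,2) _ f1 b e] gauss_transform_boundary[OF F2 V2(1,2) _ f2 y e]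
      gauss_transform_average[OF e tube_slice_continuous[OF c2 y]] fr e
    by (simp add: U_def scaleR_conv_of_real)
  have eq: "F1 (cv x y) = F2 (cv x y)" if y: "y \<in> V1" "y \<in> V2" for x y
  proof -
    obtain A where A: "slowly_growing (\<lambda>t. F1 (cv t y)) A trm" by (rule O_dual_slowly_growing[OF O1 V1(1) y(1)])
    obtain B where B: "slowly_growing (\<lambda>t. F2 (cv t y)) B trm" by (rule O_dual_slowly_growing[OF O2 V2(1) y(2)])
    have s: "tube (V1 \<inter> V2) \<subseteq> tube V1" "tube (V1 \<inter> V2) \<subseteq> tube V2" by (auto simp: tube_iff)
    have "gaussian_average F1 e x y = gaussian_average F2 e x y" if "e > 0" for e
      using avg1[OF that y(1)] avg2[OF that y(2)] by simp
    then show ?thesis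
      using y slowly_growing.growth[OF A] slowly_growing.growth[OF B]
      by (intro gaussian_average_determines[OF continuous_on_subset[OF c1 s(1)] continuous_on_subset[OF c2 s(2)]]) auto
  qed
  \<comment> \<open>The choice of \<open>F1\<close> at common heights is harmless by
    \<open>eq\<close>, which makes \<open>F0\<close> agree with \<open>F2\<close> on its whole tube;
    continuity then follows on the union of two open tubes.\<close>
  define F0 where "F0 = (\<lambda>z. if im_vec z \<in> V1 then F1 z else F2 z)"
  have F01: "F0 z = F1 z" if "z \<in> tube V1" for z using that by (simp add: F0_def tube_iff)
  have F02: "F0 z = F2 z" if "z \<in> tube V2" for z
    using that eq[of "im_vec z" "re_vec z"] by (simp add: F0_def tube_iff)
  have tube_Un: "tube (V1 \<union> V2) = tube V1 \<union> tube V2" by (auto simp: tube_iff)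
  have cF0: "continuous_on (tube (V1 \<union> V2)) F0"
    unfolding tube_Un
  proof (rule continuous_on_open_Un[OF open_tube[OF V1(1)] open_tube[OF V2(1)]])
    show "continuous_on (tube V1) F0" using c1 F01 by (simp cong: continuous_on_cong)
    show "continuous_on (tube V2) F0" using c2 F02 by (simp cong: continuous_on_cong)
  qed
  have growth0: "\<exists>C. \<forall>y\<in>K. \<forall>x. cmod (F0 (cv x y)) \<le> C * (1 + norm x) ^ ?N" if K: "compact K" "K \<subseteq> V1 \<union> V2" for K
  proof -
    obtain K1 K2 where K12: "compact K1" "K1 \<subseteq> V1" "compact K2" "K2 \<subseteq> V2" "K \<subseteq> K1 \<union> K2"
      by (rule compact_split[OF V1(1) V2(1) K])
    obtain A where A: "\<forall>y\<in>K1. \<forall>x. cmod (F1 (cv x y)) \<le> A * (1 + norm x) ^ trm" using O_dual_growth[OF O1 V1(1) K12(1,2)] by blast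
    obtain B where B: "\<forall>y\<in>K2. \<forall>x. cmod (F2 (cv x y)) \<le> B * (1 + norm x) ^ trm" using O_dual_growth[OF O2 V2(1) K12(3,4)] by blast
    define D where "D = max (max A B) 0"
    have p: "A * (1 + norm x) ^ trm \<le> D * (1 + norm x) ^ ?N" "B * (1 + norm x) ^ trm \<le> D * (1 + norm x) ^ ?N" for x :: "real^'n"
      by (intro mult_mono power_increasing; simp add: D_def)+
    have "cmod (F0 (cv x y)) \<le> D * (1 + norm x) ^ ?N" if y: "y \<in> K" for x y
    proof (cases "y \<in> K1")
      case True
      then have "F0 (cv x y) = F1 (cv x y)" using K12 by (intro F01) (auto simp: tube_iff)
      then show ?thesis using A True order_trans[OF _ p(1)] by simp
    next
      case False
      then have k: "y \<in> K2" using y K12 by blast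
      then have "F0 (cv x y) = F2 (cv x y)" using K12 by (intro F02) (auto simp: tube_iff)
      then show ?thesis using B k order_trans[OF _ p(2)] by simp
    qed
    then show ?thesis by blast
  qed
  have U: "lineholo (U e) UNIV" "continuous_on UNIV (U e)" "\<And>L. compact L \<Longrightarrow> \<exists>C. \<forall>y\<in>L. \<forall>x. cmod (U e (cv x y)) \<le> C * (1 + norm x) ^ ?N"
    if "e \<in> {0<..1}" for e
  proof -
    have e: "e > 0" using that by simp
    show "lineholo (U e) UNIV"
      using gauss_transform_lineholo[OF e, of b] unfolding U_def lineholo_def by (auto intro!: holomorphic_intros)
    show "continuous_on UNIV (U e)" unfolding U_def by (intro continuous_intros gauss_transform_continuous[OF e])
    fix L :: "(real^'n) set" assume L: "compact L"
    obtain D where D: "\<forall>y\<in>L. \<forall>x. cmod (gauss_transform (\<lambda>t. F1 (cv t b)) b e (cv x y)) \<le> D * (1 + norm x) ^ ?N"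
      using gauss_transform_growth[OF e L] by blast
    have "cmod (U e (cv x y)) \<le> (1 / e ^ CARD('n) * D) * (1 + norm x) ^ ?N" if y: "y \<in> L" for x y
    proof -
      have "cmod (U e (cv x y)) = 1 / e ^ CARD('n) * cmod (gauss_transform (\<lambda>t. F1 (cv t b)) b e (cv x y))"
        using e unfolding U_def norm_mult norm_of_real by simp
      also have "\<dots> \<le> 1 / e ^ CARD('n) * (D * (1 + norm x) ^ ?N)" using D y e by (intro mult_left_mono) auto
      finally show ?thesis by (simp only: mult.assoc)
    qed
    then show "\<exists>C. \<forall>y\<in>L. \<forall>x. cmod (U e (cv x y)) \<le> C * (1 + norm x) ^ ?N" by blast
  qed
  have avg: "U e (cv x y) = gaussian_average F0 e x y" if e: "e \<in> {0<..1}" and y: "y \<in> V1 \<union> V2" for e x y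
  proof (cases "y \<in> V1")
    case True
    then have "gaussian_average F0 e x y = gaussian_average F1 e x y" by (simp add: gaussian_average_def F0_def)
    then show ?thesis using avg1[OF _ True] e by simp
  next
    case False
    then have "gaussian_average F0 e x y = gaussian_average F2 e x y" by (simp add: gaussian_average_def F0_def)
    then show ?thesis using avg2[of e y] e y False by simp
  qed
  have "\<exists>F. lineholo F (tube (convex hull (V1 \<union> V2))) \<and> continuous_on (tube (convex hull (V1 \<union> V2))) F \<and> (\<forall>z\<in>tube (V1 \<union> V2). F z = F0 z) \<and>
    (\<forall>K. compact K \<longrightarrow> K \<subseteq> convex hull (V1 \<union> V2) \<longrightarrow> (\<exists>C. \<forall>y\<in>K. \<forall>x. cmod (F (cv x y)) \<le> C * (1 + norm x) ^ ?N))"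
    by (rule tube_extension[OF V1(1) V2(1) cF0 growth0 U avg])
  then obtain F where F: "lineholo F (tube (convex hull (V1 \<union> V2)))" "continuous_on (tube (convex hull (V1 \<union> V2))) F"
    "\<forall>z\<in>tube (V1 \<union> V2). F z = F0 z"
    "\<forall>K. compact K \<longrightarrow> K \<subseteq> convex hull (V1 \<union> V2) \<longrightarrow> (\<exists>C. \<forall>y\<in>K. \<forall>x. cmod (F (cv x y)) \<le> C * (1 + norm x) ^ ?N)"
    by (elim exE conjE) (rule that)
  have e1: "F z = F1 z" if "z \<in> tube V1" for z using F(3) F01 that by (simp add: tube_Un)
  have e2: "F z = F2 z" if "z \<in> tube V2" for z using F(3) F02 that by (simp add: tube_Un)
  have "F \<in> Ob_DE_dual E nrm (convex hull (V1 \<union> V2))"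
    by (rule Ob_DE_dual_hull[OF V1(1,3) V2(1,3) F1 F2 F(1,2) mp[OF mp[OF spec[OF F(4)]]] e1 e2])
  then show ?thesis using e1 e2 by blast
qed

end

theorem theorem5p4:
  fixes E :: "((real^'n::finite \<Rightarrow> complex) \<Rightarrow> complex) set"
    and nrm :: "((real^'n \<Rightarrow> complex) \<Rightarrow> complex) \<Rightarrow> real"
    and V1 V2 :: "(real^'n) set"
    and F1 F2 :: "complex^'n \<Rightarrow> complex"
    and f1 f2 :: "((real^'n \<Rightarrow> complex) \<Rightarrow> complex) \<Rightarrow> complex"
  assumes "translation_invariant_banach E nrm"
    and "open V1" and "connected V1" and "bounded V1"
    and "open V2" and "connected V2" and "bounded V2"
    and "0 \<in> frontier V1 \<inter> frontier V2"
    and "F1 \<in> Ob_DE_dual E nrm V1"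
    and "F2 \<in> Ob_DE_dual E nrm V2"
    and "has_weak_boundary_value E nrm V1 F1 f1"
    and "has_weak_boundary_value E nrm V2 F2 f2"
    and "f1 = f2"
  shows "\<exists>F \<in> Ob_DE_dual E nrm (convex hull (V1 \<union> V2)).
           (\<forall>z \<in> tube V1. F z = F1 z) \<and> (\<forall>z \<in> tube V2. F z = F2 z)"
proof -
  interpret tib E nrm by unfold_locales (rule assms(1))
  show ?thesis using assms(11,12) unfolding assms(13) by (rule edge_of_the_wedge[OF assms(2-10)])
qed

end
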